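(* Let $\ell\geq 9$. For every ramification type in Table W (given in the context) for this $\ell$, consisting of conjugacy classes $\mathcal C_1,\dots,\mathcal C_r$ of $S_\ell\wr S_2$, there exists a product-$1$ tuple $x_1,\dots,x_r$ corresponding to it (that is, up to the order of the classes, $x_i\in\mathcal C_i$ for all $i$, and $x_1x_2\cdots x_r=1$) such that the group $G=\langle x_1,\dots,x_r\rangle\leq S_\ell\wr S_2$ is primitive (in its action on $\{1,\dots,\ell\}^2$) and contains $A_\ell^2$.
   Context: $S_\ell\wr S_2=S_\ell^2\rtimes S_2$ is the wreath product acting on $\{1,\dots,\ell\}^2$: $S_\ell^2$ acts coordinatewise and the swap $s\in S_2$ interchanges the coordinates. **Table W.** For partitions $A_1,A_2$ of $\ell$, $(A_1,A_2)$ denotes the conjugacy class in $S_\ell\wr S_2$ of $(\alpha_1,\alpha_2)\in S_\ell^2$ with $\alpha_i$ of cycle structure $A_i$, and $(A_1,[1^\ell])s$ denotes the conjugacy class of $(\alpha_1,1)s$; $s$ alone denotes the conjugacy class of $s$. In a partition, $u^v$ means that $u$ appears $v$ times. $a$ is any integer with $0<a<\ell/2$ and $(a,\ell)=1$. A row only applies to those $\ell$ for which all exponents are nonnegative integers. Abbreviate $e=[1^\ell]$, $\tau=[2,1^{\ell-2}]$, $\tau_2=[2^2,1^{\ell-4}]$, $\tau_3=[3,1^{\ell-3}]$, $L=[\ell]$, $A=[a,\ell-a]$, $B_j=[1^j,2^{(\ell-j)/2}]$, $C_j=[1^j,3,2^{(\ell-3-j)/2}]$, $D_j=[1^j,4,2^{(\ell-4-j)/2}]$.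 I1.1: $(L,e)s,(A,e)s,(\tau,e)$. I1A.1: $(L,L),(\tau_3,e),s,s$. I1A.2a: $(L,L),(\tau,e)s,(\tau,e)s$. I1A.2b: $(L,L),(\tau,e),(\tau,e)s,s$. I1A.2c: $(L,L),(\tau,e),(\tau,e),s,s$. I1A.3: $(L,L),(\tau_2,e),s,s$. I1A.4: $(A,A),(\tau_3,e),s,s$. I1A.5a: $(A,A),(\tau,e)s,(\tau,e)s$. I1A.5b: $(A,A),(\tau,e),(\tau,e)s,s$. I1A.5c: $(A,A),(\tau,e),(\tau,e),s,s$. I1A.6: $(A,A),(\tau_2,e),s,s$. I1A.7a: $(L,A),(\tau,e),s,s$. I1A.7b: $(L,A),(\tau,e)s,s$. I2.1a: $(L,e)s,s,(B_3,B_1),(\tau,e)$. I2.1b: $(L,e)s,(\tau,e)s,(B_3,B_1)$. I2.2a: $(L,e)s,(\tau,e)s,(B_2,B_2)$. I2.2b: $(L,e)s,s,(B_2,B_2),(\tau,e)$. I2.3: $(L,e)s,s,(C_0,B_3)$. I2.4: $(L,e)s,s,(C_1,B_2)$. I2.5: $(L,e)s,s,(C_2,B_1)$. I2.6: $(L,e)s,s,(D_1,B_3)$. I2.7: $(L,e)s,s,(D_2,B_2)$. I2.8: $(L,e)s,s,(D_3,B_1)$. I2.9a: $(A,e)s,(\tau,e)s,(B_2,B_0)$. I2.9b: $(A,e)s,s,(B_2,B_0),(\tau,e)$. I2.10a: $(A,e)s,s,(B_1,B_1),(\tau,e)$. I2.10b: $(A,e)s,(\tau,e)s,(B_1,B_1)$.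 I2.11: $(A,e)s,s,(D_2,B_0)$. I2.12: $(A,e)s,s,(D_1,B_1)$. I2.13: $(A,e)s,s,(D_0,B_2)$. I2.14: $(A,e)s,s,(C_0,B_1)$. I2.15: $(A,e)s,s,(C_1,B_0)$. F2.1: $([1,2,3^{(\ell-3)/3}],[3^{\ell/3}]),([1,2,3^{(\ell-3)/3}],e)s,s$. F2.2: $([2,3^{(\ell-2)/3}],[1^2,3^{(\ell-2)/3}]),([2,3^{(\ell-2)/3}],e)s,s$. F2.3: $([1,3^{(\ell-1)/3}],[2^2,3^{(\ell-4)/3}]),([1,3^{(\ell-1)/3}],e)s,s$. F3.1: $([1,3,4^{(\ell-4)/4}],[4^{\ell/4}]),(B_2,e)s,s$. F3.2: $([2,3,4^{(\ell-5)/4}],[1,4^{(\ell-1)/4}]),(B_1,e)s,s$. F3.3: $([3,4^{(\ell-3)/4}],[1,2,4^{(\ell-3)/4}]),(B_1,e)s,s$. F1A.1a: $(B_2,B_0),(B_2,B_2),(\tau,e)s,s$. F1A.1b: $(B_2,B_0),(B_2,B_2),(\tau,e),s,s$. F1A.2a: $(B_1,B_3),(B_1,B_1),(\tau,e)s,s$. F1A.2b: $(B_1,B_3),(B_1,B_1),(\tau,e),s,s$. F1A.3a: $(C_0,B_3),(B_1,B_1),s,s$. F1A.3b: $(C_0,B_1),(B_3,B_1),s,s$. F1A.4a: $(C_1,B_0),(B_2,B_2),s,s$. F1A.4b: $(C_1,B_2),(B_0,B_2),s,s$. F1A.5: $(B_1,C_2),(B_1,B_1),s,s$. F1A.6a: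 $(D_1,B_3),(B_1,B_1),s,s$. F1A.6b: $(D_1,B_1),(B_3,B_1),s,s$. F1A.7a: $(D_2,B_0),(B_2,B_2),s,s$. F1A.7b: $(D_2,B_2),(B_0,B_2),s,s$. F1A.8: $(B_1,D_3),(B_1,B_1),s,s$. F1A.9: $(B_2,D_0),(B_2,B_2),s,s$. F4.1: $s,s,(\tau,e)s,(\tau,e)s$. F4.2: $s,s,s,(\tau,e)s,(\tau,e)$. F4.3: $s,s,s,s,(\tau,e),(\tau,e)$. F4.4: $s,s,s,s,(\tau_2,e)$. F4.5: $s,s,s,s,(\tau_3,e)$. *)

theory Defs
  imports
    Complex_Main
    "HOL-Algebra.Sym_Groups"
    "HOL-Algebra.Group_Action"
    "HOL-Algebra.Generated_Groups"
    "HOL-Combinatorics.Orbits"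
    "HOL-Library.Multiset"
begin

section \<open>Primitive actions and conjugacy classes\<close>

locale primitive_action = transitive_action +
  assumes trivial_blocks:
    "\<lbrakk> B \<subseteq> E; B \<noteq> {}; \<forall>g \<in> carrier G. (\<phi> g) ` B = B \<or> (\<phi> g) ` B \<inter> B = {} \<rbrakk>
      \<Longrightarrow> B = E \<or> is_singleton B"

definition conj_class :: "('a, 'b) monoid_scheme \<Rightarrow> 'a \<Rightarrow> 'a set" where
  "conj_class G x = {g \<otimes>\<^bsub>G\<^esub> x \<otimes>\<^bsub>G\<^esub> inv\<^bsub>G\<^esub> g | g. g \<in> carrier G}"


section \<open>The wreath product \<open>S\<^sub>l \<wr> S\<^sub>2\<close> in product action\<close>

text \<open>
  The semidirect product \<open>S\<^sub>l\<^sup>2 \<rtimes> S\<^sub>2\<close> is realised as a permutation group: \<open>(\<alpha>, \<beta>)\<close> is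
  \<open>map_prod \<alpha> \<beta>\<close>, and the swap \<open>s\<close> is \<open>prod.swap\<close>. As in \<^const>\<open>sym_group\<close>, the group
  elements are functions on the whole type; \<open>square l\<close> is the set acted on, and the action is
  restriction to it.
\<close>

definition wreath_S2 :: "nat \<Rightarrow> (nat \<times> nat \<Rightarrow> nat \<times> nat) monoid" where
  "wreath_S2 l =
    \<lparr> carrier = {map_prod \<alpha> \<beta> \<circ> t | \<alpha> \<beta> t.
        \<alpha> \<in> carrier (sym_group l) \<and> \<beta> \<in> carrier (sym_group l) \<and> t \<in> {id, prod.swap}},
      mult = (\<circ>), one = id \<rparr>"

definition square :: "nat \<Rightarrow> (nat \<times> nat) set" where
  "square l = {1..l} \<times> {1..l}"

definition square_action :: "nat \<Rightarrow> (nat \<times> nat \<Rightarrow> nat \<times> nat) \<Rightarrow> nat \<times> nat \<Rightarrow> nat \<times> nat" where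
  "square_action l g = restrict g (square l)"

definition alt_square :: "nat \<Rightarrow> (nat \<times> nat \<Rightarrow> nat \<times> nat) set" where
  "alt_square l = {map_prod \<alpha> \<beta> | \<alpha> \<beta>. \<alpha> \<in> carrier (alt_group l) \<and> \<beta> \<in> carrier (alt_group l)}"

lemma wreath_S2_carrierE:
  assumes "g \<in> carrier (wreath_S2 l)"
  obtains a b t where "g = map_prod a b \<circ> t" "a permutes {1..l}" "b permutes {1..l}"
    "t \<in> {id, prod.swap}"
  using assms unfolding wreath_S2_def sym_group_carrier by auto

lemma wreath_S2_carrierI:
  "\<lbrakk> a permutes {1..l}; b permutes {1..l}; t \<in> {id, prod.swap} \<rbrakk>
    \<Longrightarrow> map_prod a b \<circ> t \<in> carrier (wreath_S2 l)"
  unfolding wreath_S2_def sym_group_carrier by auto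

lemma wreath_S2_group: "group (wreath_S2 l)"
proof (rule groupI)
  show "\<one>\<^bsub>wreath_S2 l\<^esub> \<in> carrier (wreath_S2 l)"
    using wreath_S2_carrierI[OF permutes_id permutes_id, of id] by (simp add: wreath_S2_def prod.map_id0)
next
  fix x y assume "x \<in> carrier (wreath_S2 l)" "y \<in> carrier (wreath_S2 l)"
  then obtain a b t c d u where *: "x = map_prod a b \<circ> t" "y = map_prod c d \<circ> u"
    "a permutes {1..l}" "b permutes {1..l}" "c permutes {1..l}" "d permutes {1..l}"
    "t \<in> {id, prod.swap}" "u \<in> {id, prod.swap}"
    by (elim wreath_S2_carrierE)
  have "\<exists>c' d' u'. x \<circ> y = map_prod (a \<circ> c') (b \<circ> d') \<circ> u' \<and> c' permutes {1..l} \<and>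
      d' permutes {1..l} \<and> u' \<in> {id, prod.swap}"
  proof (cases "t = id")
    case True
    have "x \<circ> y = map_prod (a \<circ> c) (b \<circ> d) \<circ> u" using * True by (auto simp: fun_eq_iff)
    then show ?thesis using * by blast
  next
    case False
    then have t: "t = prod.swap" using * by simp
    have "x \<circ> y = map_prod (a \<circ> d) (b \<circ> c) \<circ> (prod.swap \<circ> u)"
      using * t by (auto simp: fun_eq_iff)
    moreover have "prod.swap \<circ> u \<in> {id, prod.swap}" using * by (auto simp: fun_eq_iff)
    ultimately show ?thesis using * by blast
  qed
  then obtain c' d' u' where "x \<circ> y = map_prod (a \<circ> c') (b \<circ> d') \<circ> u'" "c' permutes {1..l}"
      "d' permutes {1..l}" "u' \<in> {id, prod.swap}" by blast
  then show "x \<otimes>\<^bsub>wreath_S2 l\<^esub> y \<in> carrier (wreath_S2 l)"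
    using wreath_S2_carrierI[OF permutes_compose[of c' _ a] permutes_compose[of d' _ b], of l u'] *
    by (simp add: wreath_S2_def)
next
  fix x assume "x \<in> carrier (wreath_S2 l)"
  then obtain a b t where *: "x = map_prod a b \<circ> t"
    "a permutes {1..l}" "b permutes {1..l}" "t \<in> {id, prod.swap}"
    by (elim wreath_S2_carrierE)
  have inv: "inv' a permutes {1..l}" "inv' b permutes {1..l}"
    using * permutes_inv by auto
  show "\<exists>y\<in>carrier (wreath_S2 l). y \<otimes>\<^bsub>wreath_S2 l\<^esub> x = \<one>\<^bsub>wreath_S2 l\<^esub>"
  proof (cases "t = id")
    case True
    have "map_prod (inv' a) (inv' b) \<circ> id \<in> carrier (wreath_S2 l)"
      using inv by (intro wreath_S2_carrierI) auto
    moreover have "(map_prod (inv' a) (inv' b) \<circ> id) \<circ> x = id"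
      using * True permutes_inverses by (auto simp: fun_eq_iff)
    ultimately show ?thesis by (intro bexI) (simp_all add: wreath_S2_def)
  next
    case False
    have "map_prod (inv' b) (inv' a) \<circ> prod.swap \<in> carrier (wreath_S2 l)"
      using inv by (intro wreath_S2_carrierI) auto
    moreover have "(map_prod (inv' b) (inv' a) \<circ> prod.swap) \<circ> x = id"
      using * False permutes_inverses by (auto simp: fun_eq_iff)
    ultimately show ?thesis by (intro bexI) (simp_all add: wreath_S2_def)
  qed
qed (auto simp: wreath_S2_def comp_assoc)

lemma square_action_faithful:
  assumes "2 \<le> l"
  shows "faithful_action (wreath_S2 l) (square l) (square_action l)"
proof -
  have maps: "g p \<in> square l" if "g \<in> carrier (wreath_S2 l)" "p \<in> square l" for g p
    using that
    by (elim wreath_S2_carrierE) (auto simp: square_def permutes_in_image simp del: atLeastAtMost_iff)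
  have inj: "inj g" if g: "g \<in> carrier (wreath_S2 l)" for g
  proof -
    obtain a b t where *: "g = map_prod a b \<circ> t" "a permutes {1..l}" "b permutes {1..l}"
      "t \<in> {id, prod.swap}"
      using g by (rule wreath_S2_carrierE)
    have "inj (map_prod a b)" using permutes_inj[OF *(2)] permutes_inj[OF *(3)] by (rule prod.inj_map)
    moreover have "inj t" using *(4) by auto
    ultimately show ?thesis unfolding *(1) by (rule inj_compose)
  qed
  have Bij: "square_action l g \<in> Bij (square l)" if g: "g \<in> carrier (wreath_S2 l)" for g
  proof -
    have "inj_on g (square l)" using inj[OF g] inj_on_subset by blast
    moreover have "g ` square l \<subseteq> square l" using maps[OF g] by blast
    moreover have "finite (square l)" by (simp add: square_def)
    ultimately have "bij_betw g (square l) (square l)"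
      by (simp add: bij_betw_def endo_inj_surj)
    then show ?thesis by (simp add: Bij_def square_action_def)
  qed
  have "square_action l \<in> hom (wreath_S2 l) (BijGroup (square l))"
  proof (rule homI)
    fix g assume "g \<in> carrier (wreath_S2 l)"
    then show "square_action l g \<in> carrier (BijGroup (square l))"
      using Bij by (simp add: BijGroup_def)
  next
    fix g h assume gh: "g \<in> carrier (wreath_S2 l)" "h \<in> carrier (wreath_S2 l)"
    have "square_action l (g \<circ> h) = compose (square l) (square_action l g) (square_action l h)"
      using maps[OF gh(2)] by (auto simp: square_action_def compose_def fun_eq_iff restrict_def)
    then show "square_action l (g \<otimes>\<^bsub>wreath_S2 l\<^esub> h) =
        square_action l g \<otimes>\<^bsub>BijGroup (square l)\<^esub> square_action l h"
      using Bij gh by (simp add: BijGroup_def wreath_S2_def)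
  qed
  then have "group_action (wreath_S2 l) (square l) (square_action l)"
    by (simp add: group_action_def group_hom_def group_hom_axioms_def wreath_S2_group group_BijGroup)
  moreover have "inj_on (square_action l) (carrier (wreath_S2 l))"
  proof (rule inj_onI)
    fix g h assume "g \<in> carrier (wreath_S2 l)" "h \<in> carrier (wreath_S2 l)"
      and eq: "square_action l g = square_action l h"
    then obtain a b t c d u where *: "g = map_prod a b \<circ> t" "h = map_prod c d \<circ> u"
      "a permutes {1..l}" "b permutes {1..l}" "c permutes {1..l}" "d permutes {1..l}"
      "t \<in> {id, prod.swap}" "u \<in> {id, prod.swap}"
      by (elim wreath_S2_carrierE)
    have agree: "g (i, j) = h (i, j)" if "i \<in> {1..l}" "j \<in> {1..l}" for i j
      using fun_cong[OF eq, of "(i, j)"] that by (simp add: square_action_def square_def)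
    have "t = u"
    proof (rule ccontr)
      assume "t \<noteq> u"
      then consider "t = id" "u = prod.swap" | "t = prod.swap" "u = id" using *(7,8) by auto
      then have "a 1 = a 2"
      proof cases
        case 1
        then show ?thesis using agree[of 1 1] agree[of 2 1] assms by (simp add: *(1,2))
      next
        case 2
        then show ?thesis using agree[of 1 1] agree[of 1 2] assms by (simp add: *(1,2))
      qed
      then have "(1::nat) = 2" using permutes_inj[OF *(3)] by (rule injD[rotated])
      then show False by simp
    qed
    moreover have "a i = c i" "b i = d i" for i
    proof -
      have 1: "1 \<in> {1..l}" using assms by simp
      have "a i = c i \<and> b i = d i" if "i \<in> {1..l}"
        using agree[OF that that] *(8) by (auto simp: *(1,2) \<open>t = u\<close>)
      moreover have "a i = c i \<and> b i = d i" if "i \<notin> {1..l}"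
        using that *(3-6) by (simp add: permutes_not_in)
      ultimately show "a i = c i" "b i = d i" by blast+
    qed
    then have "a = c" "b = d" by (simp_all add: fun_eq_iff)
    ultimately show "g = h" by (simp add: *(1,2))
  qed
  ultimately show ?thesis
    by (simp add: faithful_action_def faithful_action_axioms_def)
qed

section \<open>Cycle structures\<close>

definition cycle_type :: "nat \<Rightarrow> (nat \<Rightarrow> nat) \<Rightarrow> nat multiset" where
  "cycle_type l \<alpha> = image_mset card (mset_set {Orbits.orbit \<alpha> i | i. i \<in> {1..l}})"

text \<open>
  A pair \<open>(u, v)\<close> in an exponent form stands for the symbol \<open>u\<^sup>v\<close>, that is, for \<open>v\<close> parts equal
  to \<open>u\<close>. Exponents are rational because the families below are written with fractions such as
  \<open>(l - j) / 2\<close>, which need not be natural numbers for the given \<open>l\<close>. The multiset of parts is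
  only meaningful when \<open>exponents_ok\<close> holds.
\<close>

type_synonym exponent_form = "(nat \<times> rat) list"

definition exponents_ok :: "exponent_form \<Rightarrow> bool" where
  "exponents_ok P \<longleftrightarrow> (\<forall>(u, v) \<in> set P. v \<in> \<nat>)"

definition parts :: "exponent_form \<Rightarrow> nat multiset" where
  "parts P = (\<Sum>(u, v) \<leftarrow> P. replicate_mset (nat \<lfloor>v\<rfloor>) u)"


section \<open>Conjugacy classes of the wreath product\<close>

text \<open>
  \<open>Cl_Pair P Q\<close>, \<open>Cl_Twisted P\<close> and \<open>Cl_Swap\<close> are the symbols \<open>(P, Q)\<close>, \<open>(P, [1\<^sup>l])s\<close> and \<open>s\<close>.
  All elements of given cycle structures are conjugate, so the sets of \<open>wreath_class\<close> are single
  conjugacy classes whenever the exponent forms denote partitions of \<open>l\<close>.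
\<close>

datatype class_symbol =
    Cl_Pair exponent_form exponent_form
  | Cl_Twisted exponent_form
  | Cl_Swap

fun wreath_class :: "nat \<Rightarrow> class_symbol \<Rightarrow> (nat \<times> nat \<Rightarrow> nat \<times> nat) set" where
  "wreath_class l (Cl_Pair P Q) =
    (\<Union>(\<alpha>, \<beta>) \<in> {(\<alpha>, \<beta>). \<alpha> \<in> carrier (sym_group l) \<and> \<beta> \<in> carrier (sym_group l) \<and>
        cycle_type l \<alpha> = parts P \<and> cycle_type l \<beta> = parts Q}.
      conj_class (wreath_S2 l) (map_prod \<alpha> \<beta>))"
| "wreath_class l (Cl_Twisted P) =
    (\<Union>\<alpha> \<in> {\<alpha> \<in> carrier (sym_group l). cycle_type l \<alpha> = parts P}.
      conj_class (wreath_S2 l) (map_prod \<alpha> id \<circ> prod.swap))"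
| "wreath_class l Cl_Swap = conj_class (wreath_S2 l) prod.swap"

fun symbol_ok :: "class_symbol \<Rightarrow> bool" where
  "symbol_ok (Cl_Pair P Q) \<longleftrightarrow> exponents_ok P \<and> exponents_ok Q"
| "symbol_ok (Cl_Twisted P) \<longleftrightarrow> exponents_ok P"
| "symbol_ok Cl_Swap \<longleftrightarrow> True"


section \<open>The ramification types\<close>

context
  fixes l :: nat
begin

definition e\<^sub>W :: exponent_form where
  "e\<^sub>W = [(1, of_nat l)]"

definition \<tau>\<^sub>W :: exponent_form where
  "\<tau>\<^sub>W = [(2, 1), (1, of_nat l - 2)]"

definition \<tau>2\<^sub>W :: exponent_form where
  "\<tau>2\<^sub>W = [(2, 2), (1, of_nat l - 4)]"

definition \<tau>3\<^sub>W :: exponent_form where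
  "\<tau>3\<^sub>W = [(3, 1), (1, of_nat l - 3)]"

definition L\<^sub>W :: exponent_form where
  "L\<^sub>W = [(l, 1)]"

definition A\<^sub>W :: "nat \<Rightarrow> exponent_form" where
  "A\<^sub>W a = [(a, 1), (l - a, 1)]"

definition B\<^sub>W :: "nat \<Rightarrow> exponent_form" where
  "B\<^sub>W j = [(1, of_nat j), (2, (of_nat l - of_nat j) / 2)]"

definition C\<^sub>W :: "nat \<Rightarrow> exponent_form" where
  "C\<^sub>W j = [(1, of_nat j), (3, 1), (2, (of_nat l - 3 - of_nat j) / 2)]"

definition D\<^sub>W :: "nat \<Rightarrow> exponent_form" where
  "D\<^sub>W j = [(1, of_nat j), (4, 1), (2, (of_nat l - 4 - of_nat j) / 2)]"

definition parameter_W :: "nat \<Rightarrow> bool" where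
  "parameter_W a \<longleftrightarrow> 0 < a \<and> 2 * a < l \<and> coprime a l"

inductive row_W :: "class_symbol list \<Rightarrow> bool" where
  I1_1: "parameter_W a \<Longrightarrow> row_W [Cl_Twisted L\<^sub>W, Cl_Twisted (A\<^sub>W a), Cl_Pair \<tau>\<^sub>W e\<^sub>W]"
| I1A_1: "row_W [Cl_Pair L\<^sub>W L\<^sub>W, Cl_Pair \<tau>3\<^sub>W e\<^sub>W, Cl_Swap, Cl_Swap]"
| I1A_2a: "row_W [Cl_Pair L\<^sub>W L\<^sub>W, Cl_Twisted \<tau>\<^sub>W, Cl_Twisted \<tau>\<^sub>W]"
| I1A_2b: "row_W [Cl_Pair L\<^sub>W L\<^sub>W, Cl_Pair \<tau>\<^sub>W e\<^sub>W, Cl_Twisted \<tau>\<^sub>W, Cl_Swap]"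
| I1A_2c: "row_W [Cl_Pair L\<^sub>W L\<^sub>W, Cl_Pair \<tau>\<^sub>W e\<^sub>W, Cl_Pair \<tau>\<^sub>W e\<^sub>W, Cl_Swap, Cl_Swap]"
| I1A_3: "row_W [Cl_Pair L\<^sub>W L\<^sub>W, Cl_Pair \<tau>2\<^sub>W e\<^sub>W, Cl_Swap, Cl_Swap]"
| I1A_4: "parameter_W a \<Longrightarrow> row_W [Cl_Pair (A\<^sub>W a) (A\<^sub>W a), Cl_Pair \<tau>3\<^sub>W e\<^sub>W, Cl_Swap, Cl_Swap]"
| I1A_5a: "parameter_W a \<Longrightarrow> row_W [Cl_Pair (A\<^sub>W a) (A\<^sub>W a), Cl_Twisted \<tau>\<^sub>W, Cl_Twisted \<tau>\<^sub>W]"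
| I1A_5b: "parameter_W a \<Longrightarrow> row_W [Cl_Pair (A\<^sub>W a) (A\<^sub>W a), Cl_Pair \<tau>\<^sub>W e\<^sub>W, Cl_Twisted \<tau>\<^sub>W, Cl_Swap]"
| I1A_5c: "parameter_W a \<Longrightarrow> row_W [Cl_Pair (A\<^sub>W a) (A\<^sub>W a), Cl_Pair \<tau>\<^sub>W e\<^sub>W, Cl_Pair \<tau>\<^sub>W e\<^sub>W, Cl_Swap, Cl_Swap]"
| I1A_6: "parameter_W a \<Longrightarrow> row_W [Cl_Pair (A\<^sub>W a) (A\<^sub>W a), Cl_Pair \<tau>2\<^sub>W e\<^sub>W, Cl_Swap, Cl_Swap]"
| I1A_7a: "parameter_W a \<Longrightarrow> row_W [Cl_Pair L\<^sub>W (A\<^sub>W a), Cl_Pair \<tau>\<^sub>W e\<^sub>W, Cl_Swap, Cl_Swap]"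
| I1A_7b: "parameter_W a \<Longrightarrow> row_W [Cl_Pair L\<^sub>W (A\<^sub>W a), Cl_Twisted \<tau>\<^sub>W, Cl_Swap]"
| I2_1a: "row_W [Cl_Twisted L\<^sub>W, Cl_Swap, Cl_Pair (B\<^sub>W 3) (B\<^sub>W 1), Cl_Pair \<tau>\<^sub>W e\<^sub>W]"
| I2_1b: "row_W [Cl_Twisted L\<^sub>W, Cl_Twisted \<tau>\<^sub>W, Cl_Pair (B\<^sub>W 3) (B\<^sub>W 1)]"
| I2_2a: "row_W [Cl_Twisted L\<^sub>W, Cl_Twisted \<tau>\<^sub>W, Cl_Pair (B\<^sub>W 2) (B\<^sub>W 2)]"
| I2_2b: "row_W [Cl_Twisted L\<^sub>W, Cl_Swap, Cl_Pair (B\<^sub>W 2) (B\<^sub>W 2), Cl_Pair \<tau>\<^sub>W e\<^sub>W]"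
| I2_3: "row_W [Cl_Twisted L\<^sub>W, Cl_Swap, Cl_Pair (C\<^sub>W 0) (B\<^sub>W 3)]"
| I2_4: "row_W [Cl_Twisted L\<^sub>W, Cl_Swap, Cl_Pair (C\<^sub>W 1) (B\<^sub>W 2)]"
| I2_5: "row_W [Cl_Twisted L\<^sub>W, Cl_Swap, Cl_Pair (C\<^sub>W 2) (B\<^sub>W 1)]"
| I2_6: "row_W [Cl_Twisted L\<^sub>W, Cl_Swap, Cl_Pair (D\<^sub>W 1) (B\<^sub>W 3)]"
| I2_7: "row_W [Cl_Twisted L\<^sub>W, Cl_Swap, Cl_Pair (D\<^sub>W 2) (B\<^sub>W 2)]"
| I2_8: "row_W [Cl_Twisted L\<^sub>W, Cl_Swap, Cl_Pair (D\<^sub>W 3) (B\<^sub>W 1)]"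
| I2_9a: "parameter_W a \<Longrightarrow> row_W [Cl_Twisted (A\<^sub>W a), Cl_Twisted \<tau>\<^sub>W, Cl_Pair (B\<^sub>W 2) (B\<^sub>W 0)]"
| I2_9b: "parameter_W a \<Longrightarrow> row_W [Cl_Twisted (A\<^sub>W a), Cl_Swap, Cl_Pair (B\<^sub>W 2) (B\<^sub>W 0), Cl_Pair \<tau>\<^sub>W e\<^sub>W]"
| I2_10a: "parameter_W a \<Longrightarrow> row_W [Cl_Twisted (A\<^sub>W a), Cl_Swap, Cl_Pair (B\<^sub>W 1) (B\<^sub>W 1), Cl_Pair \<tau>\<^sub>W e\<^sub>W]"
| I2_10b: "parameter_W a \<Longrightarrow> row_W [Cl_Twisted (A\<^sub>W a), Cl_Twisted \<tau>\<^sub>W, Cl_Pair (B\<^sub>W 1) (B\<^sub>W 1)]"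
| I2_11: "parameter_W a \<Longrightarrow> row_W [Cl_Twisted (A\<^sub>W a), Cl_Swap, Cl_Pair (D\<^sub>W 2) (B\<^sub>W 0)]"
| I2_12: "parameter_W a \<Longrightarrow> row_W [Cl_Twisted (A\<^sub>W a), Cl_Swap, Cl_Pair (D\<^sub>W 1) (B\<^sub>W 1)]"
| I2_13: "parameter_W a \<Longrightarrow> row_W [Cl_Twisted (A\<^sub>W a), Cl_Swap, Cl_Pair (D\<^sub>W 0) (B\<^sub>W 2)]"
| I2_14: "parameter_W a \<Longrightarrow> row_W [Cl_Twisted (A\<^sub>W a), Cl_Swap, Cl_Pair (C\<^sub>W 0) (B\<^sub>W 1)]"
| I2_15: "parameter_W a \<Longrightarrow> row_W [Cl_Twisted (A\<^sub>W a), Cl_Swap, Cl_Pair (C\<^sub>W 1) (B\<^sub>W 0)]"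
| F2_1: "row_W [Cl_Pair [(1, 1), (2, 1), (3, (of_nat l - 3) / 3)] [(3, of_nat l / 3)], Cl_Twisted [(1, 1), (2, 1), (3, (of_nat l - 3) / 3)], Cl_Swap]"
| F2_2: "row_W [Cl_Pair [(2, 1), (3, (of_nat l - 2) / 3)] [(1, 2), (3, (of_nat l - 2) / 3)], Cl_Twisted [(2, 1), (3, (of_nat l - 2) / 3)], Cl_Swap]"
| F2_3: "row_W [Cl_Pair [(1, 1), (3, (of_nat l - 1) / 3)] [(2, 2), (3, (of_nat l - 4) / 3)], Cl_Twisted [(1, 1), (3, (of_nat l - 1) / 3)], Cl_Swap]"
| F3_1: "row_W [Cl_Pair [(1, 1), (3, 1), (4, (of_nat l - 4) / 4)] [(4, of_nat l / 4)], Cl_Twisted (B\<^sub>W 2), Cl_Swap]"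
| F3_2: "row_W [Cl_Pair [(2, 1), (3, 1), (4, (of_nat l - 5) / 4)] [(1, 1), (4, (of_nat l - 1) / 4)], Cl_Twisted (B\<^sub>W 1), Cl_Swap]"
| F3_3: "row_W [Cl_Pair [(3, 1), (4, (of_nat l - 3) / 4)] [(1, 1), (2, 1), (4, (of_nat l - 3) / 4)], Cl_Twisted (B\<^sub>W 1), Cl_Swap]"
| F1A_1a: "row_W [Cl_Pair (B\<^sub>W 2) (B\<^sub>W 0), Cl_Pair (B\<^sub>W 2) (B\<^sub>W 2), Cl_Twisted \<tau>\<^sub>W, Cl_Swap]"
| F1A_1b: "row_W [Cl_Pair (B\<^sub>W 2) (B\<^sub>W 0), Cl_Pair (B\<^sub>W 2) (B\<^sub>W 2), Cl_Pair \<tau>\<^sub>W e\<^sub>W, Cl_Swap, Cl_Swap]"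
| F1A_2a: "row_W [Cl_Pair (B\<^sub>W 1) (B\<^sub>W 3), Cl_Pair (B\<^sub>W 1) (B\<^sub>W 1), Cl_Twisted \<tau>\<^sub>W, Cl_Swap]"
| F1A_2b: "row_W [Cl_Pair (B\<^sub>W 1) (B\<^sub>W 3), Cl_Pair (B\<^sub>W 1) (B\<^sub>W 1), Cl_Pair \<tau>\<^sub>W e\<^sub>W, Cl_Swap, Cl_Swap]"
| F1A_3a: "row_W [Cl_Pair (C\<^sub>W 0) (B\<^sub>W 3), Cl_Pair (B\<^sub>W 1) (B\<^sub>W 1), Cl_Swap, Cl_Swap]"
| F1A_3b: "row_W [Cl_Pair (C\<^sub>W 0) (B\<^sub>W 1), Cl_Pair (B\<^sub>W 3) (B\<^sub>W 1), Cl_Swap, Cl_Swap]"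
| F1A_4a: "row_W [Cl_Pair (C\<^sub>W 1) (B\<^sub>W 0), Cl_Pair (B\<^sub>W 2) (B\<^sub>W 2), Cl_Swap, Cl_Swap]"
| F1A_4b: "row_W [Cl_Pair (C\<^sub>W 1) (B\<^sub>W 2), Cl_Pair (B\<^sub>W 0) (B\<^sub>W 2), Cl_Swap, Cl_Swap]"
| F1A_5: "row_W [Cl_Pair (B\<^sub>W 1) (C\<^sub>W 2), Cl_Pair (B\<^sub>W 1) (B\<^sub>W 1), Cl_Swap, Cl_Swap]"
| F1A_6a: "row_W [Cl_Pair (D\<^sub>W 1) (B\<^sub>W 3), Cl_Pair (B\<^sub>W 1) (B\<^sub>W 1), Cl_Swap, Cl_Swap]"
| F1A_6b: "row_W [Cl_Pair (D\<^sub>W 1) (B\<^sub>W 1), Cl_Pair (B\<^sub>W 3) (B\<^sub>W 1), Cl_Swap, Cl_Swap]"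
| F1A_7a: "row_W [Cl_Pair (D\<^sub>W 2) (B\<^sub>W 0), Cl_Pair (B\<^sub>W 2) (B\<^sub>W 2), Cl_Swap, Cl_Swap]"
| F1A_7b: "row_W [Cl_Pair (D\<^sub>W 2) (B\<^sub>W 2), Cl_Pair (B\<^sub>W 0) (B\<^sub>W 2), Cl_Swap, Cl_Swap]"
| F1A_8: "row_W [Cl_Pair (B\<^sub>W 1) (D\<^sub>W 3), Cl_Pair (B\<^sub>W 1) (B\<^sub>W 1), Cl_Swap, Cl_Swap]"
| F1A_9: "row_W [Cl_Pair (B\<^sub>W 2) (D\<^sub>W 0), Cl_Pair (B\<^sub>W 2) (B\<^sub>W 2), Cl_Swap, Cl_Swap]"
| F4_1: "row_W [Cl_Swap, Cl_Swap, Cl_Twisted \<tau>\<^sub>W, Cl_Twisted \<tau>\<^sub>W]"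
| F4_2: "row_W [Cl_Swap, Cl_Swap, Cl_Swap, Cl_Twisted \<tau>\<^sub>W, Cl_Pair \<tau>\<^sub>W e\<^sub>W]"
| F4_3: "row_W [Cl_Swap, Cl_Swap, Cl_Swap, Cl_Swap, Cl_Pair \<tau>\<^sub>W e\<^sub>W, Cl_Pair \<tau>\<^sub>W e\<^sub>W]"
| F4_4: "row_W [Cl_Swap, Cl_Swap, Cl_Swap, Cl_Swap, Cl_Pair \<tau>2\<^sub>W e\<^sub>W]"
| F4_5: "row_W [Cl_Swap, Cl_Swap, Cl_Swap, Cl_Swap, Cl_Pair \<tau>3\<^sub>W e\<^sub>W]"

end

definition ramification_type_W :: "nat \<Rightarrow> class_symbol list \<Rightarrow> bool" where
  "ramification_type_W l R \<longleftrightarrow> row_W l R \<and> (\<forall>c \<in> set R. symbol_ok c)"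

end

theory Submission
  imports Defs "HOL-Number_Theory.Cong"
begin

text \<open>
  Every tuple is written down explicitly: the conjugacy class of \<open>(p, q)\<close> is given by the cycle
  structures of \<open>p\<close> and \<open>q\<close>, and that of \<open>(u, v)s\<close> by the cycle structure of \<open>u \<circ> v\<close>, so a product-1
  tuple comes down to a word in the symmetric group with prescribed cycle structures. The
  words used are factorisations of an \<open>l\<close>-cycle, or of a product of two cycles of coprime lengths, into
  reflections modified at a few points, and products of 3-cycles or of 4-cycles lined up in a row.

  Let \<open>G\<close> contain the tuple. If the first projection of \<open>G \<inter> S\<^sub>l\<^sup>2\<close> contains \<open>A\<^sub>l\<close> and \<open>G\<close> contains some
  \<open>(n, 1)\<close> or \<open>(1, n)\<close> with \<open>n \<noteq> 1\<close>, then the normal closure of \<open>n\<close> under \<open>A\<^sub>l\<close> contains \<open>A\<^sub>l\<close>, and a twisted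
  element of \<open>G\<close> carries this to the other coordinate. A power or a commutator of the tuple yields \<open>n\<close>,
  and the projection is treated by spreading a single 3-cycle over all points. Replacing \<open>(\<tau>, e)s\<close> by
  the two elements \<open>(\<tau>, e)\<close> and \<open>s\<close> only enlarges the group, which gives the rows that
  differ by such a splitting.
\<close>

section \<open>Three-cycles and the alternating group\<close>

text \<open>(p, q) (u, 1)s (q^-1, u^-1 p^-1)s = 1 holds identically, and the third factor is
  conjugate to ((puq)^-1, 1)s. So a row with one pair and two twisted classes asks for p, q, u such
  that p, q, u and puq have given cycle structures; a class s means that the matching word is
  trivial. Two reflections of a circle multiply to a rotation, and their numbers of fixed points
  depend only on the parity of l, so one construction serves rows for odd and for even l. The
  delicate rows are those whose short elements are double transpositions. Such an element gives a
  3-cycle only together with a conjugate meeting it in exactly one point, and the room for that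
  conjugate is what asks for nine points. For cycles of lengths a and l - a the conjugate comes from
  rotating the two cycles independently, which needs coprimality, and small a need their own shifts.
  In several rows containing the class of a twisted transposition, the element (n, 1) comes from two
  pairs of transpositions that multiply to a 3-cycle on one side and to an involution on the other;
  the square is then trivial on the second side.\<close>

lemma conj_transpose:
  assumes "bij f" shows "f \<circ> transpose a b \<circ> inv' f = transpose (f a) (f b)"
  using assms by (metis bij_inv_eq_iff transpose_comp_eq comp_assoc bij_is_surj surj_iff comp_id)

locale perm_group =
  fixes H :: "('a \<Rightarrow> 'a) set"
  assumes id_mem: "id \<in> H"
    and comp_mem: "\<lbrakk>f \<in> H; g \<in> H\<rbrakk> \<Longrightarrow> f \<circ> g \<in> H"
    and bij_mem: "f \<in> H \<Longrightarrow> bij f"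
    and inv_mem: "f \<in> H \<Longrightarrow> inv' f \<in> H"
begin

lemma conj_mem: "\<lbrakk>f \<in> H; g \<in> H\<rbrakk> \<Longrightarrow> f \<circ> g \<circ> inv' f \<in> H"
  by (simp add: comp_mem inv_mem)

lemma funpow_mem: "f \<in> H \<Longrightarrow> f ^^ n \<in> H"
  by (induction n) (auto simp: id_mem[unfolded id_def] comp_mem id_mem)

end

text \<open>The cycle i -> j -> k -> i, written so that it unfolds to
  \<open>cycle_of_list [i, j, k]\<close>, the form in which the 3-cycles are known to generate
  \<open>alt_group\<close>.\<close>

definition cyc3 :: "'a \<Rightarrow> 'a \<Rightarrow> 'a \<Rightarrow> 'a \<Rightarrow> 'a" where
  "cyc3 i j k = transpose i j \<circ> transpose j k"

lemma conj_cyc3: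
  assumes "bij f" shows "f \<circ> cyc3 i j k \<circ> inv' f = cyc3 (f i) (f j) (f k)"
proof -
  have "f \<circ> cyc3 i j k \<circ> inv' f = (f \<circ> transpose i j \<circ> inv' f) \<circ> (f \<circ> transpose j k \<circ> inv' f)"
    using assms by (auto simp: cyc3_def fun_eq_iff bij_is_inj)
  then show ?thesis using assms by (simp add: conj_transpose cyc3_def)
qed

text \<open>(a b)(c d) and (a e)(f g) share only a, so their product is a 3-cycle on a, b, e times
  the involution (c d)(f g) on other points. Squaring removes the involution and inverts the
  3-cycle.\<close>

lemma double_transpositions_cyc3:
  fixes a b c d e f g :: 'a
  assumes d: "distinct [a, b, c, d, e, f, g]"
  defines "t \<equiv> transpose a b \<circ> transpose c d" and "t' \<equiv> transpose a e \<circ> transpose f g"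
  shows "(t \<circ> t') \<circ> (t \<circ> t') = cyc3 a b e"
proof
  fix x
  have t: "t a = b" "t b = a" "t c = d" "t d = c" "\<And>x. x \<notin> {a, b, c, d} \<Longrightarrow> t x = x"
    using d by (auto simp: t_def transpose_def)
  have t': "t' a = e" "t' e = a" "t' f = g" "t' g = f" "\<And>x. x \<notin> {a, e, f, g} \<Longrightarrow> t' x = x"
    using d by (auto simp: t'_def transpose_def)
  have c: "cyc3 a b e a = b" "cyc3 a b e b = e" "cyc3 a b e e = a" "\<And>x. x \<notin> {a, b, e} \<Longrightarrow> cyc3 a b e x = x"
    using d by (auto simp: cyc3_def transpose_def)
  consider "x \<in> {a, b, c, d, e, f, g}" | "x \<notin> {a, b, c, d, e, f, g}" by blast
  then show "((t \<circ> t') \<circ> (t \<circ> t')) x = cyc3 a b e x"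
  proof cases
    case 1
    then show ?thesis using d by (elim insertE emptyE) (auto simp: t t' c)
  next
    case 2
    then show ?thesis by (simp add: t t' c)
  qed
qed

text \<open>
  Being joined by a 3-cycle of \<open>H\<close> is an \<open>H\<close>-invariant equivalence relation, and \<open>H\<close> contains the
  alternating group as soon as all points are equivalent.
\<close>

definition tri :: "('a \<Rightarrow> 'a) set \<Rightarrow> 'a \<Rightarrow> 'a \<Rightarrow> bool" where
  "tri H i j \<longleftrightarrow> i = j \<or> (\<exists>k. distinct [i, j, k] \<and> cyc3 i j k \<in> H)"

lemma tri_refl: "tri H i i"
  by (simp add: tri_def)

lemma cyc3_rotate: "distinct [i, j, k] \<Longrightarrow> cyc3 i j k = cyc3 j k i"
  by (auto simp: cyc3_def fun_eq_iff transpose_def)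

lemma cyc3_square: "distinct [i, j, k] \<Longrightarrow> cyc3 i j k \<circ> cyc3 i j k = cyc3 j i k"
  by (auto simp: cyc3_def fun_eq_iff transpose_def)

lemma cyc3_inverse: "distinct [i, j, k] \<Longrightarrow> cyc3 i j k \<circ> cyc3 j i k = id"
  by (auto simp: cyc3_def fun_eq_iff transpose_def)

lemma cyc3_apply:
  assumes "distinct [i, j, k]"
  shows "cyc3 i j k i = j" "cyc3 i j k j = k" "cyc3 i j k k = i"
    "x \<notin> {i, j, k} \<Longrightarrow> cyc3 i j k x = x"
  using assms by (auto simp: cyc3_def transpose_def)

context perm_group begin

lemma cyc3_flip_mem: "\<lbrakk>distinct [i, j, k]; cyc3 i j k \<in> H\<rbrakk> \<Longrightarrow> cyc3 j i k \<in> H"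
  using comp_mem cyc3_square by metis

lemma tri_sym: "tri H i j \<Longrightarrow> tri H j i"
  unfolding tri_def using cyc3_flip_mem by fastforce

lemma triI:
  assumes "distinct [i, j, k]" "cyc3 i j k \<in> H"
  shows "tri H i j" "tri H j k" "tri H i k"
proof -
  show "tri H i j" using assms by (auto simp: tri_def)
  have 1: "cyc3 j k i \<in> H" using assms by (simp add: cyc3_rotate[symmetric])
  then show "tri H j k" using assms by (auto simp: tri_def)
  then have "cyc3 k i j \<in> H" using assms(1) 1 cyc3_rotate[of j k i] by auto
  moreover have "distinct [k, i, j]" using assms(1) by auto
  ultimately have "tri H k i" unfolding tri_def by blast
  then show "tri H i k" by (rule tri_sym)
qed

lemma tri_image: "\<lbrakk>f \<in> H; tri H i j\<rbrakk> \<Longrightarrow> tri H (f i) (f j)"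
proof -
  assume f: "f \<in> H" and "tri H i j"
  then consider "i = j" | k where "distinct [i, j, k]" "cyc3 i j k \<in> H" by (auto simp: tri_def)
  then show ?thesis
  proof cases
    case 2
    have "distinct [f i, f j, f k]" using 2(1) bij_mem[OF f] by (auto simp: bij_def inj_eq)
    moreover have "cyc3 (f i) (f j) (f k) \<in> H"
      using conj_mem[OF f 2(2)] conj_cyc3[OF bij_mem[OF f]] by metis
    ultimately show ?thesis unfolding tri_def by blast
  qed (simp add: tri_def)
qed

text \<open>The 3-cycle through j and k carries j to k and, unless it passes through i, fixes i.
  Applying it to the related pair i, j therefore gives the pair i, k.\<close>

lemma tri_trans:
  assumes "tri H i j" "tri H j k" shows "tri H i k"
proof (cases "i = j \<or> j = k \<or> i = k")
  case True then show ?thesis using assms by (auto simp: tri_def)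
next
  case False
  then obtain m n where m: "distinct [i, j, m]" "cyc3 i j m \<in> H"
    and n: "distinct [j, k, n]" "cyc3 j k n \<in> H" using assms by (auto simp: tri_def)
  show ?thesis
  proof (cases "m = k \<or> n = i")
    case True then show ?thesis using triI[OF m] triI[OF n] tri_sym by blast
  next
    case F: False
    define h where "h = cyc3 j k n"
    have "tri H (h i) (h j)" using tri_image[OF n(2) assms(1)] by (simp add: h_def)
    moreover have "h i = i" "h j = k" using False F n(1) cyc3_apply[OF n(1)] by (auto simp: h_def)
    ultimately show ?thesis by simp
  qed
qed

text \<open>\<open>tri\<close> leaves the third point of a 3-cycle uncontrolled. If (i j m) is
  available with m other than k, a 3-cycle m -> k -> n is used to move m to k. When n is i or j the
  roles are exchanged: the 3-cycle through k is conjugated by one on i, j, m.\<close>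

lemma cyc3_mem:
  assumes ij: "tri H i j" and ik: "tri H i k" and d: "distinct [i, j, k]"
  shows "cyc3 i j k \<in> H"
proof -
  obtain m where m: "distinct [i, j, m]" "cyc3 i j m \<in> H" using ij d by (auto simp: tri_def)
  show ?thesis
  proof (cases "m = k")
    case False
    moreover have "tri H m k" using tri_trans[OF tri_sym[OF triI(3)[OF m]] ik] .
    ultimately obtain n where n: "distinct [m, k, n]" "cyc3 m k n \<in> H" by (auto simp: tri_def)
    consider "n = i" | "n = j" | "n \<noteq> i" "n \<noteq> j" by blast
    then show ?thesis
    proof cases
      case 1
      have "cyc3 i j m k = k" using d False by (intro cyc3_apply(4) m) auto
      then have "cyc3 i j m \<circ> cyc3 m k n \<circ> inv' (cyc3 i j m) = cyc3 i k j"
        using d m(1) 1 False cyc3_apply[OF m(1)] by (simp add: conj_cyc3[OF bij_mem[OF m(2)]])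
      then have "cyc3 i k j \<in> H" using conj_mem[OF m(2) n(2)] by simp
      then have "cyc3 k i j \<in> H" using d cyc3_flip_mem[of i k j] by auto
      then show ?thesis using d cyc3_rotate[of k i j] by auto
    next
      case 2
      have m': "distinct [j, i, m]" "cyc3 j i m \<in> H" using cyc3_flip_mem[OF m] m(1) by auto
      have "cyc3 j i m k = k" using d False by (intro cyc3_apply(4) m') auto
      then have "cyc3 j i m \<circ> cyc3 m k n \<circ> inv' (cyc3 j i m) = cyc3 j k i"
        using d m(1) 2 False cyc3_apply[OF m'(1)] by (simp add: conj_cyc3[OF bij_mem[OF m'(2)]])
      then show ?thesis using conj_mem[OF m'(2) n(2)] d cyc3_rotate[of i j k] by auto
    next
      case 3
      have "cyc3 m k n i = i" "cyc3 m k n j = j" using d 3 m(1) n(1) by (auto intro!: cyc3_apply(4))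
      then have "cyc3 m k n \<circ> cyc3 i j m \<circ> inv' (cyc3 m k n) = cyc3 i j k"
        using d m(1) n(1) 3 cyc3_apply[OF n(1)] by (simp add: conj_cyc3[OF bij_mem[OF n(2)]])
      then show ?thesis using conj_mem[OF n(2) m(2)] by simp
    qed
  qed (use m in simp)
qed

end

lemma cyc3_eq_cycle_of_list: "cyc3 i j k = cycle_of_list [i, j, k]"
  by (simp add: cyc3_def)

lemma cyc3_in_alt_group:
  assumes "distinct [i, j, k]" "{i, j, k} \<subseteq> {1..l}"
  shows "cyc3 i j k \<in> carrier (alt_group l)"
proof -
  have "cyc3 i j k \<in> three_cycles l"
    using assms unfolding cyc3_eq_cycle_of_list by (intro CollectI exI[of _ "[i, j, k]"]) auto
  then show ?thesis using three_cycles_incl by blast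
qed

lemma three_cyclesE:
  assumes "h \<in> three_cycles l"
  obtains i j k where "h = cyc3 i j k" "distinct [i, j, k]" "{i, j, k} \<subseteq> {1..l}"
proof -
  obtain cs where cs: "h = cycle_of_list cs" "distinct cs" "length cs = 3" "set cs \<subseteq> {1..l}"
    using assms by blast
  then obtain i j k where "cs = [i, j, k]" using stupid_lemma by metis
  then show thesis using cs that[of i j k] by (simp only: cyc3_eq_cycle_of_list list.set)
qed

lemma alt_group_subset:
  assumes H: "perm_group H" and "\<And>i j. \<lbrakk>i \<in> {1..l}; j \<in> {1..l}\<rbrakk> \<Longrightarrow> tri H i j"
  shows "carrier (alt_group l) \<subseteq> H"
proof
  interpret perm_group H by fact
  fix f assume "f \<in> carrier (alt_group l)"
  then have "f \<in> generate (alt_group l) (three_cycles l)" by (simp add: alt_group_carrier_as_three_cycles)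
  then show "f \<in> H"
  proof induction
    case one then show ?case using id_mem by (simp add: alt_group_one id_def)
  next
    case (incl h)
    then obtain i j k where h: "h = cyc3 i j k" "distinct [i, j, k]" "{i, j, k} \<subseteq> {1..l}"
      by (rule three_cyclesE)
    then show ?case using cyc3_mem[of i j k] assms(2) by auto
  next
    case (inv h)
    then obtain i j k where h: "h = cyc3 i j k" "distinct [i, j, k]" "{i, j, k} \<subseteq> {1..l}"
      by (rule three_cyclesE)
    then have "h \<in> H" using cyc3_mem[of i j k] assms(2) by auto
    moreover have "h \<in> carrier (alt_group l)" using inv three_cycles_incl by blast
    ultimately show ?case by (simp add: alt_group_inv_equality inv_mem)
  next
    case (eng h1 h2) then show ?case using comp_mem[of h1 h2] by (simp add: alt_group_mult comp_def)
  qed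
qed

section \<open>Normal closures under the alternating group\<close>

lemma cyc3_commutator:
  assumes d: "distinct [x, w1, w2]" and f: "bij f" "f x \<noteq> x" "f w1 = w1" "f w2 = w2"
  shows "(f \<circ> cyc3 x w1 w2 \<circ> inv' f) \<circ> cyc3 w1 x w2 = cyc3 x (f x) w1"
proof -
  define y where "y = f x"
  have y: "distinct [y, x, w1, w2]"
    using assms unfolding y_def by (auto simp: bij_def dest: injD[of f x w1] injD[of f x w2])
  \<comment> \<open>The two 3-cycles share w1 and w2 and differ only in the third point, y against
    x; their product collapses to a single 3-cycle.\<close>
  have "cyc3 y w1 w2 \<circ> cyc3 w1 x w2 = cyc3 x y w1"
  proof
    fix z
    have 1: "cyc3 y w1 w2 y = w1" "cyc3 y w1 w2 w1 = w2" "cyc3 y w1 w2 w2 = y" "cyc3 y w1 w2 x = x"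
      "cyc3 w1 x w2 w1 = x" "cyc3 w1 x w2 x = w2" "cyc3 w1 x w2 w2 = w1" "cyc3 w1 x w2 y = y"
      "cyc3 x y w1 x = y" "cyc3 x y w1 y = w1" "cyc3 x y w1 w1 = x" "cyc3 x y w1 w2 = w2"
      "z \<notin> {y, w1, w2} \<Longrightarrow> cyc3 y w1 w2 z = z" "z \<notin> {w1, x, w2} \<Longrightarrow> cyc3 w1 x w2 z = z"
      "z \<notin> {x, y, w1} \<Longrightarrow> cyc3 x y w1 z = z"
      using y by (auto simp: cyc3_def transpose_def)
    consider "z \<in> {x, y, w1, w2}" | "z \<notin> {x, y, w1, w2}" by blast
    then show "(cyc3 y w1 w2 \<circ> cyc3 w1 x w2) z = cyc3 x y w1 z"
      by cases (use y 1 in auto)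
  qed
  then show ?thesis using f by (simp add: conj_cyc3 y_def)
qed

text \<open>The commutator of g with a 3-cycle is a product of two 3-cycles and so moves at most six
  points. As l >= 8, it fixes two further points, and its commutator with a 3-cycle through one
  moved and these two fixed points is a 3-cycle of N, which the alternating group carries
  everywhere.\<close>

lemma alt_group_subset_normal:
  assumes l: "l \<ge> 8" and N: "perm_group N" and g: "g \<in> N" "g permutes {1..l}" "g \<noteq> id"
    and nrm: "\<And>h n. \<lbrakk>h \<in> carrier (alt_group l); n \<in> N\<rbrakk> \<Longrightarrow> h \<circ> n \<circ> inv' h \<in> N"
  shows "carrier (alt_group l) \<subseteq> N"
proof -
  interpret perm_group N by fact
  let ?S = "{1..l}"
  have ex: "\<exists>z \<in> ?S. z \<notin> set xs" if "length xs < l" for xs :: "nat list"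
  proof (rule ccontr)
    assume "\<not> (\<exists>z \<in> ?S. z \<notin> set xs)"
    then have "?S \<subseteq> set xs" by blast
    then have "card ?S \<le> card (set xs)" by (intro card_mono) auto
    then show False using that card_length[of xs] by simp
  qed
  have prod: "n \<circ> (h \<circ> inv' n \<circ> inv' h) \<in> N" if "n \<in> N" "h \<in> carrier (alt_group l)" for n h
    using that by (intro comp_mem nrm inv_mem)
  obtain x where x: "g x \<noteq> x" using g(3) by (auto simp: fun_eq_iff)
  then have "x \<in> ?S" using g(2) by (metis permutes_not_in)
  then have xS: "x \<in> ?S" "g x \<in> ?S" using permutes_in_image[OF g(2)] by blast+
  have "\<exists>z \<in> ?S. z \<notin> set [x, g x]" using l by (intro ex) simp
  then obtain z where z: "z \<in> ?S" "z \<notin> {x, g x}" unfolding list.set by blast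
  have "\<exists>w \<in> ?S. w \<notin> set [x, g x, z]" using l by (intro ex) simp
  then obtain w where w: "w \<in> ?S" "w \<notin> {x, g x, z}" unfolding list.set by blast
  \<comment> \<open>z and w avoid x and g x, so the inverse of t fixes g x, and n sends g x to g z:
    the commutator n is not the identity.\<close>
  define t where "t = cyc3 x z w"
  have d: "distinct [x, z, w]" using z w by auto
  have t: "t \<in> carrier (alt_group l)" unfolding t_def using d xS z w by (intro cyc3_in_alt_group) auto
  then have tb: "bij t" "t permutes ?S" by (auto simp: alt_group_carrier permutes_bij)
  define n where "n = g \<circ> (t \<circ> inv' g \<circ> inv' t)"
  have nN: "n \<in> N" unfolding n_def using g(1) t by (rule prod)
  have n_eq: "n = cyc3 (g x) (g z) (g w) \<circ> inv' t"
  proof -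
    have "n = (g \<circ> t \<circ> inv' g) \<circ> inv' t" by (simp add: n_def comp_assoc)
    then show ?thesis using g(1) bij_mem by (simp add: t_def conj_cyc3)
  qed
  have gd: "distinct [g x, g z, g w]" using d bij_mem[OF g(1)] by (auto simp: bij_def inj_eq)
  have inv_t: "inv' t u = u" if "u \<notin> {x, z, w}" for u
    using cyc3_apply(4)[OF d that] tb(1) by (metis bij_inv_eq_iff t_def)
  have "inv' t (g x) = g x" using x z w by (intro inv_t) auto
  then have "n (g x) = g z" by (simp add: n_eq cyc3_apply(1)[OF gd])
  then have n_gx: "n (g x) \<noteq> g x" using gd by auto
  have n_fix: "n u = u" if "u \<notin> {x, z, w, g x, g z, g w}" for u
  proof -
    have "inv' t u = u" "cyc3 (g x) (g z) (g w) u = u"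
      using that by (intro inv_t cyc3_apply(4)[OF gd]; blast)+
    then show ?thesis by (simp add: n_eq)
  qed
  have "\<exists>w1 \<in> ?S. w1 \<notin> set [x, z, w, g x, g z, g w]" using l by (intro ex) simp
  then obtain w1 where w1: "w1 \<in> ?S" "w1 \<notin> {x, z, w, g x, g z, g w}" unfolding list.set by blast
  have "\<exists>w2 \<in> ?S. w2 \<notin> set [x, z, w, g x, g z, g w, w1]" using l by (intro ex) simp
  then obtain w2 where w2: "w2 \<in> ?S" "w2 \<notin> {x, z, w, g x, g z, g w, w1}" unfolding list.set by blast
  define y where "y = g x"
  have "w1 \<noteq> y" "w2 \<noteq> y" "w1 \<noteq> w2" using w1(2) w2(2) unfolding y_def by blast+
  then have dy: "distinct [y, w1, w2]" by auto
  have fixed: "n w1 = w1" "n w2 = w2" using w1(2) w2(2) by (intro n_fix; blast)+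
  define s where "s = cyc3 y w1 w2"
  have s: "s \<in> carrier (alt_group l)"
    unfolding s_def using dy xS(2) w1(1) w2(1) unfolding y_def by (intro cyc3_in_alt_group) blast+
  have inv_s: "inv' s = cyc3 w1 y w2"
    unfolding s_def using cyc3_inverse[of y w1 w2] cyc3_inverse[of w1 y w2] dy
    by (intro inv_unique_comp) auto
  have "n y \<noteq> y" using n_gx by (simp only: y_def not_False_eq_True)
  have "n \<circ> (s \<circ> inv' n \<circ> inv' s) = (n \<circ> s \<circ> inv' n) \<circ> inv' s" by (simp only: comp_assoc)
  also have "\<dots> = cyc3 y (n y) w1"
    unfolding inv_s unfolding s_def
    by (rule cyc3_commutator[OF dy bij_mem[OF nN] \<open>n y \<noteq> y\<close> fixed])
  finally have "n \<circ> (s \<circ> inv' n \<circ> inv' s) = cyc3 y (n y) w1" .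
  then have c: "cyc3 y (n y) w1 \<in> N" using prod[OF nN s] by simp
  have "n y \<noteq> w1" using fixed(1) \<open>w1 \<noteq> y\<close> injD[OF bij_is_inj[OF bij_mem[OF nN]], of y w1] by metis
  then have dc: "distinct [y, n y, w1]" using \<open>n y \<noteq> y\<close> dy by auto
  have trih: "tri N (h i) (h j)" if ij: "tri N i j" and h: "h \<in> carrier (alt_group l)" for h i j
  proof -
    have "bij h" using h by (auto simp: alt_group_carrier permutes_bij)
    consider "i = j" | k where "distinct [i, j, k]" "cyc3 i j k \<in> N" using ij by (auto simp: tri_def)
    then show ?thesis
    proof cases
      case 2
      have "cyc3 (h i) (h j) (h k) \<in> N" using nrm[OF h 2(2)] conj_cyc3[OF \<open>bij h\<close>] by metis
      moreover have "distinct [h i, h j, h k]" using 2(1) \<open>bij h\<close> by (auto simp: bij_def inj_eq)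
      ultimately show ?thesis unfolding tri_def by blast
    qed (simp add: tri_def)
  qed
  have y_tri: "tri N y j" if "j \<in> ?S" for j
  proof (cases "j = y \<or> j = w1")
    case True then show ?thesis using True triI(3)[OF dc c] tri_refl[of N y] by auto
  next
    case False
    have "\<exists>v \<in> ?S. v \<notin> set [y, w1, j]" using l by (intro ex) simp
    then obtain v where v: "v \<in> ?S" "v \<notin> {y, w1, j}" unfolding list.set by blast
    \<comment> \<open>(w1 j v) fixes y and takes w1 to j, so it carries the related pair y, w1 to y,
      j.\<close>
    have dd: "distinct [w1, j, v]" using False v(2) by auto
    have cm: "cyc3 w1 j v \<in> carrier (alt_group l)"
      using dd w1(1) v(1) that by (intro cyc3_in_alt_group) blast+
    have "tri N (cyc3 w1 j v y) (cyc3 w1 j v w1)" by (rule trih[OF triI(3)[OF dc c] cm])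
    moreover have "cyc3 w1 j v y = y" using False v(2) dy by (intro cyc3_apply(4)[OF dd]) auto
    ultimately show ?thesis using cyc3_apply(1)[OF dd] by simp
  qed
  show ?thesis
    by (rule alt_group_subset[OF N]) (rule tri_trans[OF tri_sym[OF y_tri] y_tri])
qed

section \<open>Cycle structures under inversion and conjugation\<close>

lemma cycle_type_inv:
  assumes "f permutes {1..l}" shows "cycle_type l (inv' f) = cycle_type l f"
  using assms orbit_inv_eq[of f] by (simp add: cycle_type_def permutation_permutes) (metis finite_atLeastAtMost)

lemma orbit_conj:
  assumes "bij g" shows "Orbits.orbit (g \<circ> f \<circ> inv' g) (g x) = g ` Orbits.orbit f x"
proof -
  have "((g \<circ> f \<circ> inv' g) ^^ n) (g x) = g ((f ^^ n) x)" for n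
    using assms by (induction n) (auto simp: bij_is_inj)
  then show ?thesis by (auto simp: orbit_altdef)
qed

lemma cycle_type_conj:
  assumes g: "g permutes {1..l}" and f: "f permutes {1..l}"
  shows "cycle_type l (g \<circ> f \<circ> inv' g) = cycle_type l f"
proof -
  have bij: "bij g" using g by (rule permutes_bij)
  have "{Orbits.orbit (g \<circ> f \<circ> inv' g) i | i. i \<in> {1..l}} = (\<lambda>i. Orbits.orbit (g \<circ> f \<circ> inv' g) (g i)) ` {1..l}"
    using permutes_image[OF g] by (auto simp del: atLeastAtMost_iff) (metis (full_types) imageE imageI)
  also have "\<dots> = (`) g ` {Orbits.orbit f i | i. i \<in> {1..l}}"
    unfolding orbit_conj[OF bij] Setcompr_eq_image image_image ..
  finally have eq: "{Orbits.orbit (g \<circ> f \<circ> inv' g) i | i. i \<in> {1..l}} = (`) g ` {Orbits.orbit f i | i. i \<in> {1..l}}" .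
  have "inj_on ((`) g) {Orbits.orbit f i | i. i \<in> {1..l}}"
    using bij by (meson bij_is_inj inj_image_eq_iff inj_onI)
  then show ?thesis
    unfolding cycle_type_def eq
    using bij by (simp add: image_mset_mset_set[symmetric] multiset.map_comp comp_def card_image bij_is_inj inj_on_subset[of g UNIV])
qed

section \<open>Conjugacy classes of the wreath product\<close>

text \<open>The criterion gx = yg mentions no inverse, so membership reduces to an equality of
  explicit functions.\<close>

lemma conj_classI:
  assumes "g \<in> carrier (wreath_S2 l)" "x \<in> carrier (wreath_S2 l)" "y \<in> carrier (wreath_S2 l)" "g \<circ> x = y \<circ> g"
  shows "y \<in> conj_class (wreath_S2 l) x"
proof -
  interpret group "wreath_S2 l" by (rule wreath_S2_group)
  have "g \<otimes>\<^bsub>wreath_S2 l\<^esub> x = y \<otimes>\<^bsub>wreath_S2 l\<^esub> g" using assms(4) by (simp add: wreath_S2_def)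
  then have "y = g \<otimes>\<^bsub>wreath_S2 l\<^esub> x \<otimes>\<^bsub>wreath_S2 l\<^esub> inv\<^bsub>wreath_S2 l\<^esub> g"
    using assms(1-3) by (metis inv_solve_right m_closed)
  then show ?thesis using assms(1) by (auto simp: conj_class_def)
qed

lemma map_prod_carrier:
  "\<lbrakk>a permutes {1..l}; b permutes {1..l}\<rbrakk> \<Longrightarrow> map_prod a b \<in> carrier (wreath_S2 l)"
  using wreath_S2_carrierI[of a l b id] by simp

lemma pair_mem:
  assumes "p permutes {1..l}" "q permutes {1..l}" "cycle_type l p = parts P" "cycle_type l q = parts Q"
  shows "map_prod p q \<in> wreath_class l (Cl_Pair P Q)"
proof -
  have "map_prod p q \<in> conj_class (wreath_S2 l) (map_prod p q)"
    using assms(1,2) map_prod_carrier[OF permutes_id permutes_id]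
    by (intro conj_classI[of id]) (auto intro: map_prod_carrier simp: prod.map_id0)
  then show ?thesis using assms by (auto simp: sym_group_carrier)
qed

lemma pair_flip_mem:
  assumes "p permutes {1..l}" "q permutes {1..l}" "cycle_type l p = parts P" "cycle_type l q = parts Q"
  shows "map_prod q p \<in> wreath_class l (Cl_Pair P Q)"
proof -
  have "map_prod q p \<in> conj_class (wreath_S2 l) (map_prod p q)"
    using assms(1,2) wreath_S2_carrierI[OF permutes_id permutes_id, of prod.swap]
    by (intro conj_classI[of prod.swap]) (auto intro: map_prod_carrier simp: prod.map_id0)
  then show ?thesis using assms by (auto simp: sym_group_carrier)
qed

lemma map_prod_swap_carrier:
  "\<lbrakk>a permutes {1..l}; b permutes {1..l}\<rbrakk> \<Longrightarrow> map_prod a b \<circ> prod.swap \<in> carrier (wreath_S2 l)"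
  using wreath_S2_carrierI[of a l b prod.swap] by simp

lemma conj_class_map_prod_swap:
  assumes u: "u permutes {1..l}" and v: "v permutes {1..l}"
  shows "map_prod u v \<circ> prod.swap \<in> conj_class (wreath_S2 l) (map_prod (u \<circ> v) id \<circ> prod.swap)"
proof (rule conj_classI)
  show "map_prod id v \<in> carrier (wreath_S2 l)" using map_prod_carrier[OF permutes_id v] .
  show "map_prod (u \<circ> v) id \<circ> prod.swap \<in> carrier (wreath_S2 l)"
    using map_prod_swap_carrier[OF permutes_compose[OF v u] permutes_id] .
  show "map_prod u v \<circ> prod.swap \<in> carrier (wreath_S2 l)" using map_prod_swap_carrier[OF u v] .
  show "map_prod id v \<circ> (map_prod (u \<circ> v) id \<circ> prod.swap) = map_prod u v \<circ> prod.swap \<circ> map_prod id v"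
    by (auto simp: fun_eq_iff)
qed

lemma twisted_mem:
  assumes u: "u permutes {1..l}" and v: "v permutes {1..l}" and "cycle_type l (u \<circ> v) = parts P"
  shows "map_prod u v \<circ> prod.swap \<in> wreath_class l (Cl_Twisted P)"
  unfolding wreath_class.simps
  using conj_class_map_prod_swap[OF u v] assms(3) permutes_compose[OF v u]
  by (intro UN_I[of "u \<circ> v"]) (simp_all add: sym_group_carrier)

lemma swap_mem:
  assumes u: "u permutes {1..l}" and v: "v permutes {1..l}" and "u \<circ> v = id"
  shows "map_prod u v \<circ> prod.swap \<in> wreath_class l Cl_Swap"
  using conj_class_map_prod_swap[OF u v] assms(3) by (simp add: prod.map_id0)

lemma wreath_inv:
  assumes "g \<in> carrier (wreath_S2 l)" shows "bij g" "inv\<^bsub>wreath_S2 l\<^esub> g = inv' g"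
proof -
  interpret group "wreath_S2 l" by (rule wreath_S2_group)
  have "inv\<^bsub>wreath_S2 l\<^esub> g \<circ> g = id" "g \<circ> inv\<^bsub>wreath_S2 l\<^esub> g = id"
    using l_inv[OF assms] r_inv[OF assms] by (simp_all add: wreath_S2_def)
  then show "bij g" "inv\<^bsub>wreath_S2 l\<^esub> g = inv' g"
    by (metis o_bij, metis inv_unique_comp)
qed

section \<open>Subgroups of the wreath product and their coordinate projections\<close>

lemma perm_group_generate:
  assumes "X \<subseteq> carrier (wreath_S2 l)"
  shows "perm_group (generate (wreath_S2 l) X)"
proof -
  interpret group "wreath_S2 l" by (rule wreath_S2_group)
  have incl: "g \<in> generate (wreath_S2 l) X \<Longrightarrow> g \<in> carrier (wreath_S2 l)" for g
    using generate_incl[OF assms] by blast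
  show ?thesis
  proof
    show "id \<in> generate (wreath_S2 l) X" using generate.one[of "wreath_S2 l" X] by (simp add: wreath_S2_def)
    show "f \<circ> g \<in> generate (wreath_S2 l) X"
      if "f \<in> generate (wreath_S2 l) X" "g \<in> generate (wreath_S2 l) X" for f g
      using generate.eng[OF that] by (simp add: wreath_S2_def)
    show "bij f" if "f \<in> generate (wreath_S2 l) X" for f using wreath_inv(1) incl that by blast
    show "inv' f \<in> generate (wreath_S2 l) X" if "f \<in> generate (wreath_S2 l) X" for f
      using generate_m_inv_closed[OF assms that] wreath_inv(2)[OF incl[OF that]] by simp
  qed
qed

lemma bij_map_prodD:
  assumes "bij (map_prod f g)" shows "bij f" "bij g"
proof -
  have inj: "inj (map_prod f g)" and surj: "surj (map_prod f g)" using assms by (auto simp: bij_def)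
  have "inj f" using injD[OF inj, of "(_, undefined)" "(_, undefined)"] by (intro injI) simp
  moreover have "inj g" using injD[OF inj, of "(undefined, _)" "(undefined, _)"] by (intro injI) simp
  moreover have "\<exists>x. y = f x" for y using surjD[OF surj, of "(y, undefined)"] by auto
  moreover have "\<exists>x. y = g x" for y using surjD[OF surj, of "(undefined, y)"] by auto
  ultimately show "bij f" "bij g" by (simp_all add: bij_def surj_def)
qed

lemma inv_map_prod:
  assumes "bij f" "bij g" shows "inv' (map_prod f g) = map_prod (inv' f) (inv' g)"
  by (rule inv_unique_comp)
    (use assms in \<open>auto simp: fun_eq_iff bij_is_inj bij_is_surj surj_f_inv_f\<close>)

definition fst_projection :: "('a \<times> 'a \<Rightarrow> 'a \<times> 'a) set \<Rightarrow> ('a \<Rightarrow> 'a) set" where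
  "fst_projection G = {f. \<exists>g. map_prod f g \<in> G}"

lemma perm_group_fst_projection:
  assumes "perm_group G" shows "perm_group (fst_projection G)"
proof -
  interpret perm_group G by fact
  show ?thesis
  proof
    show "id \<in> fst_projection G" using id_mem by (auto simp: fst_projection_def prod.map_id0 intro!: exI[of _ id])
    fix f assume "f \<in> fst_projection G"
    then obtain g where g: "map_prod f g \<in> G" by (auto simp: fst_projection_def)
    show "bij f" using bij_map_prodD(1)[OF bij_mem[OF g]] .
    show "inv' f \<in> fst_projection G"
      using inv_mem[OF g] inv_map_prod[OF bij_map_prodD[OF bij_mem[OF g]]] by (auto simp: fst_projection_def)
    fix f' assume "f' \<in> fst_projection G"
    then obtain g' where "map_prod f' g' \<in> G" by (auto simp: fst_projection_def)
    then have "map_prod (f \<circ> f') (g \<circ> g') \<in> G" using comp_mem[OF g, of "map_prod f' g'"] by (simp only: map_prod.comp)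
    then show "f \<circ> f' \<in> fst_projection G" by (auto simp: fst_projection_def)
  qed
qed

lemma fst_kernel_conj:
  assumes "perm_group G" "map_prod n id \<in> G" "map_prod h k \<in> G"
  shows "map_prod (h \<circ> n \<circ> inv' h) id \<in> G"
proof -
  interpret perm_group G by fact
  have bij: "bij h" "bij k" using bij_map_prodD[OF bij_mem[OF assms(3)]] by auto
  have "map_prod h k \<circ> map_prod n id \<circ> inv' (map_prod h k) = map_prod (h \<circ> n \<circ> inv' h) id"
    using bij by (auto simp: inv_map_prod fun_eq_iff bij_is_surj surj_f_inv_f)
  then show ?thesis using conj_mem[OF assms(3,2)] by simp
qed

lemma conj_eqI:
  assumes "bij x" "x \<circ> a = b \<circ> x" shows "x \<circ> a \<circ> inv' x = b"
  using assms by (simp add: fun_eq_iff bij_is_surj surj_f_inv_f)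

lemma alt_square_subset:
  assumes l: "l \<ge> 8" and G: "perm_group G"
    and proj: "carrier (alt_group l) \<subseteq> fst_projection G"
    and n: "map_prod n id \<in> G" "n permutes {1..l}" "n \<noteq> id"
    and tw: "map_prod u v \<circ> prod.swap \<in> G" and v: "v permutes {1..l}"
  shows "alt_square l \<subseteq> G"
proof -
  interpret perm_group G by fact
  define N where "N = {n. map_prod n id \<in> G}"
  have "perm_group N"
  proof
    show "id \<in> N" using id_mem by (simp add: N_def prod.map_id0)
    fix f assume f: "f \<in> N"
    show "bij f" using f bij_map_prodD(1)[OF bij_mem] by (auto simp: N_def)
    then show "inv' f \<in> N" using f inv_mem[of "map_prod f id"] by (simp add: N_def inv_map_prod)
    fix g assume "g \<in> N"
    then have "map_prod f id \<circ> map_prod g id \<in> G" using f by (intro comp_mem) (auto simp: N_def)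
    then show "f \<circ> g \<in> N" by (simp only: N_def map_prod.comp mem_Collect_eq comp_id)
  qed
  moreover have "h \<circ> m \<circ> inv' h \<in> N" if "h \<in> carrier (alt_group l)" "m \<in> N" for h m
    using that proj fst_kernel_conj[OF G] by (fastforce simp: N_def fst_projection_def)
  ultimately have alt: "carrier (alt_group l) \<subseteq> N"
    using n by (intro alt_group_subset_normal[OF l, of N n]) (auto simp: N_def)
  have snd: "map_prod id b \<in> G" if b: "b \<in> carrier (alt_group l)" for b
  proof -
    \<comment> \<open>Conjugating (a, 1) by (u, v)s gives (1, v a v^-1), which is (1, b) for this a;
      a is even because b is.\<close>
    define a where "a = inv' v \<circ> b \<circ> v"
    have "bij v" using v by (rule permutes_bij)
    have "permutation v" "permutation b" using v b by (auto simp: permutation_permutes alt_group_carrier)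
    then have "evenperm a"
      using b by (simp add: a_def evenperm_comp evenperm_inv permutation_compose permutation_inverse alt_group_carrier)
    moreover have "a permutes {1..l}"
      using b v unfolding a_def by (intro permutes_compose permutes_inv) (auto simp: alt_group_carrier)
    ultimately have "map_prod a id \<in> G" using alt by (auto simp: N_def alt_group_carrier)
    moreover have "(map_prod u v \<circ> prod.swap) \<circ> map_prod a id = map_prod id b \<circ> (map_prod u v \<circ> prod.swap)"
      using \<open>bij v\<close> by (auto simp: a_def fun_eq_iff bij_is_surj surj_f_inv_f)
    then have "(map_prod u v \<circ> prod.swap) \<circ> map_prod a id \<circ> inv' (map_prod u v \<circ> prod.swap) = map_prod id b"
      by (rule conj_eqI[OF bij_mem[OF tw]])
    ultimately show ?thesis using conj_mem[OF tw, of "map_prod a id"] by (simp only:)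
  qed
  have "map_prod a b \<in> G" if "a \<in> carrier (alt_group l)" "b \<in> carrier (alt_group l)" for a b
  proof -
    have "map_prod a id \<circ> map_prod id b \<in> G" using that alt snd by (intro comp_mem) (auto simp: N_def)
    then show ?thesis by (simp only: map_prod.comp comp_id id_comp)
  qed
  then show ?thesis by (auto simp: alt_square_def)
qed

lemma snd_kernel_flip:
  assumes "perm_group G" and n: "map_prod id n \<in> G" "n permutes {1..l}" "n \<noteq> id"
    and tw: "map_prod u v \<circ> prod.swap \<in> G" and u: "u permutes {1..l}"
  obtains m where "map_prod m id \<in> G" "m permutes {1..l}" "m \<noteq> id"
proof
  interpret perm_group G by fact
  let ?m = "u \<circ> n \<circ> inv' u"
  have "bij u" using u by (rule permutes_bij)
  have "(map_prod u v \<circ> prod.swap) \<circ> map_prod id n = map_prod ?m id \<circ> (map_prod u v \<circ> prod.swap)"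
    using \<open>bij u\<close> by (auto simp: fun_eq_iff bij_is_inj)
  then have "(map_prod u v \<circ> prod.swap) \<circ> map_prod id n \<circ> inv' (map_prod u v \<circ> prod.swap) = map_prod ?m id"
    by (rule conj_eqI[OF bij_mem[OF tw]])
  then show "map_prod ?m id \<in> G" using conj_mem[OF tw n(1)] by simp
  show "?m permutes {1..l}" using n u by (intro permutes_compose permutes_inv)
  show "?m \<noteq> id"
  proof
    assume "?m = id"
    then have "n = inv' u \<circ> ?m \<circ> u" using \<open>bij u\<close> by (simp add: fun_eq_iff bij_is_inj)
    then show False using \<open>?m = id\<close> \<open>bij u\<close> n(3) by (simp add: bij_is_inj)
  qed
qed

section \<open>Blocks of imprimitivity on the square\<close>

lemma alt_group_transitive:
  assumes "l \<ge> 3" "i \<in> {1..l}" "j \<in> {1..l}"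
  obtains h where "h \<in> carrier (alt_group l)" "h i = j"
proof (cases "i = j")
  case True
  then show ?thesis using that[of id] by (simp add: alt_group_carrier permutes_id)
next
  case False
  have "\<not> {1..l} \<subseteq> {i, j}" using assms(1) card_mono[of "{i, j}" "{1..l}"] card_insert_le_m1[of 2 "{j}" i] by auto
  then obtain k where "k \<in> {1..l}" "k \<noteq> i" "k \<noteq> j" by blast
  then have d: "distinct [i, j, k]" and "{i, j, k} \<subseteq> {1..l}" using assms False by auto
  then show ?thesis using that[of "cyc3 i j k"] cyc3_in_alt_group cyc3_apply(1)[OF d] by blast
qed

lemma alt_group_stabilizer_transitive:
  assumes "l \<ge> 4" "i \<in> {1..l}" "j \<in> {1..l}" "x \<noteq> i" "x \<noteq> j"
  obtains h where "h \<in> carrier (alt_group l)" "h x = x" "h i = j"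
proof (cases "i = j")
  case True
  then show ?thesis using that[of id] by (simp add: alt_group_carrier permutes_id)
next
  case False
  have "card {i, j, x} \<le> 3" by (simp add: card_insert_if)
  then have "\<not> {1..l} \<subseteq> {i, j, x}" using assms(1) card_mono[of "{i, j, x}" "{1..l}"] by auto
  then obtain k where "k \<in> {1..l}" "k \<noteq> i" "k \<noteq> j" "k \<noteq> x" by blast
  then have d: "distinct [i, j, k]" and "{i, j, k} \<subseteq> {1..l}" "x \<notin> {i, j, k}" using assms False by auto
  then show ?thesis using that[of "cyc3 i j k"] cyc3_in_alt_group cyc3_apply(1,4)[OF d] by blast
qed

text \<open>If two points of B differ in the first coordinate, the elements (h, 1) with h fixing the
  first coordinate of one of them keep that point, hence B, and spread the other along the line of
  all points with its second coordinate. The twisted element turns this line into one of the other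
  direction that crosses it, so B contains both lines, and then everything.\<close>

lemma alt_square_blocks:
  assumes l: "l \<ge> 5" and alt: "alt_square l \<subseteq> G"
    and tw: "map_prod u v \<circ> prod.swap \<in> G" "u permutes {1..l}" "v permutes {1..l}"
    and B: "B \<subseteq> square l" "B \<noteq> {}" and block: "\<forall>g \<in> G. g ` B = B \<or> g ` B \<inter> B = {}"
  shows "B = square l \<or> is_singleton B"
proof (rule disjCI)
  assume "\<not> is_singleton B"
  let ?S = "{1..l}"
  have alt_mem: "map_prod a b \<in> G" if "a \<in> carrier (alt_group l)" "b \<in> carrier (alt_group l)" for a b
    using alt that by (auto simp: alt_square_def)
  have id_alt: "id \<in> carrier (alt_group l)" by (simp add: alt_group_carrier permutes_id)
  have moved: "g q \<in> B" if "g \<in> G" "p \<in> B" "g p \<in> B" "q \<in> B" for g p q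
    using that block by blast
  have row: "(x, j') \<in> B" if ij: "(i, j) \<in> B" "(i', j') \<in> B" "i \<noteq> i'" and x: "x \<in> ?S" "x \<noteq> i" for i j i' j' x
  proof -
    have "i' \<in> ?S" using ij B by (auto simp: square_def)
    then obtain h where h: "h \<in> carrier (alt_group l)" "h i = i" "h i' = x"
      using alt_group_stabilizer_transitive[of l i' x i] l ij(3) x by auto
    have "map_prod h id (i', j') \<in> B"
      using alt_mem[OF h(1) id_alt] by (rule moved[OF _ ij(1) _ ij(2)]) (use h ij in simp)
    then show ?thesis using h by simp
  qed
  have full_row: "(x, j') \<in> B" if ij: "(i, j) \<in> B" "(i', j') \<in> B" "i \<noteq> i'" and x: "x \<in> ?S" for i j i' j' x
  proof (cases "x = i")
    case True
    \<comment> \<open>The missing point (i, j') is reached by letting another point (y, j') of the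
      line play the part of the fixed one.\<close>
    have "card {i, i'} \<le> 2" by (simp add: card_insert_if)
    then have "\<not> ?S \<subseteq> {i, i'}" using l card_mono[of "{i, i'}" ?S] by auto
    then obtain y where y: "y \<in> ?S" "y \<noteq> i" "y \<noteq> i'" by blast
    then show ?thesis using row[OF row[OF ij y(1,2)] ij(2) y(3) x] True y by auto
  qed (use row[OF ij x] in blast)
  have col: "(i', y) \<in> B" if ij: "(i, j) \<in> B" "(i', j') \<in> B" "j \<noteq> j'" and y: "y \<in> ?S" "y \<noteq> j" for i j i' j' y
  proof -
    have "j' \<in> ?S" using ij B by (auto simp: square_def)
    then obtain h where h: "h \<in> carrier (alt_group l)" "h j = j" "h j' = y"
      using alt_group_stabilizer_transitive[of l j' y j] l ij(3) y by auto
    have "map_prod id h (i', j') \<in> B"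
      using alt_mem[OF id_alt h(1)] by (rule moved[OF _ ij(1) _ ij(2)]) (use h ij in simp)
    then show ?thesis using h by simp
  qed
  have full_col: "(i', y) \<in> B" if ij: "(i, j) \<in> B" "(i', j') \<in> B" "j \<noteq> j'" and y: "y \<in> ?S" for i j i' j' y
  proof (cases "y = j")
    case True
    have "card {j, j'} \<le> 2" by (simp add: card_insert_if)
    then have "\<not> ?S \<subseteq> {j, j'}" using l card_mono[of "{j, j'}" ?S] by auto
    then obtain z where z: "z \<in> ?S" "z \<noteq> j" "z \<noteq> j'" by blast
    then show ?thesis using col[OF col[OF ij z(1,2)] ij(2) z(3) y] True z by auto
  qed (use col[OF ij y] in blast)
  let ?w = "map_prod u v \<circ> prod.swap"
  have w: "?w (a, b) = (u b, v a)" for a b by simp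
  have both: "B = square l" if r: "\<And>x. x \<in> ?S \<Longrightarrow> (x, j0) \<in> B" and c: "\<And>y. y \<in> ?S \<Longrightarrow> (i0, y) \<in> B"
    and ij0: "i0 \<in> ?S" "j0 \<in> ?S" for i0 j0
  proof -
    \<comment> \<open>(i0, y) and (x, j0) lie in B. Unless y = j0 they differ in the second
      coordinate, so the whole line with first coordinate x follows.\<close>
    have "(x, y) \<in> B" if xy: "x \<in> ?S" "y \<in> ?S" for x y
    proof (cases "y = j0")
      case False
      then show ?thesis using full_col[OF c[OF xy(2)] r[OF xy(1)]] xy by auto
    qed (use r xy in blast)
    then show ?thesis using B(1) by (auto simp: square_def)
  qed
  have uS: "u x \<in> ?S \<longleftrightarrow> x \<in> ?S" and vS: "v x \<in> ?S \<longleftrightarrow> x \<in> ?S" for x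
    by (rule permutes_in_image[OF tw(2)], rule permutes_in_image[OF tw(3)])
  have inv: "u (inv' u x) = x" "v (inv' v x) = x" for x using tw by (simp_all add: permutes_inverses)
  have invS: "x \<in> ?S \<Longrightarrow> inv' u x \<in> ?S" "x \<in> ?S \<Longrightarrow> inv' v x \<in> ?S" for x
    using uS[of "inv' u x"] vS[of "inv' v x"] inv by auto
  obtain i j where ij: "(i, j) \<in> B" using B(2) by auto
  moreover have "B \<noteq> {(i, j)}" using \<open>\<not> is_singleton B\<close> by (auto simp: is_singleton_def)
  ultimately obtain i' j' where ij': "(i', j') \<in> B" "(i', j') \<noteq> (i, j)" by fast
  have S: "i \<in> ?S" "j \<in> ?S" "i' \<in> ?S" "j' \<in> ?S" using ij ij' B(1) by (auto simp: square_def)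
  show "B = square l"
  proof (cases "i = i'")
    case False
    have r: "(x, j') \<in> B" if "x \<in> ?S" for x using full_row[OF ij ij'(1) False that] .
    \<comment> \<open>The image of the line with second coordinate j' is the line with first
      coordinate u j'. The two lines cross, so the image of B meets B.\<close>
    have wB: "?w ` B \<inter> B \<noteq> {}"
      using r[OF uS[THEN iffD2, OF S(4)]] r[OF invS(2)[OF S(4)]] imageI[of "(inv' v j', j')" B ?w] w inv by auto
    have c: "(u j', y) \<in> B" if "y \<in> ?S" for y
    proof -
      have "?w ` B = B" using wB block tw(1) by blast
      moreover have "?w (inv' v y, j') = (u j', y)" by (simp add: inv)
      ultimately show ?thesis using r[OF invS(2)[OF that]] by (metis imageI)
    qed
    show ?thesis using both[OF r c] uS S by blast
  next
    case True
    then have "j \<noteq> j'" using ij' by auto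
    have c: "(i', y) \<in> B" if "y \<in> ?S" for y using full_col[OF ij ij'(1) \<open>j \<noteq> j'\<close> that] .
    have wB: "?w ` B \<inter> B \<noteq> {}"
      using c[OF vS[THEN iffD2, OF S(3)]] c[OF invS(1)[OF S(3)]] imageI[of "(i', inv' u i')" B ?w] w inv by auto
    have r: "(x, v i') \<in> B" if "x \<in> ?S" for x
    proof -
      have "?w ` B = B" using wB block tw(1) by blast
      moreover have "?w (i', inv' u x) = (x, v i')" by (simp add: inv)
      ultimately show ?thesis using c[OF invS(1)[OF that]] by (metis imageI)
    qed
    show ?thesis using both[OF r c] vS S by blast
  qed
qed

lemma primitive_square_action:
  assumes l: "l \<ge> 5" and X: "X \<subseteq> carrier (wreath_S2 l)"
    and alt: "alt_square l \<subseteq> generate (wreath_S2 l) X"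
    and tw: "map_prod u v \<circ> prod.swap \<in> generate (wreath_S2 l) X" "u permutes {1..l}" "v permutes {1..l}"
  shows "primitive_action (subgroup_generated (wreath_S2 l) X) (square l) (square_action l)"
proof -
  let ?W = "wreath_S2 l" and ?G = "subgroup_generated (wreath_S2 l) X"
  interpret W: group ?W by (rule wreath_S2_group)
  interpret F: faithful_action ?W "square l" "square_action l" using l by (intro square_action_faithful) simp
  have carrier: "carrier ?G = generate ?W X" using X by (simp add: carrier_subgroup_generated Int_absorb1)
  have "square_action l \<in> hom ?G (BijGroup (square l))"
    using W.hom_from_subgroup_generated[OF group_hom.homh[OF F.group_hom]] .
  then interpret A: group_action ?G "square l" "square_action l"
    by (simp add: group_action_def group_hom_def group_hom_axioms_def W.group_subgroup_generated group_BijGroup)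
  have act: "square_action l g p = g p" if "p \<in> square l" for g p using that by (simp add: square_action_def)
  show ?thesis
  proof
    fix p q assume pq: "p \<in> square l" "q \<in> square l"
    obtain a where a: "a \<in> carrier (alt_group l)" "a (fst p) = fst q"
      by (rule alt_group_transitive[of l "fst p" "fst q"]) (use pq l in \<open>auto simp: square_def\<close>)
    obtain b where b: "b \<in> carrier (alt_group l)" "b (snd p) = snd q"
      by (rule alt_group_transitive[of l "snd p" "snd q"]) (use pq l in \<open>auto simp: square_def\<close>)
    have "map_prod a b \<in> carrier ?G" using a(1) b(1) alt by (auto simp: alt_square_def carrier)
    moreover have "square_action l (map_prod a b) p = q"
      using a(2) b(2) pq by (simp add: act prod_eq_iff)
    ultimately show "\<exists>g\<in>carrier ?G. square_action l g p = q" by blast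
  next
    fix B assume B: "B \<subseteq> square l" "B \<noteq> {}"
      and block: "\<forall>g\<in>carrier ?G. square_action l g ` B = B \<or> square_action l g ` B \<inter> B = {}"
    have "square_action l g ` B = g ` B" for g using B(1) act by (intro image_cong) auto
    then show "B = square l \<or> is_singleton B"
      using alt_square_blocks[OF l alt tw B] block carrier by simp
  qed
qed

text \<open>
  Quantifying over all permutation groups that contain the tuple, instead of naming the group it
  generates, makes the property visibly monotone in that group; splitting a class can then only
  help.
\<close>

definition realizable :: "nat \<Rightarrow> class_symbol list \<Rightarrow> bool" where
  "realizable l R \<longleftrightarrow> (\<exists>R' xs. mset R' = mset R \<and>
    list_all2 (\<lambda>x c. x \<in> wreath_class l c) xs R' \<and> foldr (\<circ>) xs id = id \<and>
    (\<forall>G. perm_group G \<longrightarrow> set xs \<subseteq> G \<longrightarrow> alt_square l \<subseteq> G \<and>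
      (\<exists>u v. u permutes {1..l} \<and> v permutes {1..l} \<and> map_prod u v \<circ> prod.swap \<in> G)))"

lemma conj_class_carrier:
  assumes "x \<in> carrier (wreath_S2 l)" shows "conj_class (wreath_S2 l) x \<subseteq> carrier (wreath_S2 l)"
proof -
  interpret group "wreath_S2 l" by (rule wreath_S2_group)
  show ?thesis using assms by (auto simp: conj_class_def)
qed

lemma wreath_class_carrier: "wreath_class l c \<subseteq> carrier (wreath_S2 l)"
proof (cases c)
  case (Cl_Pair P Q)
  then show ?thesis using conj_class_carrier map_prod_carrier by (fastforce simp: sym_group_carrier)
next
  case (Cl_Twisted P)
  then show ?thesis using conj_class_carrier map_prod_swap_carrier[OF _ permutes_id]
    by (fastforce simp: sym_group_carrier)
next
  case Cl_Swap
  have "map_prod id id \<circ> prod.swap \<in> carrier (wreath_S2 l)"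
    by (intro map_prod_swap_carrier permutes_id)
  then show ?thesis using Cl_Swap conj_class_carrier by (simp add: prod.map_id0)
qed

lemma realizable_imp_primitive:
  assumes l: "l \<ge> 5" and R: "realizable l R"
  shows "\<exists>R' xs. mset R' = mset R \<and>
    list_all2 (\<lambda>x c. x \<in> wreath_class l c) xs R' \<and>
    foldr (\<lambda>x y. x \<otimes>\<^bsub>wreath_S2 l\<^esub> y) xs \<one>\<^bsub>wreath_S2 l\<^esub> = \<one>\<^bsub>wreath_S2 l\<^esub> \<and>
    primitive_action (subgroup_generated (wreath_S2 l) (set xs)) (square l) (square_action l) \<and>
    alt_square l \<subseteq> carrier (subgroup_generated (wreath_S2 l) (set xs))"
proof -
  obtain R' xs where *: "mset R' = mset R" "list_all2 (\<lambda>x c. x \<in> wreath_class l c) xs R'"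
    "foldr (\<circ>) xs id = id"
    and gen: "\<And>G. perm_group G \<Longrightarrow> set xs \<subseteq> G \<Longrightarrow> alt_square l \<subseteq> G \<and>
      (\<exists>u v. u permutes {1..l} \<and> v permutes {1..l} \<and> map_prod u v \<circ> prod.swap \<in> G)"
    using R unfolding realizable_def by blast
  let ?G = "generate (wreath_S2 l) (set xs)"
  have X: "set xs \<subseteq> carrier (wreath_S2 l)"
    using *(2) wreath_class_carrier by (fastforce simp: list_all2_conv_all_nth in_set_conv_nth)
  have "set xs \<subseteq> ?G" by (auto intro: generate.incl)
  then have alt: "alt_square l \<subseteq> ?G"
    and "\<exists>u v. u permutes {1..l} \<and> v permutes {1..l} \<and> map_prod u v \<circ> prod.swap \<in> ?G"
    using gen[OF perm_group_generate[OF X]] by auto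
  then have "primitive_action (subgroup_generated (wreath_S2 l) (set xs)) (square l) (square_action l)"
    using primitive_square_action[OF l X alt] by blast
  moreover have "carrier (subgroup_generated (wreath_S2 l) (set xs)) = ?G"
    using X by (simp add: carrier_subgroup_generated Int_absorb1)
  ultimately show ?thesis
    using * alt by (intro exI[of _ R'] exI[of _ xs]) (simp add: wreath_S2_def)
qed

text \<open>A split must be applied to whatever element of the twisted class a given tuple contains;
  conjugates by both kinds of group element are therefore brought to the form (u, v)s.\<close>

lemma wreath_class_twistedE:
  assumes "x \<in> wreath_class l (Cl_Twisted P)"
  obtains u v where "x = map_prod u v \<circ> prod.swap" "u permutes {1..l}" "v permutes {1..l}"
    "cycle_type l (u \<circ> v) = parts P"
proof -
  obtain \<alpha> where \<alpha>: "\<alpha> permutes {1..l}" "cycle_type l \<alpha> = parts P"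
    and "x \<in> conj_class (wreath_S2 l) (map_prod \<alpha> id \<circ> prod.swap)"
    using assms by (auto simp: sym_group_carrier)
  then obtain g where g: "g \<in> carrier (wreath_S2 l)"
    and "x = g \<otimes>\<^bsub>wreath_S2 l\<^esub> (map_prod \<alpha> id \<circ> prod.swap) \<otimes>\<^bsub>wreath_S2 l\<^esub> inv\<^bsub>wreath_S2 l\<^esub> g"
    by (auto simp: conj_class_def)
  then have x: "x = g \<circ> (map_prod \<alpha> id \<circ> prod.swap) \<circ> inv' g"
    using wreath_inv(2)[OF g] by (simp add: wreath_S2_def)
  obtain a b t where abt: "g = map_prod a b \<circ> t" "a permutes {1..l}" "b permutes {1..l}" "t \<in> {id, prod.swap}"
    using g by (rule wreath_S2_carrierE)
  have ab: "bij a" "bij b" using abt by (auto simp: permutes_bij)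
  have ct: "cycle_type l (a \<circ> \<alpha> \<circ> inv' a) = parts P" using cycle_type_conj[OF abt(2) \<alpha>(1)] \<alpha>(2) by simp
  consider "t = id" | "t = prod.swap" using abt by auto
  then show thesis
  proof cases
    case 1
    have "x = map_prod (a \<circ> \<alpha> \<circ> inv' b) (b \<circ> inv' a) \<circ> prod.swap"
      unfolding x by (rule conj_eqI[OF wreath_inv(1)[OF g]])
        (use 1 abt(1) ab in \<open>simp add: fun_eq_iff bij_is_inj\<close>)
    moreover have "(a \<circ> \<alpha> \<circ> inv' b) \<circ> (b \<circ> inv' a) = a \<circ> \<alpha> \<circ> inv' a"
      using ab by (simp add: fun_eq_iff bij_is_inj)
    ultimately show thesis
      using that abt(2,3) \<alpha>(1) ct by (metis permutes_compose permutes_inv)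
  next
    case 2
    have "x = map_prod (a \<circ> inv' b) (b \<circ> \<alpha> \<circ> inv' a) \<circ> prod.swap"
      unfolding x by (rule conj_eqI[OF wreath_inv(1)[OF g]])
        (use 2 abt(1) ab in \<open>simp add: fun_eq_iff bij_is_inj\<close>)
    moreover have "(a \<circ> inv' b) \<circ> (b \<circ> \<alpha> \<circ> inv' a) = a \<circ> \<alpha> \<circ> inv' a"
      using ab by (simp add: fun_eq_iff bij_is_inj)
    ultimately show thesis
      using that abt(2,3) \<alpha>(1) ct by (metis permutes_compose permutes_inv)
  qed
qed

lemma realizable_cong: "mset R = mset R' \<Longrightarrow> realizable l R \<longleftrightarrow> realizable l R'"
  by (simp add: realizable_def)

lemma realizable_split:
  assumes R: "realizable l (Cl_Twisted P # R)" and id: "cycle_type l id = parts Q"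
  shows "realizable l (Cl_Pair P Q # Cl_Swap # R)"
proof -
  obtain R' xs where *: "mset R' = mset (Cl_Twisted P # R)" "list_all2 (\<lambda>x c. x \<in> wreath_class l c) xs R'"
    "foldr (\<circ>) xs id = id"
    and gen: "\<And>G. perm_group G \<Longrightarrow> set xs \<subseteq> G \<Longrightarrow> alt_square l \<subseteq> G \<and>
      (\<exists>u v. u permutes {1..l} \<and> v permutes {1..l} \<and> map_prod u v \<circ> prod.swap \<in> G)"
    using R unfolding realizable_def by blast
  have "Cl_Twisted P \<in> set R'" using *(1) by (metis list.set_intros(1) set_mset_mset)
  then obtain A B where AB: "R' = A @ Cl_Twisted P # B" by (meson split_list)
  then obtain X x Y where X: "xs = X @ x # Y" "list_all2 (\<lambda>x c. x \<in> wreath_class l c) X A"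
    "x \<in> wreath_class l (Cl_Twisted P)" "list_all2 (\<lambda>x c. x \<in> wreath_class l c) Y B"
    using *(2) by (auto simp: list_all2_append2 list_all2_Cons2)
  obtain u v where uv: "x = map_prod u v \<circ> prod.swap" "u permutes {1..l}" "v permutes {1..l}"
    "cycle_type l (u \<circ> v) = parts P"
    using X(3) by (rule wreath_class_twistedE)
  \<comment> \<open>(u, v)s = (uv, 1) (v^-1, v)s: the first factor has the structure of uv, the
    second is conjugate to s. Putting both in the place of x leaves the product unchanged.\<close>
  define y z where "y = map_prod (u \<circ> v) (id :: nat \<Rightarrow> nat)" and "z = map_prod (inv' v) v \<circ> prod.swap"
  have x: "y \<circ> z = x" using uv(1,3) by (auto simp: y_def z_def fun_eq_iff permutes_inverses)
  have y: "y \<in> wreath_class l (Cl_Pair P Q)"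
    unfolding y_def using uv id by (intro pair_mem permutes_compose permutes_id)
  have z: "z \<in> wreath_class l Cl_Swap"
    unfolding z_def using uv permutes_inv_o(2)[OF uv(3)] by (intro swap_mem permutes_inv)
  show ?thesis
    unfolding realizable_def
  proof (rule exI[of _ "A @ Cl_Pair P Q # Cl_Swap # B"], rule exI[of _ "X @ y # z # Y"], intro conjI allI impI)
    show "mset (A @ Cl_Pair P Q # Cl_Swap # B) = mset (Cl_Pair P Q # Cl_Swap # R)"
      using *(1) by (simp add: AB)
    show "list_all2 (\<lambda>x c. x \<in> wreath_class l c) (X @ y # z # Y) (A @ Cl_Pair P Q # Cl_Swap # B)"
      using X y z by (simp add: list_all2_appendI del: wreath_class.simps)
    have "foldr (\<circ>) (X @ y # z # Y) id = foldr (\<circ>) (X @ x # Y) id"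
      by (simp add: x[symmetric] comp_assoc)
    then show "foldr (\<circ>) (X @ y # z # Y) id = id" using *(3) X(1) by simp
    fix G assume G: "perm_group G" "set (X @ y # z # Y) \<subseteq> G"
    then have "x \<in> G" using perm_group.comp_mem[OF G(1), of y z] x by simp
    then have "set xs \<subseteq> G" using G(2) X(1) by auto
    then show "alt_square l \<subseteq> G"
      "\<exists>u v. u permutes {1..l} \<and> v permutes {1..l} \<and> map_prod u v \<circ> prod.swap \<in> G"
      using gen[OF G(1)] by auto
  qed
qed

section \<open>Cycle types\<close>

text \<open>The points whose orbit has size k form the disjoint union of the orbits of size k. Cycle
  structures can thus be found by counting points, without listing orbits.\<close>

lemma cycle_type_count:
  assumes f: "f permutes {1..l}" and k: "k > 0"
  shows "k * count (cycle_type l f) k = card {i \<in> {1..l}. card (Orbits.orbit f i) = k}"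
proof -
  define Os where "Os = {Orbits.orbit f i | i. i \<in> {1..l}}"
  define C where "C = {X \<in> Os. card X = k}"
  have perm: "permutation f" using f by (auto simp: permutation_permutes)
  have self: "i \<in> Orbits.orbit f i" for i using permutation_self_in_orbit[OF perm] .
  have eq: "Orbits.orbit f j = Orbits.orbit f i" if "j \<in> Orbits.orbit f i" for i j
    using orbit_cyclic_eq3[OF cyclic_on_orbit'[OF perm] that] .
  have fin: "finite Os" by (simp add: Os_def Setcompr_eq_image)
  have "count (cycle_type l f) k = card C"
    unfolding cycle_type_def Os_def[symmetric] count_image_mset C_def
    using fin by (simp add: sum.If_cases vimage_def Int_def conj_commute)
  moreover have "k * card C = card (\<Union>C)"
  proof (rule card_partition)
    show "finite C" using fin by (simp add: C_def)
    show "finite (\<Union>C)" using fin k by (auto simp: C_def intro: card_ge_0_finite)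
    show "card c = k" if "c \<in> C" for c using that by (simp add: C_def)
    show "c1 \<inter> c2 = {}" if "c1 \<in> C" "c2 \<in> C" "c1 \<noteq> c2" for c1 c2
      using that eq by (auto simp: C_def Os_def) blast+
  qed
  moreover have "\<Union>C = {i \<in> {1..l}. card (Orbits.orbit f i) = k}"
  proof (intro equalityI subsetI)
    fix j assume "j \<in> \<Union>C"
    then obtain i where i: "i \<in> {1..l}" "j \<in> Orbits.orbit f i" "card (Orbits.orbit f i) = k"
      by (auto simp: C_def Os_def)
    then show "j \<in> {i \<in> {1..l}. card (Orbits.orbit f i) = k}"
      using permutes_orbit_subset[OF f i(1)] eq[OF i(2)] by auto
  next
    fix i assume "i \<in> {i \<in> {1..l}. card (Orbits.orbit f i) = k}"
    then show "i \<in> \<Union>C" using self[of i] by (auto simp: C_def Os_def)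
  qed
  ultimately show ?thesis by simp
qed

lemma cycle_type_eqI:
  assumes f: "f permutes {1..l}" and "0 \<notin># M"
    and card: "\<And>k. k > 0 \<Longrightarrow> card {i \<in> {1..l}. card (Orbits.orbit f i) = k} = k * count M k"
  shows "cycle_type l f = M"
proof (rule multiset_eqI)
  fix k
  show "count (cycle_type l f) k = count M k"
  proof (cases "k = 0")
    case True
    have "permutation f" using f by (auto simp: permutation_permutes)
    then have "finite (Orbits.orbit f i)" for i by (intro finite_orbit permutation_self_in_orbit)
    then have "0 \<notin># cycle_type l f" by (auto simp: cycle_type_def Setcompr_eq_image orbit_nonempty)
    then show ?thesis using True assms(2) by (simp add: not_in_iff)
  next
    case False
    then show ?thesis using cycle_type_count[OF f, of k] card[of k] by simp
  qed
qed

lemma card_orbit: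
  assumes "f x = x" shows "card (Orbits.orbit f x) = 1"
  using assms orbit_eq_singleton_iff[of f x] by simp

lemma card_orbit_bounded:
  assumes "(f ^^ n) x = x" "n > 0" "inj_on (\<lambda>m. (f ^^ m) x) {..<n}"
  shows "card (Orbits.orbit f x) = n"
proof -
  have "Orbits.orbit f x = (\<lambda>m. (f ^^ m) x) ` {..<n}" using orbit_altdef_bounded[OF assms(1,2)] by auto
  then show ?thesis using card_image[OF assms(3)] by simp
qed

lemma card_orbit_small:
  assumes "inj f"
  shows "f x = x \<Longrightarrow> card (Orbits.orbit f x) = 1"
    and "\<lbrakk>f x \<noteq> x; f (f x) = x\<rbrakk> \<Longrightarrow> card (Orbits.orbit f x) = 2"
    and "\<lbrakk>f x \<noteq> x; f (f (f x)) = x\<rbrakk> \<Longrightarrow> card (Orbits.orbit f x) = 3"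
    and "\<lbrakk>f (f x) \<noteq> x; f (f (f (f x))) = x\<rbrakk> \<Longrightarrow> card (Orbits.orbit f x) = 4"
proof -
  note eq = inj_eq[OF assms]
  show "f x = x \<Longrightarrow> card (Orbits.orbit f x) = 1" by (rule card_orbit)
  show "\<lbrakk>f x \<noteq> x; f (f x) = x\<rbrakk> \<Longrightarrow> card (Orbits.orbit f x) = 2"
    by (rule card_orbit_bounded) (auto simp: numeral_eq_Suc lessThan_Suc)
  show "\<lbrakk>f x \<noteq> x; f (f (f x)) = x\<rbrakk> \<Longrightarrow> card (Orbits.orbit f x) = 3"
    by (rule card_orbit_bounded) (auto simp: numeral_eq_Suc lessThan_Suc eq)
  show "\<lbrakk>f (f x) \<noteq> x; f (f (f (f x))) = x\<rbrakk> \<Longrightarrow> card (Orbits.orbit f x) = 4"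
    by (rule card_orbit_bounded) (auto simp: numeral_eq_Suc lessThan_Suc eq)
qed

text \<open>Apart from the long cycles, the permutations used below have orbits of size at most 4,
  and the four sets collect the points by orbit size; moving x under the second power while fixing
  it under the fourth already excludes the sizes 1, 2 and 3. The divisibilities make the divisions
  by 2, 3 and 4 exact.\<close>

lemma cycle_type_small:
  assumes f: "f permutes {1..l}"
    and small: "\<And>x. x \<in> {1..l} \<Longrightarrow> f x = x \<or> f (f x) = x \<or> f (f (f x)) = x \<or> f (f (f (f x))) = x"
  defines "N1 \<equiv> {x \<in> {1..l}. f x = x}" and "N2 \<equiv> {x \<in> {1..l}. f x \<noteq> x \<and> f (f x) = x}"
    and "N3 \<equiv> {x \<in> {1..l}. f x \<noteq> x \<and> f (f (f x)) = x}"
    and "N4 \<equiv> {x \<in> {1..l}. f (f x) \<noteq> x \<and> f (f (f (f x))) = x}"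
  shows "cycle_type l f = replicate_mset (card N1) 1 + replicate_mset (card N2 div 2) 2 +
      replicate_mset (card N3 div 3) 3 + replicate_mset (card N4 div 4) 4" (is ?ct)
    and "card N1 + card N2 + card N3 + card N4 = l"
    and "2 dvd card N2" "3 dvd card N3" "4 dvd card N4"
proof -
  let ?c = "\<lambda>x. card (Orbits.orbit f x)"
  have inj: "inj f" using f by (rule permutes_inj)
  note orb = card_orbit_small[OF inj]
  have c14: "?c x \<in> {1, 2, 3, 4}" if "x \<in> {1..l}" for x
    using small[OF that] orb[of x] by (cases "f x = x"; cases "f (f x) = x") auto
  have n1: "f x = x" if "x \<in> {1..l}" "?c x = 1" for x
    using small[OF that(1)] that(2) orb[of x] by (cases "f (f x) = x") auto
  have n2: "f x \<noteq> x \<and> f (f x) = x" if "x \<in> {1..l}" "?c x = 2" for x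
    using small[OF that(1)] that(2) orb[of x] by (cases "f x = x"; cases "f (f x) = x") auto
  have n3: "f x \<noteq> x \<and> f (f (f x)) = x" if "x \<in> {1..l}" "?c x = 3" for x
    using small[OF that(1)] that(2) orb[of x] by (cases "f x = x"; cases "f (f x) = x") auto
  have n4: "f (f x) \<noteq> x \<and> f (f (f (f x))) = x" if "x \<in> {1..l}" "?c x = 4" for x
    using small[OF that(1)] that(2) orb[of x] by (cases "f x = x"; cases "f (f x) = x") auto
  have N: "{x \<in> {1..l}. ?c x = 1} = N1" "{x \<in> {1..l}. ?c x = 2} = N2"
    "{x \<in> {1..l}. ?c x = 3} = N3" "{x \<in> {1..l}. ?c x = 4} = N4"
    unfolding N1_def N2_def N3_def N4_def using n1 n2 n3 n4 orb by blast+
  show dvd: "2 dvd card N2" "3 dvd card N3" "4 dvd card N4"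
    using cycle_type_count[OF f, of 2] cycle_type_count[OF f, of 3] cycle_type_count[OF f, of 4]
    unfolding N by (auto intro: dvdI[OF sym])
  show ?ct
  proof (rule cycle_type_eqI[OF f])
    fix k :: nat assume "k > 0"
    have "{x \<in> {1..l}. ?c x = k} = {}" if "k \<notin> {1, 2, 3, 4}" using c14 that by blast
    then show "card {x \<in> {1..l}. ?c x = k} = k * count (replicate_mset (card N1) 1 + replicate_mset (card N2 div 2) 2 +
      replicate_mset (card N3 div 3) 3 + replicate_mset (card N4 div 4) 4) k"
      using N dvd by (cases "k \<in> {1, 2, 3, 4}") (auto simp del: One_nat_def)
  qed (simp add: count_eq_zero_iff[symmetric])
  have "{1..l} = N1 \<union> N2 \<union> N3 \<union> N4" unfolding N[symmetric] using c14 by blast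
  moreover have "card (N1 \<union> N2 \<union> N3 \<union> N4) = card N1 + card N2 + card N3 + card N4"
  proof -
    have fin: "finite N1" "finite N2" "finite N3" "finite N4" by (simp_all add: N1_def N2_def N3_def N4_def)
    have "N1 \<inter> N2 = {}" "(N1 \<union> N2) \<inter> N3 = {}" "(N1 \<union> N2 \<union> N3) \<inter> N4 = {}"
      unfolding N[symmetric] by auto
    then show ?thesis using fin by (simp add: card_Un_disjoint)
  qed
  ultimately show "card N1 + card N2 + card N3 + card N4 = l" by (metis card_atLeastAtMost diff_Suc_1)
qed

lemma cycle_type_involution:
  assumes f: "f permutes {1..l}" and inv: "\<And>x. x \<in> {1..l} \<Longrightarrow> f (f x) = x"
    and j: "card {x \<in> {1..l}. f x = x} = j"
  obtains v where "l = j + 2 * v" "cycle_type l f = replicate_mset j 1 + replicate_mset v 2"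
proof -
  have N: "{x \<in> {1..l}. f x \<noteq> x \<and> f (f (f x)) = x} = {}" "{x \<in> {1..l}. f (f x) \<noteq> x \<and> f (f (f (f x))) = x} = {}"
    using inv by auto
  have small: "f x = x \<or> f (f x) = x \<or> f (f (f x)) = x \<or> f (f (f (f x))) = x" if "x \<in> {1..l}" for x
    using inv[OF that] by simp
  note ct = cycle_type_small[OF f small, unfolded N j]
  obtain v where "card {x \<in> {1..l}. f x \<noteq> x \<and> f (f x) = x} = 2 * v" using ct(3) by (auto elim: dvdE)
  then show thesis using ct(1,2) that[of v] by simp
qed

section \<open>The cycle structures that occur in the table\<close>

lemma cycle_type_id: "cycle_type l id = parts (e\<^sub>W l)"
proof -
  have "{x \<in> {1..l}. id x = x} = {1..l}" by auto
  then have "card {x \<in> {1..l}. id x = x} = l" by simp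
  then obtain v where "l = l + 2 * v" "cycle_type l id = replicate_mset l 1 + replicate_mset v 2"
    using cycle_type_involution[OF permutes_id, of l l] by auto
  then show ?thesis by (simp add: parts_def e\<^sub>W_def)
qed

lemma cycle_type_B:
  assumes "f permutes {1..l}" "\<And>x. x \<in> {1..l} \<Longrightarrow> f (f x) = x" "card {x \<in> {1..l}. f x = x} = j"
  shows "cycle_type l f = parts (B\<^sub>W l j)"
proof -
  obtain v where "l = j + 2 * v" "cycle_type l f = replicate_mset j 1 + replicate_mset v 2"
    using cycle_type_involution[OF assms] by blast
  then show ?thesis by (simp add: parts_def B\<^sub>W_def)
qed

lemma cycle_type_C:
  assumes f: "f permutes {1..l}" and abc: "distinct [a, b, c]" "{a, b, c} \<subseteq> {1..l}" "f a = b" "f b = c" "f c = a"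
    and inv: "\<And>x. x \<in> {1..l} - {a, b, c} \<Longrightarrow> f (f x) = x"
    and j: "card {x \<in> {1..l}. f x = x} = j"
  shows "cycle_type l f = parts (C\<^sub>W l j)"
proof -
  have X: "f x \<noteq> x \<and> f (f (f x)) = x \<and> f (f (f (f x))) \<noteq> x" if "x \<in> {a, b, c}" for x
    using that abc(1) by (elim insertE emptyE) (auto simp: abc(3-5))
  have Y: "f (f (f x)) = f x" "f (f (f (f x))) = x" "f (f x) = x" if "x \<in> {1..l}" "x \<notin> {a, b, c}" for x
    using inv[of x] that by auto
  have N3: "{x \<in> {1..l}. f x \<noteq> x \<and> f (f (f x)) = x} = {a, b, c}"
  proof -
    have "f x \<noteq> x \<and> f (f (f x)) = x \<longleftrightarrow> x \<in> {a, b, c}" if "x \<in> {1..l}" for x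
      using X[of x] Y[OF that] by (cases "x \<in> {a, b, c}") (simp_all only: simp_thms)
    then show ?thesis using abc(2) by blast
  qed
  have N4: "{x \<in> {1..l}. f (f x) \<noteq> x \<and> f (f (f (f x))) = x} = {}"
  proof -
    have "f (f x) = x \<or> f (f (f (f x))) \<noteq> x" if "x \<in> {1..l}" for x
      using X[of x] Y[OF that] by (cases "x \<in> {a, b, c}") (simp_all only: simp_thms)
    then show ?thesis by blast
  qed
  have small: "f x = x \<or> f (f x) = x \<or> f (f (f x)) = x \<or> f (f (f (f x))) = x" if "x \<in> {1..l}" for x
    using X[of x] Y[OF that] by (cases "x \<in> {a, b, c}") (simp_all only: simp_thms)
  have card3: "card {a, b, c} = 3" using abc(1) by simp
  note ct = cycle_type_small[OF f small, unfolded N3 N4 j card3]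
  obtain v where "card {x \<in> {1..l}. f x \<noteq> x \<and> f (f x) = x} = 2 * v" using ct(3) by (auto elim: dvdE)
  then have "l = j + 2 * v + 3" "cycle_type l f = replicate_mset j 1 + replicate_mset v 2 + {#3#}" using ct(1,2) by auto
  then show ?thesis by (simp add: parts_def C\<^sub>W_def)
qed

lemma cycle_type_D:
  assumes f: "f permutes {1..l}" and abc: "distinct [a, b, c, d]" "{a, b, c, d} \<subseteq> {1..l}"
      "f a = b" "f b = c" "f c = d" "f d = a"
    and inv: "\<And>x. x \<in> {1..l} - {a, b, c, d} \<Longrightarrow> f (f x) = x"
    and j: "card {x \<in> {1..l}. f x = x} = j"
  shows "cycle_type l f = parts (D\<^sub>W l j)"
proof -
  have X: "f (f x) \<noteq> x \<and> f (f (f x)) \<noteq> x \<and> f (f (f (f x))) = x" if "x \<in> {a, b, c, d}" for x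
    using that abc(1) by (elim insertE emptyE) (auto simp: abc(3-6))
  have Y: "f (f (f x)) = f x" "f (f x) = x" if "x \<in> {1..l}" "x \<notin> {a, b, c, d}" for x
    using inv[of x] that by auto
  have N4: "{x \<in> {1..l}. f (f x) \<noteq> x \<and> f (f (f (f x))) = x} = {a, b, c, d}"
  proof -
    have "f (f x) \<noteq> x \<and> f (f (f (f x))) = x \<longleftrightarrow> x \<in> {a, b, c, d}" if "x \<in> {1..l}" for x
      using X[of x] Y[OF that] by (cases "x \<in> {a, b, c, d}") (simp_all only: simp_thms)
    then show ?thesis using abc(2) by blast
  qed
  have N3: "{x \<in> {1..l}. f x \<noteq> x \<and> f (f (f x)) = x} = {}"
  proof -
    have "f x = x \<or> f (f (f x)) \<noteq> x" if "x \<in> {1..l}" for x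
      using X[of x] Y(1)[of x] that by (cases "x \<in> {a, b, c, d}") auto
    then show ?thesis by blast
  qed
  have small: "f x = x \<or> f (f x) = x \<or> f (f (f x)) = x \<or> f (f (f (f x))) = x" if "x \<in> {1..l}" for x
    using X[of x] Y[OF that] by (cases "x \<in> {a, b, c, d}") (simp_all only: simp_thms)
  have card4: "card {a, b, c, d} = 4" using abc(1) by simp
  note ct = cycle_type_small[OF f small, unfolded N3 N4 j card4]
  obtain v where "card {x \<in> {1..l}. f x \<noteq> x \<and> f (f x) = x} = 2 * v" using ct(3) by (auto elim: dvdE)
  then have "l = j + 2 * v + 4" "cycle_type l f = replicate_mset j 1 + replicate_mset v 2 + {#4#}" using ct(1,2) by auto
  then show ?thesis by (simp add: parts_def D\<^sub>W_def)
qed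

text \<open>Exponents such as l - 2 are formed in the rationals, so unfolding \<open>parts\<close>
  leaves \<open>nat\<close> of a difference of integers.\<close>

lemma nat_int_minus_numeral: "nat (int l - numeral k) = l - numeral k"
  by (simp add: nat_diff_distrib')

lemma cycle_type_transpose:
  assumes "a \<in> {1..l}" "b \<in> {1..l}" "a \<noteq> b"
  shows "cycle_type l (transpose a b) = parts (\<tau>\<^sub>W l)"
proof -
  have p: "transpose a b permutes {1..l}" using assms by (intro permutes_swap_id)
  have "{x \<in> {1..l}. transpose a b x = x} = {1..l} - {a, b}"
    using assms(3) by (auto simp: transpose_def)
  then have "card {x \<in> {1..l}. transpose a b x = x} = l - 2"
    using assms by (simp add: card_Diff_subset del: atLeastAtMost_iff)
  moreover have "2 \<le> l" using assms by auto
  ultimately obtain v where v: "l = (l - 2) + 2 * v"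
    "cycle_type l (transpose a b) = replicate_mset (l - 2) 1 + replicate_mset v 2"
    using cycle_type_involution[OF p, of "l - 2"] by auto
  then have "v = 1" using \<open>2 \<le> l\<close> by linarith
  then show ?thesis unfolding v(2) by (simp add: parts_def \<tau>\<^sub>W_def nat_int_minus_numeral)
qed

lemma cycle_type_double_transpose:
  assumes "{a, b, c, d} \<subseteq> {1..l}" "distinct [a, b, c, d]"
  shows "cycle_type l (transpose a b \<circ> transpose c d) = parts (\<tau>2\<^sub>W l)"
proof -
  let ?t = "transpose a b \<circ> transpose c d"
  have p: "?t permutes {1..l}" using assms by (intro permutes_compose permutes_swap_id) auto
  have t: "?t a = b" "?t b = a" "?t c = d" "?t d = c" "\<And>x. x \<notin> {a, b, c, d} \<Longrightarrow> ?t x = x"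
    using assms(2) by (auto simp: transpose_def)
  have "{x \<in> {1..l}. ?t x = x} = {1..l} - {a, b, c, d}"
  proof -
    have "?t x = x \<longleftrightarrow> x \<notin> {a, b, c, d}" for x
    proof (cases "x \<in> {a, b, c, d}")
      case True
      then show ?thesis using assms(2) by (elim insertE emptyE) (auto simp only: t distinct.simps list.set)
    qed (simp only: t not_False_eq_True simp_thms)
    then show ?thesis by blast
  qed
  then have "card {x \<in> {1..l}. ?t x = x} = l - card {a, b, c, d}"
    using assms(1) by (simp add: card_Diff_subset del: atLeastAtMost_iff)
  then have "card {x \<in> {1..l}. ?t x = x} = l - 4" using assms(2) by simp
  moreover have "4 \<le> l" using card_mono[OF _ assms(1)] assms(2) by simp
  moreover have "?t (?t x) = x" for x
    by (cases "x \<in> {a, b, c, d}", elim insertE emptyE) (simp_all only: t not_False_eq_True)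
  ultimately obtain v where v: "l = (l - 4) + 2 * v"
    "cycle_type l ?t = replicate_mset (l - 4) 1 + replicate_mset v 2"
    using cycle_type_involution[OF p, of "l - 4"] by metis
  then have "v = 2" using \<open>4 \<le> l\<close> by linarith
  then show ?thesis unfolding v(2) by (simp add: parts_def \<tau>2\<^sub>W_def nat_int_minus_numeral)
qed

lemma cycle_type_cyc3:
  assumes "{a, b, c} \<subseteq> {1..l}" and d: "distinct [a, b, c]"
  shows "cycle_type l (cyc3 a b c) = parts (\<tau>3\<^sub>W l)"
proof -
  let ?t = "cyc3 a b c"
  have p: "?t permutes {1..l}" using cyc3_in_alt_group[OF d assms(1)] by (simp add: alt_group_carrier)
  note t = cyc3_apply[OF d]
  have fixed: "?t x = x \<longleftrightarrow> x \<notin> {a, b, c}" for x using t d by auto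
  have "{x \<in> {1..l}. ?t x = x} = {1..l} - {a, b, c}" unfolding fixed by auto
  then have "card {x \<in> {1..l}. ?t x = x} = l - card {a, b, c}"
    using assms(1) by (simp add: card_Diff_subset del: atLeastAtMost_iff)
  then have N1: "card {x \<in> {1..l}. ?t x = x} = l - 3" using d by simp
  have t3: "?t (?t (?t x)) = x" and t2: "?t (?t x) = x \<longleftrightarrow> x \<notin> {a, b, c}" for x
    using t d by (cases "x \<in> {a, b, c}"; auto)+
  have N3: "{x \<in> {1..l}. ?t x \<noteq> x \<and> ?t (?t (?t x)) = x} = {a, b, c}"
    unfolding fixed t3 using assms by auto
  have N: "{x \<in> {1..l}. ?t x \<noteq> x \<and> ?t (?t x) = x} = {}" "{x \<in> {1..l}. ?t (?t x) \<noteq> x \<and> ?t (?t (?t (?t x))) = x} = {}"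
    unfolding t3 fixed t2 by blast+
  have card3: "card {a, b, c} = 3" using d by simp
  have small: "?t x = x \<or> ?t (?t x) = x \<or> ?t (?t (?t x)) = x \<or> ?t (?t (?t (?t x))) = x" for x
    using t by (cases "x \<in> {a, b, c}") auto
  show ?thesis
    using cycle_type_small(1)[OF p small, unfolded N1 N3 N card3] by (simp add: parts_def \<tau>3\<^sub>W_def nat_int_minus_numeral)
qed

lemma cycle_type_L:
  assumes f: "f permutes {1..l}" and x: "x \<in> {1..l}" "{1..l} \<subseteq> Orbits.orbit f x"
  shows "cycle_type l f = parts (L\<^sub>W l)"
proof -
  have perm: "permutation f" using f by (auto simp: permutation_permutes)
  have "Orbits.orbit f x = {1..l}" using permutes_orbit_subset[OF f x(1)] x(2) by (rule equalityI)
  have card: "card (Orbits.orbit f i) = l" if "i \<in> {1..l}" for i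
  proof -
    have "i \<in> Orbits.orbit f x" using x(2) that by blast
    from orbit_cyclic_eq3[OF cyclic_on_orbit'[OF perm] this] show ?thesis
      using \<open>Orbits.orbit f x = {1..l}\<close> by simp
  qed
  have "{i \<in> {1..l}. card (Orbits.orbit f i) = k} = {i \<in> {1..l}. l = k}" for k
    by (rule Collect_cong) (metis card)
  then have "{i \<in> {1..l}. card (Orbits.orbit f i) = k} = (if k = l then {1..l} else {})" for k by auto
  then have "cycle_type l f = {#l#}" using x(1) by (intro cycle_type_eqI[OF f]) simp_all
  then show ?thesis by (simp add: parts_def L\<^sub>W_def)
qed

lemma cycle_type_A:
  assumes f: "f permutes {1..l}" and a: "0 < a" "2 * a < l"
    and orb: "{1..a} \<subseteq> Orbits.orbit f 1" "{a + 1..l} \<subseteq> Orbits.orbit f (a + 1)"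
    and stable: "f ` {1..a} \<subseteq> {1..a}" "f ` {a + 1..l} \<subseteq> {a + 1..l}"
  shows "cycle_type l f = parts (A\<^sub>W l a)"
proof -
  have perm: "permutation f" using f by (auto simp: permutation_permutes)
  have sub: "Orbits.orbit f x \<subseteq> X" if "f ` X \<subseteq> X" "x \<in> X" for x X
  proof
    fix y assume "y \<in> Orbits.orbit f x" then show "y \<in> X" by induction (use that in auto)
  qed
  have same: "Orbits.orbit f i = Orbits.orbit f x" if "i \<in> Orbits.orbit f x" for i x
    by (rule orbit_cyclic_eq3[OF cyclic_on_orbit'[OF perm] that])
  have o1: "Orbits.orbit f 1 = {1..a}" using sub[OF stable(1)] orb(1) a by (intro equalityI) auto
  have o2: "Orbits.orbit f (a + 1) = {a + 1..l}" using sub[OF stable(2)] orb(2) a by (intro equalityI) auto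
  have card: "card (Orbits.orbit f i) = (if i \<le> a then a else l - a)" if "i \<in> {1..l}" for i
  proof (cases "i \<le> a")
    case True
    then have "i \<in> Orbits.orbit f 1" using that unfolding o1 by simp
    from same[OF this] show ?thesis using True unfolding o1 by simp
  next
    case False
    then have "i \<in> Orbits.orbit f (a + 1)" using that unfolding o2 by simp
    from same[OF this] show ?thesis using False unfolding o2 by simp
  qed
  have "{i \<in> {1..l}. card (Orbits.orbit f i) = k} = {i \<in> {1..l}. (if i \<le> a then a else l - a) = k}" for k
    by (rule Collect_cong) (metis card)
  then have "{i \<in> {1..l}. card (Orbits.orbit f i) = k} =
      (if k = a then {1..a} else if k = l - a then {a + 1..l} else {})" for k
    using a by auto
  then have "cycle_type l f = {#a, l - a#}" using a by (intro cycle_type_eqI[OF f]) auto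
  then show ?thesis by (simp add: parts_def A\<^sub>W_def)
qed

text \<open>Only the exceptional points are counted; the number of 3-cycles then follows from
  l.\<close>

lemma cycle_type_threes:
  assumes f: "f permutes {1..l}"
    and E: "{x \<in> {1..l}. f x = x} = E1" "{x \<in> {1..l}. f x \<noteq> x \<and> f (f x) = x} = E2"
    and three: "\<And>x. x \<in> {1..l} - E2 \<Longrightarrow> f (f (f x)) = x"
    and card: "card E1 = n1" "card E2 = 2 * n2" "l = n1 + 2 * n2 + 3 * n3"
  shows "cycle_type l f = replicate_mset n1 1 + replicate_mset n2 2 + replicate_mset n3 3"
proof -
  have "f (f x) = x \<or> f (f (f (f x))) \<noteq> x" if "x \<in> {1..l}" for x
    using three[of x] E that by (cases "x \<in> E2") auto
  then have N4: "{x \<in> {1..l}. f (f x) \<noteq> x \<and> f (f (f (f x))) = x} = {}" by blast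
  have small: "f x = x \<or> f (f x) = x \<or> f (f (f x)) = x \<or> f (f (f (f x))) = x" if "x \<in> {1..l}" for x
    using three[of x] E that by (cases "x \<in> E2") auto
  show ?thesis
    using cycle_type_small(1,2)[OF f small, unfolded E N4 card(1,2)] card(3) by simp
qed

lemma cycle_type_fours:
  assumes f: "f permutes {1..l}"
    and E: "{x \<in> {1..l}. f x = x} = E1" "{x \<in> {1..l}. f x \<noteq> x \<and> f (f x) = x} = E2"
      "{x \<in> {1..l}. f x \<noteq> x \<and> f (f (f x)) = x} = E3"
    and four: "\<And>x. x \<in> {1..l} - E3 \<Longrightarrow> f (f (f (f x))) = x"
    and card: "card E1 = n1" "card E2 = 2 * n2" "card E3 = 3 * n3" "l = n1 + 2 * n2 + 3 * n3 + 4 * n4"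
  shows "cycle_type l f = replicate_mset n1 1 + replicate_mset n2 2 + replicate_mset n3 3 + replicate_mset n4 4"
proof -
  have small: "f x = x \<or> f (f x) = x \<or> f (f (f x)) = x \<or> f (f (f (f x))) = x" if "x \<in> {1..l}" for x
    using four[of x] E that by (cases "x \<in> E3") auto
  show ?thesis
    using cycle_type_small(1,2)[OF f small, unfolded E card(1-3)] card(4) by simp
qed

section \<open>Tuples built from permutations\<close>

text \<open>
  Conjugation by \<open>s\<close> exchanges the coordinates of a pair, and \<open>(u, v)s\<close> is conjugate to \<open>(u \<circ> v, 1)s\<close>.
\<close>

fun pair_symbol :: "nat \<Rightarrow> (nat \<Rightarrow> nat) \<Rightarrow> (nat \<Rightarrow> nat) \<Rightarrow> class_symbol \<Rightarrow> bool" where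
  "pair_symbol l p q (Cl_Pair P Q) \<longleftrightarrow>
    cycle_type l p = parts P \<and> cycle_type l q = parts Q \<or>
    cycle_type l p = parts Q \<and> cycle_type l q = parts P"
| "pair_symbol l p q _ \<longleftrightarrow> False"

fun twisted_symbol :: "nat \<Rightarrow> (nat \<Rightarrow> nat) \<Rightarrow> class_symbol \<Rightarrow> bool" where
  "twisted_symbol l w (Cl_Twisted P) \<longleftrightarrow> cycle_type l w = parts P"
| "twisted_symbol l w Cl_Swap \<longleftrightarrow> w = id"
| "twisted_symbol l w _ \<longleftrightarrow> False"

lemma pair_symbol_mem:
  assumes "pair_symbol l p q c" "p permutes {1..l}" "q permutes {1..l}"
  shows "map_prod p q \<in> wreath_class l c"
  using assms pair_mem pair_flip_mem by (cases c) (auto simp del: wreath_class.simps)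

lemma twisted_symbol_mem:
  assumes "twisted_symbol l (u \<circ> v) c" "u permutes {1..l}" "v permutes {1..l}"
  shows "map_prod u v \<circ> prod.swap \<in> wreath_class l c"
  using assms twisted_mem[of u l v] swap_mem[of u l v]
  by (cases c) (simp_all del: wreath_class.simps o_apply)

lemma twisted_symbol_inv:
  assumes "w permutes {1..l}" "twisted_symbol l w c" shows "twisted_symbol l (inv' w) c"
  using assms cycle_type_inv[of w l] by (cases c) simp_all

section \<open>Elements trivial in one coordinate, and templates for product-1 tuples\<close>

definition kernel_nontrivial :: "nat \<Rightarrow> (nat \<times> nat \<Rightarrow> nat \<times> nat) set \<Rightarrow> bool" where
  "kernel_nontrivial l G \<longleftrightarrow>
    (\<exists>n. n permutes {1..l} \<and> n \<noteq> id \<and> (map_prod n id \<in> G \<or> map_prod id n \<in> G))"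

lemma kernel_nontrivialI:
  "\<lbrakk>n permutes {1..l}; n \<noteq> id; map_prod n id \<in> G \<or> map_prod id n \<in> G\<rbrakk> \<Longrightarrow> kernel_nontrivial l G"
  unfolding kernel_nontrivial_def by blast

lemma alt_square_subset':
  assumes l: "l \<ge> 8" and G: "perm_group G"
    and proj: "carrier (alt_group l) \<subseteq> fst_projection G"
    and ker: "kernel_nontrivial l G"
    and tw: "map_prod u v \<circ> prod.swap \<in> G" "u permutes {1..l}" "v permutes {1..l}"
  shows "alt_square l \<subseteq> G"
proof -
  obtain n where n: "n permutes {1..l}" "n \<noteq> id" "map_prod n id \<in> G \<or> map_prod id n \<in> G"
    using ker by (auto simp: kernel_nontrivial_def)
  then show ?thesis
  proof (elim disjE)
    assume "map_prod id n \<in> G"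
    then obtain m where "map_prod m id \<in> G" "m permutes {1..l}" "m \<noteq> id"
      using snd_kernel_flip[OF G _ n(1,2) tw(1,2)] by blast
    then show ?thesis using alt_square_subset[OF l G proj _ _ _ tw(1,3)] by blast
  qed (use alt_square_subset[OF l G proj _ n(1,2) tw(1,3)] in blast)
qed

lemma twisted_square_mem:
  assumes "perm_group G" "map_prod u v \<circ> prod.swap \<in> G"
  shows "map_prod (u \<circ> v) (v \<circ> u) \<in> G"
proof -
  have "(map_prod u v \<circ> prod.swap) \<circ> (map_prod u v \<circ> prod.swap) = map_prod (u \<circ> v) (v \<circ> u)"
    by (auto simp: fun_eq_iff)
  then show ?thesis using perm_group.comp_mem[OF assms(1) assms(2,2)] by simp
qed

lemma twisted_conj_mem:
  assumes "perm_group G" "map_prod u v \<circ> prod.swap \<in> G" "map_prod p q \<in> G" "bij u" "bij v"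
  shows "map_prod (u \<circ> q \<circ> inv' u) (v \<circ> p \<circ> inv' v) \<in> G"
proof -
  have "(map_prod u v \<circ> prod.swap) \<circ> map_prod p q \<circ> inv' (map_prod u v \<circ> prod.swap) =
      map_prod (u \<circ> q \<circ> inv' u) (v \<circ> p \<circ> inv' v)"
    by (rule conj_eqI[OF perm_group.bij_mem[OF assms(1,2)]])
      (use assms(4,5) in \<open>auto simp: fun_eq_iff bij_is_inj\<close>)
  then show ?thesis using perm_group.conj_mem[OF assms(1-3)] by simp
qed

lemma map_prod_comp_mem:
  assumes "perm_group G" "map_prod a b \<in> G" "map_prod c d \<in> G"
  shows "map_prod (a \<circ> c) (b \<circ> d) \<in> G"
  using perm_group.comp_mem[OF assms] by (simp only: map_prod.comp)

lemma map_prod_inv_mem: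
  assumes "perm_group G" "map_prod a b \<in> G" shows "map_prod (inv' a) (inv' b) \<in> G"
  using perm_group.inv_mem[OF assms] inv_map_prod[OF bij_map_prodD[OF perm_group.bij_mem[OF assms]]] by simp

lemma map_prod_conj_mem:
  assumes "perm_group G" "map_prod a b \<in> G" "map_prod c d \<in> G"
  shows "map_prod (a \<circ> c \<circ> inv' a) (b \<circ> d \<circ> inv' b) \<in> G"
  by (intro map_prod_comp_mem map_prod_inv_mem assms)

lemma map_prod_funpow_mem:
  assumes "perm_group G" "map_prod a b \<in> G" shows "map_prod (a ^^ k) (b ^^ k) \<in> G"
proof -
  have "map_prod a b ^^ k = map_prod (a ^^ k) (b ^^ k)" by (induction k) (auto simp: fun_eq_iff)
  then show ?thesis using perm_group.funpow_mem[OF assms, of k] by simp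
qed

text \<open>The third element (q^-1, u^-1 p^-1)s is forced by the product. \<open>ker\<close> may
  use the elements of the base group that are at hand: the pair itself, the square of (u, 1)s, and
  the inverse of the square of the third element.\<close>

lemma realizable_pair_twisted_twisted:
  assumes l: "l \<ge> 8"
    and p: "p permutes {1..l}" and q: "q permutes {1..l}" and u: "u permutes {1..l}"
    and c: "pair_symbol l p q C1" "twisted_symbol l u C2" "twisted_symbol l (p \<circ> u \<circ> q) C3"
    and gen: "\<And>H. \<lbrakk>perm_group H; p \<in> H; q \<in> H; u \<in> H\<rbrakk> \<Longrightarrow> carrier (alt_group l) \<subseteq> H"
    and ker: "\<And>G. \<lbrakk>perm_group G; map_prod p q \<in> G; map_prod u u \<in> G;
        map_prod (p \<circ> u \<circ> q) (q \<circ> (p \<circ> u \<circ> q) \<circ> inv' q) \<in> G\<rbrakk> \<Longrightarrow> kernel_nontrivial l G"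
  shows "realizable l [C1, C2, C3]"
proof -
  have bij: "bij p" "bij q" "bij u" using p q u by (auto simp: permutes_bij)
  define v where "v = inv' u \<circ> inv' p"
  let ?x = "map_prod p q" and ?y = "map_prod u id \<circ> prod.swap" and ?z = "map_prod (inv' q) v \<circ> prod.swap"
  have v: "v permutes {1..l}" unfolding v_def by (rule permutes_compose[OF permutes_inv[OF p] permutes_inv[OF u]])
  have puq: "p \<circ> u \<circ> q permutes {1..l}" by (rule permutes_compose[OF q permutes_compose[OF u p]])
  have inv_puq: "inv' q \<circ> v = inv' (p \<circ> u \<circ> q)"
    unfolding v_def using bij by (simp only: o_inv_distrib bij_comp comp_assoc)
  have "?x \<in> wreath_class l C1" by (rule pair_symbol_mem[OF c(1) p q])
  moreover have "?y \<in> wreath_class l C2"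
    by (rule twisted_symbol_mem[OF _ u permutes_id]) (use c(2) in \<open>simp only: comp_id\<close>)
  moreover have "?z \<in> wreath_class l C3"
    by (rule twisted_symbol_mem[OF _ permutes_inv[OF q] v])
      (use twisted_symbol_inv[OF puq c(3)] inv_puq in \<open>simp only:\<close>)
  ultimately have "list_all2 (\<lambda>x c. x \<in> wreath_class l c) [?x, ?y, ?z] [C1, C2, C3]" by (simp only: list_all2_Cons list.rel_inject simp_thms)
  moreover have "foldr (\<circ>) [?x, ?y, ?z] id = id"
    using bij by (auto simp: fun_eq_iff v_def bij_is_surj surj_f_inv_f)
  moreover have "alt_square l \<subseteq> G \<and> (\<exists>u v. u permutes {1..l} \<and> v permutes {1..l} \<and> map_prod u v \<circ> prod.swap \<in> G)"
    if G: "perm_group G" and mem: "set [?x, ?y, ?z] \<subseteq> G" for G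
  proof -
    have x: "?x \<in> G" and y: "?y \<in> G" and z: "?z \<in> G" using mem by auto
    interpret H: perm_group "fst_projection G" by (rule perm_group_fst_projection[OF G])
    have uu: "map_prod u u \<in> G" using twisted_square_mem[OF G y] by (simp only: comp_id id_comp)
    have pH: "p \<in> fst_projection G" and uH: "u \<in> fst_projection G"
      using x uu by (auto simp: fst_projection_def)
    \<comment> \<open>Conjugating (p, q) by (u, 1)s brings a conjugate of q under u to the first
      coordinate. As u is already in the projection, the conjugation can be undone there.\<close>
    have "u \<circ> q \<circ> inv' u \<in> fst_projection G"
      using twisted_conj_mem[OF G y x \<open>bij u\<close> bij_id] by (auto simp: fst_projection_def)
    from H.comp_mem[OF H.comp_mem[OF H.inv_mem[OF uH] this] uH]
    have "inv' u \<circ> (u \<circ> q \<circ> inv' u) \<circ> u \<in> fst_projection G" .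
    moreover have "inv' u \<circ> (u \<circ> q \<circ> inv' u) \<circ> u = q" using bij by (simp add: fun_eq_iff bij_is_inj)
    ultimately have qH: "q \<in> fst_projection G" by simp
    have proj: "carrier (alt_group l) \<subseteq> fst_projection G" by (rule gen[OF H.perm_group_axioms pH qH uH])
    have "map_prod (inv' (inv' q \<circ> v)) (inv' (v \<circ> inv' q)) \<in> G"
      by (rule map_prod_inv_mem[OF G twisted_square_mem[OF G z]])
    moreover have "inv' (inv' q \<circ> v) = p \<circ> u \<circ> q" "inv' (v \<circ> inv' q) = q \<circ> (p \<circ> u \<circ> q) \<circ> inv' q"
      unfolding v_def using bij
      by (simp_all add: o_inv_distrib bij_comp bij_imp_bij_inv inv_inv_eq fun_eq_iff bij_is_surj surj_f_inv_f)
    ultimately have "kernel_nontrivial l G" using ker[OF G x uu] by simp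
    then show ?thesis using alt_square_subset'[OF l G proj _ y u permutes_id] y u permutes_id by blast
  qed
  ultimately show ?thesis unfolding realizable_def by blast
qed

text \<open>(p1, q1) (p2, q2) s (q^-1, p^-1)s = 1 with p = p1 p2 and q = q1 q2, and the last factor
  has the structure of pq. As s itself lies in G, all four permutations appear in the first
  projection.\<close>

lemma realizable_pair_pair_swap_twisted:
  assumes l: "l \<ge> 8"
    and p1: "p1 permutes {1..l}" and q1: "q1 permutes {1..l}"
    and p2: "p2 permutes {1..l}" and q2: "q2 permutes {1..l}"
    and c: "pair_symbol l p1 q1 C1" "pair_symbol l p2 q2 C2" "twisted_symbol l (p1 \<circ> p2 \<circ> (q1 \<circ> q2)) C3"
    and gen: "\<And>H. \<lbrakk>perm_group H; p1 \<in> H; q1 \<in> H; p2 \<in> H; q2 \<in> H\<rbrakk> \<Longrightarrow> carrier (alt_group l) \<subseteq> H"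
    and ker: "\<And>G. \<lbrakk>perm_group G; map_prod p1 q1 \<in> G; map_prod p2 q2 \<in> G;
        map_prod (p1 \<circ> p2 \<circ> (q1 \<circ> q2)) (q1 \<circ> q2 \<circ> (p1 \<circ> p2)) \<in> G\<rbrakk> \<Longrightarrow> kernel_nontrivial l G"
  shows "realizable l [C1, C2, Cl_Swap, C3]"
proof -
  define p q where "p = p1 \<circ> p2" and "q = q1 \<circ> q2"
  have p: "p permutes {1..l}" and q: "q permutes {1..l}"
    unfolding p_def q_def by (rule permutes_compose[OF p2 p1], rule permutes_compose[OF q2 q1])
  have bij: "bij p" "bij q" using p q by (auto simp: permutes_bij)
  let ?x1 = "map_prod p1 q1" and ?x2 = "map_prod p2 q2" and ?y = "map_prod id id \<circ> (prod.swap :: nat \<times> nat \<Rightarrow> _)"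
    and ?z = "map_prod (inv' q) (inv' p) \<circ> prod.swap"
  have pq: "p \<circ> q permutes {1..l}" by (rule permutes_compose[OF q p])
  have inv_pq: "inv' q \<circ> inv' p = inv' (p \<circ> q)" using bij by (simp only: o_inv_distrib)
  have "?x1 \<in> wreath_class l C1" "?x2 \<in> wreath_class l C2"
    by (rule pair_symbol_mem[OF c(1) p1 q1], rule pair_symbol_mem[OF c(2) p2 q2])
  moreover have "?y \<in> wreath_class l Cl_Swap" by (rule swap_mem[OF permutes_id permutes_id]) simp
  moreover have "?z \<in> wreath_class l C3"
    by (rule twisted_symbol_mem[OF _ permutes_inv[OF q] permutes_inv[OF p]])
      (use twisted_symbol_inv[OF pq, of C3] c(3) inv_pq in \<open>simp only: p_def q_def\<close>)
  ultimately have "list_all2 (\<lambda>x c. x \<in> wreath_class l c) [?x1, ?x2, ?y, ?z] [C1, C2, Cl_Swap, C3]"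
    by (simp only: list_all2_Cons list.rel_inject simp_thms)
  moreover have "foldr (\<circ>) [?x1, ?x2, ?y, ?z] id = id"
  proof -
    have "p1 (p2 (inv' p a)) = a" "q1 (q2 (inv' q a)) = a" for a
      using bij by (simp_all add: bij_is_surj surj_f_inv_f flip: o_apply[of p1 p2] o_apply[of q1 q2] p_def q_def)
    then show ?thesis by (auto simp: fun_eq_iff)
  qed
  moreover have "alt_square l \<subseteq> G \<and> (\<exists>u v. u permutes {1..l} \<and> v permutes {1..l} \<and> map_prod u v \<circ> prod.swap \<in> G)"
    if G: "perm_group G" and mem: "set [?x1, ?x2, ?y, ?z] \<subseteq> G" for G
  proof -
    have x: "?x1 \<in> G" "?x2 \<in> G" and y: "?y \<in> G" and z: "?z \<in> G" using mem by auto
    interpret H: perm_group "fst_projection G" by (rule perm_group_fst_projection[OF G])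
    have flip: "map_prod b a \<in> G" if "map_prod a b \<in> G" for a b
      using twisted_conj_mem[OF G y that bij_id bij_id] by simp
    have "p1 \<in> fst_projection G" "q1 \<in> fst_projection G" "p2 \<in> fst_projection G" "q2 \<in> fst_projection G"
      using x x[THEN flip] by (auto simp: fst_projection_def)
    then have proj: "carrier (alt_group l) \<subseteq> fst_projection G" by (intro gen[OF H.perm_group_axioms])
    have "map_prod (inv' (inv' q \<circ> inv' p)) (inv' (inv' p \<circ> inv' q)) \<in> G"
      by (rule map_prod_inv_mem[OF G twisted_square_mem[OF G z]])
    moreover have "inv' (inv' q \<circ> inv' p) = p \<circ> q" "inv' (inv' p \<circ> inv' q) = q \<circ> p"
      using bij by (simp_all add: o_inv_distrib bij_imp_bij_inv inv_inv_eq)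
    ultimately have "kernel_nontrivial l G" using ker[OF G x] by (simp add: p_def q_def)
    then show ?thesis using alt_square_subset'[OF l G proj _ y permutes_id permutes_id] y permutes_id by blast
  qed
  ultimately show ?thesis unfolding realizable_def by blast
qed

text \<open>s (u, u^-1)s (v, v^-1)s (w, w^-1)s equals (u^-1 v w^-1, u v^-1 w). Killing the second
  coordinate forces w = v u^-1, and the first coordinate becomes the inverse of t. The one remaining
  class therefore has to contain a commutator of the generators.\<close>

lemma realizable_commutator:
  assumes l: "l \<ge> 8" and u: "u permutes {1..l}" and v: "v permutes {1..l}"
    and t: "t = v \<circ> inv' u \<circ> inv' v \<circ> u" "t \<noteq> id" "pair_symbol l t id C"
    and gen: "\<And>H. \<lbrakk>perm_group H; u \<in> H; v \<in> H\<rbrakk> \<Longrightarrow> carrier (alt_group l) \<subseteq> H"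
  shows "realizable l [Cl_Swap, Cl_Swap, Cl_Swap, Cl_Swap, C]"
proof -
  have bij: "bij u" "bij v" using u v by (auto simp: permutes_bij)
  define w where "w = v \<circ> inv' u"
  have w: "w permutes {1..l}" unfolding w_def by (rule permutes_compose[OF permutes_inv[OF u] v])
  have tp: "t permutes {1..l}"
    unfolding t(1) by (rule permutes_compose[OF u permutes_compose[OF permutes_inv[OF v] permutes_compose[OF permutes_inv[OF u] v]]])
  let ?s = "\<lambda>u. map_prod u (inv' u) \<circ> prod.swap"
  have s: "?s f \<in> wreath_class l Cl_Swap" if "f permutes {1..l}" for f
    by (rule swap_mem[OF that permutes_inv[OF that]]) (rule permutes_inv_o(1)[OF that])
  have "list_all2 (\<lambda>x c. x \<in> wreath_class l c) [?s id, ?s u, ?s v, ?s w, map_prod t id]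
      [Cl_Swap, Cl_Swap, Cl_Swap, Cl_Swap, C]"
    using s[OF permutes_id] s[OF u] s[OF v] s[OF w] pair_symbol_mem[OF t(3) tp permutes_id]
    by (simp only: list_all2_Cons list.rel_inject simp_thms)
  moreover have "foldr (\<circ>) [?s id, ?s u, ?s v, ?s w, map_prod t id] id = id"
    using bij by (auto simp: fun_eq_iff t(1) w_def o_inv_distrib bij_imp_bij_inv inv_inv_eq bij_is_inj bij_is_surj surj_f_inv_f)
  moreover have "alt_square l \<subseteq> G \<and> (\<exists>u v. u permutes {1..l} \<and> v permutes {1..l} \<and> map_prod u v \<circ> prod.swap \<in> G)"
    if G: "perm_group G" and mem: "set [?s id, ?s u, ?s v, ?s w, map_prod t id] \<subseteq> G" for G
  proof -
    have x: "?s id \<in> G" "?s u \<in> G" "?s v \<in> G" "map_prod t id \<in> G" using mem by auto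
    have "f \<in> fst_projection G" if "?s f \<in> G" for f
    proof -
      have "?s f \<circ> ?s id = map_prod f (inv' f)" by (auto simp: fun_eq_iff)
      then show ?thesis using perm_group.comp_mem[OF G that x(1)] by (auto simp: fst_projection_def)
    qed
    then have proj: "carrier (alt_group l) \<subseteq> fst_projection G"
      using gen[OF perm_group_fst_projection[OF G]] x by blast
    have "alt_square l \<subseteq> G"
      by (rule alt_square_subset[OF l G proj x(4) tp t(2) x(2) permutes_inv[OF u]])
    then show ?thesis using x(2) u permutes_inv[OF u] by blast
  qed
  ultimately show ?thesis unfolding realizable_def by blast
qed

text \<open>s (u, u^-1)s = (u^-1, u), while (v, 1)s (u^-1, vu)s = (u, u^-1) because v is an
  involution. The square of the fourth element is (u^-1 v u, v), and multiplying it by (v, v), the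
  square of the third, clears the second coordinate.\<close>

lemma realizable_swap_swap_twisted_twisted:
  assumes l: "l \<ge> 8" and u: "u permutes {1..l}" and v: "v permutes {1..l}" "v \<circ> v = id"
    and c: "twisted_symbol l v C3" "twisted_symbol l (inv' u \<circ> v \<circ> u) C4"
    and neq: "inv' u \<circ> v \<circ> u \<noteq> v"
    and gen: "\<And>H. \<lbrakk>perm_group H; u \<in> H; v \<in> H\<rbrakk> \<Longrightarrow> carrier (alt_group l) \<subseteq> H"
  shows "realizable l [Cl_Swap, Cl_Swap, C3, C4]"
proof -
  have bij: "bij u" "bij v" using u v by (auto simp: permutes_bij)
  have vu: "v \<circ> u permutes {1..l}" by (rule permutes_compose[OF u v(1)])
  let ?x1 = "map_prod id id \<circ> (prod.swap :: nat \<times> nat \<Rightarrow> _)" and ?x2 = "map_prod u (inv' u) \<circ> prod.swap"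
    and ?x3 = "map_prod v id \<circ> prod.swap" and ?x4 = "map_prod (inv' u) (v \<circ> u) \<circ> prod.swap"
  have "?x1 \<in> wreath_class l Cl_Swap" by (rule swap_mem[OF permutes_id permutes_id]) simp
  moreover have "?x2 \<in> wreath_class l Cl_Swap" by (rule swap_mem[OF u permutes_inv[OF u] permutes_inv_o(1)[OF u]])
  moreover have "?x3 \<in> wreath_class l C3"
    by (rule twisted_symbol_mem[OF _ v(1) permutes_id]) (use c(1) in \<open>simp only: comp_id\<close>)
  moreover have "?x4 \<in> wreath_class l C4"
    by (rule twisted_symbol_mem[OF _ permutes_inv[OF u] vu]) (use c(2) in \<open>simp only: comp_assoc\<close>)
  ultimately have "list_all2 (\<lambda>x c. x \<in> wreath_class l c) [?x1, ?x2, ?x3, ?x4] [Cl_Swap, Cl_Swap, C3, C4]"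
    by (simp only: list_all2_Cons list.rel_inject simp_thms)
  moreover have "foldr (\<circ>) [?x1, ?x2, ?x3, ?x4] id = id"
    using bij v(2) by (auto simp: fun_eq_iff bij_is_inj bij_is_surj surj_f_inv_f)
  moreover have "alt_square l \<subseteq> G \<and> (\<exists>u v. u permutes {1..l} \<and> v permutes {1..l} \<and> map_prod u v \<circ> prod.swap \<in> G)"
    if G: "perm_group G" and mem: "set [?x1, ?x2, ?x3, ?x4] \<subseteq> G" for G
  proof -
    have x: "?x1 \<in> G" "?x2 \<in> G" "?x3 \<in> G" "?x4 \<in> G" using mem by auto
    have "?x2 \<circ> ?x1 = map_prod u (inv' u)" by (auto simp: fun_eq_iff)
    then have uG: "map_prod u (inv' u) \<in> G" using perm_group.comp_mem[OF G x(2,1)] by simp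
    have vG: "map_prod v v \<in> G" using twisted_square_mem[OF G x(3)] by (simp only: comp_id id_comp)
    have "u \<in> fst_projection G" "v \<in> fst_projection G" using uG vG by (auto simp: fst_projection_def)
    then have proj: "carrier (alt_group l) \<subseteq> fst_projection G" by (intro gen[OF perm_group_fst_projection[OF G]])
    have "map_prod (inv' u \<circ> (v \<circ> u) \<circ> v) (v \<circ> u \<circ> inv' u \<circ> v) \<in> G"
      by (rule map_prod_comp_mem[OF G twisted_square_mem[OF G x(4)] vG])
    moreover have "v \<circ> u \<circ> inv' u \<circ> v = id" using bij v(2) by (auto simp: fun_eq_iff bij_is_surj surj_f_inv_f)
    ultimately have ker: "map_prod (inv' u \<circ> (v \<circ> u) \<circ> v) id \<in> G" by simp
    have "inv' u \<circ> (v \<circ> u) \<circ> v \<noteq> id"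
    proof
      assume "inv' u \<circ> (v \<circ> u) \<circ> v = id"
      then have "inv' u \<circ> (v \<circ> u) \<circ> v \<circ> v = v" by (simp only: id_comp)
      then show False using neq v(2) by (simp only: comp_assoc comp_id)
    qed
    then have "alt_square l \<subseteq> G"
      by (intro alt_square_subset[OF l G proj ker _ _ x(2) permutes_inv[OF u]])
        (rule permutes_compose[OF v(1) permutes_compose[OF vu permutes_inv[OF u]]])
    then show ?thesis using x(2) u permutes_inv[OF u] by blast
  qed
  ultimately show ?thesis unfolding realizable_def by blast
qed

section \<open>Rotations, reflections and their relatives\<close>

lemma permutes_by_inverse:
  assumes "finite S" "\<And>x. x \<notin> S \<Longrightarrow> f x = x" "\<And>x. x \<in> S \<Longrightarrow> f x \<in> S" "\<And>x. x \<in> S \<Longrightarrow> g (f x) = x"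
  shows "f permutes S"
proof (rule bij_imp_permutes)
  have "inj_on f S" using assms(4) by (rule inj_on_inverseI)
  then show "bij_betw f S S" using assms(1,3) by (intro endo_inj_surj bij_betw_imageI) auto
qed (use assms(2) in simp)

definition rot :: "nat \<Rightarrow> nat \<Rightarrow> nat" where
  "rot l x = (if x = l then 1 else if 1 \<le> x \<and> x < l then x + 1 else x)"

definition two_cycles :: "nat \<Rightarrow> nat \<Rightarrow> nat \<Rightarrow> nat" where
  "two_cycles l a x = (if x = a then 1 else if x = l then a + 1 else if 1 \<le> x \<and> x < l then x + 1 else x)"

definition flip :: "nat \<Rightarrow> nat \<Rightarrow> nat \<Rightarrow> nat" where
  "flip l m x = (if m \<le> x \<and> x \<le> l then l + m - x else x)"

lemma rot_permutes: "l \<ge> 1 \<Longrightarrow> rot l permutes {1..l}"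
  by (rule permutes_by_inverse[of _ _ "\<lambda>x. if x = 1 then l else x - 1"]) (auto simp: rot_def)

lemma two_cycles_permutes: "\<lbrakk>1 \<le> a; a < l\<rbrakk> \<Longrightarrow> two_cycles l a permutes {1..l}"
  by (rule permutes_by_inverse[of _ _ "\<lambda>x. if x = 1 then a else if x = a + 1 then l else x - 1"])
    (auto simp: two_cycles_def)

lemma flip_permutes: "m \<ge> 1 \<Longrightarrow> flip l m permutes {1..l}"
  by (rule permutes_by_inverse[of _ _ "flip l m"]) (auto simp: flip_def)

lemma orbit_segment:
  assumes m: "m \<in> Orbits.orbit f x" and step: "\<And>i. m \<le> i \<Longrightarrow> i < n \<Longrightarrow> f i = Suc i"
  shows "{m..n} \<subseteq> Orbits.orbit f x"
proof
  fix y assume "y \<in> {m..n}"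
  then have "m \<le> y" "y \<le> n" by auto
  then show "y \<in> Orbits.orbit f x"
  proof (induction y rule: dec_induct)
    case (step i)
    then have "f i \<in> Orbits.orbit f x" by (intro orbit.step) auto
    then show ?case using assms(2)[of i] step by simp
  qed (rule m)
qed

lemma cycle_type_rot: assumes "l \<ge> 1" shows "cycle_type l (rot l) = parts (L\<^sub>W l)"
proof (rule cycle_type_L[OF rot_permutes[OF assms], of l])
  have "rot l l \<in> Orbits.orbit (rot l) l" by (rule orbit.base)
  then have "1 \<in> Orbits.orbit (rot l) l" by (simp add: rot_def)
  then show "{1..l} \<subseteq> Orbits.orbit (rot l) l" by (rule orbit_segment) (simp add: rot_def)
qed (use assms in simp)

lemma cycle_type_two_cycles:
  assumes a: "0 < a" "2 * a < l" shows "cycle_type l (two_cycles l a) = parts (A\<^sub>W l a)"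
proof (rule cycle_type_A[OF two_cycles_permutes a])
  have perm: "permutation (two_cycles l a)"
    using two_cycles_permutes[of a l] a by (auto simp: permutation_permutes)
  show "{1..a} \<subseteq> Orbits.orbit (two_cycles l a) 1"
    by (rule orbit_segment[OF permutation_self_in_orbit[OF perm]]) (use a in \<open>simp add: two_cycles_def\<close>)
  show "{a + 1..l} \<subseteq> Orbits.orbit (two_cycles l a) (a + 1)"
    by (rule orbit_segment[OF permutation_self_in_orbit[OF perm]]) (use a in \<open>simp add: two_cycles_def\<close>)
qed (use a in \<open>auto simp: two_cycles_def\<close>)

text \<open>A transposition of two points at distance a on the circle cuts the l-cycle into cycles
  of lengths a and l - a.\<close>

lemma two_cycles_eq_rot:
  assumes "1 \<le> a" "a < l"
  shows "two_cycles l a = rot l \<circ> transpose a l" "two_cycles l a = transpose 1 (a + 1) \<circ> rot l"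
  using assms by (auto simp: fun_eq_iff two_cycles_def rot_def transpose_def)

section \<open>Generation by a rotation or by two cycles of coprime lengths\<close>

lemma total_of_rot_invariant:
  assumes sym: "\<And>x y. R x y \<Longrightarrow> R y x" and trans: "\<And>x y z. \<lbrakk>R x y; R y z\<rbrakk> \<Longrightarrow> R x z" and refl: "\<And>x. R x x"
    and rot: "\<And>x y. R x y \<Longrightarrow> R (rot l x) (rot l y)"
    and i: "R i (Suc i)" "1 \<le> i" "i < l"
    and xy: "x \<in> {1..l}" "y \<in> {1..l}"
  shows "R x y"
proof -
  have up: "R k (Suc k)" if "j \<le> k" "k < l" "1 \<le> j" "R j (Suc j)" for j k
    using that
  proof (induction k rule: dec_induct)
    case (step n)
    then show ?case using rot[of n "Suc n"] by (simp add: rot_def)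
  qed
  have e: "rot l (l - 1) = l" "rot l l = 1" "rot l 1 = Suc 1" using i by (auto simp: rot_def)
  \<comment> \<open>The relation between neighbours moves up from i to (l - 1, l), then across the
    seam to (l, 1) and (1, 2), from where it reaches every point.\<close>
  have "R (l - 1) l" using up[of i "l - 1"] i by simp
  from rot[OF this] have "R l 1" by (simp only: e)
  from rot[OF this] have 1: "R 1 (Suc 1)" by (simp only: e)
  have "R 1 k" if "1 \<le> k" "k \<le> l" for k
    using that
  proof (induction k rule: dec_induct)
    case (step n)
    then show ?case using trans[of 1 n "Suc n"] up[of 1 n] 1 by simp
  qed (rule refl)
  then show ?thesis using xy trans[OF sym, of 1 x y] by simp
qed

lemma alt_group_subset_rot:
  assumes H: "perm_group H" and "rot l \<in> H" "tri H i (Suc i)" "1 \<le> i" "i < l"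
  shows "carrier (alt_group l) \<subseteq> H"
proof (rule alt_group_subset[OF H])
  interpret perm_group H by fact
  show "tri H x y" if "x \<in> {1..l}" "y \<in> {1..l}" for x y
    by (rule total_of_rot_invariant[OF tri_sym tri_trans tri_refl tri_image[OF assms(2)] assms(3-5) that])
qed

lemma two_cycles_funpow:
  assumes "1 \<le> a" "a < l"
  shows "x \<in> {1..a} \<Longrightarrow> (two_cycles l a ^^ k) x = (x - 1 + k) mod a + 1"
    and "x \<in> {a + 1..l} \<Longrightarrow> (two_cycles l a ^^ k) x = (x - (a + 1) + k) mod (l - a) + (a + 1)"
proof -
  show "(two_cycles l a ^^ k) x = (x - 1 + k) mod a + 1" if "x \<in> {1..a}"
  proof (induction k)
    case 0
    have "x - 1 < a" "1 \<le> x" using that by auto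
    then show ?case by simp
  next
    case (Suc k)
    define y where "y = (x - 1 + k) mod a"
    have y: "y < a" using assms by (simp add: y_def)
    have "(two_cycles l a ^^ Suc k) x = two_cycles l a (y + 1)" using Suc by (simp add: y_def)
    also have "\<dots> = (if Suc y = a then 0 else Suc y) + 1" using y assms by (auto simp: two_cycles_def)
    also have "(if Suc y = a then 0 else Suc y) = (x - 1 + Suc k) mod a" by (simp add: y_def mod_Suc)
    finally show ?case .
  qed
  show "(two_cycles l a ^^ k) x = (x - (a + 1) + k) mod (l - a) + (a + 1)" if "x \<in> {a + 1..l}"
  proof (induction k)
    case 0
    have "x - (a + 1) < l - a" "a + 1 \<le> x" using that assms by auto
    then show ?case by simp
  next
    case (Suc k)
    define y where "y = (x - (a + 1) + k) mod (l - a)"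
    have y: "y < l - a" using assms by (simp add: y_def)
    have "(two_cycles l a ^^ Suc k) x = two_cycles l a (y + (a + 1))" using Suc by (simp add: y_def)
    also have "\<dots> = (if Suc y = l - a then 0 else Suc y) + (a + 1)" using y assms by (auto simp: two_cycles_def)
    also have "(if Suc y = l - a then 0 else Suc y) = (x - (a + 1) + Suc k) mod (l - a)"
      by (simp add: y_def mod_Suc)
    finally show ?case .
  qed
qed

text \<open>Since a and l - a are coprime, the Chinese remainder theorem yields one power of
  \<open>two_cycles l a\<close> that rotates both cycles by prescribed amounts. This is the main use
  of the condition (a, l) = 1.\<close>

lemma two_cycles_independent_rotations:
  assumes H: "perm_group H" "two_cycles l a \<in> H" and a: "1 \<le> a" "a < l" "coprime a l"
  obtains g where "g \<in> H"
    "\<And>x. x \<in> {1..a} \<Longrightarrow> g x = (x - 1 + r) mod a + 1"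
    "\<And>x. x \<in> {a + 1..l} \<Longrightarrow> g x = (x - (a + 1) + s) mod (l - a) + (a + 1)"
proof -
  have "coprime a (l - a)"
    using a gcd_diff1_nat[of a l] by (simp add: coprime_iff_gcd_eq_1 gcd.commute)
  then obtain k where "[k = r] (mod a)" "[k = s] (mod (l - a))"
    using binary_chinese_remainder_nat by blast
  then have *: "(x - 1 + k) mod a = (x - 1 + r) mod a" "(x - (a + 1) + k) mod (l - a) = (x - (a + 1) + s) mod (l - a)" for x
    by (metis cong_def mod_add_right_eq)+
  show thesis
    by (rule that[of "two_cycles l a ^^ k"]; (rule perm_group.funpow_mem[OF H])?)
      (simp_all only: two_cycles_funpow[OF a(1,2)] *)
qed

text \<open>Independent rotations carry one related pair across the two cycles to every such pair;
  two points of the same cycle are then related through any point of the other.\<close>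

lemma alt_group_subset_two_cycles:
  assumes H: "perm_group H" "two_cycles l a \<in> H" and a: "1 \<le> a" "a < l" "coprime a l"
    and xy: "x \<in> {1..a}" "y \<in> {a + 1..l}" "tri H x y"
  shows "carrier (alt_group l) \<subseteq> H"
proof (rule alt_group_subset[OF H(1)])
  interpret perm_group H by fact
  have cross: "tri H x' y'" if "x' \<in> {1..a}" "y' \<in> {a + 1..l}" for x' y'
  proof -
    \<comment> \<open>The rotation amounts x' - x and y' - y are raised by a and l - a to stay
      within the natural numbers.\<close>
    obtain g where g: "g \<in> H"
      "\<And>z. z \<in> {1..a} \<Longrightarrow> g z = (z - 1 + (x' + a - x)) mod a + 1"
      "\<And>z. z \<in> {a + 1..l} \<Longrightarrow> g z = (z - (a + 1) + (y' + (l - a) - y)) mod (l - a) + (a + 1)"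
      using two_cycles_independent_rotations[OF H a] by blast
    have "x - 1 + (x' + a - x) = x' - 1 + a" "y - (a + 1) + (y' + (l - a) - y) = y' - (a + 1) + (l - a)"
      using xy that by auto
    then have "g x = (x' - 1 + a) mod a + 1" "g y = (y' - (a + 1) + (l - a)) mod (l - a) + (a + 1)"
      using g(2)[OF xy(1)] g(3)[OF xy(2)] by (simp_all only:)
    moreover have lt: "x' - 1 < a" "y' - (a + 1) < l - a" and ge: "x' \<ge> 1" "y' \<ge> a + 1" using that a by auto
    have "(x' - 1 + a) mod a = x' - 1" "(y' - (a + 1) + (l - a)) mod (l - a) = y' - (a + 1)"
      using lt by (simp_all only: mod_add_self2 mod_less)
    ultimately have "g x = x'" "g y = y'" using ge by (simp_all only: le_add_diff_inverse2)
    then show ?thesis using tri_image[OF g(1) xy(3)] by simp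
  qed
  have "1 \<in> {1..a}" "l \<in> {a + 1..l}" using a by auto
  show "tri H i j" if "i \<in> {1..l}" "j \<in> {1..l}" for i j
  proof (cases "i \<le> a"; cases "j \<le> a")
    assume "i \<le> a" "j \<le> a"
    then show ?thesis using tri_trans[OF cross[of i l] tri_sym[OF cross[of j l]]] that a by simp
  next
    assume "i \<le> a" "\<not> j \<le> a"
    then show ?thesis using cross[of i j] that by simp
  next
    assume "\<not> i \<le> a" "j \<le> a"
    then show ?thesis using tri_sym[OF cross[of j i]] that by simp
  next
    assume "\<not> i \<le> a" "\<not> j \<le> a"
    then show ?thesis using tri_trans[OF tri_sym[OF cross[of 1 i]] cross[of 1 j]] that a by simp
  qed
qed

lemma (in perm_group) transpose_transpose_tri:
  assumes "transpose x y \<in> H" "transpose x z \<in> H" "distinct [x, y, z]" shows "tri H x y"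
proof -
  have "cyc3 y x z \<in> H"
    unfolding cyc3_def using assms(1,2) by (intro comp_mem) (simp_all add: transpose_commute)
  moreover have "distinct [y, x, z]" using assms(3) by auto
  ultimately show ?thesis by (meson triI(1) tri_sym)
qed

text \<open>Rotating only the cycle of y fixes x and moves y. This gives a second transposition
  through x, and the two multiply to a 3-cycle.\<close>

lemma alt_group_subset_two_cycles_transpose:
  assumes H: "perm_group H" "two_cycles l a \<in> H" and a: "1 \<le> a" "2 * a < l" "coprime a l" "l \<ge> 3"
    and xy: "x \<in> {1..a}" "y \<in> {a + 1..l}" "transpose x y \<in> H"
  shows "carrier (alt_group l) \<subseteq> H"
proof -
  interpret perm_group H by fact
  have al: "a < l" using a by simp
  obtain g where g: "g \<in> H" "\<And>z. z \<in> {1..a} \<Longrightarrow> g z = (z - 1 + 0) mod a + 1"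
      "\<And>z. z \<in> {a + 1..l} \<Longrightarrow> g z = (z - (a + 1) + 1) mod (l - a) + (a + 1)"
    using two_cycles_independent_rotations[OF H a(1) al a(3), of 0 1] by blast
  have gx: "g x = x" using g(2)[OF xy(1)] xy by auto
  have "g y = (if Suc (y - (a + 1)) = l - a then 0 else Suc (y - (a + 1))) + (a + 1)"
    using g(3)[OF xy(2)] xy by (auto simp: mod_Suc)
  then have gy: "g y \<noteq> y" "g y \<in> {a + 1..l}" using xy a by auto
  have "transpose x (g y) \<in> H"
    using conj_mem[OF g(1) xy(3)] conj_transpose[OF bij_mem[OF g(1)], of x y] gx by simp
  then have "tri H x y" using transpose_transpose_tri[OF xy(3)] gy xy by auto
  then show ?thesis by (rule alt_group_subset_two_cycles[OF H a(1) al a(3) xy(1,2)])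
qed

lemma alt_group_subset_rot_transpose:
  assumes H: "perm_group H" "rot l \<in> H" and i: "transpose i (Suc i) \<in> H" "1 \<le> i" "Suc i < l"
  shows "carrier (alt_group l) \<subseteq> H"
proof -
  interpret perm_group H by fact
  have "transpose (Suc i) (Suc (Suc i)) \<in> H"
    using conj_mem[OF H(2) i(1)] conj_transpose[OF bij_mem[OF H(2)], of i "Suc i"] i by (simp add: rot_def)
  moreover have "transpose (Suc i) i \<in> H" using i(1) by (simp add: transpose_commute)
  ultimately have "tri H (Suc i) i" using transpose_transpose_tri[of "Suc i" i "Suc (Suc i)"] by simp
  then show ?thesis using alt_group_subset_rot[OF H tri_sym] i by simp
qed

section \<open>Rows with an l-cycle or two long cycles and a short element\<close>

lemma transpose_neq_id: "a \<noteq> b \<Longrightarrow> transpose a b \<noteq> id"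
  by (metis id_apply transpose_apply_first)

lemma rot_simps: "rot l l = 1" "\<lbrakk>1 \<le> x; x < l\<rbrakk> \<Longrightarrow> rot l x = Suc x"
  by (auto simp: rot_def)

lemma inv_rot:
  assumes "l \<ge> 1" shows "inv' (rot l) 1 = l" "\<lbrakk>1 \<le> x; x < l\<rbrakk> \<Longrightarrow> inv' (rot l) (Suc x) = x"
  using permutes_inj[OF rot_permutes[OF assms]] by (auto intro!: inv_f_eq simp: rot_simps)

lemma rot_funpow: "1 \<le> x \<Longrightarrow> x \<le> l \<Longrightarrow> (rot l ^^ k) x = (x - 1 + k) mod l + 1"
proof (induction k)
  case 0
  then have "x - 1 < l" by simp
  then show ?case using 0 by simp
next
  case (Suc k)
  define y where "y = (x - 1 + k) mod l"
  have y: "y < l" using Suc.prems by (simp add: y_def)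
  have "(rot l ^^ Suc k) x = rot l (y + 1)" using Suc by (simp add: y_def)
  also have "\<dots> = (if Suc y = l then 0 else Suc y) + 1" using y by (auto simp: rot_def)
  also have "(if Suc y = l then 0 else Suc y) = (x - 1 + Suc k) mod l" by (simp add: y_def mod_Suc)
  finally show ?case .
qed

text \<open>Taking q1 = 1 and q2 = (tp)^-1 makes the word t p (tp)^-1 trivial, so the last class is
  s. It remains to find t for which p and tp both have the required long cycles.\<close>

lemma realizable_pair_pair_swap_swap:
  assumes l: "l \<ge> 8" and t: "t permutes {1..l}" "t \<noteq> id" and p: "p permutes {1..l}"
    and c: "pair_symbol l t id C1" "pair_symbol l p (t \<circ> p) C2"
    and gen: "\<And>H. \<lbrakk>perm_group H; t \<in> H; p \<in> H\<rbrakk> \<Longrightarrow> carrier (alt_group l) \<subseteq> H"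
  shows "realizable l [C2, C1, Cl_Swap, Cl_Swap]"
proof -
  have tp: "t \<circ> p permutes {1..l}" by (rule permutes_compose[OF p t(1)])
  have "pair_symbol l p (inv' (t \<circ> p)) C2" using c(2) cycle_type_inv[OF tp] by (cases C2) auto
  then have "realizable l [C1, C2, Cl_Swap, Cl_Swap]"
    using t(2) gen
    by (intro realizable_pair_pair_swap_twisted[OF l t(1) permutes_id p permutes_inv[OF tp] c(1)])
      (auto simp: permutes_inv_o[OF tp] intro: kernel_nontrivialI[OF t(1)] simp del: o_apply)
  then show ?thesis by (rule realizable_cong[THEN iffD1, rotated]) simp
qed

lemma row_I1_1:
  assumes l: "l \<ge> 9" and a: "parameter_W l a"
  shows "realizable l [Cl_Twisted (L\<^sub>W l), Cl_Twisted (A\<^sub>W l a), Cl_Pair (\<tau>\<^sub>W l) (e\<^sub>W l)]"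
proof -
  have a': "1 \<le> a" "0 < a" "2 * a < l" "coprime a l" "a < l" using a by (auto simp: parameter_W_def)
  let ?t = "transpose 1 (a + 1)"
  have t: "?t permutes {1..l}" using a' by (intro permutes_swap_id) auto
  have puq: "?t \<circ> rot l \<circ> id = two_cycles l a" using two_cycles_eq_rot(2)[OF a'(1,5)] by simp
  have "realizable l [Cl_Pair (\<tau>\<^sub>W l) (e\<^sub>W l), Cl_Twisted (L\<^sub>W l), Cl_Twisted (A\<^sub>W l a)]"
  proof (rule realizable_pair_twisted_twisted[OF _ t permutes_id rot_permutes])
    show "pair_symbol l ?t id (Cl_Pair (\<tau>\<^sub>W l) (e\<^sub>W l))"
      using a' by (simp add: cycle_type_transpose cycle_type_id)
    show "twisted_symbol l (rot l) (Cl_Twisted (L\<^sub>W l))" using l by (simp add: cycle_type_rot)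
    show "twisted_symbol l (?t \<circ> rot l \<circ> id) (Cl_Twisted (A\<^sub>W l a))"
      unfolding puq using a' by (simp add: cycle_type_two_cycles)
    fix H assume H: "perm_group H" "?t \<in> H" "rot l \<in> H"
    then have "two_cycles l a \<in> H" unfolding two_cycles_eq_rot(2)[OF a'(1,5)] by (rule perm_group.comp_mem)
    then show "carrier (alt_group l) \<subseteq> H"
      using alt_group_subset_two_cycles_transpose[OF H(1) _ a'(1,3,4) _ _ _ H(2)] a' by auto
  next
    fix G :: "(nat \<times> nat \<Rightarrow> nat \<times> nat) set" assume "map_prod ?t id \<in> G"
    moreover have "?t \<noteq> id" using a' by (intro transpose_neq_id) simp
    ultimately show "kernel_nontrivial l G" using t by (blast intro: kernel_nontrivialI)
  qed (use l in auto)
  then show ?thesis by (rule realizable_cong[THEN iffD1, rotated]) simp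
qed

text \<open>With q = p^-1 the word puq is a conjugate of the transposition u. The third element
  contributes (puq, u) to G, and (u, u) clears its second coordinate.\<close>

lemma realizable_transposition_twists:
  assumes l: "l \<ge> 8" and p: "p permutes {1..l}" and u: "transpose a b permutes {1..l}" "a \<noteq> b"
    and ab: "a \<in> {1..l}" "b \<in> {1..l}"
    and c: "cycle_type l p = parts P" and neq: "transpose (p a) (p b) \<noteq> transpose a b"
    and gen: "\<And>H. \<lbrakk>perm_group H; p \<in> H; transpose a b \<in> H\<rbrakk> \<Longrightarrow> carrier (alt_group l) \<subseteq> H"
  shows "realizable l [Cl_Pair P P, Cl_Twisted (\<tau>\<^sub>W l), Cl_Twisted (\<tau>\<^sub>W l)]"
proof (rule realizable_pair_twisted_twisted[OF l p permutes_inv[OF p] u(1)])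
  have bij: "bij p" using p by (rule permutes_bij)
  have puq: "p \<circ> transpose a b \<circ> inv' p = transpose (p a) (p b)" by (rule conj_transpose[OF bij])
  show "pair_symbol l p (inv' p) (Cl_Pair P P)" using c cycle_type_inv[OF p] by simp
  show "twisted_symbol l (transpose a b) (Cl_Twisted (\<tau>\<^sub>W l))" using u(2) ab by (simp add: cycle_type_transpose)
  have pab: "p a \<in> {1..l}" "p b \<in> {1..l}" using ab permutes_in_image[OF p] by blast+
  moreover have "p a \<noteq> p b" using u(2) bij by (auto simp: bij_def inj_eq)
  ultimately show "twisted_symbol l (p \<circ> transpose a b \<circ> inv' p) (Cl_Twisted (\<tau>\<^sub>W l))"
    unfolding puq by (simp add: cycle_type_transpose)
  fix G assume G: "perm_group G" "map_prod (transpose a b) (transpose a b) \<in> G"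
    "map_prod (p \<circ> transpose a b \<circ> inv' p) (inv' p \<circ> (p \<circ> transpose a b \<circ> inv' p) \<circ> inv' (inv' p)) \<in> G"
  have "inv' p \<circ> (p \<circ> transpose a b \<circ> inv' p) \<circ> inv' (inv' p) = transpose a b"
    using bij by (simp add: inv_inv_eq fun_eq_iff bij_is_inj)
  then have "map_prod (transpose (p a) (p b)) (transpose a b) \<in> G" using G(3) puq by simp
  then have "map_prod (transpose (p a) (p b) \<circ> transpose a b) (transpose a b \<circ> transpose a b) \<in> G"
    by (rule map_prod_comp_mem[OF G(1) _ G(2)])
  then have "map_prod (transpose (p a) (p b) \<circ> transpose a b) id \<in> G" by simp
  moreover have "transpose (p a) (p b) \<circ> transpose a b \<noteq> id"
  proof
    assume "transpose (p a) (p b) \<circ> transpose a b = id"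
    then have "transpose (p a) (p b) \<circ> transpose a b \<circ> transpose a b = transpose a b" by (simp only: id_comp)
    then show False using neq by (simp add: comp_assoc)
  qed
  moreover have "transpose (p a) (p b) \<circ> transpose a b permutes {1..l}"
    using pab by (intro permutes_compose[OF u(1)] permutes_swap_id)
  ultimately show "kernel_nontrivial l G" by (blast intro: kernel_nontrivialI)
qed (use gen in blast)

lemma row_I1A_2a:
  assumes l: "l \<ge> 9"
  shows "realizable l [Cl_Pair (L\<^sub>W l) (L\<^sub>W l), Cl_Twisted (\<tau>\<^sub>W l), Cl_Twisted (\<tau>\<^sub>W l)]"
proof (rule realizable_transposition_twists[of l "rot l" 1 2])
  show "transpose (rot l 1) (rot l 2) \<noteq> transpose 1 2"
  proof
    assume "transpose (rot l 1) (rot l 2) = transpose 1 2"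
    then have "transpose (rot l 1) (rot l 2) 1 = 2" by simp
    then show False using l by (simp add: rot_def transpose_def)
  qed
  show "carrier (alt_group l) \<subseteq> H" if "perm_group H" "rot l \<in> H" "transpose 1 2 \<in> H" for H
    using alt_group_subset_rot_transpose[OF that(1,2), of 1] that(3) l by (simp add: numeral_2_eq_2)
  show "rot l permutes {1..l}" "transpose 1 2 permutes {1..l}"
    using l by (intro rot_permutes permutes_swap_id; simp)+
qed (use l in \<open>simp_all add: cycle_type_rot\<close>)

lemma row_I1A_5a:
  assumes l: "l \<ge> 9" and a: "parameter_W l a"
  shows "realizable l [Cl_Pair (A\<^sub>W l a) (A\<^sub>W l a), Cl_Twisted (\<tau>\<^sub>W l), Cl_Twisted (\<tau>\<^sub>W l)]"
proof -
  have a': "1 \<le> a" "0 < a" "2 * a < l" "coprime a l" "a < l" using a by (auto simp: parameter_W_def)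
  show ?thesis
  proof (rule realizable_transposition_twists[of l "two_cycles l a" a l])
    have two: "two_cycles l a a = 1" "two_cycles l a l = a + 1" using a' by (auto simp: two_cycles_def)
    show "transpose (two_cycles l a a) (two_cycles l a l) \<noteq> transpose a l"
    proof
      assume "transpose (two_cycles l a a) (two_cycles l a l) = transpose a l"
      then have "transpose 1 (a + 1) l = a" using two by simp
      then show False using l a' by (simp add: transpose_def split: if_splits)
    qed
    show "carrier (alt_group l) \<subseteq> H" if "perm_group H" "two_cycles l a \<in> H" "transpose a l \<in> H" for H
      using alt_group_subset_two_cycles_transpose[OF that(1,2) a'(1,3,4) _ _ _ that(3)] a' l by auto
    show "two_cycles l a permutes {1..l}" "transpose a l permutes {1..l}"
      using a' by (intro two_cycles_permutes permutes_swap_id; simp)+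
  qed (use l a' in \<open>simp_all add: cycle_type_two_cycles\<close>)
qed

lemma row_I1A_7b:
  assumes l: "l \<ge> 9" and a: "parameter_W l a"
  shows "realizable l [Cl_Pair (L\<^sub>W l) (A\<^sub>W l a), Cl_Twisted (\<tau>\<^sub>W l), Cl_Swap]"
proof -
  have a': "1 \<le> a" "0 < a" "2 * a < l" "coprime a l" "a < l" using a by (auto simp: parameter_W_def)
  \<comment> \<open>A common multiple of both cycle lengths, so the k-th power kills
    \<open>two_cycles l a\<close>; l does not divide it, so the k-th power of the l-cycle
    survives.\<close>
  define k where "k = a * (l - a)"
  have rp: "rot l permutes {1..l}" and tp: "two_cycles l a permutes {1..l}"
    using l a' by (intro rot_permutes two_cycles_permutes; simp)+
  have bij: "bij (rot l)" "bij (two_cycles l a)" using rp tp by (auto simp: permutes_bij)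
  have puq: "two_cycles l a \<circ> id \<circ> inv' (rot l) = transpose 1 (a + 1)"
    unfolding two_cycles_eq_rot(2)[OF a'(1,5)] using bij by (simp add: fun_eq_iff bij_is_surj surj_f_inv_f)
  have "realizable l [Cl_Pair (L\<^sub>W l) (A\<^sub>W l a), Cl_Swap, Cl_Twisted (\<tau>\<^sub>W l)]"
  proof (rule realizable_pair_twisted_twisted[OF _ tp permutes_inv[OF rp] permutes_id])
    show "pair_symbol l (two_cycles l a) (inv' (rot l)) (Cl_Pair (L\<^sub>W l) (A\<^sub>W l a))"
      using l a' cycle_type_inv[OF rp] by (simp add: cycle_type_rot cycle_type_two_cycles)
    show "twisted_symbol l (two_cycles l a \<circ> id \<circ> inv' (rot l)) (Cl_Twisted (\<tau>\<^sub>W l))"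
      unfolding puq using a' by (simp add: cycle_type_transpose)
    fix H assume H: "perm_group H" "two_cycles l a \<in> H" "inv' (rot l) \<in> H"
    have "two_cycles l a \<circ> inv' (rot l) \<in> H" by (rule perm_group.comp_mem[OF H])
    then have "transpose 1 (a + 1) \<in> H" using puq by simp
    then show "carrier (alt_group l) \<subseteq> H"
      using alt_group_subset_two_cycles_transpose[OF H(1,2) a'(1,3,4), of 1 "a + 1"] a' by auto
  next
    fix G assume G: "perm_group G" "map_prod (two_cycles l a) (inv' (rot l)) \<in> G"
    have "two_cycles l a ^^ k = id"
    proof
      fix x
      consider "x \<in> {1..a}" | "x \<in> {a + 1..l}" | "x \<notin> {1..l}" using a' by fastforce
      then show "(two_cycles l a ^^ k) x = id x"
      proof cases
        case 1
        then have "x - 1 < a" "1 \<le> x" by auto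
        moreover have "(x - 1 + k) mod a = (x - 1) mod a" unfolding k_def by (rule mod_mult_self2)
        ultimately show ?thesis unfolding two_cycles_funpow(1)[OF a'(1,5) 1, of k] by simp
      next
        case 2
        then have "x - (a + 1) < l - a" "a + 1 \<le> x" by auto
        moreover have "(x - (a + 1) + k) mod (l - a) = (x - (a + 1)) mod (l - a)"
          unfolding k_def by (rule mod_mult_self1)
        ultimately show ?thesis unfolding two_cycles_funpow(2)[OF a'(1,5) 2, of k] by simp
      next
        case 3
        then have "two_cycles l a x = x" by (rule permutes_not_in[OF tp])
        then show ?thesis by (induction k) auto
      qed
    qed
    then have "map_prod id (inv' (rot l) ^^ k) \<in> G" using map_prod_funpow_mem[OF G, of k] by simp
    moreover have "inv' (rot l) ^^ k \<noteq> id"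
    proof
      assume "inv' (rot l) ^^ k = id"
      then have "inv' (rot l ^^ k) = id" using bij(1) by (simp add: inv_fn)
      moreover have "(inv' (rot l ^^ k)) ((rot l ^^ k) 1) = 1" using bij_fn[OF bij(1), of k] by (simp add: bij_is_inj)
      ultimately have "(rot l ^^ k) 1 = 1" by simp
      then have "l dvd a * (l - a)" using rot_funpow[of 1 l k] l by (simp add: k_def mod_eq_0_iff_dvd)
      then have "l dvd l - a" using a'(4) by (simp add: coprime_dvd_mult_right_iff coprime_commute)
      then show False using a' by (auto dest: dvd_imp_le)
    qed
    moreover have "inv' (rot l) ^^ k permutes {1..l}" using permutes_inv[OF rp] by (rule permutes_funpow)
    ultimately show "kernel_nontrivial l G" by (blast intro: kernel_nontrivialI)
  qed (use l in auto)
  then show ?thesis by (rule realizable_cong[THEN iffD1, rotated]) simp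
qed

section \<open>Generation from double transpositions\<close>

lemma conj_double_transposition:
  assumes "bij f"
  shows "f \<circ> (transpose a b \<circ> transpose c d) \<circ> inv' f = transpose (f a) (f b) \<circ> transpose (f c) (f d)"
proof -
  have "f \<circ> (transpose a b \<circ> transpose c d) \<circ> inv' f =
      (f \<circ> transpose a b \<circ> inv' f) \<circ> (f \<circ> transpose c d \<circ> inv' f)"
    using assms by (auto simp: fun_eq_iff bij_is_inj)
  then show ?thesis using assms by (simp only: conj_transpose)
qed

context perm_group begin

lemma double_transposition_conj_mem:
  assumes "transpose a b \<circ> transpose c d \<in> H" "g \<in> H"
  shows "transpose (g a) (g b) \<circ> transpose (g c) (g d) \<in> H"
  using conj_mem[OF assms(2,1)] conj_double_transposition[OF bij_mem[OF assms(2)]] by metis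

lemma double_transpositions_tri:
  assumes "transpose a b \<circ> transpose c d \<in> H" "transpose a e \<circ> transpose f g \<in> H"
    and d: "distinct [a, b, c, d, e, f, g]"
  shows "tri H a b" "tri H a e" "tri H b e"
proof -
  have "cyc3 a b e \<in> H"
    unfolding double_transpositions_cyc3[OF d, symmetric] by (intro comp_mem[OF comp_mem comp_mem] assms)
  moreover have "distinct [a, b, e]" using d by auto
  ultimately show "tri H a b" "tri H a e" "tri H b e" using triI by blast+
qed

end

lemma alt_group_subset_rot_double_transposition:
  assumes l: "l \<ge> 9" and H: "perm_group H" "rot l \<in> H" and t: "transpose 1 3 \<circ> transpose 2 5 \<in> H"
  shows "carrier (alt_group l) \<subseteq> H"
proof -
  interpret perm_group H by fact
  \<comment> \<open>Shifting (1 3)(2 5) by 4 gives (5 7)(6 9), which meets it only in 5; the point 9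
    is used here. This relates 5 to 2 and to 7. Shifting the first relation by 2 relates 7 to 4, and
    so 4 to its neighbour 5.\<close>
  have r: "(rot l ^^ 4) 1 = 5" "(rot l ^^ 4) 3 = 7" "(rot l ^^ 4) 2 = 6" "(rot l ^^ 4) 5 = 9"
    using l by (simp_all add: numeral_eq_Suc rot_def)
  have "transpose 5 7 \<circ> transpose 6 9 \<in> H"
    using double_transposition_conj_mem[OF t funpow_mem[OF H(2), of 4]] unfolding r .
  moreover have "transpose 5 2 \<circ> transpose 1 3 \<in> H"
  proof -
    have "transpose 5 2 \<circ> transpose 1 3 = transpose (1::nat) 3 \<circ> transpose 2 5"
      by (auto simp: fun_eq_iff transpose_def)
    then show ?thesis using t by simp
  qed
  ultimately have *: "tri H 5 2" "tri H 5 7" using double_transpositions_tri[of 5 2 1 3 7 6 9] by simp_all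
  have "tri H 7 4" using tri_image[OF H(2) tri_image[OF H(2) *(1)]] l by (simp add: rot_def)
  then have "tri H 4 (Suc 4)" using tri_trans[OF *(2)] tri_sym by fastforce
  then show ?thesis using alt_group_subset_rot[OF H, of 4] l by simp
qed

text \<open>
  For these \<open>k\<close> some product of independent rotations of the two cycles conjugates
  \<open>(1 a+1)(k k+a)\<close> to a double transposition that meets it in a single point.
\<close>

definition usable_shift :: "nat \<Rightarrow> nat \<Rightarrow> bool" where
  "usable_shift a k \<longleftrightarrow> a \<ge> 3 \<and> k = 2 \<or> a \<ge> 3 \<and> a \<noteq> 4 \<and> k = 3 \<or> a = 1 \<and> (k = 3 \<or> k = 4) \<or> a = 2 \<and> k = 5"

text \<open>The cycles (1 .. a) and (a+1 .. l) are rotated by amounts for which the conjugate shares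
  just one point with the original. For a >= 3 this point is 2 or 3; for a <= 2 the first cycle
  stays put and the point is 1.\<close>

lemma alt_group_subset_two_cycles_double_transposition:
  assumes l: "l \<ge> 9" and H: "perm_group H" "two_cycles l a \<in> H" and a: "1 \<le> a" "2 * a < l" "coprime a l"
    and t: "transpose 1 (a + 1) \<circ> transpose k (k + a) \<in> H"
    and k: "usable_shift a k"
  shows "carrier (alt_group l) \<subseteq> H"
proof -
  interpret perm_group H by fact
  have al: "a < l" using a by simp
  note rotations = two_cycles_independent_rotations[OF H a(1) al a(3)]
  note finish = alt_group_subset_two_cycles[OF H a(1) al a(3)]
  from k consider "a \<ge> 3" "k = 2" | "a \<ge> 3" "a \<noteq> 4" "k = 3" | "a = 1" "k = 3" | "a = 1" "k = 4" | "a = 2" "k = 5"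
    by (auto simp: usable_shift_def)
  then show ?thesis
  proof cases
    case 1
    obtain g where g: "g \<in> H" "\<And>x. x \<in> {1..a} \<Longrightarrow> g x = (x - 1 + 1) mod a + 1"
      "\<And>x. x \<in> {a + 1..l} \<Longrightarrow> g x = (x - (a + 1) + 2) mod (l - a) + (a + 1)"
      using rotations by blast
    have "g 1 = 2" "g 2 = 3" "g (a + 1) = a + 3" "g (2 + a) = a + 4"
      using g(2)[of 1] g(2)[of 2] g(3)[of "a + 1"] g(3)[of "2 + a"] 1 a by auto
    then have "transpose 2 (a + 3) \<circ> transpose 3 (a + 4) \<in> H"
      using double_transposition_conj_mem[OF t g(1)] 1 by simp
    moreover have "transpose 2 (2 + a) \<circ> transpose 1 (a + 1) \<in> H"
    proof -
      have "transpose 2 (2 + a) \<circ> transpose 1 (a + 1) = transpose 1 (a + 1) \<circ> transpose 2 (2 + a)"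
        using 1 by (auto simp: fun_eq_iff transpose_def)
      then show ?thesis using t 1 by simp
    qed
    ultimately have "tri H 2 (2 + a)" using 1 by (intro double_transpositions_tri(1)) auto
    then show ?thesis by (rule finish[rotated 2]) (use 1 a in auto)
  next
    case 2
    obtain g where g: "g \<in> H" "\<And>x. x \<in> {1..a} \<Longrightarrow> g x = (x - 1 + 2) mod a + 1"
      "\<And>x. x \<in> {a + 1..l} \<Longrightarrow> g x = (x - (a + 1) + 1) mod (l - a) + (a + 1)"
      using rotations by blast
    \<comment> \<open>The shift by 2 takes 3 to 5, wrapping round to 2 when a = 3. For a = 4 it
      would lead back to 1, a second common point.\<close>
    define y where "y = (if a = 3 then 2 else 5 :: nat)"
    have "g 1 = 3" "g 3 = y" "g (a + 1) = a + 2" "g (3 + a) = a + 4"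
      using g(2)[of 1] g(2)[of 3] g(3)[of "a + 1"] g(3)[of "3 + a"] 2 a by (auto simp: y_def)
    then have "transpose 3 (a + 2) \<circ> transpose y (a + 4) \<in> H"
      using double_transposition_conj_mem[OF t g(1)] 2 by simp
    moreover have "transpose 3 (3 + a) \<circ> transpose 1 (a + 1) \<in> H"
    proof -
      have "transpose 3 (3 + a) \<circ> transpose 1 (a + 1) = transpose 1 (a + 1) \<circ> transpose 3 (3 + a)"
        using 2 by (auto simp: fun_eq_iff transpose_def)
      then show ?thesis using t 2 by simp
    qed
    ultimately have "tri H 3 (3 + a)" using 2 by (intro double_transpositions_tri(1)) (auto simp: y_def split: if_splits)
    then show ?thesis by (rule finish[rotated 2]) (use 2 a in auto)
  next
    case 3
    obtain g where g: "g \<in> H" "\<And>x. x \<in> {1..a} \<Longrightarrow> g x = (x - 1 + 0) mod a + 1"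
      "\<And>x. x \<in> {a + 1..l} \<Longrightarrow> g x = (x - (a + 1) + 3) mod (l - a) + (a + 1)"
      using rotations by blast
    have "g 1 = 1" "g 2 = 5" "g 3 = 6" "g 4 = 7"
      using g(2)[of 1] g(3)[of 2] g(3)[of 3] g(3)[of 4] 3 l by auto
    then have "transpose 1 5 \<circ> transpose 6 7 \<in> H"
      using double_transposition_conj_mem[OF t g(1)] 3 by (simp add: numeral_2_eq_2)
    then have "tri H 1 2" using t 3 by (intro double_transpositions_tri(1)) (auto simp: numeral_2_eq_2)
    then show ?thesis by (rule finish[rotated 2]) (use 3 l in auto)
  next
    case 4
    obtain g where g: "g \<in> H" "\<And>x. x \<in> {1..a} \<Longrightarrow> g x = (x - 1 + 0) mod a + 1"
      "\<And>x. x \<in> {a + 1..l} \<Longrightarrow> g x = (x - (a + 1) + 4) mod (l - a) + (a + 1)"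
      using rotations by blast
    \<comment> \<open>The shift by 4 moves 2, 4 and 5 off themselves and reaches the point
      9.\<close>
    have "g 1 = 1" "g 2 = 6" "g 4 = 8" "g 5 = 9"
      using g(2)[of 1] g(3)[of 2] g(3)[of 4] g(3)[of 5] 4 l by auto
    then have "transpose 1 6 \<circ> transpose 8 9 \<in> H"
      using double_transposition_conj_mem[OF t g(1)] 4 by (simp add: numeral_2_eq_2)
    then have "tri H 1 2" using t 4 by (intro double_transpositions_tri(1)) (auto simp: numeral_2_eq_2)
    then show ?thesis by (rule finish[rotated 2]) (use 4 l in auto)
  next
    case 5
    obtain g where g: "g \<in> H" "\<And>x. x \<in> {1..a} \<Longrightarrow> g x = (x - 1 + 0) mod a + 1"
      "\<And>x. x \<in> {a + 1..l} \<Longrightarrow> g x = (x - (a + 1) + 1) mod (l - a) + (a + 1)"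
      using rotations by blast
    have "g 1 = 1" "g 3 = 4" "g 5 = 6" "g 7 = 8"
      using g(2)[of 1] g(3)[of 3] g(3)[of 5] g(3)[of 7] 5 l by auto
    then have "transpose 1 4 \<circ> transpose 6 8 \<in> H"
      using double_transposition_conj_mem[OF t g(1)] 5 by simp
    then have "tri H 1 3" using t 5 by (intro double_transpositions_tri(1)) auto
    then show ?thesis by (rule finish[rotated 2]) (use 5 l in auto)
  qed
qed

lemma transpose_rot_conj:
  assumes "1 \<le> k" "k + a < l" "1 \<le> a"
  shows "transpose (Suc k) (Suc k + a) \<circ> rot l = rot l \<circ> (transpose k (k + a) \<circ> rot l) \<circ> inv' (rot l)"
proof -
  have bij: "bij (rot l)" using rot_permutes[of l] assms by (auto simp: permutes_bij)
  have "rot l \<circ> (transpose k (k + a) \<circ> rot l) \<circ> inv' (rot l) = rot l \<circ> transpose k (k + a) \<circ> inv' (rot l) \<circ> rot l"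
    using bij by (simp add: fun_eq_iff bij_is_inj bij_is_surj surj_f_inv_f)
  also have "\<dots> = transpose (rot l k) (rot l (k + a)) \<circ> rot l" using bij by (simp only: conj_transpose)
  finally show ?thesis using assms by (simp add: rot_def)
qed

text \<open>Conjugating by the rotation moves the cutting chord one step along the circle, so only
  its length a matters; for k = 1 the product is \<open>two_cycles l a\<close>.\<close>

lemma cycle_type_transpose_rot:
  assumes a: "0 < a" "2 * a < l" and k: "1 \<le> k" "k + a \<le> l"
  shows "cycle_type l (transpose k (k + a) \<circ> rot l) = parts (A\<^sub>W l a)"
  using k
proof (induction k rule: dec_induct)
  case base
  have "transpose 1 (1 + a) \<circ> rot l = two_cycles l a" using two_cycles_eq_rot(2)[of a l] a by simp
  then show ?case using cycle_type_two_cycles[OF a] by simp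
next
  case (step n)
  have rp: "rot l permutes {1..l}" using a by (intro rot_permutes) simp
  have "transpose n (n + a) permutes {1..l}" using step by (intro permutes_swap_id) auto
  then have p: "transpose n (n + a) \<circ> rot l permutes {1..l}" by (rule permutes_compose[OF rp])
  have "transpose (Suc n) (Suc n + a) \<circ> rot l = rot l \<circ> (transpose n (n + a) \<circ> rot l) \<circ> inv' (rot l)"
    using step a by (intro transpose_rot_conj) auto
  then show ?case using cycle_type_conj[OF rp p] step by (simp only:)
qed

lemma row_I1A_1:
  assumes l: "l \<ge> 9"
  shows "realizable l [Cl_Pair (L\<^sub>W l) (L\<^sub>W l), Cl_Pair (\<tau>3\<^sub>W l) (e\<^sub>W l), Cl_Swap, Cl_Swap]"
proof (rule realizable_pair_pair_swap_swap[of l "cyc3 1 2 3" "rot l"])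
  have d: "distinct [1, 2, 3 :: nat]" "{1, 2, 3} \<subseteq> {1..l}" using l by auto
  show t: "cyc3 1 2 3 permutes {1..l}" using cyc3_in_alt_group[OF d] by (simp add: alt_group_carrier)
  show "cyc3 1 2 3 \<noteq> (id :: nat \<Rightarrow> nat)" using cyc3_apply(1)[OF d(1)] by (metis id_apply numeral_One numeral_eq_iff num.distinct(1))
  show r: "rot l permutes {1..l}" using l by (intro rot_permutes) simp
  show "pair_symbol l (cyc3 1 2 3) id (Cl_Pair (\<tau>3\<^sub>W l) (e\<^sub>W l))"
    using cycle_type_cyc3[OF d(2,1)] cycle_type_id by simp
  let ?f = "cyc3 1 2 3 \<circ> rot l"
  have f: "?f l = 2" "?f 2 = 1" "?f 1 = 3" "\<And>i. 3 \<le> i \<Longrightarrow> i < l \<Longrightarrow> ?f i = Suc i"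
    using l by (auto simp: rot_def cyc3_def transpose_def)
  have "cycle_type l ?f = parts (L\<^sub>W l)"
  proof (rule cycle_type_L)
    show "?f permutes {1..l}" by (rule permutes_compose[OF r t])
    have 2: "2 \<in> Orbits.orbit ?f l" using orbit.base[of ?f l] unfolding f .
    have 1: "1 \<in> Orbits.orbit ?f l" using orbit.step[OF 2] unfolding f .
    have "3 \<in> Orbits.orbit ?f l" using orbit.step[OF 1] unfolding f .
    then have "{3..l} \<subseteq> Orbits.orbit ?f l" by (rule orbit_segment) (use f(4) in simp)
    moreover have "{1..l} \<subseteq> {1, 2} \<union> {3..l}" by auto
    ultimately show "{1..l} \<subseteq> Orbits.orbit ?f l" using 1 2 by blast
  qed (use l in simp)
  then show "pair_symbol l (rot l) ?f (Cl_Pair (L\<^sub>W l) (L\<^sub>W l))" using cycle_type_rot[of l] l by simp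
  show "carrier (alt_group l) \<subseteq> H" if H: "perm_group H" "cyc3 1 2 3 \<in> H" "rot l \<in> H" for H
  proof -
    have "tri H 1 (Suc 1)" using perm_group.triI(1)[OF H(1) d(1) H(2)] by (simp add: numeral_2_eq_2)
    then show ?thesis using alt_group_subset_rot[OF H(1,3), of 1] l by simp
  qed
qed (use l in simp)

lemma double_transposition_permutes:
  "{a, b, c, d} \<subseteq> S \<Longrightarrow> transpose a b \<circ> transpose c d permutes S"
  by (rule permutes_compose; rule permutes_swap_id) auto

lemma double_transposition_neq_id:
  assumes "distinct [a, b, c, d]" shows "transpose a b \<circ> transpose c d \<noteq> id"
proof
  assume "transpose a b \<circ> transpose c d = id"
  then have "(transpose a b \<circ> transpose c d) a = a" by simp
  then show False using assms by (simp add: transpose_def)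
qed

text \<open>The chords 1-3 and 2-5 of the circle cross, so one transposition cuts the l-cycle and
  the other joins the pieces again. The relations this element produces have lengths 3 and 2 on the
  circle, which combine to relate neighbours.\<close>

lemma row_I1A_3:
  assumes l: "l \<ge> 9"
  shows "realizable l [Cl_Pair (L\<^sub>W l) (L\<^sub>W l), Cl_Pair (\<tau>2\<^sub>W l) (e\<^sub>W l), Cl_Swap, Cl_Swap]"
proof (rule realizable_pair_pair_swap_swap[of l "transpose 1 3 \<circ> transpose 2 5" "rot l"])
  let ?t = "transpose (1 :: nat) 3 \<circ> transpose 2 5"
  have d: "distinct [1, 3, 2, 5 :: nat]" "{1, 3, 2, 5} \<subseteq> {1..l}" using l by auto
  show t: "?t permutes {1..l}" using d(2) by (rule double_transposition_permutes)
  show "?t \<noteq> id" using d(1) by (rule double_transposition_neq_id)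
  show r: "rot l permutes {1..l}" using l by (intro rot_permutes) simp
  show "pair_symbol l ?t id (Cl_Pair (\<tau>2\<^sub>W l) (e\<^sub>W l))"
    using cycle_type_double_transpose[OF d(2,1)] cycle_type_id by simp
  let ?f = "?t \<circ> rot l"
  have f: "?f l = 3" "?f 3 = 4" "?f 4 = 2" "?f 2 = 1" "?f 1 = 5" "\<And>i. 5 \<le> i \<Longrightarrow> i < l \<Longrightarrow> ?f i = Suc i"
    using l by (auto simp: rot_def transpose_def)
  have "cycle_type l ?f = parts (L\<^sub>W l)"
  proof (rule cycle_type_L)
    show "?f permutes {1..l}" by (rule permutes_compose[OF r t])
    have 3: "3 \<in> Orbits.orbit ?f l" using orbit.base[of ?f l] unfolding f .
    have 4: "4 \<in> Orbits.orbit ?f l" using orbit.step[OF 3] unfolding f .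
    have 2: "2 \<in> Orbits.orbit ?f l" using orbit.step[OF 4] unfolding f .
    have 1: "1 \<in> Orbits.orbit ?f l" using orbit.step[OF 2] unfolding f .
    have "5 \<in> Orbits.orbit ?f l" using orbit.step[OF 1] unfolding f .
    then have "{5..l} \<subseteq> Orbits.orbit ?f l" by (rule orbit_segment) (use f(6) in simp)
    moreover have "{1..l} \<subseteq> {1, 2, 3, 4} \<union> {5..l}" by auto
    ultimately show "{1..l} \<subseteq> Orbits.orbit ?f l" using 1 2 3 4 by blast
  qed (use l in simp)
  then show "pair_symbol l (rot l) ?f (Cl_Pair (L\<^sub>W l) (L\<^sub>W l))" using cycle_type_rot[of l] l by simp
  show "carrier (alt_group l) \<subseteq> H" if H: "perm_group H" "?t \<in> H" "rot l \<in> H" for H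
    using alt_group_subset_rot_double_transposition[OF l H(1,3,2)] .
qed (use l in simp)

text \<open>The factor (1 a+1) of t joins the two cycles back into the rotation, and (k k+a) cuts it
  elsewhere at the same distance, so the product again has cycles of lengths a and l - a. For k = a
  + 1 the two transpositions overlap in a 3-cycle; otherwise they are disjoint.\<close>

lemma row_I1A_4_6:
  assumes l: "l \<ge> 9" and a: "parameter_W l a" and k: "1 < k" "k + a \<le> l"
    and t: "t = transpose k (k + a) \<circ> transpose 1 (a + 1)" "t \<noteq> id" "cycle_type l t = parts T"
    and gen: "\<And>H. \<lbrakk>perm_group H; t \<in> H; two_cycles l a \<in> H\<rbrakk> \<Longrightarrow> carrier (alt_group l) \<subseteq> H"
  shows "realizable l [Cl_Pair (A\<^sub>W l a) (A\<^sub>W l a), Cl_Pair T (e\<^sub>W l), Cl_Swap, Cl_Swap]"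
proof (rule realizable_pair_pair_swap_swap[OF _ _ t(2)])
  have a': "1 \<le> a" "0 < a" "2 * a < l" "coprime a l" "a < l" using a by (auto simp: parameter_W_def)
  show "t permutes {1..l}" unfolding t(1) using k a' by (intro double_transposition_permutes) auto
  show "two_cycles l a permutes {1..l}" using two_cycles_permutes[OF a'(1,5)] .
  show "pair_symbol l t id (Cl_Pair T (e\<^sub>W l))" using t(3) cycle_type_id by simp
  have "t \<circ> two_cycles l a = transpose k (k + a) \<circ> rot l"
    unfolding t(1) two_cycles_eq_rot(2)[OF a'(1,5)] by (simp add: fun_eq_iff)
  then show "pair_symbol l (two_cycles l a) (t \<circ> two_cycles l a) (Cl_Pair (A\<^sub>W l a) (A\<^sub>W l a))"
    using cycle_type_two_cycles[OF a'(2,3)] cycle_type_transpose_rot[OF a'(2,3)] k by simp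
qed (use l gen in auto)

lemma row_I1A_4:
  assumes l: "l \<ge> 9" and a: "parameter_W l a"
  shows "realizable l [Cl_Pair (A\<^sub>W l a) (A\<^sub>W l a), Cl_Pair (\<tau>3\<^sub>W l) (e\<^sub>W l), Cl_Swap, Cl_Swap]"
proof (rule row_I1A_4_6[OF l a])
  have a': "1 \<le> a" "0 < a" "2 * a < l" "coprime a l" "a < l" using a by (auto simp: parameter_W_def)
  let ?t = "cyc3 (a + 1 + a) (a + 1) 1"
  have d: "distinct [a + 1 + a, a + 1, 1]" "{a + 1 + a, a + 1, 1} \<subseteq> {1..l}" using a' by auto
  show "?t = transpose (a + 1) (a + 1 + a) \<circ> transpose 1 (a + 1)" by (simp add: cyc3_def transpose_commute)
  show "cycle_type l ?t = parts (\<tau>3\<^sub>W l)" by (rule cycle_type_cyc3[OF d(2,1)])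
  show "?t \<noteq> id" using cyc3_apply(2)[OF d(1)] a' by (metis id_apply d(1) distinct_length_2_or_more)
  show "carrier (alt_group l) \<subseteq> H" if H: "perm_group H" "?t \<in> H" "two_cycles l a \<in> H" for H
  proof -
    have "tri H 1 (a + 1)"
      using perm_group.triI(2)[OF H(1) d(1) H(2)] perm_group.tri_sym[OF H(1)] by blast
    then show ?thesis using alt_group_subset_two_cycles[OF H(1,3) a'(1,5,4), of 1 "a + 1"] a' by simp
  qed
qed (use a in \<open>auto simp: parameter_W_def\<close>)

lemma row_I1A_6:
  assumes l: "l \<ge> 9" and a: "parameter_W l a"
  shows "realizable l [Cl_Pair (A\<^sub>W l a) (A\<^sub>W l a), Cl_Pair (\<tau>2\<^sub>W l) (e\<^sub>W l), Cl_Swap, Cl_Swap]"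
proof -
  have a': "1 \<le> a" "0 < a" "2 * a < l" "coprime a l" "a < l" using a by (auto simp: parameter_W_def)
  \<comment> \<open>k = 2 would collide with a + 1 for a = 1, and so would k = 3 for a = 2. The
    values taken instead satisfy \<open>usable_shift\<close>.\<close>
  define k where "k = (if a \<ge> 3 then 2 else if a = 1 then 3 else 5 :: nat)"
  have k: "1 < k" "k + a \<le> l" and kc: "usable_shift a k"
    using a' l by (auto simp: k_def usable_shift_def)
  have d: "distinct [k, k + a, 1, a + 1]" "{k, k + a, 1, a + 1} \<subseteq> {1..l}" using a' k by (auto simp: k_def)
  let ?t = "transpose k (k + a) \<circ> transpose 1 (a + 1)"
  have comm: "transpose 1 (a + 1) \<circ> transpose k (k + a) = ?t" using d(1) by (auto simp: fun_eq_iff transpose_def)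
  show ?thesis
  proof (rule row_I1A_4_6[OF l a k refl])
    show "?t \<noteq> id" using d(1) by (rule double_transposition_neq_id)
    show "cycle_type l ?t = parts (\<tau>2\<^sub>W l)" by (rule cycle_type_double_transpose[OF d(2,1)])
    show "carrier (alt_group l) \<subseteq> H" if H: "perm_group H" "?t \<in> H" "two_cycles l a \<in> H" for H
      using alt_group_subset_two_cycles_double_transposition[OF l H(1,3) a'(1,3,4), of k] H(2) comm kc by simp
  qed
qed

section \<open>Rows built mainly from swaps\<close>

lemma row_F4_1:
  assumes l: "l \<ge> 9"
  shows "realizable l [Cl_Swap, Cl_Swap, Cl_Twisted (\<tau>\<^sub>W l), Cl_Twisted (\<tau>\<^sub>W l)]"
proof (rule realizable_swap_swap_twisted_twisted)
  show r: "rot l permutes {1..l}" using l by (intro rot_permutes) simp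
  have bij: "bij (inv' (rot l))" using r by (intro bij_imp_bij_inv permutes_bij)
  have inv: "inv' (rot l) 1 = l" "inv' (rot l) 2 = 1" using inv_rot(1)[of l] inv_rot(2)[of l 1] l by (auto simp: numeral_2_eq_2)
  have conj: "inv' (rot l) \<circ> transpose 1 2 \<circ> rot l = transpose l 1"
    using conj_transpose[OF bij, of 1 2] inv r by (simp add: inv_inv_eq permutes_bij)
  show "twisted_symbol l (transpose 1 2) (Cl_Twisted (\<tau>\<^sub>W l))"
    using l by (simp add: cycle_type_transpose)
  show "twisted_symbol l (inv' (rot l) \<circ> transpose 1 2 \<circ> rot l) (Cl_Twisted (\<tau>\<^sub>W l))"
    unfolding conj using l by (simp add: cycle_type_transpose)
  show "inv' (rot l) \<circ> transpose 1 2 \<circ> rot l \<noteq> transpose 1 2"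
  proof
    assume "inv' (rot l) \<circ> transpose 1 2 \<circ> rot l = transpose 1 2"
    then have "transpose l 1 2 = transpose 1 2 2" unfolding conj by simp
    then show False using l by (simp add: transpose_def)
  qed
  show "transpose 1 2 permutes {1..l}" using l by (intro permutes_swap_id) simp_all
  show "carrier (alt_group l) \<subseteq> H" if "perm_group H" "rot l \<in> H" "transpose 1 2 \<in> H" for H
    using alt_group_subset_rot_transpose[OF that(1,2), of 1] that(3) l by (simp add: numeral_2_eq_2)
qed (use l in auto)

text \<open>The transposition (1 2) and its translate (l 1) overlap in 1, so the commutator of (1 2)
  with the rotation is a 3-cycle.\<close>

lemma row_F4_5:
  assumes l: "l \<ge> 9"
  shows "realizable l [Cl_Swap, Cl_Swap, Cl_Swap, Cl_Swap, Cl_Pair (\<tau>3\<^sub>W l) (e\<^sub>W l)]"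
proof (rule realizable_commutator)
  show r: "rot l permutes {1..l}" using l by (intro rot_permutes) simp
  show "transpose 1 2 permutes {1..l}" using l by (intro permutes_swap_id) simp_all
  have bij: "bij (inv' (rot l))" using r by (intro bij_imp_bij_inv permutes_bij)
  have inv: "inv' (rot l) 1 = l" "inv' (rot l) 2 = 1" using inv_rot(1)[of l] inv_rot(2)[of l 1] l by (auto simp: numeral_2_eq_2)
  have conj: "inv' (rot l) \<circ> transpose 1 2 \<circ> rot l = transpose l 1"
    using conj_transpose[OF bij, of 1 2] inv r by (simp add: inv_inv_eq permutes_bij)
  have d: "distinct [2, 1, l]" "{2, 1, l} \<subseteq> {1..l}" using l by auto
  have c: "cyc3 2 1 l = transpose 1 2 \<circ> transpose l 1" by (simp add: cyc3_def transpose_commute)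
  have "transpose 1 2 \<circ> inv' (rot l) \<circ> inv' (transpose 1 2) \<circ> rot l =
      transpose 1 2 \<circ> (inv' (rot l) \<circ> transpose 1 2 \<circ> rot l)" by (simp add: comp_assoc inv_transpose_eq)
  then show "cyc3 2 1 l = transpose 1 2 \<circ> inv' (rot l) \<circ> inv' (transpose 1 2) \<circ> rot l"
    using c by (simp only: conj)
  show "pair_symbol l (cyc3 2 1 l) id (Cl_Pair (\<tau>3\<^sub>W l) (e\<^sub>W l))"
    using cycle_type_cyc3[OF d(2,1)] cycle_type_id by simp
  show "cyc3 2 1 l \<noteq> id" using cyc3_apply(1)[OF d(1)] by (metis id_apply d(1) distinct_length_2_or_more)
  show "carrier (alt_group l) \<subseteq> H" if "perm_group H" "rot l \<in> H" "transpose 1 2 \<in> H" for H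
    using alt_group_subset_rot_transpose[OF that(1,2), of 1] that(3) l by (simp add: numeral_2_eq_2)
qed (use l in auto)

text \<open>(1 3)(2 5) times the rotation is again an l-cycle, running through 3, 4, 2, 1, 5, ...,
  l. The permutation v sends 1, 2, 3, ... to this sequence, hence conjugates the rotation into that
  cycle. Up to conjugation by the rotation, (1 3)(2 5) is thereby a commutator.\<close>

lemma row_F4_4:
  assumes l: "l \<ge> 9"
  shows "realizable l [Cl_Swap, Cl_Swap, Cl_Swap, Cl_Swap, Cl_Pair (\<tau>2\<^sub>W l) (e\<^sub>W l)]"
proof -
  let ?v = "cycle_of_list [1, 3, 2, 4 :: nat]" and ?t = "transpose l 2 \<circ> transpose 1 4"
  have v: "?v 1 = 3" "?v 3 = 2" "?v 2 = 4" "?v 4 = 1" "\<And>x. x \<notin> {1, 2, 3, 4} \<Longrightarrow> ?v x = x"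
    by (simp_all add: transpose_def)
  have vp: "?v permutes {1..l}" by (rule permutes_subset[OF cycle_permutes]) (use l in auto)
  have r: "rot l permutes {1..l}" using l by (intro rot_permutes) simp
  have bij: "bij (rot l)" "bij ?v" using r vp by (auto simp: permutes_bij)
  have vr: "?v \<circ> rot l = (transpose 1 3 \<circ> transpose 2 5) \<circ> rot l \<circ> ?v"
  proof
    fix x
    consider "x = 1" | "x = 2" | "x = 3" | "x = 4" | "x = l" | "5 \<le> x \<and> x < l" | "x = 0 \<or> l < x" by linarith
    then show "(?v \<circ> rot l) x = ((transpose 1 3 \<circ> transpose 2 5) \<circ> rot l \<circ> ?v) x"
      by cases (use l in \<open>auto simp: rot_def transpose_def\<close>)
  qed
  have "?v \<circ> inv' (rot l) \<circ> inv' ?v = inv' (rot l) \<circ> (transpose 1 3 \<circ> transpose 2 5)"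
  proof -
    have "?v \<circ> rot l \<circ> inv' ?v = (transpose 1 3 \<circ> transpose 2 5) \<circ> rot l"
      by (rule conj_eqI[OF bij(2) vr])
    then have "inv' (?v \<circ> rot l \<circ> inv' ?v) = inv' ((transpose 1 3 \<circ> transpose 2 5) \<circ> rot l)" by simp
    moreover have "inv' (transpose 1 3 \<circ> transpose 2 (5::nat)) = transpose 1 3 \<circ> transpose 2 5"
      by (simp add: o_inv_distrib) (auto simp: fun_eq_iff transpose_def)
    ultimately show ?thesis using bij
      by (simp add: o_inv_distrib bij_comp bij_imp_bij_inv inv_inv_eq comp_assoc)
  qed
  then have t: "?v \<circ> inv' (rot l) \<circ> inv' ?v \<circ> rot l = inv' (rot l) \<circ> (transpose 1 3 \<circ> transpose 2 5) \<circ> rot l" by simp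
  also have "\<dots> = ?t"
  proof -
    have "inv' (rot l) 1 = l" "inv' (rot l) 2 = 1" "inv' (rot l) 3 = 2" "inv' (rot l) 5 = 4"
      using inv_rot(1)[of l] inv_rot(2)[of l 1] inv_rot(2)[of l 2] inv_rot(2)[of l 4] l by (auto simp: eval_nat_numeral)
    then show ?thesis
      using conj_double_transposition[OF bij_imp_bij_inv[OF bij(1)], of 1 3 2 5] bij by (simp add: inv_inv_eq)
  qed
  finally have t_eq: "?t = ?v \<circ> inv' (rot l) \<circ> inv' ?v \<circ> rot l" by simp
  have d: "distinct [l, 2, 1, 4]" "{l, 2, 1, 4} \<subseteq> {1..l}" using l by auto
  show ?thesis
  proof (rule realizable_commutator[OF _ r vp t_eq])
    show "?t \<noteq> id" using d(1) by (rule double_transposition_neq_id)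
    show "pair_symbol l ?t id (Cl_Pair (\<tau>2\<^sub>W l) (e\<^sub>W l))"
      using cycle_type_double_transpose[OF d(2,1)] cycle_type_id by simp
    show "carrier (alt_group l) \<subseteq> H" if H: "perm_group H" "rot l \<in> H" "?v \<in> H" for H
    proof -
      interpret perm_group H by fact
      have "?t \<in> H" unfolding t_eq by (intro comp_mem inv_mem H)
      moreover have "rot l l = 1" "rot l 2 = 3" "rot l 1 = 2" "rot l 4 = 5" using l by (auto simp: rot_def)
      ultimately have "transpose 1 3 \<circ> transpose 2 5 \<in> H"
        using double_transposition_conj_mem[OF _ H(2), of l 2 1 4] by (simp only:)
      then show ?thesis by (rule alt_group_subset_rot_double_transposition[OF l H(1,2)])
    qed
  qed (use l in simp)
qed

section \<open>Trivial words with involutions\<close>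

lemma realizable_spider:
  assumes l: "l \<ge> 8" and p: "p permutes {1..l}" and q: "q permutes {1..l}" "q \<circ> q = id" and u: "u permutes {1..l}"
    and puq: "p \<circ> u \<circ> q = id" and pp: "p \<circ> p \<noteq> id"
    and c: "pair_symbol l p q C" "twisted_symbol l u C'"
    and gen: "\<And>H. \<lbrakk>perm_group H; p \<in> H; q \<in> H; u \<in> H\<rbrakk> \<Longrightarrow> carrier (alt_group l) \<subseteq> H"
  shows "realizable l [C', Cl_Swap, C]"
proof -
  have "realizable l [C, C', Cl_Swap]"
  proof (rule realizable_pair_twisted_twisted[OF l p q(1) u c])
    show "twisted_symbol l (p \<circ> u \<circ> q) Cl_Swap" using puq by simp
    fix G assume G: "perm_group G" "map_prod p q \<in> G"
    \<comment> \<open>Since q is an involution, squaring the pair clears the second coordinate and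
      only the long cycle of p can survive in the first.\<close>
    have "map_prod (p \<circ> p) id \<in> G" using map_prod_comp_mem[OF G(1,2,2)] q(2) by simp
    then show "kernel_nontrivial l G" using kernel_nontrivialI[OF permutes_compose[OF p p] pp] by blast
  qed (use gen in blast)
  then show ?thesis by (rule realizable_cong[THEN iffD1, rotated]) simp
qed

lemma involution_kernel_nontrivial:
  assumes "perm_group G" "map_prod p q \<in> G" "p permutes {1..l}" "q \<circ> q = id" "p \<circ> p \<noteq> id"
  shows "kernel_nontrivial l G"
proof -
  have "map_prod (p \<circ> p) id \<in> G" using map_prod_comp_mem[OF assms(1,2,2)] assms(4) by simp
  then show ?thesis using kernel_nontrivialI[OF permutes_compose[OF assms(3,3)] assms(5)] by blast
qed

text \<open>A word p y1 y2 q = 1 distributes its factors over two pairs. Read directly, it pairs p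
  with y2 and y1 with q. To pair p with q instead, y2 q is rewritten as (y2 q y2^-1) y2, which
  replaces q by a conjugate.\<close>

lemma realizable_four_involutions:
  assumes l: "l \<ge> 8" and p: "p permutes {1..l}" and q: "q permutes {1..l}" "q \<circ> q = id"
    and y: "y1 permutes {1..l}" "y2 permutes {1..l}" "y2 \<circ> y2 = id"
    and word: "p \<circ> (y1 \<circ> y2) \<circ> q = id" and pp: "p \<circ> p \<noteq> id"
    and gen: "\<And>H. \<lbrakk>perm_group H; p \<in> H; q \<in> H; y1 \<circ> y2 \<in> H\<rbrakk> \<Longrightarrow> carrier (alt_group l) \<subseteq> H"
  shows "\<lbrakk>pair_symbol l p y2 C1; pair_symbol l y1 q C2\<rbrakk> \<Longrightarrow> realizable l [C1, C2, Cl_Swap, Cl_Swap]"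
    and "\<lbrakk>pair_symbol l p q C1; pair_symbol l y1 y2 C2\<rbrakk> \<Longrightarrow> realizable l [C1, C2, Cl_Swap, Cl_Swap]"
proof -
  assume c: "pair_symbol l p y2 C1" "pair_symbol l y1 q C2"
  show "realizable l [C1, C2, Cl_Swap, Cl_Swap]"
  proof (rule realizable_pair_pair_swap_twisted[OF l p y(2) y(1) q(1) c])
    show "twisted_symbol l (p \<circ> y1 \<circ> (y2 \<circ> q)) Cl_Swap" using word by (simp add: comp_assoc)
    show "kernel_nontrivial l G" if "perm_group G" "map_prod p y2 \<in> G" for G
      using involution_kernel_nontrivial[OF that p y(3) pp] .
    show "carrier (alt_group l) \<subseteq> H" if H: "perm_group H" "p \<in> H" "y2 \<in> H" "y1 \<in> H" "q \<in> H" for H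
      using gen[OF H(1,2,5)] perm_group.comp_mem[OF H(1,4,3)] by simp
  qed
next
  assume c: "pair_symbol l p q C1" "pair_symbol l y1 y2 C2"
  have inv: "inv' y2 = y2" using y(3) by (intro inv_unique_comp)
  let ?q = "y2 \<circ> q \<circ> inv' y2"
  have q': "?q permutes {1..l}" by (rule permutes_compose[OF permutes_inv[OF y(2)] permutes_compose[OF q(1) y(2)]])
  have "?q \<circ> ?q = y2 \<circ> q \<circ> (y2 \<circ> y2) \<circ> q \<circ> y2" by (simp only: inv comp_assoc)
  also have "\<dots> = y2 \<circ> (q \<circ> q) \<circ> y2" by (simp only: y(3) comp_assoc id_comp)
  finally have q'_inv: "?q \<circ> ?q = id" using q(2) y(3) by simp
  show "realizable l [C1, C2, Cl_Swap, Cl_Swap]"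
  proof (rule realizable_pair_pair_swap_twisted[OF l p q' y(1) y(2) _ c(2)])
    show "pair_symbol l p ?q C1" using c(1) cycle_type_conj[OF y(2) q(1)] by (cases C1) auto
    have "?q \<circ> y2 = y2 \<circ> q" using y(3) by (simp only: inv comp_assoc comp_id)
    then show "twisted_symbol l (p \<circ> y1 \<circ> (?q \<circ> y2)) Cl_Swap" using word by (simp add: comp_assoc)
    show "kernel_nontrivial l G" if "perm_group G" "map_prod p ?q \<in> G" for G
      using involution_kernel_nontrivial[OF that p q'_inv pp] .
    show "carrier (alt_group l) \<subseteq> H" if H: "perm_group H" "p \<in> H" "?q \<in> H" "y1 \<in> H" "y2 \<in> H" for H
    proof -
      have "y2 \<circ> ?q \<circ> y2 \<in> H" using H by (intro perm_group.comp_mem[OF H(1)] H)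
      moreover have "y2 \<circ> ?q \<circ> y2 = (y2 \<circ> y2) \<circ> q \<circ> (y2 \<circ> y2)" by (simp only: inv comp_assoc)
      ultimately have "q \<in> H" using y(3) by simp
      then show ?thesis using gen[OF H(1,2)] perm_group.comp_mem[OF H(1,4,5)] by simp
    qed
  qed
qed

lemma rot_out: "rot (Suc k) 0 = 0" "l < x \<Longrightarrow> rot l x = x" "0 < l \<Longrightarrow> rot l 0 = 0"
  by (simp_all add: rot_def)

lemma flip_flip: "flip l m (flip l m x) = x"
  by (auto simp: flip_def)

lemma rot_eq_flips: "l \<ge> 1 \<Longrightarrow> rot l = flip l 2 \<circ> flip l 1"
  by (auto simp: fun_eq_iff rot_def flip_def)

text \<open>
  Each pair below satisfies \<open>p \<circ> rot l \<circ> q = id\<close> with \<open>q\<close> an involution. Beyond a few points both are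
  reflections, as in the factorisation of a rotation into two reflections. The digits are the lengths
  of the short arcs into which the long cycle of \<open>p\<close> cuts the circle, with \<open>p\<close> moving each of its points to the
  previous one.
\<close>

definition tripod12 :: "nat \<Rightarrow> nat \<Rightarrow> nat" where
  "tripod12 l x = (if x = 1 then 4 else if x = 4 then 2 else if x = 2 then 1 else flip l 5 x)"

definition tripod12' :: "nat \<Rightarrow> nat \<Rightarrow> nat" where
  "tripod12' l x = (if x = 2 then 3 else if x = 3 then 2 else flip l 4 x)"

definition tripod11 :: "nat \<Rightarrow> nat \<Rightarrow> nat" where
  "tripod11 l x = (if x = 1 then 3 else if x = 3 then 2 else if x = 2 then 1 else flip l 4 x)"

definition quadpod112 :: "nat \<Rightarrow> nat \<Rightarrow> nat" where
  "quadpod112 l x = (if x = 1 then 5 else if x = 5 then 3 else if x = 3 then 2 else if x = 2 then 1 else flip l 6 x)"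

definition quadpod112' :: "nat \<Rightarrow> nat \<Rightarrow> nat" where
  "quadpod112' l x = (if x = 3 then 4 else if x = 4 then 3 else flip l 5 x)"

definition quadpod122 :: "nat \<Rightarrow> nat \<Rightarrow> nat" where
  "quadpod122 l x = (if x = 1 then 6 else if x = 6 then 4 else if x = 4 then 2 else if x = 2 then 1 else flip l 7 x)"

definition quadpod122' :: "nat \<Rightarrow> nat \<Rightarrow> nat" where
  "quadpod122' l x = (if x = 2 then 3 else if x = 3 then 2 else if x = 4 then 5 else if x = 5 then 4 else flip l 6 x)"

section \<open>Explicit factorisations of the rotation and the squares of their factors\<close>

context
  fixes l :: nat assumes l: "l \<ge> 9"
begin

lemma tripod12_simps:
  "tripod12 l 1 = 4" "tripod12 l 2 = 1" "tripod12 l 3 = 3" "tripod12 l 4 = 2"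
  "\<lbrakk>5 \<le> x; x \<le> l\<rbrakk> \<Longrightarrow> tripod12 l x = l + 5 - x" "x = 0 \<Longrightarrow> tripod12 l x = x" "l < x \<Longrightarrow> tripod12 l x = x"
  using l by (simp_all add: tripod12_def flip_def)

lemma tripod12_permutes: "tripod12 l permutes {1..l}"
proof (rule permutes_by_inverse)
  define g where "g x = (if x = 1 then 2 else if x = 2 then 4 else if x = 4 then 1 else flip l 5 x)" for x
  have g: "g 1 = 2" "g 2 = 4" "g 3 = 3" "g 4 = 1" "\<And>x. \<lbrakk>5 \<le> x; x \<le> l\<rbrakk> \<Longrightarrow> g x = l + 5 - x"
    using l by (simp_all add: g_def flip_def)
  fix x :: nat
  show "x \<notin> {1..l} \<Longrightarrow> tripod12 l x = x" by (cases "x = 0") (simp_all add: tripod12_simps)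
  have *: "x \<in> {1..l} \<Longrightarrow> tripod12 l x \<in> {1..l} \<and> g (tripod12 l x) = x"
  proof -
    assume "x \<in> {1..l}"
    then consider "x = 1" | "x = 2" | "x = 3" | "x = 4" | "5 \<le> x" "x \<le> l" by fastforce
    then show ?thesis by cases (use l in \<open>auto simp del: One_nat_def simp: tripod12_simps g\<close>)
  qed
  then show "x \<in> {1..l} \<Longrightarrow> tripod12 l x \<in> {1..l}" "x \<in> {1..l} \<Longrightarrow> g (tripod12 l x) = x" by blast+
qed simp

lemma tripod12'_simps:
  "tripod12' l 1 = 1" "tripod12' l 2 = 3" "tripod12' l 3 = 2"
  "\<lbrakk>4 \<le> x; x \<le> l\<rbrakk> \<Longrightarrow> tripod12' l x = l + 4 - x" "x = 0 \<Longrightarrow> tripod12' l x = x" "l < x \<Longrightarrow> tripod12' l x = x"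
  using l by (simp_all add: tripod12'_def flip_def)

lemma tripod12'_involution: "tripod12' l \<circ> tripod12' l = id"
proof
  fix x
  consider "x = 0" | "l < x" | "x = 1" | "x = 2" | "x = 3" | "x = 4" | "4 < x" "x \<le> l" by linarith
  then show "(tripod12' l \<circ> tripod12' l) x = id x"
    by cases (use l in \<open>auto simp del: One_nat_def simp: tripod12'_simps\<close>)
qed

lemma tripod12'_permutes: "tripod12' l permutes {1..l}"
proof (rule permutes_by_inverse)
  fix x :: nat
  show "x \<notin> {1..l} \<Longrightarrow> tripod12' l x = x" by (cases "x = 0") (simp_all add: tripod12'_simps)
  show "tripod12' l (tripod12' l x) = x" using fun_cong[OF tripod12'_involution, of x] by simp
  show "tripod12' l x \<in> {1..l}" if xS: "x \<in> {1..l}"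
  proof -
    consider "x = 1" | "x = 2" | "x = 3" | "4 \<le> x" "x \<le> l" using xS by fastforce
    then show ?thesis by cases (use l in \<open>auto simp del: One_nat_def simp: tripod12'_simps\<close>)
  qed
qed simp

lemma tripod12_word: "tripod12 l \<circ> rot l \<circ> tripod12' l = id"
proof
  fix x
  \<comment> \<open>x = 4 is separate because \<open>tripod12' l\<close> sends it to l, where the
    rotation wraps round to 1.\<close>
  consider "x = 0" | "l < x" | "x = 1" | "x = 2" | "x = 3" | "x = 4" | "4 < x" "x \<le> l" by linarith
  then show "(tripod12 l \<circ> rot l \<circ> tripod12' l) x = (id) x"
    by cases (use l in \<open>auto simp del: One_nat_def simp: tripod12_simps tripod12'_simps rot_simps rot_out\<close>)
qed

text \<open>Away from the 3-cycle 1 -> 4 -> 2 -> 1 the permutation is an involution, so its square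
  is the inverse 3-cycle. This serves both as the kernel element and as the 3-cycle that is spread
  over all points.\<close>

lemma tripod12_square: "tripod12 l \<circ> tripod12 l = cyc3 1 2 4"
proof
  fix x
  consider "x = 0" | "l < x" | "x = 1" | "x = 2" | "x = 3" | "x = 4" | "x = 5" | "5 < x" "x \<le> l" by linarith
  then show "(tripod12 l \<circ> tripod12 l) x = (cyc3 1 2 4) x"
    by cases (use l in \<open>auto simp del: One_nat_def simp: tripod12_simps cyc3_def transpose_def\<close>)
qed

lemma tripod11_simps:
  "tripod11 l 1 = 3" "tripod11 l 2 = 1" "tripod11 l 3 = 2"
  "\<lbrakk>4 \<le> x; x \<le> l\<rbrakk> \<Longrightarrow> tripod11 l x = l + 4 - x" "x = 0 \<Longrightarrow> tripod11 l x = x" "l < x \<Longrightarrow> tripod11 l x = x"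
  using l by (simp_all add: tripod11_def flip_def)

lemma tripod11_permutes: "tripod11 l permutes {1..l}"
proof (rule permutes_by_inverse)
  define g where "g x = (if x = 1 then 2 else if x = 2 then 3 else if x = 3 then 1 else flip l 4 x)" for x
  have g: "g 1 = 2" "g 2 = 3" "g 3 = 1" "\<And>x. \<lbrakk>4 \<le> x; x \<le> l\<rbrakk> \<Longrightarrow> g x = l + 4 - x"
    using l by (simp_all add: g_def flip_def)
  fix x :: nat
  show "x \<notin> {1..l} \<Longrightarrow> tripod11 l x = x" by (cases "x = 0") (simp_all add: tripod11_simps)
  have *: "x \<in> {1..l} \<Longrightarrow> tripod11 l x \<in> {1..l} \<and> g (tripod11 l x) = x"
  proof -
    assume "x \<in> {1..l}"
    then consider "x = 1" | "x = 2" | "x = 3" | "4 \<le> x" "x \<le> l" by fastforce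
    then show ?thesis by cases (use l in \<open>auto simp del: One_nat_def simp: tripod11_simps g\<close>)
  qed
  then show "x \<in> {1..l} \<Longrightarrow> tripod11 l x \<in> {1..l}" "x \<in> {1..l} \<Longrightarrow> g (tripod11 l x) = x" by blast+
qed simp

lemma tripod11_word: "tripod11 l \<circ> rot l \<circ> flip l 3 = id"
proof
  fix x
  consider "x = 0" | "l < x" | "x = 1" | "x = 2" | "x = 3" | "3 < x" "x \<le> l" by linarith
  then show "(tripod11 l \<circ> rot l \<circ> flip l 3) x = (id) x"
    by cases (use l in \<open>auto simp del: One_nat_def simp: tripod11_simps flip_def rot_simps rot_out\<close>)
qed

lemma tripod11_square: "tripod11 l \<circ> tripod11 l = cyc3 1 2 3"
proof
  fix x
  consider "x = 0" | "l < x" | "x = 1" | "x = 2" | "x = 3" | "x = 4" | "4 < x" "x \<le> l" by linarith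
  then show "(tripod11 l \<circ> tripod11 l) x = (cyc3 1 2 3) x"
    by cases (use l in \<open>auto simp del: One_nat_def simp: tripod11_simps cyc3_def transpose_def\<close>)
qed

lemma quadpod112_simps:
  "quadpod112 l 1 = 5" "quadpod112 l 2 = 1" "quadpod112 l 3 = 2" "quadpod112 l 4 = 4" "quadpod112 l 5 = 3"
  "\<lbrakk>6 \<le> x; x \<le> l\<rbrakk> \<Longrightarrow> quadpod112 l x = l + 6 - x" "x = 0 \<Longrightarrow> quadpod112 l x = x" "l < x \<Longrightarrow> quadpod112 l x = x"
  using l by (simp_all add: quadpod112_def flip_def)

lemma quadpod112_permutes: "quadpod112 l permutes {1..l}"
proof (rule permutes_by_inverse)
  define g where "g x = (if x = 1 then 2 else if x = 2 then 3 else if x = 3 then 5 else if x = 5 then 1 else flip l 6 x)" for x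
  have g: "g 1 = 2" "g 2 = 3" "g 3 = 5" "g 4 = 4" "g 5 = 1" "\<And>x. \<lbrakk>6 \<le> x; x \<le> l\<rbrakk> \<Longrightarrow> g x = l + 6 - x"
    using l by (simp_all add: g_def flip_def)
  fix x :: nat
  show "x \<notin> {1..l} \<Longrightarrow> quadpod112 l x = x" by (cases "x = 0") (simp_all add: quadpod112_simps)
  have *: "x \<in> {1..l} \<Longrightarrow> quadpod112 l x \<in> {1..l} \<and> g (quadpod112 l x) = x"
  proof -
    assume "x \<in> {1..l}"
    then consider "x = 1" | "x = 2" | "x = 3" | "x = 4" | "x = 5" | "6 \<le> x" "x \<le> l" by fastforce
    then show ?thesis by cases (use l in \<open>auto simp del: One_nat_def simp: quadpod112_simps g\<close>)
  qed
  then show "x \<in> {1..l} \<Longrightarrow> quadpod112 l x \<in> {1..l}" "x \<in> {1..l} \<Longrightarrow> g (quadpod112 l x) = x" by blast+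
qed simp

lemma quadpod112'_simps:
  "quadpod112' l 1 = 1" "quadpod112' l 2 = 2" "quadpod112' l 3 = 4" "quadpod112' l 4 = 3"
  "\<lbrakk>5 \<le> x; x \<le> l\<rbrakk> \<Longrightarrow> quadpod112' l x = l + 5 - x" "x = 0 \<Longrightarrow> quadpod112' l x = x" "l < x \<Longrightarrow> quadpod112' l x = x"
  using l by (simp_all add: quadpod112'_def flip_def)

lemma quadpod112'_involution: "quadpod112' l \<circ> quadpod112' l = id"
proof
  fix x
  consider "x = 0" | "l < x" | "x = 1" | "x = 2" | "x = 3" | "x = 4" | "x = 5" | "5 < x" "x \<le> l" by linarith
  then show "(quadpod112' l \<circ> quadpod112' l) x = id x"
    by cases (use l in \<open>auto simp del: One_nat_def simp: quadpod112'_simps\<close>)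
qed

lemma quadpod112'_permutes: "quadpod112' l permutes {1..l}"
proof (rule permutes_by_inverse)
  fix x :: nat
  show "x \<notin> {1..l} \<Longrightarrow> quadpod112' l x = x" by (cases "x = 0") (simp_all add: quadpod112'_simps)
  show "quadpod112' l (quadpod112' l x) = x" using fun_cong[OF quadpod112'_involution, of x] by simp
  show "quadpod112' l x \<in> {1..l}" if xS: "x \<in> {1..l}"
  proof -
    consider "x = 1" | "x = 2" | "x = 3" | "x = 4" | "5 \<le> x" "x \<le> l" using xS by fastforce
    then show ?thesis by cases (use l in \<open>auto simp del: One_nat_def simp: quadpod112'_simps\<close>)
  qed
qed simp

lemma quadpod112_word: "quadpod112 l \<circ> rot l \<circ> quadpod112' l = id"
proof
  fix x
  consider "x = 0" | "l < x" | "x = 1" | "x = 2" | "x = 3" | "x = 4" | "x = 5" | "5 < x" "x \<le> l" by linarith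
  then show "(quadpod112 l \<circ> rot l \<circ> quadpod112' l) x = (id) x"
    by cases (use l in \<open>auto simp del: One_nat_def simp: quadpod112_simps quadpod112'_simps rot_simps rot_out\<close>)
qed

text \<open>The square of the 4-cycle 1 -> 5 -> 3 -> 2 -> 1, the rest being an involution. It is the
  double transposition for which generation together with the rotation is already known.\<close>

lemma quadpod112_square: "quadpod112 l \<circ> quadpod112 l = transpose 1 3 \<circ> transpose 2 5"
proof
  fix x
  consider "x = 0" | "l < x" | "x = 1" | "x = 2" | "x = 3" | "x = 4" | "x = 5" | "x = 6" | "6 < x" "x \<le> l" by linarith
  then show "(quadpod112 l \<circ> quadpod112 l) x = (transpose 1 3 \<circ> transpose 2 5) x"
    by cases (use l in \<open>auto simp del: One_nat_def simp: quadpod112_simps transpose_def\<close>)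
qed

lemma quadpod122_simps:
  "quadpod122 l 1 = 6" "quadpod122 l 2 = 1" "quadpod122 l 3 = 3" "quadpod122 l 4 = 2" "quadpod122 l 5 = 5" "quadpod122 l 6 = 4"
  "\<lbrakk>7 \<le> x; x \<le> l\<rbrakk> \<Longrightarrow> quadpod122 l x = l + 7 - x" "x = 0 \<Longrightarrow> quadpod122 l x = x" "l < x \<Longrightarrow> quadpod122 l x = x"
  using l by (simp_all add: quadpod122_def flip_def)

lemma quadpod122_permutes: "quadpod122 l permutes {1..l}"
proof (rule permutes_by_inverse)
  define g where "g x = (if x = 1 then 2 else if x = 2 then 4 else if x = 4 then 6 else if x = 6 then 1 else flip l 7 x)" for x
  have g: "g 1 = 2" "g 2 = 4" "g 3 = 3" "g 4 = 6" "g 5 = 5" "g 6 = 1" "\<And>x. \<lbrakk>7 \<le> x; x \<le> l\<rbrakk> \<Longrightarrow> g x = l + 7 - x"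
    using l by (simp_all add: g_def flip_def)
  fix x :: nat
  show "x \<notin> {1..l} \<Longrightarrow> quadpod122 l x = x" by (cases "x = 0") (simp_all add: quadpod122_simps)
  have *: "x \<in> {1..l} \<Longrightarrow> quadpod122 l x \<in> {1..l} \<and> g (quadpod122 l x) = x"
  proof -
    assume "x \<in> {1..l}"
    then consider "x = 1" | "x = 2" | "x = 3" | "x = 4" | "x = 5" | "x = 6" | "7 \<le> x" "x \<le> l" by fastforce
    then show ?thesis by cases (use l in \<open>auto simp del: One_nat_def simp: quadpod122_simps g\<close>)
  qed
  then show "x \<in> {1..l} \<Longrightarrow> quadpod122 l x \<in> {1..l}" "x \<in> {1..l} \<Longrightarrow> g (quadpod122 l x) = x" by blast+
qed simp

lemma quadpod122'_simps:
  "quadpod122' l 1 = 1" "quadpod122' l 2 = 3" "quadpod122' l 3 = 2" "quadpod122' l 4 = 5" "quadpod122' l 5 = 4"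
  "\<lbrakk>6 \<le> x; x \<le> l\<rbrakk> \<Longrightarrow> quadpod122' l x = l + 6 - x" "x = 0 \<Longrightarrow> quadpod122' l x = x" "l < x \<Longrightarrow> quadpod122' l x = x"
  using l by (simp_all add: quadpod122'_def flip_def)

lemma quadpod122'_involution: "quadpod122' l \<circ> quadpod122' l = id"
proof
  fix x
  consider "x = 0" | "l < x" | "x = 1" | "x = 2" | "x = 3" | "x = 4" | "x = 5" | "x = 6" | "6 < x" "x \<le> l" by linarith
  then show "(quadpod122' l \<circ> quadpod122' l) x = id x"
    by cases (use l in \<open>auto simp del: One_nat_def simp: quadpod122'_simps\<close>)
qed

lemma quadpod122'_permutes: "quadpod122' l permutes {1..l}"
proof (rule permutes_by_inverse)
  fix x :: nat
  show "x \<notin> {1..l} \<Longrightarrow> quadpod122' l x = x" by (cases "x = 0") (simp_all add: quadpod122'_simps)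
  show "quadpod122' l (quadpod122' l x) = x" using fun_cong[OF quadpod122'_involution, of x] by simp
  show "quadpod122' l x \<in> {1..l}" if xS: "x \<in> {1..l}"
  proof -
    consider "x = 1" | "x = 2" | "x = 3" | "x = 4" | "x = 5" | "6 \<le> x" "x \<le> l" using xS by fastforce
    then show ?thesis by cases (use l in \<open>auto simp del: One_nat_def simp: quadpod122'_simps\<close>)
  qed
qed simp

lemma quadpod122_word: "quadpod122 l \<circ> rot l \<circ> quadpod122' l = id"
proof
  fix x
  consider "x = 0" | "l < x" | "x = 1" | "x = 2" | "x = 3" | "x = 4" | "x = 5" | "x = 6" | "6 < x" "x \<le> l" by linarith
  then show "(quadpod122 l \<circ> rot l \<circ> quadpod122' l) x = (id) x"
    by cases (use l in \<open>auto simp del: One_nat_def simp: quadpod122_simps quadpod122'_simps rot_simps rot_out\<close>)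
qed

lemma quadpod122_square: "quadpod122 l \<circ> quadpod122 l = transpose 1 4 \<circ> transpose 2 6"
proof
  fix x
  consider "x = 0" | "l < x" | "x = 1" | "x = 2" | "x = 3" | "x = 4" | "x = 5" | "x = 6" | "x = 7" | "7 < x" "x \<le> l" by linarith
  then show "(quadpod122 l \<circ> quadpod122 l) x = (transpose 1 4 \<circ> transpose 2 6) x"
    by cases (use l in \<open>auto simp del: One_nat_def simp: quadpod122_simps transpose_def\<close>)
qed

end

section \<open>Fixed points and cycle structures of the explicit permutations\<close>

lemma card_fixed_points:
  fixes l m :: nat and f :: "nat \<Rightarrow> nat"
  assumes ml: "1 \<le> m" "m \<le> l" and f: "\<And>x. \<lbrakk>m \<le> x; x \<le> l\<rbrakk> \<Longrightarrow> f x = l + m - x"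
    and F: "{x. 1 \<le> x \<and> x < m \<and> f x = x} = F"
  shows "card {x \<in> {1..l}. f x = x} = card F + (if even (l + m) then 1 else 0)"
proof -
  \<comment> \<open>The reflection of m, ..., l can fix only the midpoint, which is an integer
    exactly when l + m is even.\<close>
  let ?E = "{x. m \<le> x \<and> x \<le> l \<and> 2 * x = l + m}"
  have eq: "f x = x \<longleftrightarrow> 2 * x = l + m" if "m \<le> x" "x \<le> l" for x using f[OF that] that by auto
  have "x \<in> {1..l} \<and> f x = x \<longleftrightarrow> (1 \<le> x \<and> x < m \<and> f x = x) \<or> x \<in> ?E" for x
    using eq[of x] ml by (cases "x < m") auto
  then have "{x \<in> {1..l}. f x = x} = F \<union> ?E" unfolding F[symmetric] by blast
  moreover have "F \<inter> ?E = {}" "finite F" "finite ?E" unfolding F[symmetric] by auto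
  moreover have "card ?E = (if even (l + m) then 1 else 0)"
  proof (cases "even (l + m)")
    case True
    then have "?E = {(l + m) div 2}" using ml by auto
    then show ?thesis using True by simp
  next
    case False
    have "2 * x \<noteq> l + m" for x
    proof
      assume "2 * x = l + m"
      then have "even (l + m)" by (metis dvd_triv_left)
      then show False using False by simp
    qed
    then have "?E = {}" by blast
    then show ?thesis using False by simp
  qed
  ultimately show ?thesis by (simp add: card_Un_disjoint)
qed

text \<open>The tripod followed by the transposition (1 2): its 3-cycle breaks into the
  transposition (1 4) and the fixed point 2.\<close>

definition tripod12_cut :: "nat \<Rightarrow> nat \<Rightarrow> nat" where
  "tripod12_cut l x = (if x = 1 then 4 else if x = 4 then 1 else flip l 5 x)"

text \<open>The reflection x -> 3 - x modulo l. Applied after \<open>flip l 2\<close>, which is x ->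
  2 - x, it gives the rotation.\<close>

definition refl3 :: "nat \<Rightarrow> nat \<Rightarrow> nat" where
  "refl3 l x = (if x = 1 then 2 else if x = 2 then 1 else flip l 3 x)"

context
  fixes l :: nat assumes l: "l \<ge> 9"
begin

lemma tripod12_cut_simps:
  "tripod12_cut l 1 = 4" "tripod12_cut l 2 = 2" "tripod12_cut l 3 = 3" "tripod12_cut l 4 = 1"
  "\<lbrakk>5 \<le> x; x \<le> l\<rbrakk> \<Longrightarrow> tripod12_cut l x = l + 5 - x" "x = 0 \<Longrightarrow> tripod12_cut l x = x" "l < x \<Longrightarrow> tripod12_cut l x = x"
  using l by (simp_all add: tripod12_cut_def flip_def)

lemma tripod12_cut_involution: "tripod12_cut l \<circ> tripod12_cut l = id"
proof
  fix x
  consider "x = 0" | "l < x" | "x = 1" | "x = 2" | "x = 3" | "x = 4" | "x = 5" | "5 < x" "x \<le> l" by linarith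
  then show "(tripod12_cut l \<circ> tripod12_cut l) x = id x"
    by cases (use l in \<open>auto simp del: One_nat_def simp: tripod12_cut_simps\<close>)
qed

lemma tripod12_cut_permutes: "tripod12_cut l permutes {1..l}"
proof (rule permutes_by_inverse)
  fix x :: nat
  show "x \<notin> {1..l} \<Longrightarrow> tripod12_cut l x = x" by (cases "x = 0") (simp_all add: tripod12_cut_simps)
  show "tripod12_cut l (tripod12_cut l x) = x" using fun_cong[OF tripod12_cut_involution, of x] by simp
  show "tripod12_cut l x \<in> {1..l}" if xS: "x \<in> {1..l}"
  proof -
    consider "x = 1" | "x = 2" | "x = 3" | "x = 4" | "5 \<le> x" "x \<le> l" using xS by fastforce
    then show ?thesis by cases (use l in \<open>auto simp del: One_nat_def simp: tripod12_cut_simps\<close>)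
  qed
qed simp

lemma refl3_simps:
  "refl3 l 1 = 2" "refl3 l 2 = 1"
  "\<lbrakk>3 \<le> x; x \<le> l\<rbrakk> \<Longrightarrow> refl3 l x = l + 3 - x" "x = 0 \<Longrightarrow> refl3 l x = x" "l < x \<Longrightarrow> refl3 l x = x"
  using l by (simp_all add: refl3_def flip_def)

lemma refl3_involution: "refl3 l \<circ> refl3 l = id"
proof
  fix x
  consider "x = 0" | "l < x" | "x = 1" | "x = 2" | "x = 3" | "3 < x" "x \<le> l" by linarith
  then show "(refl3 l \<circ> refl3 l) x = id x"
    by cases (use l in \<open>auto simp del: One_nat_def simp: refl3_simps\<close>)
qed

lemma refl3_permutes: "refl3 l permutes {1..l}"
proof (rule permutes_by_inverse)
  fix x :: nat
  show "x \<notin> {1..l} \<Longrightarrow> refl3 l x = x" by (cases "x = 0") (simp_all add: refl3_simps)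
  show "refl3 l (refl3 l x) = x" using fun_cong[OF refl3_involution, of x] by simp
  show "refl3 l x \<in> {1..l}" if xS: "x \<in> {1..l}"
  proof -
    consider "x = 1" | "x = 2" | "3 \<le> x" "x \<le> l" using xS by fastforce
    then show ?thesis by cases (use l in \<open>auto simp del: One_nat_def simp: refl3_simps\<close>)
  qed
qed simp

lemma card_fixed_tripod12: "card {x \<in> {1..l}. tripod12 l x = x} = 1 + (if even (l + 5) then 1 else 0)"
proof -
  have "{x. 1 \<le> x \<and> x < 5 \<and> tripod12 l x = x} = {3}"
  proof (intro equalityI subsetI)
    fix x assume x: "x \<in> {x. 1 \<le> x \<and> x < 5 \<and> tripod12 l x = x}"
    then consider "x = 1" | "x = 2" | "x = 3" | "x = 4" by fastforce
    then show "x \<in> {3}" by cases (use x l in \<open>auto simp del: One_nat_def simp: tripod12_simps\<close>)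
  qed (use l in \<open>auto simp del: One_nat_def simp: tripod12_simps\<close>)
  from card_fixed_points[OF _ _ _ this] show ?thesis using l by (simp add: tripod12_simps)
qed

lemma card_fixed_tripod12': "card {x \<in> {1..l}. tripod12' l x = x} = 1 + (if even (l + 4) then 1 else 0)"
proof -
  have "{x. 1 \<le> x \<and> x < 4 \<and> tripod12' l x = x} = {1}"
  proof (intro equalityI subsetI)
    fix x assume x: "x \<in> {x. 1 \<le> x \<and> x < 4 \<and> tripod12' l x = x}"
    then consider "x = 1" | "x = 2" | "x = 3" by fastforce
    then show "x \<in> {1}" by cases (use x l in \<open>auto simp del: One_nat_def simp: tripod12'_simps\<close>)
  qed (use l in \<open>auto simp del: One_nat_def simp: tripod12'_simps\<close>)
  from card_fixed_points[OF _ _ _ this] show ?thesis using l by (simp add: tripod12'_simps)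
qed

lemma card_fixed_tripod11: "card {x \<in> {1..l}. tripod11 l x = x} = 0 + (if even (l + 4) then 1 else 0)"
proof -
  have "{x. 1 \<le> x \<and> x < 4 \<and> tripod11 l x = x} = {}"
  proof (intro equalityI subsetI)
    fix x assume x: "x \<in> {x. 1 \<le> x \<and> x < 4 \<and> tripod11 l x = x}"
    then consider "x = 1" | "x = 2" | "x = 3" by fastforce
    then show "x \<in> {}" by cases (use x l in \<open>auto simp del: One_nat_def simp: tripod11_simps\<close>)
  qed (use l in \<open>auto simp del: One_nat_def simp: tripod11_simps\<close>)
  from card_fixed_points[OF _ _ _ this] show ?thesis using l by (simp add: tripod11_simps)
qed

lemma card_fixed_quadpod112: "card {x \<in> {1..l}. quadpod112 l x = x} = 1 + (if even (l + 6) then 1 else 0)"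
proof -
  have "{x. 1 \<le> x \<and> x < 6 \<and> quadpod112 l x = x} = {4}"
  proof (intro equalityI subsetI)
    fix x assume x: "x \<in> {x. 1 \<le> x \<and> x < 6 \<and> quadpod112 l x = x}"
    then consider "x = 1" | "x = 2" | "x = 3" | "x = 4" | "x = 5" by fastforce
    then show "x \<in> {4}" by cases (use x l in \<open>auto simp del: One_nat_def simp: quadpod112_simps\<close>)
  qed (use l in \<open>auto simp del: One_nat_def simp: quadpod112_simps\<close>)
  from card_fixed_points[OF _ _ _ this] show ?thesis using l by (simp add: quadpod112_simps)
qed

lemma card_fixed_quadpod112': "card {x \<in> {1..l}. quadpod112' l x = x} = 2 + (if even (l + 5) then 1 else 0)"
proof -
  have "{x. 1 \<le> x \<and> x < 5 \<and> quadpod112' l x = x} = {1, 2}"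
  proof (intro equalityI subsetI)
    fix x assume x: "x \<in> {x. 1 \<le> x \<and> x < 5 \<and> quadpod112' l x = x}"
    then consider "x = 1" | "x = 2" | "x = 3" | "x = 4" by fastforce
    then show "x \<in> {1, 2}" by cases (use x l in \<open>auto simp del: One_nat_def simp: quadpod112'_simps\<close>)
  qed (use l in \<open>auto simp del: One_nat_def simp: quadpod112'_simps\<close>)
  from card_fixed_points[OF _ _ _ this] show ?thesis using l by (simp add: quadpod112'_simps)
qed

lemma card_fixed_quadpod122: "card {x \<in> {1..l}. quadpod122 l x = x} = 2 + (if even (l + 7) then 1 else 0)"
proof -
  have "{x. 1 \<le> x \<and> x < 7 \<and> quadpod122 l x = x} = {3, 5}"
  proof (intro equalityI subsetI)
    fix x assume x: "x \<in> {x. 1 \<le> x \<and> x < 7 \<and> quadpod122 l x = x}"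
    then consider "x = 1" | "x = 2" | "x = 3" | "x = 4" | "x = 5" | "x = 6" by fastforce
    then show "x \<in> {3, 5}" by cases (use x l in \<open>auto simp del: One_nat_def simp: quadpod122_simps\<close>)
  qed (use l in \<open>auto simp del: One_nat_def simp: quadpod122_simps\<close>)
  from card_fixed_points[OF _ _ _ this] show ?thesis using l by (simp add: quadpod122_simps)
qed

lemma card_fixed_quadpod122': "card {x \<in> {1..l}. quadpod122' l x = x} = 1 + (if even (l + 6) then 1 else 0)"
proof -
  have "{x. 1 \<le> x \<and> x < 6 \<and> quadpod122' l x = x} = {1}"
  proof (intro equalityI subsetI)
    fix x assume x: "x \<in> {x. 1 \<le> x \<and> x < 6 \<and> quadpod122' l x = x}"
    then consider "x = 1" | "x = 2" | "x = 3" | "x = 4" | "x = 5" by fastforce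
    then show "x \<in> {1}" by cases (use x l in \<open>auto simp del: One_nat_def simp: quadpod122'_simps\<close>)
  qed (use l in \<open>auto simp del: One_nat_def simp: quadpod122'_simps\<close>)
  from card_fixed_points[OF _ _ _ this] show ?thesis using l by (simp add: quadpod122'_simps)
qed

lemma card_fixed_tripod12_cut: "card {x \<in> {1..l}. tripod12_cut l x = x} = 2 + (if even (l + 5) then 1 else 0)"
proof -
  have "{x. 1 \<le> x \<and> x < 5 \<and> tripod12_cut l x = x} = {2, 3}"
  proof (intro equalityI subsetI)
    fix x assume x: "x \<in> {x. 1 \<le> x \<and> x < 5 \<and> tripod12_cut l x = x}"
    then consider "x = 1" | "x = 2" | "x = 3" | "x = 4" by fastforce
    then show "x \<in> {2, 3}" by cases (use x l in \<open>auto simp del: One_nat_def simp: tripod12_cut_simps\<close>)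
  qed (use l in \<open>auto simp del: One_nat_def simp: tripod12_cut_simps\<close>)
  from card_fixed_points[OF _ _ _ this] show ?thesis using l by (simp add: tripod12_cut_simps)
qed

lemma card_fixed_refl3: "card {x \<in> {1..l}. refl3 l x = x} = 0 + (if even (l + 3) then 1 else 0)"
proof -
  have "{x. 1 \<le> x \<and> x < 3 \<and> refl3 l x = x} = {}"
  proof (intro equalityI subsetI)
    fix x assume x: "x \<in> {x. 1 \<le> x \<and> x < 3 \<and> refl3 l x = x}"
    then consider "x = 1" | "x = 2" by fastforce
    then show "x \<in> {}" by cases (use x l in \<open>auto simp del: One_nat_def simp: refl3_simps\<close>)
  qed (use l in \<open>auto simp del: One_nat_def simp: refl3_simps\<close>)
  from card_fixed_points[OF _ _ _ this] show ?thesis using l by (simp add: refl3_simps)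
qed

end

context
  fixes l :: nat assumes l: "l \<ge> 9"
begin

lemma card_fixed_flip: "card {x \<in> {1..l}. flip l 1 x = x} = (if even (l + 1) then 1 else 0)"
  "card {x \<in> {1..l}. flip l 2 x = x} = 1 + (if even (l + 2) then 1 else 0)"
  "card {x \<in> {1..l}. flip l 3 x = x} = 2 + (if even (l + 3) then 1 else 0)"
proof -
  have F: "{x. 1 \<le> x \<and> x < 1 \<and> flip l 1 x = x} = {}" "{x. 1 \<le> x \<and> x < 2 \<and> flip l 2 x = x} = {1}"
    "{x. 1 \<le> x \<and> x < 3 \<and> flip l 3 x = x} = {1, 2}"
    by (auto simp: flip_def)
  have f: "\<lbrakk>m \<le> x; x \<le> l\<rbrakk> \<Longrightarrow> flip l m x = l + m - x" for m x by (simp add: flip_def)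
  show "card {x \<in> {1..l}. flip l 1 x = x} = (if even (l + 1) then 1 else 0)"
    using card_fixed_points[OF _ _ f F(1)] l by simp
  show "card {x \<in> {1..l}. flip l 2 x = x} = 1 + (if even (l + 2) then 1 else 0)"
    using card_fixed_points[OF _ _ f F(2)] l by simp
  show "card {x \<in> {1..l}. flip l 3 x = x} = 2 + (if even (l + 3) then 1 else 0)"
    using card_fixed_points[OF _ _ f F(3)] l by simp
qed

lemma flip_involution: "flip l m \<circ> flip l m = id"
  by (simp add: fun_eq_iff flip_flip)

lemma rot_eq: "rot l = flip l 2 \<circ> flip l 1"
  using l by (simp add: rot_eq_flips)

lemma flips_word: "p \<circ> rot l \<circ> q = id \<Longrightarrow> p \<circ> (flip l 2 \<circ> flip l 1) \<circ> q = id"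
  by (simp only: rot_eq)

lemmas flip_permutes' = flip_permutes[of 1 l, OF order_refl] flip_permutes[of 2 l, OF one_le_numeral]
  flip_permutes[of 3 l, OF one_le_numeral]

text \<open>The parity of l decides whether the reflected part has a midpoint, and with it the
  number j of fixed points. So the same permutation serves one row for odd l and another for even
  l.\<close>

lemma cycle_type_tripod12_odd: "odd l \<Longrightarrow> cycle_type l (tripod12 l) = parts (C\<^sub>W l 2)"
proof (rule cycle_type_C[OF tripod12_permutes[OF l], of 1 4 2])
  fix x assume x: "x \<in> {1..l} - {1, 4, 2}"
  then consider "x = 3" |  "5 \<le> x" "x \<le> l" by fastforce
  then show "tripod12 l (tripod12 l x) = x" by cases (use x l in \<open>auto simp del: One_nat_def simp: tripod12_simps\<close>)
qed (use l card_fixed_tripod12[OF l] in \<open>simp_all del: One_nat_def add: tripod12_simps\<close>)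

lemma cycle_type_tripod12'_odd: "odd l \<Longrightarrow> cycle_type l (tripod12' l) = parts (B\<^sub>W l 1)"
  using card_fixed_tripod12'[OF l] fun_cong[OF tripod12'_involution[OF l]] by (intro cycle_type_B tripod12'_permutes[OF l]) auto

lemma cycle_type_tripod12_even: "even l \<Longrightarrow> cycle_type l (tripod12 l) = parts (C\<^sub>W l 1)"
proof (rule cycle_type_C[OF tripod12_permutes[OF l], of 1 4 2])
  fix x assume x: "x \<in> {1..l} - {1, 4, 2}"
  then consider "x = 3" |  "5 \<le> x" "x \<le> l" by fastforce
  then show "tripod12 l (tripod12 l x) = x" by cases (use x l in \<open>auto simp del: One_nat_def simp: tripod12_simps\<close>)
qed (use l card_fixed_tripod12[OF l] in \<open>simp_all del: One_nat_def add: tripod12_simps\<close>)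

lemma cycle_type_tripod12'_even: "even l \<Longrightarrow> cycle_type l (tripod12' l) = parts (B\<^sub>W l 2)"
  using card_fixed_tripod12'[OF l] fun_cong[OF tripod12'_involution[OF l]] by (intro cycle_type_B tripod12'_permutes[OF l]) auto

lemma cycle_type_tripod11_odd: "odd l \<Longrightarrow> cycle_type l (tripod11 l) = parts (C\<^sub>W l 0)"
proof (rule cycle_type_C[OF tripod11_permutes[OF l], of 1 3 2])
  fix x assume x: "x \<in> {1..l} - {1, 3, 2}"
  then consider  "4 \<le> x" "x \<le> l" by fastforce
  then show "tripod11 l (tripod11 l x) = x" by cases (use x l in \<open>auto simp del: One_nat_def simp: tripod11_simps\<close>)
qed (use l card_fixed_tripod11[OF l] in \<open>simp_all del: One_nat_def add: tripod11_simps\<close>)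

lemma cycle_type_quadpod112_odd: "odd l \<Longrightarrow> cycle_type l (quadpod112 l) = parts (D\<^sub>W l 1)"
proof (rule cycle_type_D[OF quadpod112_permutes[OF l], of 1 5 3 2])
  fix x assume x: "x \<in> {1..l} - {1, 5, 3, 2}"
  then consider "x = 4" |  "6 \<le> x" "x \<le> l" by fastforce
  then show "quadpod112 l (quadpod112 l x) = x" by cases (use x l in \<open>auto simp del: One_nat_def simp: quadpod112_simps\<close>)
qed (use l card_fixed_quadpod112[OF l] in \<open>simp_all del: One_nat_def add: quadpod112_simps\<close>)

lemma cycle_type_quadpod112'_odd: "odd l \<Longrightarrow> cycle_type l (quadpod112' l) = parts (B\<^sub>W l 3)"
  using card_fixed_quadpod112'[OF l] fun_cong[OF quadpod112'_involution[OF l]] by (intro cycle_type_B quadpod112'_permutes[OF l]) auto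

lemma cycle_type_quadpod112_even: "even l \<Longrightarrow> cycle_type l (quadpod112 l) = parts (D\<^sub>W l 2)"
proof (rule cycle_type_D[OF quadpod112_permutes[OF l], of 1 5 3 2])
  fix x assume x: "x \<in> {1..l} - {1, 5, 3, 2}"
  then consider "x = 4" |  "6 \<le> x" "x \<le> l" by fastforce
  then show "quadpod112 l (quadpod112 l x) = x" by cases (use x l in \<open>auto simp del: One_nat_def simp: quadpod112_simps\<close>)
qed (use l card_fixed_quadpod112[OF l] in \<open>simp_all del: One_nat_def add: quadpod112_simps\<close>)

lemma cycle_type_quadpod112'_even: "even l \<Longrightarrow> cycle_type l (quadpod112' l) = parts (B\<^sub>W l 2)"
  using card_fixed_quadpod112'[OF l] fun_cong[OF quadpod112'_involution[OF l]] by (intro cycle_type_B quadpod112'_permutes[OF l]) auto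

lemma cycle_type_quadpod122_odd: "odd l \<Longrightarrow> cycle_type l (quadpod122 l) = parts (D\<^sub>W l 3)"
proof (rule cycle_type_D[OF quadpod122_permutes[OF l], of 1 6 4 2])
  fix x assume x: "x \<in> {1..l} - {1, 6, 4, 2}"
  then consider "x = 3" | "x = 5" |  "7 \<le> x" "x \<le> l" by fastforce
  then show "quadpod122 l (quadpod122 l x) = x" by cases (use x l in \<open>auto simp del: One_nat_def simp: quadpod122_simps\<close>)
qed (use l card_fixed_quadpod122[OF l] in \<open>simp_all del: One_nat_def add: quadpod122_simps\<close>)

lemma cycle_type_quadpod122'_odd: "odd l \<Longrightarrow> cycle_type l (quadpod122' l) = parts (B\<^sub>W l 1)"
  using card_fixed_quadpod122'[OF l] fun_cong[OF quadpod122'_involution[OF l]] by (intro cycle_type_B quadpod122'_permutes[OF l]) auto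

lemma cycle_type_flip1_odd: "odd l \<Longrightarrow> cycle_type l (flip l 1) = parts (B\<^sub>W l 1)"
  using card_fixed_flip(1) flip_flip by (intro cycle_type_B flip_permutes') auto

lemma cycle_type_flip2_odd: "odd l \<Longrightarrow> cycle_type l (flip l 2) = parts (B\<^sub>W l 1)"
  using card_fixed_flip(2) flip_flip by (intro cycle_type_B flip_permutes') auto

lemma cycle_type_flip3_odd: "odd l \<Longrightarrow> cycle_type l (flip l 3) = parts (B\<^sub>W l 3)"
  using card_fixed_flip(3) flip_flip by (intro cycle_type_B flip_permutes') auto

lemma cycle_type_tripod12_cut_odd: "odd l \<Longrightarrow> cycle_type l (tripod12_cut l) = parts (B\<^sub>W l 3)"
  using card_fixed_tripod12_cut[OF l] fun_cong[OF tripod12_cut_involution[OF l]] by (intro cycle_type_B tripod12_cut_permutes[OF l]) auto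

lemma cycle_type_refl3_odd: "odd l \<Longrightarrow> cycle_type l (refl3 l) = parts (B\<^sub>W l 1)"
  using card_fixed_refl3[OF l] fun_cong[OF refl3_involution[OF l]] by (intro cycle_type_B refl3_permutes[OF l]) auto

lemma cycle_type_flip1_even: "even l \<Longrightarrow> cycle_type l (flip l 1) = parts (B\<^sub>W l 0)"
  using card_fixed_flip(1) flip_flip by (intro cycle_type_B flip_permutes') auto

lemma cycle_type_flip2_even: "even l \<Longrightarrow> cycle_type l (flip l 2) = parts (B\<^sub>W l 2)"
  using card_fixed_flip(2) flip_flip by (intro cycle_type_B flip_permutes') auto

lemma cycle_type_flip3_even: "even l \<Longrightarrow> cycle_type l (flip l 3) = parts (B\<^sub>W l 2)"
  using card_fixed_flip(3) flip_flip by (intro cycle_type_B flip_permutes') auto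

lemma cycle_type_tripod12_cut_even: "even l \<Longrightarrow> cycle_type l (tripod12_cut l) = parts (B\<^sub>W l 2)"
  using card_fixed_tripod12_cut[OF l] fun_cong[OF tripod12_cut_involution[OF l]] by (intro cycle_type_B tripod12_cut_permutes[OF l]) auto

lemma cycle_type_refl3_even: "even l \<Longrightarrow> cycle_type l (refl3 l) = parts (B\<^sub>W l 0)"
  using card_fixed_refl3[OF l] fun_cong[OF refl3_involution[OF l]] by (intro cycle_type_B refl3_permutes[OF l]) auto

lemma tripod12_generates:
  assumes H: "perm_group H" "tripod12 l \<in> H" "rot l \<in> H" shows "carrier (alt_group l) \<subseteq> H"
proof -
  have "cyc3 1 2 4 \<in> H" using perm_group.comp_mem[OF H(1,2,2)] unfolding tripod12_square[OF l] .
  then have "tri H 1 (Suc 1)" using perm_group.triI(1)[OF H(1), of 1 2 4] by (simp add: numeral_2_eq_2)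
  then show ?thesis using alt_group_subset_rot[OF H(1,3), of 1] l by simp
qed

lemma tripod11_generates:
  assumes H: "perm_group H" "tripod11 l \<in> H" "rot l \<in> H" shows "carrier (alt_group l) \<subseteq> H"
proof -
  have "cyc3 1 2 3 \<in> H" using perm_group.comp_mem[OF H(1,2,2)] unfolding tripod11_square[OF l] .
  then have "tri H 1 (Suc 1)" using perm_group.triI(1)[OF H(1), of 1 2 3] by (simp add: numeral_2_eq_2)
  then show ?thesis using alt_group_subset_rot[OF H(1,3), of 1] l by simp
qed

lemma quadpod112_generates:
  assumes H: "perm_group H" "quadpod112 l \<in> H" "rot l \<in> H" shows "carrier (alt_group l) \<subseteq> H"
proof -
  have "transpose 1 3 \<circ> transpose 2 5 \<in> H"
    using perm_group.comp_mem[OF H(1,2,2)] unfolding quadpod112_square[OF l] .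
  then show ?thesis by (rule alt_group_subset_rot_double_transposition[OF l H(1,3)])
qed

lemma quadpod122_generates:
  assumes H: "perm_group H" "quadpod122 l \<in> H" "rot l \<in> H" shows "carrier (alt_group l) \<subseteq> H"
proof -
  interpret perm_group H by fact
  have t: "transpose 1 4 \<circ> transpose 2 6 \<in> H"
    using comp_mem[OF H(2,2)] unfolding quadpod122_square[OF l] .
  \<comment> \<open>Already the shift by 1, which is (2 5)(3 7), meets (1 4)(2 6) only in 2, and the
    resulting 3-cycle relates the neighbours 5 and 6.\<close>
  have r: "rot l 1 = 2" "rot l 4 = 5" "rot l 2 = 3" "rot l 6 = 7" using l by (auto simp: rot_def)
  have "transpose 2 5 \<circ> transpose 3 7 \<in> H" using double_transposition_conj_mem[OF t H(3)] unfolding r .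
  moreover have "transpose 2 6 \<circ> transpose 1 4 = transpose (1 :: nat) 4 \<circ> transpose 2 6"
    by (auto simp: fun_eq_iff transpose_def)
  then have "transpose 2 6 \<circ> transpose 1 4 \<in> H" using t by simp
  ultimately have "tri H 6 5" using double_transpositions_tri(3)[of 2 6 1 4 5 3 7] by simp
  then have "tri H 5 (Suc 5)" using tri_sym by simp
  then show ?thesis using alt_group_subset_rot[OF H(1,3), of 5] l by simp
qed

lemma squares_neq_id:
  "tripod12 l \<circ> tripod12 l \<noteq> id" "tripod11 l \<circ> tripod11 l \<noteq> id"
  "quadpod112 l \<circ> quadpod112 l \<noteq> id" "quadpod122 l \<circ> quadpod122 l \<noteq> id"
proof -
  have "cyc3 1 2 4 \<noteq> (id :: nat \<Rightarrow> nat)" "cyc3 1 2 3 \<noteq> (id :: nat \<Rightarrow> nat)"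
    by (auto simp: fun_eq_iff cyc3_def transpose_def intro!: exI[of _ 1])
  then show "tripod12 l \<circ> tripod12 l \<noteq> id" "tripod11 l \<circ> tripod11 l \<noteq> id"
    unfolding tripod12_square[OF l] tripod11_square[OF l] .
  show "quadpod112 l \<circ> quadpod112 l \<noteq> id" "quadpod122 l \<circ> quadpod122 l \<noteq> id"
    unfolding quadpod112_square[OF l] quadpod122_square[OF l] by (rule double_transposition_neq_id; simp)+
qed

lemma row_I2_3:
  assumes "odd l"
  shows "realizable l [Cl_Twisted (L\<^sub>W l), Cl_Swap, Cl_Pair (C\<^sub>W l 0) (B\<^sub>W l 3)]"
  using l assms cycle_type_tripod11_odd cycle_type_flip3_odd tripod11_generates
  by (intro realizable_spider[OF _ tripod11_permutes[OF l] flip_permutes'(3) flip_involution rot_permutes tripod11_word[OF l] squares_neq_id(2)])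
    (simp_all add: cycle_type_rot)

lemma row_I2_4:
  assumes "even l"
  shows "realizable l [Cl_Twisted (L\<^sub>W l), Cl_Swap, Cl_Pair (C\<^sub>W l 1) (B\<^sub>W l 2)]"
  using l assms cycle_type_tripod12_even cycle_type_tripod12'_even tripod12_generates
  by (intro realizable_spider[OF _ tripod12_permutes[OF l] tripod12'_permutes[OF l] tripod12'_involution[OF l] rot_permutes tripod12_word[OF l] squares_neq_id(1)])
    (simp_all add: cycle_type_rot)

lemma row_I2_5:
  assumes "odd l"
  shows "realizable l [Cl_Twisted (L\<^sub>W l), Cl_Swap, Cl_Pair (C\<^sub>W l 2) (B\<^sub>W l 1)]"
  using l assms cycle_type_tripod12_odd cycle_type_tripod12'_odd tripod12_generates
  by (intro realizable_spider[OF _ tripod12_permutes[OF l] tripod12'_permutes[OF l] tripod12'_involution[OF l] rot_permutes tripod12_word[OF l] squares_neq_id(1)])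
    (simp_all add: cycle_type_rot)

lemma row_I2_6:
  assumes "odd l"
  shows "realizable l [Cl_Twisted (L\<^sub>W l), Cl_Swap, Cl_Pair (D\<^sub>W l 1) (B\<^sub>W l 3)]"
  using l assms cycle_type_quadpod112_odd cycle_type_quadpod112'_odd quadpod112_generates
  by (intro realizable_spider[OF _ quadpod112_permutes[OF l] quadpod112'_permutes[OF l] quadpod112'_involution[OF l] rot_permutes quadpod112_word[OF l] squares_neq_id(3)])
    (simp_all add: cycle_type_rot)

lemma row_I2_7:
  assumes "even l"
  shows "realizable l [Cl_Twisted (L\<^sub>W l), Cl_Swap, Cl_Pair (D\<^sub>W l 2) (B\<^sub>W l 2)]"
  using l assms cycle_type_quadpod112_even cycle_type_quadpod112'_even quadpod112_generates
  by (intro realizable_spider[OF _ quadpod112_permutes[OF l] quadpod112'_permutes[OF l] quadpod112'_involution[OF l] rot_permutes quadpod112_word[OF l] squares_neq_id(3)])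
    (simp_all add: cycle_type_rot)

lemma row_I2_8:
  assumes "odd l"
  shows "realizable l [Cl_Twisted (L\<^sub>W l), Cl_Swap, Cl_Pair (D\<^sub>W l 3) (B\<^sub>W l 1)]"
  using l assms cycle_type_quadpod122_odd cycle_type_quadpod122'_odd quadpod122_generates
  by (intro realizable_spider[OF _ quadpod122_permutes[OF l] quadpod122'_permutes[OF l] quadpod122'_involution[OF l] rot_permutes quadpod122_word[OF l] squares_neq_id(4)])
    (simp_all add: cycle_type_rot)

text \<open>The rotation is itself a product of the reflections \<open>flip l 2\<close> and
  \<open>flip l 1\<close>, so the word behind I2.3 becomes one with four factors. The two ways of
  pairing them give this row and the next.\<close>

lemma row_F1A_3a:
  assumes "odd l"
  shows "realizable l [Cl_Pair (C\<^sub>W l 0) (B\<^sub>W l 3), Cl_Pair (B\<^sub>W l 1) (B\<^sub>W l 1), Cl_Swap, Cl_Swap]"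
  using l assms cycle_type_tripod11_odd cycle_type_flip3_odd cycle_type_flip1_odd cycle_type_flip2_odd
    tripod11_generates[unfolded rot_eq]
  by (intro realizable_four_involutions(2)[OF _ tripod11_permutes[OF l] flip_permutes'(3) flip_involution flip_permutes'(2,1) flip_involution
        flips_word[OF tripod11_word[OF l]] squares_neq_id(2)]) simp_all

lemma row_F1A_3b:
  assumes "odd l"
  shows "realizable l [Cl_Pair (C\<^sub>W l 0) (B\<^sub>W l 1), Cl_Pair (B\<^sub>W l 3) (B\<^sub>W l 1), Cl_Swap, Cl_Swap]"
  using l assms cycle_type_tripod11_odd cycle_type_flip3_odd cycle_type_flip1_odd cycle_type_flip2_odd
    tripod11_generates[unfolded rot_eq]
  by (intro realizable_four_involutions(1)[OF _ tripod11_permutes[OF l] flip_permutes'(3) flip_involution flip_permutes'(2,1) flip_involution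
        flips_word[OF tripod11_word[OF l]] squares_neq_id(2)]) simp_all

lemma row_F1A_4a:
  assumes "even l"
  shows "realizable l [Cl_Pair (C\<^sub>W l 1) (B\<^sub>W l 0), Cl_Pair (B\<^sub>W l 2) (B\<^sub>W l 2), Cl_Swap, Cl_Swap]"
  using l assms cycle_type_tripod12_even cycle_type_tripod12'_even cycle_type_flip1_even cycle_type_flip2_even
    tripod12_generates[unfolded rot_eq]
  by (intro realizable_four_involutions(1)[OF _ tripod12_permutes[OF l] tripod12'_permutes[OF l] tripod12'_involution[OF l] flip_permutes'(2,1) flip_involution
        flips_word[OF tripod12_word[OF l]] squares_neq_id(1)]) simp_all

lemma row_F1A_4b:
  assumes "even l"
  shows "realizable l [Cl_Pair (C\<^sub>W l 1) (B\<^sub>W l 2), Cl_Pair (B\<^sub>W l 0) (B\<^sub>W l 2), Cl_Swap, Cl_Swap]"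
  using l assms cycle_type_tripod12_even cycle_type_tripod12'_even cycle_type_flip1_even cycle_type_flip2_even
    tripod12_generates[unfolded rot_eq]
  by (intro realizable_four_involutions(2)[OF _ tripod12_permutes[OF l] tripod12'_permutes[OF l] tripod12'_involution[OF l] flip_permutes'(2,1) flip_involution
        flips_word[OF tripod12_word[OF l]] squares_neq_id(1)]) simp_all

lemma row_F1A_5:
  assumes "odd l"
  shows "realizable l [Cl_Pair (B\<^sub>W l 1) (C\<^sub>W l 2), Cl_Pair (B\<^sub>W l 1) (B\<^sub>W l 1), Cl_Swap, Cl_Swap]"
  using l assms cycle_type_tripod12_odd cycle_type_tripod12'_odd cycle_type_flip1_odd cycle_type_flip2_odd
    tripod12_generates[unfolded rot_eq]
  by (intro realizable_four_involutions(1)[OF _ tripod12_permutes[OF l] tripod12'_permutes[OF l] tripod12'_involution[OF l] flip_permutes'(2,1) flip_involution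
        flips_word[OF tripod12_word[OF l]] squares_neq_id(1)]) simp_all

lemma row_F1A_6a:
  assumes "odd l"
  shows "realizable l [Cl_Pair (D\<^sub>W l 1) (B\<^sub>W l 3), Cl_Pair (B\<^sub>W l 1) (B\<^sub>W l 1), Cl_Swap, Cl_Swap]"
  using l assms cycle_type_quadpod112_odd cycle_type_quadpod112'_odd cycle_type_flip1_odd cycle_type_flip2_odd
    quadpod112_generates[unfolded rot_eq]
  by (intro realizable_four_involutions(2)[OF _ quadpod112_permutes[OF l] quadpod112'_permutes[OF l] quadpod112'_involution[OF l] flip_permutes'(2,1) flip_involution
        flips_word[OF quadpod112_word[OF l]] squares_neq_id(3)]) simp_all

lemma row_F1A_6b:
  assumes "odd l"
  shows "realizable l [Cl_Pair (D\<^sub>W l 1) (B\<^sub>W l 1), Cl_Pair (B\<^sub>W l 3) (B\<^sub>W l 1), Cl_Swap, Cl_Swap]"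
  using l assms cycle_type_quadpod112_odd cycle_type_quadpod112'_odd cycle_type_flip1_odd cycle_type_flip2_odd
    quadpod112_generates[unfolded rot_eq]
  by (intro realizable_four_involutions(1)[OF _ quadpod112_permutes[OF l] quadpod112'_permutes[OF l] quadpod112'_involution[OF l] flip_permutes'(2,1) flip_involution
        flips_word[OF quadpod112_word[OF l]] squares_neq_id(3)]) simp_all

lemma row_F1A_7a:
  assumes "even l"
  shows "realizable l [Cl_Pair (D\<^sub>W l 2) (B\<^sub>W l 0), Cl_Pair (B\<^sub>W l 2) (B\<^sub>W l 2), Cl_Swap, Cl_Swap]"
  using l assms cycle_type_quadpod112_even cycle_type_quadpod112'_even cycle_type_flip1_even cycle_type_flip2_even
    quadpod112_generates[unfolded rot_eq]
  by (intro realizable_four_involutions(1)[OF _ quadpod112_permutes[OF l] quadpod112'_permutes[OF l] quadpod112'_involution[OF l] flip_permutes'(2,1) flip_involution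
        flips_word[OF quadpod112_word[OF l]] squares_neq_id(3)]) simp_all

lemma row_F1A_7b:
  assumes "even l"
  shows "realizable l [Cl_Pair (D\<^sub>W l 2) (B\<^sub>W l 2), Cl_Pair (B\<^sub>W l 0) (B\<^sub>W l 2), Cl_Swap, Cl_Swap]"
  using l assms cycle_type_quadpod112_even cycle_type_quadpod112'_even cycle_type_flip1_even cycle_type_flip2_even
    quadpod112_generates[unfolded rot_eq]
  by (intro realizable_four_involutions(2)[OF _ quadpod112_permutes[OF l] quadpod112'_permutes[OF l] quadpod112'_involution[OF l] flip_permutes'(2,1) flip_involution
        flips_word[OF quadpod112_word[OF l]] squares_neq_id(3)]) simp_all

lemma row_F1A_8:
  assumes "odd l"
  shows "realizable l [Cl_Pair (B\<^sub>W l 1) (D\<^sub>W l 3), Cl_Pair (B\<^sub>W l 1) (B\<^sub>W l 1), Cl_Swap, Cl_Swap]"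
  using l assms cycle_type_quadpod122_odd cycle_type_quadpod122'_odd cycle_type_flip1_odd cycle_type_flip2_odd
    quadpod122_generates[unfolded rot_eq]
  by (intro realizable_four_involutions(1)[OF _ quadpod122_permutes[OF l] quadpod122'_permutes[OF l] quadpod122'_involution[OF l] flip_permutes'(2,1) flip_involution
        flips_word[OF quadpod122_word[OF l]] squares_neq_id(4)]) simp_all

end

section \<open>Rows with a twisted transposition, from cut tripods\<close>

lemma comp_square_cyc3_neq_id:
  assumes "distinct [a, b, c]"
  shows "(transpose a b \<circ> transpose a c) \<circ> (transpose a b \<circ> transpose a c) \<noteq> id"
proof -
  have "((transpose a b \<circ> transpose a c) \<circ> (transpose a b \<circ> transpose a c)) a = b"
    using assms by (auto simp: transpose_def)
  then show ?thesis using assms by (metis distinct_length_2_or_more id_apply)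
qed

lemma disjoint_transpositions_square:
  assumes "distinct [a, b, c, d]"
  shows "(transpose a b \<circ> transpose c d) \<circ> (transpose a b \<circ> transpose c d) = id"
  using assms by (auto simp: fun_eq_iff transpose_def)

text \<open>
  The square of the product is a 3-cycle in the first coordinate and trivial in the second.
\<close>

lemma transposition_pairs_kernel_nontrivial:
  assumes G: "perm_group G" and mem: "map_prod (transpose a b) (transpose x y) \<in> G"
      "map_prod (transpose a c) (transpose z w) \<in> G"
    and d: "distinct [a, b, c]"
    and sq: "(transpose x y \<circ> transpose z w) \<circ> (transpose x y \<circ> transpose z w) = id"
    and S: "{a, b, c} \<subseteq> {1..l}"
  shows "kernel_nontrivial l G"
proof -
  let ?f = "transpose a b \<circ> transpose a c" and ?g = "transpose x y \<circ> transpose z w"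
  have "map_prod ?f ?g \<in> G" by (rule map_prod_comp_mem[OF G mem])
  from map_prod_comp_mem[OF G this this] have "map_prod (?f \<circ> ?f) id \<in> G"
    unfolding sq .
  moreover have f: "?f permutes {1..l}" using S by (intro double_transposition_permutes) auto
  have "?f \<circ> ?f permutes {1..l}" by (rule permutes_compose[OF f f])
  ultimately show ?thesis using comp_square_cyc3_neq_id[OF d] by (blast intro: kernel_nontrivialI)
qed

context
  fixes l :: nat assumes l: "l \<ge> 9"
begin

lemma tripod12_cut_eq: "tripod12_cut l = transpose 1 2 \<circ> tripod12 l"
proof
  fix x
  consider "x = 0" | "l < x" | "x = 1" | "x = 2" | "x = 3" | "x = 4" | "5 \<le> x" "x \<le> l" by linarith
  then show "tripod12_cut l x = (transpose 1 2 \<circ> tripod12 l) x"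
    by cases (use l in \<open>auto simp del: One_nat_def simp: tripod12_cut_simps tripod12_simps transpose_def\<close>)
qed

text \<open>The word of the uncut tripod is trivial, so the transposition that cuts it is all that
  remains.\<close>

lemma tripod12_cut_word: "tripod12_cut l \<circ> rot l \<circ> tripod12' l = transpose 1 2"
proof -
  have "tripod12_cut l \<circ> rot l \<circ> tripod12' l = transpose 1 2 \<circ> (tripod12 l \<circ> rot l \<circ> tripod12' l)"
    by (simp only: tripod12_cut_eq comp_assoc)
  then show ?thesis by (simp only: tripod12_word[OF l] comp_id)
qed

lemma involution_inv: "f \<circ> f = id \<Longrightarrow> inv' f = f"
  by (rule inv_unique_comp)

lemma tripod12'_conj: "tripod12' l \<circ> transpose 1 2 \<circ> tripod12' l = transpose 1 3"
  using conj_transpose[OF permutes_bij[OF tripod12'_permutes[OF l]], of 1 2]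
  by (simp add: involution_inv[OF tripod12'_involution[OF l]] tripod12'_simps[OF l] del: One_nat_def)

lemma tripod12_cut_realizable:
  assumes c: "pair_symbol l (tripod12_cut l) (tripod12' l) C"
  shows "realizable l [Cl_Twisted (L\<^sub>W l), Cl_Twisted (\<tau>\<^sub>W l), C]"
proof -
  have r: "rot l permutes {1..l}" using l by (intro rot_permutes) simp
  have "realizable l [C, Cl_Twisted (L\<^sub>W l), Cl_Twisted (\<tau>\<^sub>W l)]"
  proof (rule realizable_pair_twisted_twisted[OF _ tripod12_cut_permutes[OF l] tripod12'_permutes[OF l] r c])
    show "twisted_symbol l (rot l) (Cl_Twisted (L\<^sub>W l))" using l by (simp add: cycle_type_rot)
    show "twisted_symbol l (tripod12_cut l \<circ> rot l \<circ> tripod12' l) (Cl_Twisted (\<tau>\<^sub>W l))"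
      unfolding tripod12_cut_word using l by (simp add: cycle_type_transpose)
    fix H assume H: "perm_group H" "tripod12_cut l \<in> H" "tripod12' l \<in> H" "rot l \<in> H"
    have "tripod12_cut l \<circ> rot l \<circ> tripod12' l \<in> H" by (intro perm_group.comp_mem[OF H(1)] H)
    then have "transpose 1 (Suc 1) \<in> H" unfolding tripod12_cut_word by (simp add: numeral_2_eq_2)
    then show "carrier (alt_group l) \<subseteq> H" using alt_group_subset_rot_transpose[OF H(1,4)] l by simp
  next
    fix G assume G: "perm_group G" "map_prod (rot l) (rot l) \<in> G"
      "map_prod (tripod12_cut l \<circ> rot l \<circ> tripod12' l)
        (tripod12' l \<circ> (tripod12_cut l \<circ> rot l \<circ> tripod12' l) \<circ> inv' (tripod12' l)) \<in> G"
    \<comment> \<open>((1 2), (1 3)) and its shift ((2 3), (2 4)) multiply to a 3-cycle in the first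
      coordinate and to disjoint transpositions in the second.\<close>
    then have m: "map_prod (transpose 1 2) (transpose 1 3) \<in> G"
      unfolding tripod12_cut_word involution_inv[OF tripod12'_involution[OF l]] tripod12'_conj by simp
    have v: "rot l 1 = 2" "rot l 2 = 3" "rot l 3 = 4" using l by (auto simp: rot_def)
    have "map_prod (transpose 2 3) (transpose 2 4) \<in> G"
      using map_prod_conj_mem[OF G(1,2) m] unfolding conj_transpose[OF permutes_bij[OF r]] v .
    moreover have "map_prod (transpose 2 1) (transpose 1 3) \<in> G" using m by (simp add: transpose_commute)
    ultimately show "kernel_nontrivial l G"
      using transposition_pairs_kernel_nontrivial[OF G(1), of 2 3 2 4 1 1 3 l] l disjoint_transpositions_square[of "2 :: nat" 4 1 3] by simp
  qed (use l in simp)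
  then show ?thesis by (rule realizable_cong[THEN iffD1, rotated]) simp
qed

lemma row_I2_1b:
  assumes "odd l"
  shows "realizable l [Cl_Twisted (L\<^sub>W l), Cl_Twisted (\<tau>\<^sub>W l), Cl_Pair (B\<^sub>W l 3) (B\<^sub>W l 1)]"
  using assms l by (intro tripod12_cut_realizable) (simp add: cycle_type_tripod12_cut_odd cycle_type_tripod12'_odd)

lemma row_I2_2a:
  assumes "even l"
  shows "realizable l [Cl_Twisted (L\<^sub>W l), Cl_Twisted (\<tau>\<^sub>W l), Cl_Pair (B\<^sub>W l 2) (B\<^sub>W l 2)]"
  using assms l by (intro tripod12_cut_realizable) (simp add: cycle_type_tripod12_cut_even cycle_type_tripod12'_even)

lemma refl3_flip: "refl3 l \<circ> flip l 2 = rot l"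
proof
  fix x
  consider "x = 0" | "l < x" | "x = 1" | "x = l" | "2 \<le> x" "x < l" by linarith
  then show "(refl3 l \<circ> flip l 2) x = rot l x"
    by cases (use l in \<open>auto simp del: One_nat_def simp: refl3_simps rot_def flip_def\<close>)
qed

text \<open>\<open>refl3\<close> is conjugated by P so that in the word Q p2 P F the inner copies of
  P cancel and \<open>refl3\<close> meets F, forming the rotation. What is left is the word of the
  cut tripod conjugated by Q, the transposition (1 3).\<close>

lemma refl3_conj_realizable:
  assumes c: "pair_symbol l (tripod12' l) (tripod12_cut l) C1"
      "pair_symbol l (refl3 l) (flip l 2) C2"
  shows "realizable l [C1, C2, Cl_Swap, Cl_Twisted (\<tau>\<^sub>W l)]"
proof -
  let ?P = "tripod12_cut l" and ?Q = "tripod12' l" and ?F = "flip l 2"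
  have P: "?P permutes {1..l}" and Q: "?Q permutes {1..l}" and R: "refl3 l permutes {1..l}"
    and F: "?F permutes {1..l}"
    using tripod12_cut_permutes[OF l] tripod12'_permutes[OF l] refl3_permutes[OF l] flip_permutes[of 2 l] by simp_all
  have PP: "?P \<circ> ?P = id" and QQ: "?Q \<circ> ?Q = id" and FF: "?F \<circ> ?F = id"
    using tripod12_cut_involution[OF l] tripod12'_involution[OF l] flip_involution[OF l, of 2] by simp_all
  note inv = involution_inv[OF PP] involution_inv[OF QQ] involution_inv[OF FF]
  define p2 where "p2 = ?P \<circ> refl3 l \<circ> inv' ?P"
  have p2: "p2 permutes {1..l}"
    unfolding p2_def by (rule permutes_compose[OF permutes_inv[OF P] permutes_compose[OF R P]])
  have word: "?Q \<circ> p2 \<circ> (?P \<circ> ?F) = transpose 1 3"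
  proof -
    have "?Q \<circ> p2 \<circ> (?P \<circ> ?F) = ?Q \<circ> ?P \<circ> refl3 l \<circ> (?P \<circ> ?P) \<circ> ?F" by (simp only: p2_def inv comp_assoc)
    also have "\<dots> = ?Q \<circ> (?P \<circ> rot l)" by (simp only: PP refl3_flip[symmetric] comp_id comp_assoc)
    also have "\<dots> = ?Q \<circ> (?P \<circ> rot l \<circ> ?Q) \<circ> ?Q" by (simp only: QQ comp_id comp_assoc)
    finally show ?thesis by (simp only: tripod12_cut_word tripod12'_conj)
  qed
  have dual: "?P \<circ> ?F \<circ> (?Q \<circ> p2) = transpose 4 6"
  proof -
    have bij: "bij (?P \<circ> ?F)" using P F by (intro bij_comp permutes_bij)
    have "(?P \<circ> ?F) \<circ> (?Q \<circ> p2 \<circ> (?P \<circ> ?F)) = ?P \<circ> ?F \<circ> (?Q \<circ> p2) \<circ> (?P \<circ> ?F)" by (simp only: comp_assoc)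
    then have "(?P \<circ> ?F) \<circ> (?Q \<circ> p2 \<circ> (?P \<circ> ?F)) \<circ> inv' (?P \<circ> ?F) = ?P \<circ> ?F \<circ> (?Q \<circ> p2)"
      by (rule conj_eqI[OF bij])
    then have "?P \<circ> ?F \<circ> (?Q \<circ> p2) = transpose ((?P \<circ> ?F) 1) ((?P \<circ> ?F) 3)"
      unfolding word conj_transpose[OF bij] by simp
    moreover have "?F 1 = 1" "?F 3 = l - 1" "?P (l - 1) = 6" using l by (auto simp: flip_def tripod12_cut_simps)
    ultimately show ?thesis using tripod12_cut_simps(1)[OF l] by (simp del: One_nat_def)
  qed
  show ?thesis
  proof (rule realizable_pair_pair_swap_twisted[OF _ Q P p2 F c(1)])
    show "pair_symbol l p2 ?F C2" unfolding p2_def using c(2) cycle_type_conj[OF P R] by (cases C2) auto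
    show "twisted_symbol l (?Q \<circ> p2 \<circ> (?P \<circ> ?F)) (Cl_Twisted (\<tau>\<^sub>W l))"
      unfolding word using l by (simp add: cycle_type_transpose)
    fix H assume H: "perm_group H" "?Q \<in> H" "?P \<in> H" "p2 \<in> H" "?F \<in> H"
    interpret perm_group H by fact
    have "?P \<circ> p2 \<circ> ?P \<circ> ?F \<in> H" by (intro comp_mem H)
    moreover have "?P \<circ> p2 \<circ> ?P \<circ> ?F = (?P \<circ> ?P) \<circ> refl3 l \<circ> (?P \<circ> ?P) \<circ> ?F" by (simp only: p2_def inv comp_assoc)
    ultimately have rot: "rot l \<in> H" by (simp only: PP id_comp comp_id refl3_flip)
    have "?P \<circ> rot l \<circ> ?Q \<in> H" by (intro comp_mem H rot)
    then have "transpose 1 (Suc 1) \<in> H" unfolding tripod12_cut_word by (simp add: numeral_2_eq_2)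
    then show "carrier (alt_group l) \<subseteq> H" using alt_group_subset_rot_transpose[OF H(1) rot] l by simp
  next
    fix G assume G: "perm_group G" "map_prod ?Q ?P \<in> G"
      "map_prod (?Q \<circ> p2 \<circ> (?P \<circ> ?F)) (?P \<circ> ?F \<circ> (?Q \<circ> p2)) \<in> G"
    have m: "map_prod (transpose 1 3) (transpose 4 6) \<in> G" using G(3) unfolding word dual .
    \<comment> \<open>Conjugating ((1 3), (4 6)) by (Q, P) gives ((1 2), (1 l-1)). The first
      coordinates share the point 1, the second coordinates are disjoint.\<close>
    have v: "?Q 1 = 1" "?Q 3 = 2" "?P 4 = 1" "?P 6 = l - 1"
      using l by (auto simp del: One_nat_def simp: tripod12'_simps tripod12_cut_simps)
    have "map_prod (transpose 1 2) (transpose 1 (l - 1)) \<in> G"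
      using map_prod_conj_mem[OF G(1,2) m] unfolding conj_transpose[OF permutes_bij[OF P]] conj_transpose[OF permutes_bij[OF Q]] v .
    moreover have "distinct [1, l - 1, 4, 6]" using l by auto
    ultimately show "kernel_nontrivial l G"
      using transposition_pairs_kernel_nontrivial[OF G(1), of 1 2 1 "l - 1" 3 4 6 l] m l
        disjoint_transpositions_square[of 1 "l - 1" 4 6] by simp
  qed (use l in simp)
qed

lemma row_F1A_1a:
  assumes "even l"
  shows "realizable l [Cl_Pair (B\<^sub>W l 2) (B\<^sub>W l 0), Cl_Pair (B\<^sub>W l 2) (B\<^sub>W l 2), Cl_Twisted (\<tau>\<^sub>W l), Cl_Swap]"
proof -
  have "realizable l [Cl_Pair (B\<^sub>W l 2) (B\<^sub>W l 2), Cl_Pair (B\<^sub>W l 2) (B\<^sub>W l 0), Cl_Swap, Cl_Twisted (\<tau>\<^sub>W l)]"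
    using assms l by (intro refl3_conj_realizable) (simp_all add: cycle_type_tripod12_cut_even cycle_type_tripod12'_even
      cycle_type_refl3_even cycle_type_flip2_even)
  then show ?thesis by (rule realizable_cong[THEN iffD1, rotated]) simp
qed

lemma row_F1A_2a:
  assumes "odd l"
  shows "realizable l [Cl_Pair (B\<^sub>W l 1) (B\<^sub>W l 3), Cl_Pair (B\<^sub>W l 1) (B\<^sub>W l 1), Cl_Twisted (\<tau>\<^sub>W l), Cl_Swap]"
proof -
  have "realizable l [Cl_Pair (B\<^sub>W l 1) (B\<^sub>W l 3), Cl_Pair (B\<^sub>W l 1) (B\<^sub>W l 1), Cl_Swap, Cl_Twisted (\<tau>\<^sub>W l)]"
    using assms l by (intro refl3_conj_realizable) (simp_all add: cycle_type_tripod12_cut_odd cycle_type_tripod12'_odd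
      cycle_type_refl3_odd cycle_type_flip2_odd)
  then show ?thesis by (rule realizable_cong[THEN iffD1, rotated]) simp
qed

end

section \<open>Reflections with two long cycles\<close>

lemma equal_or_disjoint_transpositions_square:
  assumes "x \<noteq> y" "z \<noteq> w" "{x, y} = {z, w} \<or> {x, y} \<inter> {z, w} = {}"
  shows "(transpose x y \<circ> transpose z w) \<circ> (transpose x y \<circ> transpose z w) = id"
proof (cases "{x, y} = {z, w}")
  case True
  then have "transpose z w = transpose x y" by (auto simp: doubleton_eq_iff transpose_commute)
  then show ?thesis by simp
next
  case False
  then show ?thesis using assms by (intro disjoint_transpositions_square) auto
qed

text \<open>The reflection x -> e - x modulo l, with l standing for the residue 0.\<close>

definition reflect :: "nat \<Rightarrow> nat \<Rightarrow> nat \<Rightarrow> nat" where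
  "reflect l e x = (if 1 \<le> x \<and> x < e then e - x else if e \<le> x \<and> x \<le> l then l + e - x else x)"

lemma reflect_simps:
  "\<lbrakk>1 \<le> x; x < e\<rbrakk> \<Longrightarrow> reflect l e x = e - x"
  "\<lbrakk>e \<le> x; x \<le> l\<rbrakk> \<Longrightarrow> reflect l e x = l + e - x"
  "\<lbrakk>x = 0; 1 \<le> e\<rbrakk> \<Longrightarrow> reflect l e x = x" "\<lbrakk>l < x; e \<le> l\<rbrakk> \<Longrightarrow> reflect l e x = x"
  by (simp_all add: reflect_def)

context
  fixes l e :: nat assumes e: "1 \<le> e" "e \<le> l"
begin

lemma reflect_involution: "reflect l e \<circ> reflect l e = id"
proof
  fix x
  consider "x = 0" | "l < x" | "1 \<le> x" "x < e" | "e \<le> x" "x \<le> l" by linarith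
  then show "(reflect l e \<circ> reflect l e) x = id x" by cases (use e in \<open>auto simp: reflect_simps\<close>)
qed

lemma reflect_permutes: "reflect l e permutes {1..l}"
proof (rule permutes_by_inverse)
  fix x :: nat
  show "x \<notin> {1..l} \<Longrightarrow> reflect l e x = x" using e by (cases "x = 0") (simp_all add: reflect_simps)
  show "reflect l e (reflect l e x) = x" using fun_cong[OF reflect_involution, of x] by simp
  show "reflect l e x \<in> {1..l}" if xS: "x \<in> {1..l}"
  proof -
    consider "1 \<le> x" "x < e" | "e \<le> x" "x \<le> l" using xS by fastforce
    then show ?thesis by cases (use e in \<open>auto simp: reflect_simps\<close>)
  qed
qed simp

text \<open>The fixed points solve 2x = e below e, and 2x = l + e from e on.\<close>

lemma card_fixed_reflect:
  "card {x \<in> {1..l}. reflect l e x = x} = (if even e then 1 else 0) + (if even (l + e) then 1 else 0)"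
proof -
  have "{x. 1 \<le> x \<and> x < e \<and> reflect l e x = x} = (if even e then {e div 2} else {})"
  proof -
    have "reflect l e x = x \<longleftrightarrow> 2 * x = e" if "1 \<le> x" "x < e" for x using that by (auto simp: reflect_simps)
    then have "1 \<le> x \<and> x < e \<and> reflect l e x = x \<longleftrightarrow> 2 * x = e" for x using e by auto
    moreover have "2 * x = e \<longleftrightarrow> even e \<and> x = e div 2" for x by auto
    ultimately show ?thesis by auto
  qed
  from card_fixed_points[OF e _ this] show ?thesis by (simp add: reflect_simps split: if_splits)
qed

lemma cycle_type_reflect:
  "cycle_type l (reflect l e) = parts (B\<^sub>W l ((if even e then 1 else 0) + (if even (l + e) then 1 else 0)))"
  using card_fixed_reflect fun_cong[OF reflect_involution] by (intro cycle_type_B reflect_permutes) auto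

end

lemma reflect_rot:
  assumes "1 \<le> e" "e < l" shows "reflect l (Suc e) \<circ> rot l = reflect l e"
proof
  fix x
  consider "x = 0" | "l < x" | "1 \<le> x" "x < e" | "e \<le> x" "x < l" | "x = l" by linarith
  then show "(reflect l (Suc e) \<circ> rot l) x = reflect l e x"
    by cases (use assms in \<open>auto simp: reflect_simps rot_def\<close>)
qed

context
  fixes l a :: nat assumes l: "l \<ge> 9" and a: "parameter_W l a"
begin

lemma parameter_bounds: "1 \<le> a" "0 < a" "2 * a < l" "coprime a l" "a < l"
  using a by (auto simp: parameter_W_def)

lemma two_cycles_permutes': "two_cycles l a permutes {1..l}"
  using two_cycles_permutes parameter_bounds by blast

text \<open>With the uncut rotation between the two flips the word is trivial. The transposition (a
  l) that cuts the rotation therefore survives as its conjugate under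
  \<open>flip l 1\<close>.\<close>

lemma flip2_two_cycles_word: "flip l 2 \<circ> two_cycles l a \<circ> flip l 1 = transpose 1 (l + 1 - a)"
proof -
  have inv: "inv' (flip l 1) = flip l 1" by (rule involution_inv[OF l flip_involution[OF l]])
  have "flip l 2 \<circ> two_cycles l a \<circ> flip l 1 = (flip l 2 \<circ> flip l 2) \<circ> (flip l 1 \<circ> transpose a l \<circ> inv' (flip l 1))"
    by (simp only: two_cycles_eq_rot(1)[OF parameter_bounds(1,5)] rot_eq[OF l] inv comp_assoc)
  also have "\<dots> = transpose (flip l 1 a) (flip l 1 l)"
    by (simp only: flip_involution[OF l] id_comp conj_transpose[OF permutes_bij[OF flip_permutes'(1)[OF l]]])
  finally show ?thesis using parameter_bounds by (simp add: flip_def transpose_commute)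
qed

lemma realizable_flips_two_cycles:
  assumes c: "pair_symbol l (flip l 2) (flip l 1) C"
  shows "realizable l [Cl_Twisted (A\<^sub>W l a), Cl_Twisted (\<tau>\<^sub>W l), C]"
proof -
  let ?p = "flip l 2" and ?q = "flip l 1" and ?U = "two_cycles l a"
  note p = flip_permutes'(2)[OF l] and q = flip_permutes'(1)[OF l]
  have invq: "inv' ?q = ?q" by (rule involution_inv[OF l flip_involution[OF l]])
  have fl: "?q 1 = l" "?q (l + 1 - a) = a" "?p (l + 1 - a) = a + 1" "?p 1 = 1" "?q a = l + 1 - a" "?q l = 1"
    using l parameter_bounds by (auto simp: flip_def)
  have "realizable l [C, Cl_Twisted (A\<^sub>W l a), Cl_Twisted (\<tau>\<^sub>W l)]"
  proof (rule realizable_pair_twisted_twisted[OF _ p q two_cycles_permutes' c])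
    show "twisted_symbol l ?U (Cl_Twisted (A\<^sub>W l a))" using parameter_bounds by (simp add: cycle_type_two_cycles)
    show "twisted_symbol l (?p \<circ> ?U \<circ> ?q) (Cl_Twisted (\<tau>\<^sub>W l))"
    proof -
      have "1 \<in> {1..l}" "l + 1 - a \<in> {1..l}" "1 \<noteq> l + 1 - a" using parameter_bounds by auto
      from cycle_type_transpose[OF this] show ?thesis by (simp only: flip2_two_cycles_word twisted_symbol.simps)
    qed
    fix H assume H: "perm_group H" "?p \<in> H" "?q \<in> H" "?U \<in> H"
    interpret perm_group H by fact
    have "inv' ?q \<circ> (?p \<circ> ?U \<circ> ?q) \<circ> ?q \<in> H" by (intro comp_mem inv_mem H)
    moreover have "inv' ?q \<circ> (?p \<circ> ?U \<circ> ?q) \<circ> ?q = transpose a l"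
    proof -
      have "?q \<circ> transpose 1 (l + 1 - a) \<circ> inv' ?q = transpose l a"
        unfolding conj_transpose[OF permutes_bij[OF q]] fl ..
      then show ?thesis unfolding flip2_two_cycles_word invq by (simp add: transpose_commute)
    qed
    ultimately have "transpose a l \<in> H" by simp
    then show "carrier (alt_group l) \<subseteq> H"
      using alt_group_subset_two_cycles_transpose[OF H(1,4) parameter_bounds(1,3,4), of a l] parameter_bounds l by simp
  next
    fix G assume G: "perm_group G" "map_prod ?p ?q \<in> G"
      "map_prod (?p \<circ> ?U \<circ> ?q) (?q \<circ> (?p \<circ> ?U \<circ> ?q) \<circ> inv' ?q) \<in> G"
    have m: "map_prod (transpose 1 (l + 1 - a)) (transpose l a) \<in> G"
      using G(3) unfolding flip2_two_cycles_word conj_transpose[OF permutes_bij[OF q]] fl .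
    have m': "map_prod (transpose 1 (a + 1)) (transpose 1 (l + 1 - a)) \<in> G"
      using map_prod_conj_mem[OF G(1,2) m]
      unfolding conj_transpose[OF permutes_bij[OF q]] conj_transpose[OF permutes_bij[OF p]] fl .
    \<comment> \<open>For a = 1 the two transpositions coincide, otherwise they are disjoint; in
      both cases their product squares to the identity.\<close>
    have "{l, a} = {1, l + 1 - a} \<or> {l, a} \<inter> {1, l + 1 - a} = {}"
      using parameter_bounds l by (cases "a = 1") auto
    then have "(transpose l a \<circ> transpose 1 (l + 1 - a)) \<circ> (transpose l a \<circ> transpose 1 (l + 1 - a)) = id"
      using parameter_bounds by (intro equal_or_disjoint_transpositions_square) auto
    moreover have "distinct [1, l + 1 - a, a + 1]" "{1, l + 1 - a, a + 1} \<subseteq> {1..l}" using parameter_bounds by auto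
    ultimately show "kernel_nontrivial l G"
      by (intro transposition_pairs_kernel_nontrivial[OF G(1) m m'])
  qed (use l in simp)
  then show ?thesis by (rule realizable_cong[THEN iffD1, rotated]) simp
qed

lemma row_I2_9a:
  assumes "even l"
  shows "realizable l [Cl_Twisted (A\<^sub>W l a), Cl_Twisted (\<tau>\<^sub>W l), Cl_Pair (B\<^sub>W l 2) (B\<^sub>W l 0)]"
  using assms l by (intro realizable_flips_two_cycles) (simp add: cycle_type_flip2_even cycle_type_flip1_even del: One_nat_def)

lemma row_I2_10b:
  assumes "odd l"
  shows "realizable l [Cl_Twisted (A\<^sub>W l a), Cl_Twisted (\<tau>\<^sub>W l), Cl_Pair (B\<^sub>W l 1) (B\<^sub>W l 1)]"
  using assms l by (intro realizable_flips_two_cycles) (simp add: cycle_type_flip2_odd cycle_type_flip1_odd del: One_nat_def)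

text \<open>Absorbing the leftover transposition (1 l+1-a) into \<open>flip l 2\<close> makes the
  word trivial. It joins the fixed point 1 of the reflection to the exchanged points l + 1 - a and a
  + 1, producing a 3-cycle.\<close>

definition bent :: "nat \<Rightarrow> nat" where "bent = transpose 1 (l + 1 - a) \<circ> flip l 2"

lemma bent_permutes: "bent permutes {1..l}"
  unfolding bent_def using parameter_bounds by (intro permutes_compose[OF flip_permutes'(2)[OF l]] permutes_swap_id) auto

lemma bent_simps: "bent 1 = l + 1 - a" "bent (l + 1 - a) = a + 1" "bent (a + 1) = 1"
  "x \<notin> {1, l + 1 - a, a + 1} \<Longrightarrow> bent x = flip l 2 x"
  using parameter_bounds by (auto simp: bent_def flip_def transpose_def)

lemma bent_word: "bent \<circ> two_cycles l a \<circ> flip l 1 = id"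
proof -
  have "bent \<circ> two_cycles l a \<circ> flip l 1 = transpose 1 (l + 1 - a) \<circ> (flip l 2 \<circ> two_cycles l a \<circ> flip l 1)"
    by (simp only: bent_def comp_assoc)
  then show ?thesis unfolding flip2_two_cycles_word by simp
qed

lemma bent_distinct: "distinct [1, l + 1 - a, a + 1]" "{1, l + 1 - a, a + 1} \<subseteq> {1..l}"
  using parameter_bounds by auto

lemma card_fixed_bent: "card {x \<in> {1..l}. bent x = x} = (if even l then 1 else 0)"
proof -
  have "bent x = x \<longleftrightarrow> flip l 2 x = x \<and> x \<noteq> 1" if "x \<in> {1..l}" for x
  proof (cases "x \<in> {1, l + 1 - a, a + 1}")
    case True
    moreover have "flip l 2 (l + 1 - a) = a + 1" "flip l 2 (a + 1) = l + 1 - a" using parameter_bounds by (auto simp: flip_def)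
    ultimately show ?thesis using bent_simps(1-3) bent_distinct(1) by (elim insertE emptyE) auto
  qed (auto simp: bent_simps(4))
  then have "{x \<in> {1..l}. bent x = x} = {x \<in> {1..l}. flip l 2 x = x} - {1}" by blast
  moreover have "1 \<in> {x \<in> {1..l}. flip l 2 x = x}" using l by (simp add: flip_def)
  ultimately show ?thesis using card_fixed_flip(2)[OF l] by simp
qed

lemma cycle_type_bent: "cycle_type l bent = parts (C\<^sub>W l (if even l then 1 else 0))"
proof (rule cycle_type_C[OF bent_permutes bent_distinct bent_simps(1-3) _ card_fixed_bent])
  fix x assume x: "x \<in> {1..l} - {1, l + 1 - a, a + 1}"
  have "flip l 2 x \<notin> {1, l + 1 - a, a + 1}"
  proof
    assume "flip l 2 x \<in> {1, l + 1 - a, a + 1}"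
    then have "flip l 2 (flip l 2 x) \<in> {1, l + 1 - a, a + 1}" using parameter_bounds by (auto simp: flip_def)
    then show False using x by (simp only: flip_flip) blast
  qed
  then show "bent (bent x) = x" using x bent_simps(4) flip_flip[of l 2 x] by simp
qed

lemma row_I2_14_15: "pair_symbol l bent (flip l 1) C \<Longrightarrow> realizable l [Cl_Twisted (A\<^sub>W l a), Cl_Swap, C]"
proof (rule realizable_spider[OF _ bent_permutes flip_permutes'(1)[OF l] flip_involution[OF l] two_cycles_permutes' bent_word])
  show "twisted_symbol l (two_cycles l a) (Cl_Twisted (A\<^sub>W l a))" using parameter_bounds by (simp add: cycle_type_two_cycles)
  have b: "(bent \<circ> bent) 1 = a + 1" by (simp add: bent_simps del: One_nat_def)
  then show "bent \<circ> bent \<noteq> id" using parameter_bounds by (metis id_apply add_right_cancel add_0 less_numeral_extra(3))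
  fix H assume H: "perm_group H" "bent \<in> H" "two_cycles l a \<in> H"
  interpret perm_group H by fact
  have d: "distinct [1, a + 1, l + 1 - a]" using bent_distinct(1) by auto
  have "cyc3 1 (a + 1) (l + 1 - a) = bent \<circ> bent"
  proof
    fix x
    show "cyc3 1 (a + 1) (l + 1 - a) x = (bent \<circ> bent) x"
    proof (cases "x \<in> {1, a + 1, l + 1 - a}")
      case True
      then show ?thesis by (elim insertE emptyE) (simp_all add: cyc3_apply(1-3)[OF d] bent_simps(1-3) del: One_nat_def)
    next
      case False
      have "bent (bent x) = x"
      proof (cases "x \<in> {1..l}")
        case True
        have "flip l 2 x \<notin> {1, l + 1 - a, a + 1}"
        proof
          assume "flip l 2 x \<in> {1, l + 1 - a, a + 1}"
          then have "flip l 2 (flip l 2 x) \<in> {1, l + 1 - a, a + 1}" using parameter_bounds by (auto simp: flip_def)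
          then show False using False by (simp only: flip_flip) blast
        qed
        then show ?thesis using False bent_simps(4) flip_flip[of l 2 x] by simp
      next
        case nS: False
        show ?thesis using permutes_not_in[OF bent_permutes nS] by simp
      qed
      then show ?thesis using cyc3_apply(4)[OF d False] by simp
    qed
  qed
  then have "cyc3 1 (a + 1) (l + 1 - a) \<in> H" using comp_mem[OF H(2,2)] by simp
  \<comment> \<open>1 and a + 1 lie in different cycles of \<open>two_cycles l a\<close>, so this
    one relation is enough.\<close>
  then have "tri H 1 (a + 1)" using triI(1)[OF d] by simp
  then show "carrier (alt_group l) \<subseteq> H"
    using alt_group_subset_two_cycles[OF H(1,3) parameter_bounds(1,5,4), of 1 "a + 1"] parameter_bounds by simp
qed (use l in simp_all)

lemma row_I2_14:
  "odd l \<Longrightarrow> realizable l [Cl_Twisted (A\<^sub>W l a), Cl_Swap, Cl_Pair (C\<^sub>W l 0) (B\<^sub>W l 1)]"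
  using l by (intro row_I2_14_15) (simp add: cycle_type_bent cycle_type_flip1_odd del: One_nat_def)

lemma row_I2_15:
  "even l \<Longrightarrow> realizable l [Cl_Twisted (A\<^sub>W l a), Cl_Swap, Cl_Pair (C\<^sub>W l 1) (B\<^sub>W l 0)]"
  using l by (intro row_I2_14_15) (simp add: cycle_type_bent cycle_type_flip1_even del: One_nat_def)

end

section \<open>Rows with a 4-cycle and two long cycles\<close>

context
  fixes l a k :: nat
  assumes l: "l \<ge> 9" and a: "parameter_W l a"
    and k: "usable_shift a k"
begin

lemma shift_bounds: "1 < k" "k \<noteq> a + 1" "k + a < l"
  using k a l by (auto simp: parameter_W_def usable_shift_def)

text \<open>The reflection x -> k + a + 1 - x exchanges 1 with k + a, and k with a + 1; the
  transposition (k k+a) joins these two pairs into a 4-cycle. It is the transposition left over when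
  the cut rotation stands between the reflections with parameters k + a + 1 and k + a.\<close>

definition crossed :: "nat \<Rightarrow> nat" where
  "crossed = transpose k (k + a) \<circ> reflect l (Suc (k + a))"

lemma reflect_values: "reflect l (Suc (k + a)) 1 = k + a" "reflect l (Suc (k + a)) (k + a) = 1"
  "reflect l (Suc (k + a)) k = a + 1" "reflect l (Suc (k + a)) (a + 1) = k"
  "reflect l (k + a) a = k" "reflect l (k + a) l = k + a"
  using shift_bounds parameter_bounds[OF l a] by (auto simp: reflect_def)

lemma crossed_distinct: "distinct [k, a + 1, k + a, 1]" "{k, a + 1, k + a, 1} \<subseteq> {1..l}"
  using shift_bounds parameter_bounds[OF l a] by auto

lemma crossed_simps: "crossed k = a + 1" "crossed (a + 1) = k + a" "crossed (k + a) = 1" "crossed 1 = k"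
  using crossed_distinct(1) unfolding crossed_def o_apply reflect_values by (auto simp: transpose_def)

lemma reflect_permutes': "reflect l (Suc (k + a)) permutes {1..l}" "reflect l (k + a) permutes {1..l}"
  using shift_bounds by (intro reflect_permutes; simp)+

lemma reflect_refl: "reflect l (Suc (k + a)) (reflect l (Suc (k + a)) x) = x"
  using fun_cong[OF reflect_involution[of "Suc (k + a)" l], of x] shift_bounds by simp

lemma reflect_other:
  "x \<notin> {k, a + 1, k + a, 1} \<Longrightarrow> reflect l (Suc (k + a)) x \<notin> {k, a + 1, k + a, 1}"
  using reflect_refl[of x] reflect_values by (metis insert_iff empty_iff)

lemma crossed_other: "x \<notin> {k, a + 1, k + a, 1} \<Longrightarrow> crossed x = reflect l (Suc (k + a)) x"
  using reflect_other[of x] by (auto simp: crossed_def transpose_def)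

lemma crossed_permutes: "crossed permutes {1..l}"
  unfolding crossed_def using shift_bounds by (intro permutes_compose[OF reflect_permutes'(1)] permutes_swap_id) auto

lemma crossed_word: "crossed \<circ> two_cycles l a \<circ> reflect l (k + a) = id"
proof -
  have inv: "inv' (reflect l (k + a)) = reflect l (k + a)"
    using shift_bounds by (intro involution_inv[OF l] reflect_involution) auto
  have "crossed \<circ> two_cycles l a \<circ> reflect l (k + a) =
      transpose k (k + a) \<circ> ((reflect l (Suc (k + a)) \<circ> rot l) \<circ> transpose a l \<circ> reflect l (k + a))"
    by (simp only: crossed_def two_cycles_eq_rot(1)[OF parameter_bounds(1,5)[OF l a]] comp_assoc)
  also have "reflect l (Suc (k + a)) \<circ> rot l = reflect l (k + a)" using shift_bounds by (intro reflect_rot) auto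
  also have "reflect l (k + a) \<circ> transpose a l \<circ> reflect l (k + a) = transpose k (k + a)"
    using conj_transpose[OF permutes_bij[OF reflect_permutes'(2)], of a l] unfolding inv reflect_values .
  finally show ?thesis by (simp only: transpose_comp_involutory)
qed

text \<open>The square of the 4-cycle k -> a + 1 -> k + a -> 1 -> k; at all other points the
  permutation is an involution.\<close>

lemma crossed_square: "crossed \<circ> crossed = transpose 1 (a + 1) \<circ> transpose k (k + a)"
proof
  fix x
  show "(crossed \<circ> crossed) x = (transpose 1 (a + 1) \<circ> transpose k (k + a)) x"
  proof (cases "x \<in> {k, a + 1, k + a, 1}")
    case True
    then show ?thesis using crossed_distinct(1)
      by (elim insertE emptyE) (auto simp: crossed_simps transpose_def simp del: One_nat_def)
  next
    case False
    then show ?thesis using crossed_other[OF False] crossed_other[OF reflect_other[OF False]] reflect_refl[of x]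
      by (simp add: transpose_def del: One_nat_def)
  qed
qed

lemma card_fixed_crossed:
  "card {x \<in> {1..l}. crossed x = x} = (if even (Suc (k + a)) then 1 else 0) + (if even (l + Suc (k + a)) then 1 else 0)"
proof -
  have "crossed x = x \<longleftrightarrow> reflect l (Suc (k + a)) x = x" for x
  proof (cases "x \<in> {k, a + 1, k + a, 1}")
    case True
    then show ?thesis using crossed_distinct(1) reflect_values crossed_simps by (elim insertE emptyE) auto
  qed (simp add: crossed_other)
  then show ?thesis using card_fixed_reflect[of "Suc (k + a)" l] shift_bounds by simp
qed

lemma cycle_type_crossed:
  "cycle_type l crossed = parts (D\<^sub>W l ((if even (Suc (k + a)) then 1 else 0) + (if even (l + Suc (k + a)) then 1 else 0)))"
proof (rule cycle_type_D[OF crossed_permutes crossed_distinct crossed_simps _ card_fixed_crossed])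
  fix x assume "x \<in> {1..l} - {k, a + 1, k + a, 1}"
  then have x: "x \<notin> {k, a + 1, k + a, 1}" by blast
  then show "crossed (crossed x) = x"
    using crossed_other[OF x] crossed_other[OF reflect_other[OF x]] reflect_refl by simp
qed

lemma cycle_type_reflect_crossed:
  "cycle_type l (reflect l (k + a)) = parts (B\<^sub>W l ((if even (k + a) then 1 else 0) + (if even (l + (k + a)) then 1 else 0)))"
  using shift_bounds by (intro cycle_type_reflect) auto

lemma cycle_types_odd:
  assumes "odd l"
  shows "cycle_type l crossed = parts (D\<^sub>W l 1)" "cycle_type l (reflect l (k + a)) = parts (B\<^sub>W l 1)"
proof -
  have "(if even (Suc (k + a)) then 1 else 0) + (if even (l + Suc (k + a)) then 1 else 0) = (1 :: nat)"
    "(if even (k + a) then 1 else 0) + (if even (l + (k + a)) then 1 else 0) = (1 :: nat)"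
    using assms by auto
  then show "cycle_type l crossed = parts (D\<^sub>W l 1)" "cycle_type l (reflect l (k + a)) = parts (B\<^sub>W l 1)"
    unfolding cycle_type_crossed cycle_type_reflect_crossed by (simp_all only:)
qed

text \<open>For even l each of the two permutations has 0 or 2 fixed points, according to the parity
  of k + a. So the parity of k selects between the rows with (D_2, B_0) and with (D_0, B_2).\<close>

lemma cycle_types_even_odd:
  assumes "even l" "odd (k + a)"
  shows "cycle_type l crossed = parts (D\<^sub>W l 2)" "cycle_type l (reflect l (k + a)) = parts (B\<^sub>W l 0)"
proof -
  have "(if even (Suc (k + a)) then 1 else 0) + (if even (l + Suc (k + a)) then 1 else 0) = (2 :: nat)"
    "(if even (k + a) then 1 else 0) + (if even (l + (k + a)) then 1 else 0) = (0 :: nat)"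
    using assms by auto
  then show "cycle_type l crossed = parts (D\<^sub>W l 2)" "cycle_type l (reflect l (k + a)) = parts (B\<^sub>W l 0)"
    unfolding cycle_type_crossed cycle_type_reflect_crossed by (simp_all only:)
qed

lemma cycle_types_even_even:
  assumes "even l" "even (k + a)"
  shows "cycle_type l crossed = parts (D\<^sub>W l 0)" "cycle_type l (reflect l (k + a)) = parts (B\<^sub>W l 2)"
proof -
  have "(if even (Suc (k + a)) then 1 else 0) + (if even (l + Suc (k + a)) then 1 else 0) = (0 :: nat)"
    "(if even (k + a) then 1 else 0) + (if even (l + (k + a)) then 1 else 0) = (2 :: nat)"
    using assms by auto
  then show "cycle_type l crossed = parts (D\<^sub>W l 0)" "cycle_type l (reflect l (k + a)) = parts (B\<^sub>W l 2)"
    unfolding cycle_type_crossed cycle_type_reflect_crossed by (simp_all only:)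
qed

lemma crossed_square_neq_id: "crossed \<circ> crossed \<noteq> id"
  unfolding crossed_square using crossed_distinct(1) by (intro double_transposition_neq_id) auto

lemma crossed_generates:
  assumes H: "perm_group H" "crossed \<in> H" "two_cycles l a \<in> H"
  shows "carrier (alt_group l) \<subseteq> H"
proof -
  have "transpose 1 (a + 1) \<circ> transpose k (k + a) \<in> H"
    using perm_group.comp_mem[OF H(1,2,2)] unfolding crossed_square .
  then show ?thesis
    using alt_group_subset_two_cycles_double_transposition[OF l H(1,3) parameter_bounds(1,3,4)[OF l a] _ k] by blast
qed

lemma crossed_realizable:
  assumes "pair_symbol l crossed (reflect l (k + a)) C"
  shows "realizable l [Cl_Twisted (A\<^sub>W l a), Cl_Swap, C]"
proof (rule realizable_spider[OF _ crossed_permutes reflect_permutes'(2) _ two_cycles_permutes'[OF l a] crossed_word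
      crossed_square_neq_id assms])
  show "reflect l (k + a) \<circ> reflect l (k + a) = id" using shift_bounds by (intro reflect_involution) auto
  show "twisted_symbol l (two_cycles l a) (Cl_Twisted (A\<^sub>W l a))"
    using parameter_bounds[OF l a] by (simp add: cycle_type_two_cycles)
qed (use l crossed_generates in auto)

end

lemma row_I2_11_12:
  assumes l: "l \<ge> 9" and a: "parameter_W l a"
  shows "odd l \<Longrightarrow> realizable l [Cl_Twisted (A\<^sub>W l a), Cl_Swap, Cl_Pair (D\<^sub>W l 1) (B\<^sub>W l 1)]"
    and "even l \<Longrightarrow> realizable l [Cl_Twisted (A\<^sub>W l a), Cl_Swap, Cl_Pair (D\<^sub>W l 2) (B\<^sub>W l 0)]"
proof -
  \<comment> \<open>Even l forces a to be odd, and then k has to be even: 2, or 4 when a = 1. The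
    value 5 occurs only for a = 2, where l is odd and every usable k gives (D_1, B_1).\<close>
  define k where "k = (if a \<ge> 3 then 2 else if a = 1 then 4 else 5 :: nat)"
  have k: "usable_shift a k"
    using a by (auto simp: k_def parameter_W_def usable_shift_def)
  show "realizable l [Cl_Twisted (A\<^sub>W l a), Cl_Swap, Cl_Pair (D\<^sub>W l 1) (B\<^sub>W l 1)]" if "odd l"
    by (rule crossed_realizable[OF l a k]) (simp only: pair_symbol.simps cycle_types_odd[OF l a k that] simp_thms)
  show "realizable l [Cl_Twisted (A\<^sub>W l a), Cl_Swap, Cl_Pair (D\<^sub>W l 2) (B\<^sub>W l 0)]" if "even l"
  proof (rule crossed_realizable[OF l a k])
    have "odd a" using a that by (auto simp: parameter_W_def)
    then have "odd (k + a)" by (auto simp: k_def elim: oddE)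
    then show "pair_symbol l (crossed l a k) (reflect l (k + a)) (Cl_Pair (D\<^sub>W l 2) (B\<^sub>W l 0))"
      by (simp only: pair_symbol.simps cycle_types_even_odd[OF l a k that] simp_thms)
  qed
qed

text \<open>The values 2 and 4 of a, for which the shift 3 is excluded, cannot occur when l is even;
  and since a is odd, the shift 3 makes k + a even.\<close>

lemma odd_parameter_usable_shift_3:
  assumes "parameter_W l a" "even l"
  shows "odd a" "usable_shift a 3"
proof -
  show "odd a" using assms by (auto simp: parameter_W_def)
  then have "a \<noteq> 4" "a \<noteq> 2" by auto
  moreover have "0 < a" using assms(1) by (simp add: parameter_W_def)
  ultimately show "usable_shift a 3" by (auto simp: usable_shift_def)
qed

lemma row_I2_13:
  assumes l: "l \<ge> 9" "even l" and a: "parameter_W l a"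
  shows "realizable l [Cl_Twisted (A\<^sub>W l a), Cl_Swap, Cl_Pair (D\<^sub>W l 0) (B\<^sub>W l 2)]"
proof -
  note k = odd_parameter_usable_shift_3[OF a l(2)]
  have "even (3 + a)" using k(1) by simp
  from cycle_types_even_even[OF l(1) a k(2) l(2) this] show ?thesis
    by (intro crossed_realizable[OF l(1) a k(2)]) (simp only: pair_symbol.simps simp_thms)
qed

text \<open>All three involutions must have two fixed points, but for even l the factor
  \<open>flip l 1\<close> of the rotation has none. The cycle (2 .. l), which is the case a = 1, is
  used instead: it is the product of \<open>flip l 3\<close> and \<open>flip l 2\<close>, each with
  two fixed points.\<close>

lemma row_F1A_9:
  assumes l: "l \<ge> 9" "even l"
  shows "realizable l [Cl_Pair (B\<^sub>W l 2) (D\<^sub>W l 0), Cl_Pair (B\<^sub>W l 2) (B\<^sub>W l 2), Cl_Swap, Cl_Swap]"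
proof -
  have a: "parameter_W l 1" using l by (simp add: parameter_W_def)
  note k = odd_parameter_usable_shift_3[OF a l(2)]
  have "even (3 + 1 :: nat)" by simp
  note ct = cycle_types_even_even[OF l(1) a k(2) l(2) this]
  have w: "two_cycles l 1 = flip l 3 \<circ> flip l 2"
  proof
    fix x
    consider "x = 0" | "l < x" | "x = 1" | "x = 2" | "2 < x" "x < l" | "x = l" using l by linarith
    then show "two_cycles l 1 x = (flip l 3 \<circ> flip l 2) x"
      by cases (use l in \<open>auto simp: two_cycles_def flip_def\<close>)
  qed
  show ?thesis
  proof (rule realizable_four_involutions(1)[OF _ crossed_permutes[OF l(1) a k(2)] reflect_permutes'(2)[OF l(1) a k(2)] _
        flip_permutes'(3,2)[OF l(1)] flip_involution[OF l(1)] _ crossed_square_neq_id[OF l(1) a k(2)]])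
    show "reflect l (3 + 1) \<circ> reflect l (3 + 1) = id" using l by (intro reflect_involution) auto
    show "crossed l 1 3 \<circ> (flip l 3 \<circ> flip l 2) \<circ> reflect l (3 + 1) = id"
      using crossed_word[OF l(1) a k(2)] unfolding w .
    show "pair_symbol l (crossed l 1 3) (flip l 2) (Cl_Pair (B\<^sub>W l 2) (D\<^sub>W l 0))"
      by (simp only: pair_symbol.simps ct cycle_type_flip2_even[OF l] simp_thms)
    show "pair_symbol l (flip l 3) (reflect l (3 + 1)) (Cl_Pair (B\<^sub>W l 2) (B\<^sub>W l 2))"
      by (simp only: pair_symbol.simps ct cycle_type_flip3_even[OF l] simp_thms)
    show "carrier (alt_group l) \<subseteq> H" if "perm_group H" "crossed l 1 3 \<in> H" "flip l 3 \<circ> flip l 2 \<in> H" for H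
      using crossed_generates[OF l(1) a k(2) that(1,2)] that(3) unfolding w by blast
  qed (use l in simp)
qed

section \<open>Products of equal cycles\<close>

lemma permutes_of_small_periods:
  assumes "finite S" "\<And>x. x \<notin> S \<Longrightarrow> f x = x" "\<And>x. x \<in> S \<Longrightarrow> f x \<in> S"
    and small: "\<And>x. x \<in> S \<Longrightarrow> f x = x \<or> f (f x) = x \<or> f (f (f x)) = x \<or> f (f (f (f x))) = x"
  shows "f permutes S"
\<comment> \<open>12 is the least common multiple of 1, 2, 3 and 4, so the eleventh power inverts f
  on S.\<close>
proof (rule permutes_by_inverse[OF assms(1-3), of "f ^^ 11"])
  fix x assume "x \<in> S"
  from small[OF this] have "(f ^^ 12) x = x" by (auto simp: numeral_eq_Suc)
  then show "(f ^^ 11) (f x) = x" by (simp add: numeral_eq_Suc)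
qed

lemma permutes_cycle_type_threes:
  assumes out: "\<And>x. x \<notin> {1..l} \<Longrightarrow> f x = x" and S: "\<And>x. x \<in> {1..l} \<Longrightarrow> f x \<in> {1..l}"
    and E: "E1 \<subseteq> {1..l}" "E2 \<subseteq> {1..l}" "\<And>x. x \<in> E1 \<Longrightarrow> f x = x" "\<And>x. x \<in> E2 \<Longrightarrow> f x \<noteq> x \<and> f (f x) = x"
    and three: "\<And>x. \<lbrakk>x \<in> {1..l}; x \<notin> E1; x \<notin> E2\<rbrakk> \<Longrightarrow> f x \<noteq> x \<and> f (f x) \<noteq> x \<and> f (f (f x)) = x"
    and card: "card E1 = n1" "card E2 = 2 * n2" "l = n1 + 2 * n2 + 3 * n3"
  shows "f permutes {1..l} \<and> cycle_type l f = replicate_mset n1 1 + replicate_mset n2 2 + replicate_mset n3 3"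
proof -
  have f: "f permutes {1..l}"
  proof (rule permutes_of_small_periods[OF _ out S])
    fix x assume "x \<in> {1..l}"
    then show "f x = x \<or> f (f x) = x \<or> f (f (f x)) = x \<or> f (f (f (f x))) = x"
      using three[of x] E(3,4)[of x] by metis
  qed auto
  have "{x \<in> {1..l}. f x = x} = E1" "{x \<in> {1..l}. f x \<noteq> x \<and> f (f x) = x} = E2"
    by (intro equalityI subsetI; use three E in force)+
  moreover have "f (f (f x)) = x" if "x \<in> {1..l} - E2" for x
    using three[of x] E(3)[of x] that by (cases "x \<in> E1") auto
  ultimately show ?thesis by (intro conjI f cycle_type_threes[OF f _ _ _ card]) auto
qed

lemma permutes_cycle_type_fours:
  assumes out: "\<And>x. x \<notin> {1..l} \<Longrightarrow> f x = x" and S: "\<And>x. x \<in> {1..l} \<Longrightarrow> f x \<in> {1..l}"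
    and E: "E1 \<subseteq> {1..l}" "E2 \<subseteq> {1..l}" "E3 \<subseteq> {1..l}" "\<And>x. x \<in> E1 \<Longrightarrow> f x = x"
      "\<And>x. x \<in> E2 \<Longrightarrow> f x \<noteq> x \<and> f (f x) = x" "\<And>x. x \<in> E3 \<Longrightarrow> f x \<noteq> x \<and> f (f x) \<noteq> x \<and> f (f (f x)) = x"
    and four: "\<And>x. \<lbrakk>x \<in> {1..l}; x \<notin> E1; x \<notin> E2; x \<notin> E3\<rbrakk> \<Longrightarrow>
      f x \<noteq> x \<and> f (f x) \<noteq> x \<and> f (f (f x)) \<noteq> x \<and> f (f (f (f x))) = x"
    and card: "card E1 = n1" "card E2 = 2 * n2" "card E3 = 3 * n3" "l = n1 + 2 * n2 + 3 * n3 + 4 * n4"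
  shows "f permutes {1..l} \<and> cycle_type l f = replicate_mset n1 1 + replicate_mset n2 2 + replicate_mset n3 3 + replicate_mset n4 4"
proof -
  have f: "f permutes {1..l}"
  proof (rule permutes_of_small_periods[OF _ out S])
    fix x assume "x \<in> {1..l}"
    then show "f x = x \<or> f (f x) = x \<or> f (f (f x)) = x \<or> f (f (f (f x))) = x"
      using four[of x] E(4-6)[of x] by metis
  qed auto
  have not3: "f (f (f x)) \<noteq> x" if "x \<in> E2" for x using E(5)[OF that] by auto
  have eq: "{x \<in> {1..l}. f x = x} = E1" "{x \<in> {1..l}. f x \<noteq> x \<and> f (f x) = x} = E2"
    "{x \<in> {1..l}. f x \<noteq> x \<and> f (f (f x)) = x} = E3"
    by (intro equalityI subsetI; use four E not3 in force)+
  have "f (f (f (f x))) = x" if "x \<in> {1..l} - E3" for x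
    using four[of x] E(4)[of x] E(5)[of x] that by (cases "x \<in> E1"; cases "x \<in> E2") auto
  then show ?thesis by (intro conjI f cycle_type_fours[OF f eq _ card]) auto
qed

lemma split3:
  fixes x s m :: nat
  assumes "s \<le> x" "x < s + 3 * m"
  obtains (a) j where "j < m" "x = 3 * j + s" | (b) j where "j < m" "x = 3 * j + (s + 1)"
    | (c) j where "j < m" "x = 3 * j + (s + 2)"
proof -
  define j where "j = (x - s) div 3"
  have j: "j < m" using assms by (auto simp: j_def)
  have "(x - s) mod 3 < 3" "x = 3 * j + s + (x - s) mod 3" using assms by (auto simp: j_def)
  then consider "x = 3 * j + s" | "x = 3 * j + (s + 1)" | "x = 3 * j + (s + 2)" by linarith
  then show thesis using j a b c by cases auto
qed

lemma split4:
  fixes x s m :: nat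
  assumes "s \<le> x" "x < s + 4 * m"
  obtains (a) j where "j < m" "x = 4 * j + s" | (b) j where "j < m" "x = 4 * j + (s + 1)"
    | (c) j where "j < m" "x = 4 * j + (s + 2)" | (d) j where "j < m" "x = 4 * j + (s + 3)"
proof -
  define j where "j = (x - s) div 4"
  have j: "j < m" using assms by (auto simp: j_def)
  have "(x - s) mod 4 < 4" "x = 4 * j + s + (x - s) mod 4" using assms by (auto simp: j_def)
  then consider "x = 4 * j + s" | "x = 4 * j + (s + 1)" | "x = 4 * j + (s + 2)" | "x = 4 * j + (s + 3)" by linarith
  then show thesis using j a b c d by cases auto
qed

text \<open>The case u = 1 of the general word: the row only asks for p and q such that pq has the
  prescribed structure.\<close>

lemma realizable_triangle:
  assumes l: "l \<ge> 8" and p: "p permutes {1..l}" and q: "q permutes {1..l}"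
    and c: "pair_symbol l p q C" "cycle_type l (p \<circ> q) = parts Z"
    and gen: "\<And>H. \<lbrakk>perm_group H; p \<in> H; q \<in> H\<rbrakk> \<Longrightarrow> carrier (alt_group l) \<subseteq> H"
    and ker: "\<And>G. \<lbrakk>perm_group G; map_prod p q \<in> G\<rbrakk> \<Longrightarrow> kernel_nontrivial l G"
  shows "realizable l [C, Cl_Twisted Z, Cl_Swap]"
proof -
  have "realizable l [C, Cl_Swap, Cl_Twisted Z]"
    by (rule realizable_pair_twisted_twisted[OF l p q permutes_id c(1)]) (use c(2) gen ker in auto)
  then show ?thesis by (rule realizable_cong[THEN iffD1, rotated]) simp
qed

lemma power_kernel_nontrivial:
  assumes G: "perm_group G" "map_prod p q \<in> G" and S: "p permutes {1..l}" "q permutes {1..l}"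
    and pow: "(p ^^ k) x \<noteq> x \<and> q ^^ k = id \<or> (q ^^ k) x \<noteq> x \<and> p ^^ k = id"
  shows "kernel_nontrivial l G"
proof -
  have m: "map_prod (p ^^ k) (q ^^ k) \<in> G" by (rule map_prod_funpow_mem[OF G])
  show ?thesis
    using pow
  proof (elim disjE conjE)
    assume "(p ^^ k) x \<noteq> x" "q ^^ k = id"
    then show ?thesis using m by (intro kernel_nontrivialI[OF permutes_funpow[OF S(1)], of k]) auto
  next
    assume "(q ^^ k) x \<noteq> x" "p ^^ k = id"
    then show ?thesis using m by (intro kernel_nontrivialI[OF permutes_funpow[OF S(2)], of k]) auto
  qed
qed

text \<open>If y is related to 1 and f y = x, then x is related to f 1 and hence to 1; induction
  along the chain reaches every point.\<close>

lemma alt_group_subset_chain: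
  assumes H: "perm_group H" and chain: "\<And>x. \<lbrakk>1 < x; x \<le> l\<rbrakk> \<Longrightarrow> \<exists>y f. 1 \<le> y \<and> y < x \<and> f \<in> H \<and> f y = x \<and> tri H (f 1) 1"
  shows "carrier (alt_group l) \<subseteq> H"
proof (rule alt_group_subset[OF H])
  interpret perm_group H by fact
  have one: "tri H x 1" if "1 \<le> x" "x \<le> l" for x
    using that
  proof (induction x rule: less_induct)
    case (less x)
    show ?case
    proof (cases "x = 1")
      case False
      then have "1 < x" using less.prems by simp
      from chain[OF this less.prems(2)]
      obtain y f where y: "1 \<le> y" "y < x" "f \<in> H" "f y = x" "tri H (f 1) 1" by blast
      have "tri H y 1" using less.IH[OF y(2,1)] y(2) less.prems by simp
      then have "tri H (f y) (f 1)" by (rule tri_image[OF y(3)])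
      then show ?thesis using tri_trans[OF _ y(5)] y(4) by simp
    qed (simp add: tri_refl)
  qed
  show "tri H i j" if "i \<in> {1..l}" "j \<in> {1..l}" for i j using tri_trans[OF one tri_sym[OF one], of i j] that by simp
qed

lemma alt_group_subset_successors:
  assumes H: "perm_group H" "p \<in> H" "q \<in> H" and one: "tri H (p 1) 1" "tri H (q 1) 1"
    and succ: "\<And>x. \<lbrakk>1 \<le> x; x < l\<rbrakk> \<Longrightarrow> p x = x + 1 \<or> q x = x + 1"
  shows "carrier (alt_group l) \<subseteq> H"
proof (rule alt_group_subset_chain[OF H(1)])
  fix x :: nat assume x: "1 < x" "x \<le> l"
  then have "p (x - 1) = x \<or> q (x - 1) = x" using succ[of "x - 1"] by simp
  moreover have "1 \<le> x - 1" "x - 1 < x" using x by simp_all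
  ultimately show "\<exists>y f. 1 \<le> y \<and> y < x \<and> f \<in> H \<and> f y = x \<and> tri H (f 1) 1" using H one by blast
qed

lemma (in perm_group) transpose_overlap_tri:
  assumes "transpose x y \<in> H" "f \<in> H" "f x = y" "f y = z" "distinct [x, y, z]"
  shows "tri H x y"
proof -
  have "transpose y z \<in> H"
    using conj_mem[OF assms(2,1)] conj_transpose[OF bij_mem[OF assms(2)], of x y] assms(3,4) by simp
  then have "tri H y x"
    using assms by (intro transpose_transpose_tri[of y x z]) (auto simp: transpose_commute)
  then show ?thesis by (rule tri_sym)
qed

section \<open>Products of 3-cycles\<close>

lemma funpow_3: "(f ^^ 3) x = f (f (f x))"
  by (simp add: numeral_eq_Suc)

lemma three_cycles_up:
  fixes f :: "nat \<Rightarrow> nat"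
  assumes f: "\<And>j. j < n \<Longrightarrow> f (3 * j + s) = 3 * j + (s + 1) \<and> f (3 * j + (s + 1)) = 3 * j + (s + 2) \<and> f (3 * j + (s + 2)) = 3 * j + s"
    and x: "s \<le> x" "x < s + 3 * n"
  shows "f x \<noteq> x \<and> f (f x) \<noteq> x \<and> f (f (f x)) = x"
  using x
proof (cases rule: split3)
  case (a j) then show ?thesis using f[of j] by simp
next
  case (b j) then show ?thesis using f[of j] by simp
next
  case (c j) then show ?thesis using f[of j] by simp
qed

lemma three_cycles_down:
  fixes f :: "nat \<Rightarrow> nat"
  assumes f: "\<And>j. j < n \<Longrightarrow> f (3 * j + s) = 3 * j + (s + 2) \<and> f (3 * j + (s + 1)) = 3 * j + s \<and> f (3 * j + (s + 2)) = 3 * j + (s + 1)"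
    and x: "s \<le> x" "x < s + 3 * n"
  shows "f x \<noteq> x \<and> f (f x) \<noteq> x \<and> f (f (f x)) = x"
  using x
proof (cases rule: split3)
  case (a j) then show ?thesis using f[of j] by simp
next
  case (b j) then show ?thesis using f[of j] by simp
next
  case (c j) then show ?thesis using f[of j] by simp
qed

context
  fixes m :: nat
  assumes m: "m \<ge> 2"
begin

text \<open>\<open>p1_threes = (1 2)(3 4 5)(6 7 8)...\<close> and \<open>q1_threes = (1 2 3)(4 5 6)...\<close>\<close>

definition p1_threes :: "nat \<Rightarrow> nat" where
  "p1_threes x = (if x = 1 then 2 else if x = 2 then 1 else if x < 3 \<or> x \<ge> 3 * m + 3 then x
    else if x mod 3 = 2 then x - 2 else x + 1)"

definition q1_threes :: "nat \<Rightarrow> nat" where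
  "q1_threes x = (if x < 1 \<or> x > 3 * m + 3 then x else if x mod 3 = 0 then x - 2 else x + 1)"

lemma p1_threes_block:
  "j < m \<Longrightarrow> p1_threes (3 * j + 3) = 3 * j + (3 + 1) \<and> p1_threes (3 * j + (3 + 1)) = 3 * j + (3 + 2)
    \<and> p1_threes (3 * j + (3 + 2)) = 3 * j + 3"
  by (simp add: p1_threes_def)

lemma q1_threes_block:
  "j < m + 1 \<Longrightarrow> q1_threes (3 * j + 1) = 3 * j + (1 + 1) \<and> q1_threes (3 * j + (1 + 1)) = 3 * j + (1 + 2)
    \<and> q1_threes (3 * j + (1 + 2)) = 3 * j + 1"
  by (simp add: q1_threes_def mod_Suc)

text \<open>The blocks of p start at 3 and those of q at 1. Composing the two tilings gives blocks
  starting at 2, traversed downwards.\<close>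

lemma r1_threes_block:
  assumes "j < m"
  shows "p1_threes (q1_threes (3 * j + 2)) = 3 * j + (2 + 2) \<and> p1_threes (q1_threes (3 * j + (2 + 1))) = 3 * j + 2
    \<and> p1_threes (q1_threes (3 * j + (2 + 2))) = 3 * j + (2 + 1)"
proof -
  have "q1_threes (3 * j + 2) = 3 * j + 3" "q1_threes (3 * j + 3) = 3 * j + 1" "q1_threes (3 * j + 4) = 3 * j + 5"
    using assms by (simp_all add: q1_threes_def mod_Suc)
  moreover have "p1_threes (3 * j + 1) = 3 * j + 2"
    using assms by (simp add: p1_threes_def mod_Suc)
  ultimately show ?thesis using p1_threes_block[OF assms] by (simp del: One_nat_def)
qed

lemma p1_threes_cycle_type:
  "p1_threes permutes {1..3 * m + 3} \<and>
    cycle_type (3 * m + 3) p1_threes = replicate_mset 1 1 + replicate_mset 1 2 + replicate_mset m 3"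
proof (rule permutes_cycle_type_threes[where ?E1.0 = "{3 * m + 3}" and ?E2.0 = "{1, 2}"])
  fix x assume x: "x \<in> {1..3 * m + 3}" "x \<notin> {3 * m + 3}" "x \<notin> {1, 2}"
  then show "p1_threes x \<noteq> x \<and> p1_threes (p1_threes x) \<noteq> x \<and> p1_threes (p1_threes (p1_threes x)) = x"
    by (intro three_cycles_up[of m, OF p1_threes_block]) auto
qed (use m in \<open>auto simp: p1_threes_def\<close>)

lemma q1_threes_cycle_type:
  "q1_threes permutes {1..3 * m + 3} \<and>
    cycle_type (3 * m + 3) q1_threes = replicate_mset 0 1 + replicate_mset 0 2 + replicate_mset (m + 1) 3"
proof (rule permutes_cycle_type_threes[where ?E1.0 = "{}" and ?E2.0 = "{}"])
  fix x assume x: "x \<in> {1..3 * m + 3}"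
  then show "q1_threes x \<noteq> x \<and> q1_threes (q1_threes x) \<noteq> x \<and> q1_threes (q1_threes (q1_threes x)) = x"
    by (intro three_cycles_up[of "m + 1", OF q1_threes_block]) auto
  show "q1_threes x \<in> {1..3 * m + 3}"
    using x by (cases "x = 3 * m + 3") (auto simp: q1_threes_def)
qed (auto simp: q1_threes_def)

lemma r1_threes_cycle_type:
  "cycle_type (3 * m + 3) (p1_threes \<circ> q1_threes) = replicate_mset 1 1 + replicate_mset 1 2 + replicate_mset m 3"
proof -
  let ?r = "p1_threes \<circ> q1_threes"
  have r: "?r permutes {1..3 * m + 3}"
    using p1_threes_cycle_type q1_threes_cycle_type by (blast intro: permutes_compose)
  have E: "q1_threes 1 = 2" "p1_threes 2 = 1" "q1_threes (3 * m + 2) = 3 * m + 3" "p1_threes (3 * m + 3) = 3 * m + 3"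
      "q1_threes (3 * m + 3) = 3 * m + 1" "p1_threes (3 * m + 1) = 3 * m + 2"
    using m by (simp_all add: p1_threes_def q1_threes_def mod_Suc)
  have "?r permutes {1..3 * m + 3} \<and>
    cycle_type (3 * m + 3) ?r = replicate_mset 1 1 + replicate_mset 1 2 + replicate_mset m 3"
  proof (rule permutes_cycle_type_threes[where ?E1.0 = "{1}" and ?E2.0 = "{3 * m + 2, 3 * m + 3}"])
    fix x assume x: "x \<in> {1..3 * m + 3}" "x \<notin> {1}" "x \<notin> {3 * m + 2, 3 * m + 3}"
    then have x2: "2 \<le> x" "x < 2 + 3 * m" by auto
    show "?r x \<noteq> x \<and> ?r (?r x) \<noteq> x \<and> ?r (?r (?r x)) = x"
      by (rule three_cycles_down[of m ?r, OF _ x2]) (use r1_threes_block in simp)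
  next
    fix x assume "x \<in> {3 * m + 2, 3 * m + 3}"
    then show "?r x \<noteq> x \<and> ?r (?r x) = x" using E by auto
  qed (use E permutes_in_image[OF r] permutes_not_in[OF r] m in \<open>auto simp del: One_nat_def\<close>)
  then show ?thesis by blast
qed

text \<open>Cubing removes the 3-cycles and keeps the transposition (1 2). The same power kills the
  other coordinate, so it also supplies the kernel element.\<close>

lemma p1_threes_cube: "p1_threes ^^ 3 = transpose 1 2"
proof
  fix x
  consider "x = 1" | "x = 2" | "x = 0 \<or> 3 * m + 3 \<le> x" | "3 \<le> x" "x < 3 + 3 * m" by linarith
  then show "(p1_threes ^^ 3) x = transpose 1 2 x"
  proof cases
    case 4
    then have "p1_threes (p1_threes (p1_threes x)) = x" using three_cycles_up[OF p1_threes_block 4] by blast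
    then show ?thesis using 4 by (simp add: funpow_3 transpose_def)
  next
    case 3
    then have "p1_threes x = x" by (auto simp: p1_threes_def)
    then show ?thesis using 3 by (auto simp: funpow_3 transpose_def)
  qed (simp_all add: funpow_3 p1_threes_def)
qed

lemma q1_threes_cube: "q1_threes ^^ 3 = id"
proof
  fix x
  show "(q1_threes ^^ 3) x = id x"
  proof (cases "1 \<le> x \<and> x < 1 + 3 * (m + 1)")
    case True
    then show ?thesis using three_cycles_up[OF q1_threes_block, of "m + 1" x] by (simp add: funpow_3)
  next
    case False
    then have "q1_threes x = x" by (auto simp: q1_threes_def)
    then show ?thesis by (simp add: funpow_3)
  qed
qed

lemma row_F2_1_aux:
  "realizable (3 * m + 3) [Cl_Pair [(1, 1), (2, 1), (3, (of_nat (3 * m + 3) - 3) / 3)] [(3, of_nat (3 * m + 3) / 3)],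
    Cl_Twisted [(1, 1), (2, 1), (3, (of_nat (3 * m + 3) - 3) / 3)], Cl_Swap]"
proof (rule realizable_triangle)
  have P: "parts [(1, 1), (2, 1), (3, (of_nat (3 * m + 3) - 3) / 3)] = replicate_mset 1 1 + replicate_mset 1 2 + replicate_mset m 3"
    by (simp add: parts_def)
  have Q: "parts [(3, of_nat (3 * m + 3) / 3)] = replicate_mset (m + 1) 3"
    by (simp add: parts_def add_divide_distrib nat_add_distrib)
  show "3 * m + 3 \<ge> 8" using m by simp
  show perm: "p1_threes permutes {1..3 * m + 3}" "q1_threes permutes {1..3 * m + 3}"
    using p1_threes_cycle_type q1_threes_cycle_type by blast+
  show "pair_symbol (3 * m + 3) p1_threes q1_threes
      (Cl_Pair [(1, 1), (2, 1), (3, (of_nat (3 * m + 3) - 3) / 3)] [(3, of_nat (3 * m + 3) / 3)])"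
    unfolding pair_symbol.simps P Q using p1_threes_cycle_type q1_threes_cycle_type by simp
  show "cycle_type (3 * m + 3) (p1_threes \<circ> q1_threes) = parts [(1, 1), (2, 1), (3, (of_nat (3 * m + 3) - 3) / 3)]"
    unfolding P by (rule r1_threes_cycle_type)
  show "kernel_nontrivial (3 * m + 3) G" if "perm_group G" "map_prod p1_threes q1_threes \<in> G" for G
    by (rule power_kernel_nontrivial[OF that perm, of 3 1]) (simp add: p1_threes_cube q1_threes_cube)
  fix H assume H: "perm_group H" "p1_threes \<in> H" "q1_threes \<in> H"
  interpret perm_group H by fact
  have E: "p1_threes 1 = 2" "q1_threes 1 = 2" "q1_threes 2 = 3"
    by (simp_all add: p1_threes_def q1_threes_def)
  \<comment> \<open>q moves 1 to 2 and 2 to 3, so conjugating (1 2) by q gives the overlapping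
    transposition (2 3).\<close>
  have "transpose 1 2 \<in> H" using funpow_mem[OF H(2), of 3] unfolding p1_threes_cube .
  then have "tri H 1 2" by (rule transpose_overlap_tri[OF _ H(3) E(2,3)]) simp
  then have "tri H 2 1" by (rule tri_sym)
  then show "carrier (alt_group (3 * m + 3)) \<subseteq> H"
  proof (intro alt_group_subset_successors[OF H])
    fix x assume "1 \<le> x" "x < 3 * m + 3"
    then show "p1_threes x = x + 1 \<or> q1_threes x = x + 1"
      by (auto simp: p1_threes_def q1_threes_def)
  qed (simp_all only: E)
qed

end

lemma row_F2_1:
  assumes "l \<ge> 9" "3 dvd l"
  shows "realizable l [Cl_Pair [(1, 1), (2, 1), (3, (of_nat l - 3) / 3)] [(3, of_nat l / 3)],
    Cl_Twisted [(1, 1), (2, 1), (3, (of_nat l - 3) / 3)], Cl_Swap]"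
proof -
  define m where "m = l div 3 - 1"
  have "m \<ge> 2" "l = 3 * m + 3" using assms by (auto simp: m_def)
  then show ?thesis using row_F2_1_aux by blast
qed

text \<open>\<open>q2_threes = (2 3 4)(5 6 7)...\<close>\<close>

definition q2_threes :: "nat \<Rightarrow> nat \<Rightarrow> nat" where
  "q2_threes n x = (if x < 2 \<or> x > 3 * n + 1 then x else if x mod 3 = 1 then x - 2 else x + 1)"

lemma q2_threes_block:
  "j < n \<Longrightarrow> q2_threes n (3 * j + 2) = 3 * j + (2 + 1) \<and> q2_threes n (3 * j + (2 + 1)) = 3 * j + (2 + 2)
    \<and> q2_threes n (3 * j + (2 + 2)) = 3 * j + 2"
  by (simp add: q2_threes_def mod_Suc)

lemma q2_threes_cube: "q2_threes n ^^ 3 = id"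
proof
  fix x
  show "(q2_threes n ^^ 3) x = id x"
  proof (cases "2 \<le> x \<and> x < 2 + 3 * n")
    case True
    then show ?thesis using three_cycles_up[OF q2_threes_block[of _ n], of n x] by (simp add: funpow_3)
  next
    case False
    then have "q2_threes n x = x" by (auto simp: q2_threes_def)
    then show ?thesis by (simp add: funpow_3)
  qed
qed

context
  fixes n :: nat
  assumes n: "n \<ge> 3"
begin

lemma n_ge_2: "n \<ge> 2"
  using n by simp

text \<open>\<open>p1_threes n\<close> fixes 3n + 3, so it also acts on the points up to 3n + 2, now
  without a fixed point.\<close>

lemma p1_threes_cycle_type':
  "p1_threes n permutes {1..3 * n + 2} \<and>
    cycle_type (3 * n + 2) (p1_threes n) = replicate_mset 0 1 + replicate_mset 1 2 + replicate_mset n 3"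
proof (rule permutes_cycle_type_threes[where ?E1.0 = "{}" and ?E2.0 = "{1, 2}"])
  fix x assume x: "x \<in> {1..3 * n + 2}" "x \<notin> {}" "x \<notin> {1, 2}"
  then show "p1_threes n x \<noteq> x \<and> p1_threes n (p1_threes n x) \<noteq> x \<and> p1_threes n (p1_threes n (p1_threes n x)) = x"
    by (intro three_cycles_up[OF p1_threes_block[OF n_ge_2], of n]) auto
next
  fix x assume "x \<in> {1..3 * n + 2}"
  then show "p1_threes n x \<in> {1..3 * n + 2}" by (cases "x = 3 * n + 2") (auto simp: p1_threes_def[OF n_ge_2] mod_Suc)
qed (use n in \<open>auto simp: p1_threes_def[OF n_ge_2]\<close>)

lemma q2_threes_cycle_type:
  "q2_threes n permutes {1..3 * n + 2} \<and>
    cycle_type (3 * n + 2) (q2_threes n) = replicate_mset 2 1 + replicate_mset 0 2 + replicate_mset n 3"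
proof (rule permutes_cycle_type_threes[where ?E1.0 = "{1, 3 * n + 2}" and ?E2.0 = "{}"])
  fix x assume x: "x \<in> {1..3 * n + 2}" "x \<notin> {1, 3 * n + 2}"
  then show "q2_threes n x \<noteq> x \<and> q2_threes n (q2_threes n x) \<noteq> x \<and> q2_threes n (q2_threes n (q2_threes n x)) = x"
    by (intro three_cycles_up[OF q2_threes_block[of _ n], of n]) auto
next
  fix x assume "x \<in> {1..3 * n + 2}"
  then show "q2_threes n x \<in> {1..3 * n + 2}" by (cases "x = 2") (auto simp: q2_threes_def)
qed (use n in \<open>auto simp: q2_threes_def\<close>)

lemma r2_threes_cycle_type:
  "cycle_type (3 * n + 2) (p1_threes n \<circ> q2_threes n) = replicate_mset 0 1 + replicate_mset 1 2 + replicate_mset n 3"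
proof -
  let ?r = "p1_threes n \<circ> q2_threes n"
  have r: "?r permutes {1..3 * n + 2}"
    using p1_threes_cycle_type' q2_threes_cycle_type by (blast intro: permutes_compose)
  have E: "?r 1 = 2" "?r 2 = 4" "?r 4 = 1" "?r (3 * n) = 3 * n + 2" "?r (3 * n + 2) = 3 * n"
    using n by (simp_all add: p1_threes_def[OF n_ge_2] q2_threes_def mod_Suc)
  \<comment> \<open>The 3-cycles of the product interlace: 3j + 4 belongs with 3j, so a point
    congruent to 1 modulo 3 is assigned to the block before its own quotient.\<close>
  have B: "?r (3 * j) = 3 * j + 2 \<and> ?r (3 * j + 2) = 3 * j + 4 \<and> ?r (3 * j + 4) = 3 * j" if "1 \<le> j" "j < n" for j
    using that by (simp add: p1_threes_def[OF n_ge_2] q2_threes_def mod_Suc)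
  have "?r permutes {1..3 * n + 2} \<and>
    cycle_type (3 * n + 2) ?r = replicate_mset 0 1 + replicate_mset 1 2 + replicate_mset n 3"
  proof (rule permutes_cycle_type_threes[where ?E1.0 = "{}" and ?E2.0 = "{3 * n, 3 * n + 2}"])
    fix x assume x: "x \<in> {1..3 * n + 2}" "x \<notin> {}" "x \<notin> {3 * n, 3 * n + 2}"
    then consider "x \<in> {1, 2, 4}" | j where "1 \<le> j" "j < n" "x \<in> {3 * j, 3 * j + 2, 3 * j + 4}"
    proof -
      assume *: "x \<in> {1, 2, 4} \<Longrightarrow> thesis" "\<And>j. \<lbrakk>1 \<le> j; j < n; x \<in> {3 * j, 3 * j + 2, 3 * j + 4}\<rbrakk> \<Longrightarrow> thesis"
      define j where "j = x div 3"
      have "x = 3 * j \<or> x = 3 * j + 1 \<or> x = 3 * j + 2" unfolding j_def by presburger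
      then show thesis
      proof (elim disjE)
        assume "x = 3 * j"
        then show ?thesis using x by (intro *(2)[of j]) auto
      next
        assume xj: "x = 3 * j + 1"
        consider "j = 0" | "j = 1" | "j \<ge> 2" by linarith
        then show ?thesis
        proof cases
          case 3
          then show ?thesis using x xj by (intro *(2)[of "j - 1"]) auto
        qed (use xj * in auto)
      next
        assume xj: "x = 3 * j + 2"
        show ?thesis
        proof (cases "j = 0")
          case False
          then show ?thesis using x xj by (intro *(2)[of j]) auto
        qed (use xj * in auto)
      qed
    qed
    then show "?r x \<noteq> x \<and> ?r (?r x) \<noteq> x \<and> ?r (?r (?r x)) = x"
    proof cases
      case 1
      then show ?thesis using E(1-3) by (auto simp del: One_nat_def o_apply)
    next
      case 2
      then show ?thesis using B[OF 2(1,2)] by (auto simp del: o_apply)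
    qed
  next
    fix x assume "x \<in> {3 * n, 3 * n + 2}"
    then show "?r x \<noteq> x \<and> ?r (?r x) = x" using E(4,5) by (auto simp del: o_apply)
  qed (use permutes_in_image[OF r] permutes_not_in[OF r] n in \<open>auto simp del: One_nat_def\<close>)
  then show ?thesis by blast
qed

lemma row_F2_2_aux:
  "realizable (3 * n + 2) [Cl_Pair [(2, 1), (3, (of_nat (3 * n + 2) - 2) / 3)] [(1, 2), (3, (of_nat (3 * n + 2) - 2) / 3)],
    Cl_Twisted [(2, 1), (3, (of_nat (3 * n + 2) - 2) / 3)], Cl_Swap]"
proof (rule realizable_triangle)
  have P: "parts [(2, 1), (3, (of_nat (3 * n + 2) - 2) / 3)] = replicate_mset 0 1 + replicate_mset 1 2 + replicate_mset n 3"
    and Q: "parts [(1, 2), (3, (of_nat (3 * n + 2) - 2) / 3)] = replicate_mset 2 1 + replicate_mset 0 2 + replicate_mset n 3"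
    by (simp_all add: parts_def)
  show "3 * n + 2 \<ge> 8" using n by simp
  show perm: "p1_threes n permutes {1..3 * n + 2}" "q2_threes n permutes {1..3 * n + 2}"
    using p1_threes_cycle_type' q2_threes_cycle_type by blast+
  show "pair_symbol (3 * n + 2) (p1_threes n) (q2_threes n)
      (Cl_Pair [(2, 1), (3, (of_nat (3 * n + 2) - 2) / 3)] [(1, 2), (3, (of_nat (3 * n + 2) - 2) / 3)])"
    unfolding pair_symbol.simps P Q using p1_threes_cycle_type' q2_threes_cycle_type by blast
  show "cycle_type (3 * n + 2) (p1_threes n \<circ> q2_threes n) = parts [(2, 1), (3, (of_nat (3 * n + 2) - 2) / 3)]"
    unfolding P by (rule r2_threes_cycle_type)
  show "kernel_nontrivial (3 * n + 2) G" if "perm_group G" "map_prod (p1_threes n) (q2_threes n) \<in> G" for G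
    by (rule power_kernel_nontrivial[OF that perm, of 3 1]) (simp add: p1_threes_cube[OF n_ge_2] q2_threes_cube)
  fix H assume H: "perm_group H" "p1_threes n \<in> H" "q2_threes n \<in> H"
  interpret perm_group H by fact
  have E: "p1_threes n 1 = 2" "q2_threes n 1 = 1" "q2_threes n 2 = 3"
    using n by (simp_all add: p1_threes_def[OF n_ge_2] q2_threes_def)
  have t: "transpose 1 2 \<in> H" using funpow_mem[OF H(2), of 3] unfolding p1_threes_cube[OF n_ge_2] .
  have "transpose 1 3 \<in> H"
    using conj_mem[OF H(3) t] unfolding conj_transpose[OF bij_mem[OF H(3)]] E .
  with t have "tri H 1 2" by (rule transpose_transpose_tri) simp
  then have "tri H 2 1" by (rule tri_sym)
  then show "carrier (alt_group (3 * n + 2)) \<subseteq> H"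
  proof (intro alt_group_subset_successors[OF H])
    fix x assume "1 \<le> x" "x < 3 * n + 2"
    then show "p1_threes n x = x + 1 \<or> q2_threes n x = x + 1"
      by (auto simp: p1_threes_def[OF n_ge_2] q2_threes_def)
  qed (simp_all only: E tri_refl)
qed

end

lemma row_F2_2:
  assumes "l \<ge> 9" "l mod 3 = 2"
  shows "realizable l [Cl_Pair [(2, 1), (3, (of_nat l - 2) / 3)] [(1, 2), (3, (of_nat l - 2) / 3)],
    Cl_Twisted [(2, 1), (3, (of_nat l - 2) / 3)], Cl_Swap]"
proof -
  define n where "n = l div 3"
  have "n \<ge> 3" "l = 3 * n + 2" using assms mult_div_mod_eq[of 3 l] by (simp_all add: n_def del: mult_div_mod_eq)
  then show ?thesis using row_F2_2_aux by blast
qed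

context
  fixes k :: nat
  assumes k: "k \<ge> 2"
begin

text \<open>\<open>q3_threes = (1 2)(3 4 5)...(l-4 l-3 l-2)(l-1 l)\<close> with \<open>l = 3 * k + 4\<close>\<close>

definition q3_threes :: "nat \<Rightarrow> nat" where
  "q3_threes x = (if x = 3 * k + 3 then 3 * k + 4 else if x = 3 * k + 4 then 3 * k + 3 else p1_threes k x)"

lemma p3_threes_cycle_type:
  "q2_threes (k + 1) permutes {1..3 * k + 4} \<and>
    cycle_type (3 * k + 4) (q2_threes (k + 1)) = replicate_mset 1 1 + replicate_mset 0 2 + replicate_mset (k + 1) 3"
proof (rule permutes_cycle_type_threes[where ?E1.0 = "{1}" and ?E2.0 = "{}"])
  fix x assume x: "x \<in> {1..3 * k + 4}" "x \<notin> {1}"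
  then show "q2_threes (k + 1) x \<noteq> x \<and> q2_threes (k + 1) (q2_threes (k + 1) x) \<noteq> x
      \<and> q2_threes (k + 1) (q2_threes (k + 1) (q2_threes (k + 1) x)) = x"
    by (intro three_cycles_up[OF q2_threes_block[of _ "k + 1"], of "k + 1"]) auto
next
  fix x assume "x \<in> {1..3 * k + 4}"
  then consider "x = 2" | "x = 3 * k + 4" | "2 < x" "x < 3 * k + 4" | "x = 1" by fastforce
  then show "q2_threes (k + 1) x \<in> {1..3 * k + 4}" by cases (auto simp: q2_threes_def)
qed (auto simp: q2_threes_def)

lemma q3_threes_block:
  "j < k \<Longrightarrow> q3_threes (3 * j + 3) = 3 * j + (3 + 1) \<and> q3_threes (3 * j + (3 + 1)) = 3 * j + (3 + 2)
    \<and> q3_threes (3 * j + (3 + 2)) = 3 * j + 3"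
  using p1_threes_block[OF k, of j] by (simp add: q3_threes_def)

lemma q3_threes_ends:
  "q3_threes 1 = 2" "q3_threes 2 = 1" "q3_threes (3 * k + 3) = 3 * k + 4" "q3_threes (3 * k + 4) = 3 * k + 3"
  using k by (simp_all add: q3_threes_def p1_threes_def[OF k])

lemma q3_threes_cycle_type:
  "q3_threes permutes {1..3 * k + 4} \<and>
    cycle_type (3 * k + 4) q3_threes = replicate_mset 0 1 + replicate_mset 2 2 + replicate_mset k 3"
proof (rule permutes_cycle_type_threes[where ?E1.0 = "{}" and ?E2.0 = "{1, 2, 3 * k + 3, 3 * k + 4}"])
  fix x assume x: "x \<in> {1..3 * k + 4}" "x \<notin> {1, 2, 3 * k + 3, 3 * k + 4}"
  then show "q3_threes x \<noteq> x \<and> q3_threes (q3_threes x) \<noteq> x \<and> q3_threes (q3_threes (q3_threes x)) = x"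
    by (intro three_cycles_up[OF q3_threes_block, of k]) auto
next
  fix x assume "x \<in> {1, 2, 3 * k + 3, 3 * k + 4}"
  then show "q3_threes x \<noteq> x \<and> q3_threes (q3_threes x) = x" using q3_threes_ends by auto
next
  fix x assume "x \<in> {1..3 * k + 4}"
  then show "q3_threes x \<in> {1..3 * k + 4}" by (auto simp: q3_threes_def p1_threes_def[OF k])
qed (use k in \<open>auto simp: q3_threes_def p1_threes_def[OF k]\<close>)

text \<open>Here the product tiles from 1, again downwards. The transposition (1 2) of
  \<open>q3_threes\<close> stands for a block cut off by the left end, so the middle value is
  checked separately for j = 0.\<close>

lemma r3_threes_block:
  assumes "j < k + 1"
  shows "q2_threes (k + 1) (q3_threes (3 * j + 1)) = 3 * j + (1 + 2)
    \<and> q2_threes (k + 1) (q3_threes (3 * j + (1 + 1))) = 3 * j + 1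
    \<and> q2_threes (k + 1) (q3_threes (3 * j + (1 + 2))) = 3 * j + (1 + 1)"
proof -
  have "q3_threes (3 * j + 1) = 3 * j + 2" using assms k by (simp add: q3_threes_def p1_threes_def[OF k] mod_Suc)
  moreover have "q3_threes (3 * j + 3) = 3 * j + 4" using assms k by (simp add: q3_threes_def p1_threes_def[OF k] mod_Suc)
  moreover have "q2_threes (k + 1) (q3_threes (3 * j + 2)) = 3 * j + 1"
    using assms k by (cases "j = 0") (simp_all add: q3_threes_def p1_threes_def[OF k] q2_threes_def mod_Suc)
  ultimately show ?thesis using q2_threes_block[OF assms] by (simp del: One_nat_def)
qed

lemma r3_threes_cycle_type:
  "cycle_type (3 * k + 4) (q2_threes (k + 1) \<circ> q3_threes) = replicate_mset 1 1 + replicate_mset 0 2 + replicate_mset (k + 1) 3"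
proof -
  let ?r = "q2_threes (k + 1) \<circ> q3_threes"
  have r: "?r permutes {1..3 * k + 4}"
    using p3_threes_cycle_type q3_threes_cycle_type by (blast intro: permutes_compose)
  have E: "?r (3 * k + 4) = 3 * k + 4"
    by (simp add: q3_threes_ends) (simp add: q2_threes_def)
  have "?r permutes {1..3 * k + 4} \<and>
    cycle_type (3 * k + 4) ?r = replicate_mset 1 1 + replicate_mset 0 2 + replicate_mset (k + 1) 3"
  proof (rule permutes_cycle_type_threes[where ?E1.0 = "{3 * k + 4}" and ?E2.0 = "{}"])
    fix x assume x: "x \<in> {1..3 * k + 4}" "x \<notin> {3 * k + 4}"
    then have x1: "1 \<le> x" "x < 1 + 3 * (k + 1)" by auto
    show "?r x \<noteq> x \<and> ?r (?r x) \<noteq> x \<and> ?r (?r (?r x)) = x"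
      by (rule three_cycles_down[of "k + 1" ?r, OF _ x1]) (use r3_threes_block in simp)
  qed (use E permutes_in_image[OF r] permutes_not_in[OF r] in \<open>auto simp del: One_nat_def o_apply\<close>)
  then show ?thesis by blast
qed

lemma q3_threes_cube: "q3_threes ^^ 3 = transpose 1 2 \<circ> transpose (3 * k + 3) (3 * k + 4)"
proof
  fix x
  let ?t = "transpose 1 2 \<circ> transpose (3 * k + 3) (3 * k + 4)"
  consider "x = 1" | "x = 2" | "x = 3 * k + 3" | "x = 3 * k + 4" | "x = 0 \<or> 3 * k + 4 < x" | "3 \<le> x" "x < 3 + 3 * k" by linarith
  then show "(q3_threes ^^ 3) x = ?t x"
  proof cases
    case 5
    then have "q3_threes x = x" by (auto simp: q3_threes_def p1_threes_def[OF k])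
    then show ?thesis using 5 by (auto simp: funpow_3 transpose_def)
  next
    case 6
    then have "q3_threes (q3_threes (q3_threes x)) = x" using three_cycles_up[OF q3_threes_block 6] by blast
    then show ?thesis using 6 by (simp add: funpow_3 transpose_def)
  qed (use q3_threes_ends k in \<open>simp_all add: funpow_3 transpose_def\<close>)
qed

text \<open>The cube of \<open>q3_threes\<close> is only the double transposition (1 2)(l-1 l), with
  one factor at each end. Conjugates are formed until two of them agree at the right end; their
  product lives at the left end and leads to a 3-cycle.\<close>

lemma row_F2_3_aux:
  "realizable (3 * k + 4) [Cl_Pair [(1, 1), (3, (of_nat (3 * k + 4) - 1) / 3)] [(2, 2), (3, (of_nat (3 * k + 4) - 4) / 3)],
    Cl_Twisted [(1, 1), (3, (of_nat (3 * k + 4) - 1) / 3)], Cl_Swap]"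
proof (rule realizable_triangle)
  let ?p = "q2_threes (k + 1)"
  have "(of_nat (3 * k + 4) - 1) / 3 = (of_nat (k + 1) :: rat)" by (simp add: field_simps)
  then have P: "parts [(1, 1), (3, (of_nat (3 * k + 4) - 1) / 3)] = replicate_mset 1 1 + replicate_mset 0 2 + replicate_mset (k + 1) 3"
    by (simp only: parts_def floor_of_nat) (simp add: nat_add_distrib)
  have Q: "parts [(2, 2), (3, (of_nat (3 * k + 4) - 4) / 3)] = replicate_mset 0 1 + replicate_mset 2 2 + replicate_mset k 3"
    by (simp add: parts_def)
  show "3 * k + 4 \<ge> 8" using k by simp
  show perm: "?p permutes {1..3 * k + 4}" "q3_threes permutes {1..3 * k + 4}"
    using p3_threes_cycle_type q3_threes_cycle_type by blast+
  show "pair_symbol (3 * k + 4) ?p q3_threes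
      (Cl_Pair [(1, 1), (3, (of_nat (3 * k + 4) - 1) / 3)] [(2, 2), (3, (of_nat (3 * k + 4) - 4) / 3)])"
    unfolding pair_symbol.simps P Q using p3_threes_cycle_type q3_threes_cycle_type by blast
  show "cycle_type (3 * k + 4) (?p \<circ> q3_threes) = parts [(1, 1), (3, (of_nat (3 * k + 4) - 1) / 3)]"
    unfolding P by (rule r3_threes_cycle_type)
  have "(q3_threes ^^ 3) 1 = 2" using k by (simp add: q3_threes_cube transpose_def)
  then show "kernel_nontrivial (3 * k + 4) G" if "perm_group G" "map_prod ?p q3_threes \<in> G" for G
    by (intro power_kernel_nontrivial[OF that perm, of 3 1]) (simp add: q2_threes_cube)
  fix H assume H: "perm_group H" "?p \<in> H" "q3_threes \<in> H"
  interpret perm_group H by fact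
  have p: "?p 1 = 1" "?p 2 = 3" "?p 3 = 4" "?p (3 * k + 3) = 3 * k + 4" "?p (3 * k + 4) = 3 * k + 2" "?p (3 * k + 2) = 3 * k + 3"
    by (simp_all add: q2_threes_def mod_Suc)
  have q: "q3_threes 1 = 2" "q3_threes 2 = 1" "q3_threes 3 = 4" "q3_threes 4 = 5"
    using k by (simp_all add: q3_threes_def p1_threes_def[OF k])
  have t0: "transpose 1 2 \<circ> transpose (3 * k + 3) (3 * k + 4) \<in> H"
    using funpow_mem[OF H(3), of 3] unfolding q3_threes_cube .
  have t1: "transpose 1 3 \<circ> transpose (3 * k + 4) (3 * k + 2) \<in> H"
    using double_transposition_conj_mem[OF t0 H(2)] unfolding p .
  have t2: "transpose 1 4 \<circ> transpose (3 * k + 2) (3 * k + 3) \<in> H"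
    using double_transposition_conj_mem[OF t1 H(2)] unfolding p .
  let ?t1 = "transpose 1 3 \<circ> transpose (3 * k + 4) (3 * k + 2)"
  have e: "?t1 1 = 3" "?t1 2 = 2" "?t1 (3 * k + 3) = 3 * k + 3" "?t1 (3 * k + 4) = 3 * k + 2"
    using k by (simp_all add: transpose_def)
  have t3: "transpose 3 2 \<circ> transpose (3 * k + 3) (3 * k + 2) \<in> H"
    using double_transposition_conj_mem[OF t0 t1] unfolding e .
  \<comment> \<open>Both elements contain the transposition of 3k + 2 and 3k + 3, which
    cancels.\<close>
  have "transpose 3 2 \<circ> transpose (3 * k + 3) (3 * k + 2) \<circ> (transpose 1 4 \<circ> transpose (3 * k + 2) (3 * k + 3))
      = transpose 3 2 \<circ> transpose 1 4"
    using k by (auto simp: fun_eq_iff transpose_def)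
  then have t4: "transpose 3 2 \<circ> transpose 1 4 \<in> H" using comp_mem[OF t3 t2] by simp
  have t5: "transpose 4 1 \<circ> transpose 2 5 \<in> H"
    using double_transposition_conj_mem[OF t4 H(3)] unfolding q .
  \<comment> \<open>(1 4) is common to both factors and cancels; (3 2)(2 5) is a 3-cycle.\<close>
  have "transpose 3 2 \<circ> transpose 1 4 \<circ> (transpose 4 1 \<circ> transpose 2 5) = cyc3 3 2 (5 :: nat)"
    by (auto simp: fun_eq_iff transpose_def cyc3_def)
  then have "cyc3 3 2 5 \<in> H" using comp_mem[OF t4 t5] by simp
  then have c: "tri H 3 2" "tri H 2 5" "tri H 3 5" by (rule triI[rotated]; simp)+
  have "tri H 4 3" using tri_image[OF H(2) c(1)] unfolding p .
  then have "tri H 4 2" using c tri_trans by blast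
  moreover have "tri H 4 1" using tri_image[OF H(3) c(1)] unfolding q .
  ultimately have "tri H 2 1" using tri_trans tri_sym by blast
  then show "carrier (alt_group (3 * k + 4)) \<subseteq> H"
  proof (intro alt_group_subset_successors[OF H])
    fix x assume "1 \<le> x" "x < 3 * k + 4"
    then show "?p x = x + 1 \<or> q3_threes x = x + 1"
      by (auto simp: q2_threes_def q3_threes_def p1_threes_def[OF k])
  qed (simp_all only: p q tri_refl)
qed

end

lemma row_F2_3:
  assumes "l \<ge> 9" "l mod 3 = 1"
  shows "realizable l [Cl_Pair [(1, 1), (3, (of_nat l - 1) / 3)] [(2, 2), (3, (of_nat l - 4) / 3)],
    Cl_Twisted [(1, 1), (3, (of_nat l - 1) / 3)], Cl_Swap]"
proof -
  define k where "k = l div 3 - 1"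
  have "k \<ge> 2" "l = 3 * k + 4"
    using assms mult_div_mod_eq[of 3 l] by (simp_all add: k_def del: mult_div_mod_eq)
  then show ?thesis using row_F2_3_aux by blast
qed

section \<open>Products of 4-cycles\<close>

lemma funpow_4: "(f ^^ 4) x = f (f (f (f x)))"
  by (simp add: numeral_eq_Suc)

lemma four_cycle:
  assumes "f a = b" "f b = c" "f c = d" "f d = a" "distinct [a, b, c, d]" "x \<in> {a, b, c, d}"
  shows "f x \<noteq> x \<and> f (f x) \<noteq> x \<and> f (f (f x)) \<noteq> x \<and> f (f (f (f x))) = x"
  using assms by auto

lemma four_cycles_up:
  fixes f :: "nat \<Rightarrow> nat"
  assumes f: "\<And>j. j < n \<Longrightarrow> f (4 * j + s) = 4 * j + (s + 1) \<and> f (4 * j + (s + 1)) = 4 * j + (s + 2)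
      \<and> f (4 * j + (s + 2)) = 4 * j + (s + 3) \<and> f (4 * j + (s + 3)) = 4 * j + s"
    and x: "s \<le> x" "x < s + 4 * n"
  shows "f x \<noteq> x \<and> f (f x) \<noteq> x \<and> f (f (f x)) \<noteq> x \<and> f (f (f (f x))) = x"
proof -
  obtain j where j: "j < n" "x \<in> {4 * j + s, 4 * j + (s + 1), 4 * j + (s + 2), 4 * j + (s + 3)}"
    using x by (cases rule: split4) blast+
  show ?thesis by (rule four_cycle[OF _ _ _ _ _ j(2)]) (use f[OF j(1)] in simp_all)
qed

lemma involution_pairs:
  fixes f :: "nat \<Rightarrow> nat"
  assumes f: "\<And>j. j < n \<Longrightarrow> f (4 * j + s) = 4 * j + (s + 2) \<and> f (4 * j + (s + 1)) = 4 * j + (s + 3)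
      \<and> f (4 * j + (s + 2)) = 4 * j + s \<and> f (4 * j + (s + 3)) = 4 * j + (s + 1)"
    and x: "s \<le> x" "x < s + 4 * n"
  shows "f x \<noteq> x \<and> f (f x) = x"
proof -
  obtain j where j: "j < n" "x \<in> {4 * j + s, 4 * j + (s + 1), 4 * j + (s + 2), 4 * j + (s + 3)}"
    using x by (cases rule: split4) blast+
  show ?thesis using f[OF j(1)] j(2) by auto
qed

text \<open>1 and 2 need not be related at the outset: p preserves their classes and r exchanges
  them. Every point is related to 1 or to 2, and a fixed point of r that is related to one of them
  is related to both, which merges the classes.\<close>

lemma alt_group_subset_two_classes:
  assumes H: "perm_group H" "p \<in> H" "r \<in> H"
    and p: "tri H (p 1) 1" "tri H (p 2) 2" and r: "r 1 = 2" "r 2 = 1" "1 \<le> y" "y \<le> l" "r y = y"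
    and chain: "\<And>x. \<lbrakk>2 < x; x \<le> l\<rbrakk> \<Longrightarrow> \<exists>y. 1 \<le> y \<and> y < x \<and> (p y = x \<or> r y = x)"
  shows "carrier (alt_group l) \<subseteq> H"
proof -
  interpret perm_group H by fact
  have cl: "tri H x 1 \<or> tri H x 2" if "1 \<le> x" "x \<le> l" for x
    using that
  proof (induction x rule: less_induct)
    case (less x)
    consider "x = 1" | "x = 2" | "2 < x" using less.prems by linarith
    then show ?case
    proof cases
      case 3
      obtain y where y: "1 \<le> y" "y < x" "p y = x \<or> r y = x" using chain[OF 3 less.prems(2)] by blast
      then have IH: "tri H y 1 \<or> tri H y 2" using less.IH[of y] less.prems by simp
      from y(3) show ?thesis
      proof
        assume "p y = x"
        with IH have "tri H x (p 1) \<or> tri H x (p 2)" using tri_image[OF H(2), of y] by blast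
        then show ?thesis using tri_trans p by blast
      next
        assume "r y = x"
        with IH have "tri H x (r 1) \<or> tri H x (r 2)" using tri_image[OF H(3), of y] by blast
        then show ?thesis unfolding r(1,2) by blast
      qed
    qed (simp_all add: tri_refl)
  qed
  have "tri H y 1 \<and> tri H y 2"
    using cl[OF r(3,4)] tri_image[OF H(3), of y 1] tri_image[OF H(3), of y 2] unfolding r by blast
  then have 12: "tri H 2 1" using tri_sym tri_trans by blast
  show ?thesis
  proof (rule alt_group_subset[OF H(1)])
    fix i j assume "i \<in> {1..l}" "j \<in> {1..l}"
    then have "tri H i 1" "tri H j 1" using cl[of i] cl[of j] tri_trans[OF _ 12] by auto
    then show "tri H i j" using tri_trans tri_sym by blast
  qed
qed

context
  fixes m :: nat
  assumes m: "m \<ge> 1"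
begin

text \<open>
  \<open>p1_fours = (2 3 4)(5 6 7 8)...\<close>, and \<open>q1_fours\<close> is chosen so that the product is
  \<open>(1 2)(3 5)(4 6)(7 9)(8 10)...(l-5 l-3)(l-4 l-2)\<close>.
\<close>

definition p1_fours :: "nat \<Rightarrow> nat" where
  "p1_fours x = (if x = 2 then 3 else if x = 3 then 4 else if x = 4 then 2 else if x < 5 \<or> 4 * m + 8 < x then x
    else if x mod 4 = 0 then x - 3 else x + 1)"

definition q1_fours :: "nat \<Rightarrow> nat" where
  "q1_fours x = (if x = 1 then 4 else if x = 2 then 1 else if x < 1 \<or> 4 * m + 8 < x then x
    else if x = 4 * m + 8 \<or> x = 4 * m + 7 then x - 1
    else if x mod 4 = 0 then x + 1 else if x mod 4 = 3 then x + 5 else x - 3)"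

lemma p1_fours_block:
  "j < m + 1 \<Longrightarrow> p1_fours (4 * j + 5) = 4 * j + (5 + 1) \<and> p1_fours (4 * j + (5 + 1)) = 4 * j + (5 + 2)
      \<and> p1_fours (4 * j + (5 + 2)) = 4 * j + (5 + 3) \<and> p1_fours (4 * j + (5 + 3)) = 4 * j + 5"
  by (simp add: p1_fours_def)

lemma p1_fours_ends: "p1_fours 1 = 1" "p1_fours 2 = 3" "p1_fours 3 = 4" "p1_fours 4 = 2"
  by (simp_all add: p1_fours_def)

lemma q1_fours_block:
  "j < m \<Longrightarrow> q1_fours (4 * j + 3) = 4 * j + 8 \<and> q1_fours (4 * j + 8) = 4 * j + 9
      \<and> q1_fours (4 * j + 9) = 4 * j + 6 \<and> q1_fours (4 * j + 6) = 4 * j + 3"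
  by (simp add: q1_fours_def)

lemma q1_fours_ends:
  "q1_fours 1 = 4" "q1_fours 4 = 5" "q1_fours 5 = 2" "q1_fours 2 = 1"
  "q1_fours (4 * m + 3) = 4 * m + 8" "q1_fours (4 * m + 8) = 4 * m + 7" "q1_fours (4 * m + 7) = 4 * m + 6" "q1_fours (4 * m + 6) = 4 * m + 3"
  using m by (simp_all add: q1_fours_def)

text \<open>The 4-cycle with index j runs through 4j + 3, 4j + 8, 4j + 9, 4j + 6, so neighbouring
  cycles interlace. Depending on the residue, a point with quotient i belongs to the index i, i - 1
  or i - 2.\<close>

lemma q1_fours_cover:
  assumes "1 \<le> x" "x \<le> 4 * m + 8"
  shows "x \<in> {1, 4, 5, 2} \<or> x \<in> {4 * m + 3, 4 * m + 8, 4 * m + 7, 4 * m + 6} \<or> (\<exists>j<m. x \<in> {4 * j + 3, 4 * j + 8, 4 * j + 9, 4 * j + 6})"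
proof (cases "x \<in> {1, 4, 5, 2} \<or> x \<in> {4 * m + 3, 4 * m + 8, 4 * m + 7, 4 * m + 6}")
  case False
  define i where "i = x div 4"
  have "x = 4 * i \<or> x = 4 * i + 1 \<or> x = 4 * i + 2 \<or> x = 4 * i + 3" unfolding i_def by presburger
  then show ?thesis
  proof (elim disjE)
    assume "x = 4 * i"
    then have "i - 2 < m" "x = 4 * (i - 2) + 8" using assms False by auto
    then show ?thesis by blast
  next
    assume "x = 4 * i + 1"
    then have "i - 2 < m" "x = 4 * (i - 2) + 9" using assms False by auto
    then show ?thesis by blast
  next
    assume "x = 4 * i + 2"
    then have "i - 1 < m" "x = 4 * (i - 1) + 6" using assms False by auto
    then show ?thesis by blast
  next
    assume "x = 4 * i + 3"
    then have "i < m" "x = 4 * i + 3" using assms False by auto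
    then show ?thesis by blast
  qed
qed blast

lemma p1_fours_cycle_type:
  "p1_fours permutes {1..4 * m + 8} \<and> cycle_type (4 * m + 8) p1_fours =
    replicate_mset 1 1 + replicate_mset 0 2 + replicate_mset 1 3 + replicate_mset (m + 1) 4"
proof (rule permutes_cycle_type_fours[where ?E1.0 = "{1}" and ?E2.0 = "{}" and ?E3.0 = "{2, 3, 4}"])
  fix x assume x: "x \<in> {1..4 * m + 8}" "x \<notin> {1}" "x \<notin> {2, 3, 4}"
  then show "p1_fours x \<noteq> x \<and> p1_fours (p1_fours x) \<noteq> x \<and> p1_fours (p1_fours (p1_fours x)) \<noteq> x
      \<and> p1_fours (p1_fours (p1_fours (p1_fours x))) = x"
    by (intro four_cycles_up[OF p1_fours_block, of "m + 1"]) auto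
next
  fix x assume "x \<in> {1..4 * m + 8}"
  then show "p1_fours x \<in> {1..4 * m + 8}" by (cases "x = 4 * m + 8") (auto simp: p1_fours_def)
next
  fix x :: nat assume "x \<in> {2, 3, 4}"
  then show "p1_fours x \<noteq> x \<and> p1_fours (p1_fours x) \<noteq> x \<and> p1_fours (p1_fours (p1_fours x)) = x"
    by (elim insertE) (simp_all add: p1_fours_ends)
next
  fix x assume "x \<notin> {1..4 * m + 8}"
  then show "p1_fours x = x" by (auto simp: p1_fours_def)
qed (simp_all add: p1_fours_ends(1)[unfolded One_nat_def])

lemma q1_fours_four_cycles:
  assumes "1 \<le> x" "x \<le> 4 * m + 8"
  shows "q1_fours x \<noteq> x \<and> q1_fours (q1_fours x) \<noteq> x \<and> q1_fours (q1_fours (q1_fours x)) \<noteq> x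
      \<and> q1_fours (q1_fours (q1_fours (q1_fours x))) = x"
  using q1_fours_cover[OF assms]
proof (elim disjE exE conjE)
  assume x: "x \<in> {1, 4, 5, 2}"
  show ?thesis by (rule four_cycle[OF q1_fours_ends(1-4) _ x]) simp
next
  assume x: "x \<in> {4 * m + 3, 4 * m + 8, 4 * m + 7, 4 * m + 6}"
  show ?thesis by (rule four_cycle[OF q1_fours_ends(5-8) _ x]) simp
next
  fix j assume j: "j < m" and x: "x \<in> {4 * j + 3, 4 * j + 8, 4 * j + 9, 4 * j + 6}"
  show ?thesis by (rule four_cycle[OF _ _ _ _ _ x]) (use q1_fours_block[OF j] in simp_all)
qed

lemma q1_fours_cycle_type:
  "q1_fours permutes {1..4 * m + 8} \<and> cycle_type (4 * m + 8) q1_fours =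
    replicate_mset 0 1 + replicate_mset 0 2 + replicate_mset 0 3 + replicate_mset (m + 2) 4"
proof (rule permutes_cycle_type_fours[where ?E1.0 = "{}" and ?E2.0 = "{}" and ?E3.0 = "{}"])
  fix x assume x: "x \<in> {1..4 * m + 8}"
  then consider "x \<in> {1, 4, 5, 2}" | "x \<in> {4 * m + 3, 4 * m + 8, 4 * m + 7, 4 * m + 6}"
    | j where "j < m" "x \<in> {4 * j + 3, 4 * j + 8, 4 * j + 9, 4 * j + 6}"
    using q1_fours_cover[of x] by auto
  then show "q1_fours x \<in> {1..4 * m + 8}"
  proof cases
    case 3
    then show ?thesis using q1_fours_block[OF 3(1)] by auto
  qed (use q1_fours_ends m in auto)
  show "q1_fours x \<noteq> x \<and> q1_fours (q1_fours x) \<noteq> x \<and> q1_fours (q1_fours (q1_fours x)) \<noteq> x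
      \<and> q1_fours (q1_fours (q1_fours (q1_fours x))) = x"
    using x by (intro q1_fours_four_cycles) auto
qed (auto simp: q1_fours_def)

lemma r1_fours_block:
  assumes "j < m + 1"
  shows "p1_fours (q1_fours (4 * j + 3)) = 4 * j + (3 + 2) \<and> p1_fours (q1_fours (4 * j + (3 + 1))) = 4 * j + (3 + 3)
      \<and> p1_fours (q1_fours (4 * j + (3 + 2))) = 4 * j + 3 \<and> p1_fours (q1_fours (4 * j + (3 + 3))) = 4 * j + (3 + 1)"
  using assms m by (cases "j = 0") (simp_all add: q1_fours_def p1_fours_def mod_Suc)

lemma r1_fours_ends:
  "p1_fours (q1_fours 1) = 2" "p1_fours (q1_fours 2) = 1"
  "p1_fours (q1_fours (4 * m + 7)) = 4 * m + 7" "p1_fours (q1_fours (4 * m + 8)) = 4 * m + 8"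
  using m by (simp_all add: q1_fours_def p1_fours_def)

lemma r1_fours_cycle_type: "cycle_type (4 * m + 8) (p1_fours \<circ> q1_fours) = parts (B\<^sub>W (4 * m + 8) 2)"
proof (rule cycle_type_B)
  let ?r = "p1_fours \<circ> q1_fours"
  show "?r permutes {1..4 * m + 8}"
    using p1_fours_cycle_type q1_fours_cycle_type by (blast intro: permutes_compose)
  have *: "x \<in> {1, 2} \<or> x \<in> {4 * m + 7, 4 * m + 8} \<or> 3 \<le> x \<and> x < 3 + 4 * (m + 1)" if "x \<in> {1..4 * m + 8}" for x
    using that by auto
  have pairs: "?r x \<noteq> x \<and> ?r (?r x) = x" if "3 \<le> x \<and> x < 3 + 4 * (m + 1)" for x
    by (rule involution_pairs[of "m + 1" ?r 3]) (use that r1_fours_block in simp_all)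
  show "?r (?r x) = x" if "x \<in> {1..4 * m + 8}" for x
    using *[OF that]
  proof (elim disjE)
    assume "3 \<le> x \<and> x < 3 + 4 * (m + 1)"
    then show ?thesis using pairs by blast
  qed (use r1_fours_ends in auto)
  have "{x \<in> {1..4 * m + 8}. ?r x = x} = {4 * m + 7, 4 * m + 8}"
  proof (intro equalityI subsetI)
    fix x assume "x \<in> {x \<in> {1..4 * m + 8}. ?r x = x}"
    then have x: "x \<in> {1..4 * m + 8}" and "?r x = x" by blast+
    then have "\<not> (3 \<le> x \<and> x < 3 + 4 * (m + 1))" "x \<notin> {1, 2}" using pairs r1_fours_ends by auto
    then show "x \<in> {4 * m + 7, 4 * m + 8}" using *[OF x] by blast
  qed (use r1_fours_ends in auto)
  then show "card {x \<in> {1..4 * m + 8}. ?r x = x} = 2" by simp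
qed

text \<open>The fourth power removes the 4-cycles and returns the 3-cycle itself.\<close>

lemma p1_fours_power: "p1_fours ^^ 4 = cyc3 2 3 4"
proof
  fix x
  have d: "distinct [2, 3, 4 :: nat]" by simp
  have "x = 1 \<or> x = 2 \<or> x = 3 \<or> x = 4 \<or> x = 0 \<or> 4 * m + 8 < x \<or> 5 \<le> x \<and> x < 5 + 4 * (m + 1)" by presburger
  then consider "x = 1" | "x = 2" | "x = 3" | "x = 4" | "x = 0 \<or> 4 * m + 8 < x" | "5 \<le> x" "x < 5 + 4 * (m + 1)" by blast
  then show "(p1_fours ^^ 4) x = cyc3 2 3 4 x"
  proof cases
    case 5
    then have "p1_fours x = x" by (auto simp: p1_fours_def)
    moreover have "x \<notin> {2, 3, 4}" using 5 by auto
    ultimately show ?thesis using cyc3_apply(4)[OF d] by (simp add: funpow_4)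
  next
    case 6
    then have "p1_fours (p1_fours (p1_fours (p1_fours x))) = x" using four_cycles_up[OF p1_fours_block 6] by blast
    moreover have "x \<notin> {2, 3, 4}" using 6 by auto
    ultimately show ?thesis using cyc3_apply(4)[OF d] by (simp add: funpow_4)
  next
    case 1
    then show ?thesis using cyc3_apply(4)[OF d, of 1] p1_fours_ends by (simp add: funpow_4)
  qed (simp_all add: funpow_4 p1_fours_ends cyc3_apply[OF d])
qed

lemma q1_fours_power: "q1_fours ^^ 4 = id"
proof
  fix x
  show "(q1_fours ^^ 4) x = id x"
  proof (cases "1 \<le> x \<and> x \<le> 4 * m + 8")
    case True
    then show ?thesis using q1_fours_four_cycles by (simp add: funpow_4)
  next
    case False
    then have "q1_fours x = x" by (auto simp: q1_fours_def)
    then show ?thesis by (simp add: funpow_4)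
  qed
qed

lemma row_F3_1_aux:
  "realizable (4 * m + 8) [Cl_Pair [(1, 1), (3, 1), (4, (of_nat (4 * m + 8) - 4) / 4)] [(4, of_nat (4 * m + 8) / 4)],
    Cl_Twisted (B\<^sub>W (4 * m + 8) 2), Cl_Swap]"
proof (rule realizable_triangle)
  have "(of_nat (4 * m + 8) - 4) / 4 = (of_nat (m + 1) :: rat)" "of_nat (4 * m + 8) / 4 = (of_nat (m + 2) :: rat)"
    by (simp_all add: field_simps)
  then have P: "parts [(1, 1), (3, 1), (4, (of_nat (4 * m + 8) - 4) / 4)] =
      replicate_mset 1 1 + replicate_mset 0 2 + replicate_mset 1 3 + replicate_mset (m + 1) 4"
    and Q: "parts [(4, of_nat (4 * m + 8) / 4)] =
      replicate_mset 0 1 + replicate_mset 0 2 + replicate_mset 0 3 + replicate_mset (m + 2) 4"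
    by (simp_all only: parts_def floor_of_nat) (simp_all add: nat_add_distrib)
  show "4 * m + 8 \<ge> 8" by simp
  show perm: "p1_fours permutes {1..4 * m + 8}" "q1_fours permutes {1..4 * m + 8}"
    using p1_fours_cycle_type q1_fours_cycle_type by blast+
  show "pair_symbol (4 * m + 8) p1_fours q1_fours
      (Cl_Pair [(1, 1), (3, 1), (4, (of_nat (4 * m + 8) - 4) / 4)] [(4, of_nat (4 * m + 8) / 4)])"
    unfolding pair_symbol.simps P Q using p1_fours_cycle_type q1_fours_cycle_type by blast
  show "cycle_type (4 * m + 8) (p1_fours \<circ> q1_fours) = parts (B\<^sub>W (4 * m + 8) 2)"
    by (rule r1_fours_cycle_type)
  have "(p1_fours ^^ 4) 2 = 3" by (simp add: funpow_4 p1_fours_ends)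
  then show "kernel_nontrivial (4 * m + 8) G" if "perm_group G" "map_prod p1_fours q1_fours \<in> G" for G
    by (intro power_kernel_nontrivial[OF that perm, of 4 2]) (simp add: q1_fours_power)
  fix H assume H: "perm_group H" "p1_fours \<in> H" "q1_fours \<in> H"
  interpret perm_group H by fact
  let ?r = "p1_fours \<circ> q1_fours"
  have r: "?r \<in> H" by (rule comp_mem[OF H(2,3)])
  have "cyc3 2 3 4 \<in> H" using funpow_mem[OF H(2), of 4] unfolding p1_fours_power .
  then have "tri H 2 3" by (rule triI[rotated]) simp
  then have "tri H 3 2" by (rule tri_sym)
  show "carrier (alt_group (4 * m + 8)) \<subseteq> H"
  proof (rule alt_group_subset_two_classes[OF H(1,2) r, of "4 * m + 8"])
    fix x :: nat assume x: "2 < x" "x \<le> 4 * m + 8"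
    show "\<exists>y\<ge>1. y < x \<and> (p1_fours y = x \<or> ?r y = x)"
    \<comment> \<open>The 4-cycles of p start at points congruent to 1, which p does not reach from
      below; there r takes over, moving 4j + 3 to 4j + 5.\<close>
    proof (cases "x mod 4 = 1")
      case True
      then have "x = 4 * (x div 4 - 1) + 5" "x div 4 - 1 < m + 1"
        using x mult_div_mod_eq[of 4 x] by (simp_all del: mult_div_mod_eq)
      then obtain j where j: "j < m + 1" "x = 4 * j + 5" by blast
      then have "?r (4 * j + 3) = x" using r1_fours_block[OF j(1)] by simp
      then show ?thesis using j by (intro exI[of _ "4 * j + 3"]) simp
    next
      case False
      obtain y where y: "x = Suc y" using x by (cases x) auto
      then have "p1_fours y = x" using x False by (auto simp: p1_fours_def mod_Suc split: if_splits)
      then show ?thesis using x y by (intro exI[of _ y]) simp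
    qed
  qed (use \<open>tri H 3 2\<close> r1_fours_ends p1_fours_ends in \<open>simp_all add: tri_refl\<close>)
qed

end

lemma row_F3_1:
  assumes "l \<ge> 9" "4 dvd l"
  shows "realizable l [Cl_Pair [(1, 1), (3, 1), (4, (of_nat l - 4) / 4)] [(4, of_nat l / 4)],
    Cl_Twisted (B\<^sub>W l 2), Cl_Swap]"
proof -
  define m where "m = l div 4 - 2"
  have "m \<ge> 1" "l = 4 * m + 8" using assms by (auto simp: m_def)
  then show ?thesis using row_F3_1_aux by blast
qed

text \<open>\<open>p2_fours = (1 2 3)(4 5 6 7)(8 9 10 11)...\<close>\<close>

definition p2_fours :: "nat \<Rightarrow> nat \<Rightarrow> nat" where
  "p2_fours m x = (if x = 1 then 2 else if x = 2 then 3 else if x = 3 then 1 else if x < 4 \<or> 4 * m + 7 < x then x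
    else if x mod 4 = 3 then x - 3 else x + 1)"

lemma p2_fours_block:
  "j < m + 1 \<Longrightarrow> p2_fours m (4 * j + 4) = 4 * j + (4 + 1) \<and> p2_fours m (4 * j + (4 + 1)) = 4 * j + (4 + 2)
      \<and> p2_fours m (4 * j + (4 + 2)) = 4 * j + (4 + 3) \<and> p2_fours m (4 * j + (4 + 3)) = 4 * j + 4"
  by (simp add: p2_fours_def)

lemma p2_fours_ends: "p2_fours m 1 = 2" "p2_fours m 2 = 3" "p2_fours m 3 = 1"
  by (simp_all add: p2_fours_def)

lemma p2_fours_cycle_type:
  "p2_fours m permutes {1..4 * m + 7} \<and> cycle_type (4 * m + 7) (p2_fours m) =
    replicate_mset 0 1 + replicate_mset 0 2 + replicate_mset 1 3 + replicate_mset (m + 1) 4"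
proof (rule permutes_cycle_type_fours[where ?E1.0 = "{}" and ?E2.0 = "{}" and ?E3.0 = "{1, 2, 3}"])
  fix x assume x: "x \<in> {1..4 * m + 7}" "x \<notin> {1, 2, 3}"
  then show "p2_fours m x \<noteq> x \<and> p2_fours m (p2_fours m x) \<noteq> x \<and> p2_fours m (p2_fours m (p2_fours m x)) \<noteq> x
      \<and> p2_fours m (p2_fours m (p2_fours m (p2_fours m x))) = x"
    by (intro four_cycles_up[OF p2_fours_block[of _ m], of "m + 1"]) auto
next
  fix x assume "x \<in> {1..4 * m + 7}"
  then show "p2_fours m x \<in> {1..4 * m + 7}" by (cases "x = 4 * m + 7") (auto simp: p2_fours_def)
next
  fix x :: nat assume "x \<in> {1, 2, 3}"
  then show "p2_fours m x \<noteq> x \<and> p2_fours m (p2_fours m x) \<noteq> x \<and> p2_fours m (p2_fours m (p2_fours m x)) = x"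
    using p2_fours_ends by (elim insertE) simp_all
next
  fix x assume "x \<notin> {1..4 * m + 7}"
  then show "p2_fours m x = x" by (auto simp: p2_fours_def)
qed simp_all

lemma p2_fours_power: "p2_fours m ^^ 4 = cyc3 1 2 3"
proof
  fix x
  have d: "distinct [1, 2, 3 :: nat]" by simp
  have "x = 1 \<or> x = 2 \<or> x = 3 \<or> x = 0 \<or> 4 * m + 7 < x \<or> 4 \<le> x \<and> x < 4 + 4 * (m + 1)" by presburger
  then consider "x = 1" | "x = 2" | "x = 3" | "x = 0 \<or> 4 * m + 7 < x" | "4 \<le> x" "x < 4 + 4 * (m + 1)" by blast
  then show "(p2_fours m ^^ 4) x = cyc3 1 2 3 x"
  proof cases
    case 4
    then have "p2_fours m x = x" by (auto simp: p2_fours_def)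
    moreover have "x \<notin> {1, 2, 3}" using 4 by auto
    ultimately show ?thesis using cyc3_apply(4)[OF d] by (simp add: funpow_4)
  next
    case 5
    then have "p2_fours m (p2_fours m (p2_fours m (p2_fours m x))) = x" using four_cycles_up[OF p2_fours_block[of _ m] 5] by blast
    moreover have "x \<notin> {1, 2, 3}" using 5 by auto
    ultimately show ?thesis using cyc3_apply(4)[OF d] by (simp add: funpow_4)
  qed (use p2_fours_ends cyc3_apply(1-3)[OF d] in \<open>simp_all add: funpow_4\<close>)
qed

text \<open>Shared by \<open>q2_fours\<close> and \<open>q3_fours\<close>, which have these cycles
  in common and differ near the right end. The cycle 5, 6, 11, 8 shifted by 4j interlaces with its
  neighbours, hence the index shifts by 1 and 2.\<close>

lemma q2_fours_cover:
  fixes x m :: nat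
  assumes "1 \<le> x" "x < 4 * m + 8" "x \<notin> {4 * m + 5, 4 * m + 6}"
  shows "x = 1 \<or> x \<in> {2, 3, 7, 4} \<or> (\<exists>j<m. x \<in> {4 * j + 5, 4 * j + 6, 4 * j + 11, 4 * j + 8})"
proof (cases "x \<in> {1, 2, 3, 4, 7}")
  case False
  define i where "i = x div 4"
  have "x = 4 * i \<or> x = 4 * i + 1 \<or> x = 4 * i + 2 \<or> x = 4 * i + 3" unfolding i_def by presburger
  then show ?thesis
  proof (elim disjE)
    assume "x = 4 * i"
    then have "i - 2 < m" "x = 4 * (i - 2) + 8" using assms False by auto
    then show ?thesis by blast
  next
    assume x: "x = 4 * i + 1"
    then have "i \<noteq> 0" "i \<noteq> m + 1" "i < m + 2" using assms False by auto
    then have "i - 1 < m" "x = 4 * (i - 1) + 5" using x by auto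
    then show ?thesis by blast
  next
    assume x: "x = 4 * i + 2"
    then have "i \<noteq> 0" "i \<noteq> m + 1" "i < m + 2" using assms False by auto
    then have "i - 1 < m" "x = 4 * (i - 1) + 6" using x by auto
    then show ?thesis by blast
  next
    assume x: "x = 4 * i + 3"
    then have "i \<noteq> 0" "i \<noteq> 1" "i < m + 2" using assms False by auto
    then have "i - 2 < m" "x = 4 * (i - 2) + 11" using x assms by auto
    then show ?thesis by blast
  qed
qed blast

text \<open>
  Chosen so that \<open>p2_fours \<circ> q2_fours\<close> and \<open>p3_fours \<circ> q3_fours\<close> both begin with
  \<open>(1 2)(3 4)(5 7)(6 8)(9 11)(10 12)...\<close>.
\<close>

definition q2_fours :: "nat \<Rightarrow> nat \<Rightarrow> nat" where
  "q2_fours m x = (if x = 4 * m + 5 then 4 * m + 6 else if x = 4 * m + 6 then 4 * m + 5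
    else if x < 2 \<or> 4 * m + 7 < x then x else if x = 2 then 3 else if x = 3 then 7 else if x = 4 then 2
    else if x mod 4 = 1 then x + 1 else if x mod 4 = 2 then x + 5 else x - 3)"

definition q3_fours :: "nat \<Rightarrow> nat \<Rightarrow> nat" where
  "q3_fours m x = (if x = 4 * m + 6 then 4 * m + 9 else if x = 4 * m + 9 then 4 * m + 8
    else if x < 2 \<or> 4 * m + 9 < x then x else if x = 2 then 3 else if x = 3 then 7 else if x = 4 then 2
    else if x mod 4 = 1 then x + 1 else if x mod 4 = 2 then x + 5 else x - 3)"

definition p3_fours :: "nat \<Rightarrow> nat \<Rightarrow> nat" where
  "p3_fours m x = (if x = 4 * m + 8 then 4 * m + 9 else if x = 4 * m + 9 then 4 * m + 8 else p2_fours m x)"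

context
  fixes m :: nat
  assumes m: "m \<ge> 1"
begin

lemma q2_fours_block:
  "j < m \<Longrightarrow> q2_fours m (4 * j + 5) = 4 * j + 6 \<and> q2_fours m (4 * j + 6) = 4 * j + 11
      \<and> q2_fours m (4 * j + 11) = 4 * j + 8 \<and> q2_fours m (4 * j + 8) = 4 * j + 5"
  by (simp add: q2_fours_def) presburger

lemma q2_fours_ends:
  "q2_fours m 1 = 1" "q2_fours m 2 = 3" "q2_fours m 3 = 7" "q2_fours m 7 = 4" "q2_fours m 4 = 2"
  "q2_fours m (4 * m + 5) = 4 * m + 6" "q2_fours m (4 * m + 6) = 4 * m + 5"
  using m by (simp_all add: q2_fours_def)

lemma q2_fours_outside: "x \<notin> {1..4 * m + 7} \<Longrightarrow> q2_fours m x = x"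
  by (auto simp: q2_fours_def)

lemma q2_fours_four_cycles:
  assumes "1 \<le> x" "x \<le> 4 * m + 7" "x \<notin> {1, 4 * m + 5, 4 * m + 6}"
  shows "q2_fours m x \<noteq> x \<and> q2_fours m (q2_fours m x) \<noteq> x \<and> q2_fours m (q2_fours m (q2_fours m x)) \<noteq> x
      \<and> q2_fours m (q2_fours m (q2_fours m (q2_fours m x))) = x"
proof -
  consider "x \<in> {2, 3, 7, 4}" | j where "j < m" "x \<in> {4 * j + 5, 4 * j + 6, 4 * j + 11, 4 * j + 8}"
    using q2_fours_cover[of x m] assms by auto
  then show ?thesis
  proof cases
    case 1
    show ?thesis by (rule four_cycle[OF q2_fours_ends(2-5) _ 1]) simp
  next
    case (2 j)
    show ?thesis by (rule four_cycle[OF _ _ _ _ _ 2(2)]) (use q2_fours_block[OF 2(1)] in simp_all)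
  qed
qed

lemma q2_fours_cycle_type:
  "q2_fours m permutes {1..4 * m + 7} \<and> cycle_type (4 * m + 7) (q2_fours m) =
    replicate_mset 1 1 + replicate_mset 1 2 + replicate_mset 0 3 + replicate_mset (m + 1) 4"
proof (rule permutes_cycle_type_fours[where ?E1.0 = "{1}" and ?E2.0 = "{4 * m + 5, 4 * m + 6}" and ?E3.0 = "{}"])
  fix x assume x: "x \<in> {1..4 * m + 7}"
  then consider "x = 1" | "x \<in> {4 * m + 5, 4 * m + 6}" | "x \<in> {2, 3, 7, 4}"
    | j where "j < m" "x \<in> {4 * j + 5, 4 * j + 6, 4 * j + 11, 4 * j + 8}"
    using q2_fours_cover[of x m] by auto
  then show "q2_fours m x \<in> {1..4 * m + 7}"
  proof cases
    case 4
    then show ?thesis using q2_fours_block[OF 4(1)] by auto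
  qed (use q2_fours_ends m in auto)
next
  fix x assume "x \<in> {1..4 * m + 7}" "x \<notin> {1}" "x \<notin> {4 * m + 5, 4 * m + 6}"
  then show "q2_fours m x \<noteq> x \<and> q2_fours m (q2_fours m x) \<noteq> x \<and> q2_fours m (q2_fours m (q2_fours m x)) \<noteq> x
      \<and> q2_fours m (q2_fours m (q2_fours m (q2_fours m x))) = x"
    by (intro q2_fours_four_cycles) auto
next
  fix x assume "x \<in> {4 * m + 5, 4 * m + 6}"
  then show "q2_fours m x \<noteq> x \<and> q2_fours m (q2_fours m x) = x" using q2_fours_ends by auto
next
  fix x :: nat assume "x \<in> {1}"
  then show "q2_fours m x = x" using q2_fours_ends(1) by simp
qed (simp_all add: q2_fours_outside)

lemma r2_fours_block:
  assumes "j < m"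
  shows "p2_fours m (q2_fours m (4 * j + 5)) = 4 * j + (5 + 2) \<and> p2_fours m (q2_fours m (4 * j + (5 + 1))) = 4 * j + (5 + 3)
      \<and> p2_fours m (q2_fours m (4 * j + (5 + 2))) = 4 * j + 5 \<and> p2_fours m (q2_fours m (4 * j + (5 + 3))) = 4 * j + (5 + 1)"
  using assms m by (cases "j = 0") (simp_all add: q2_fours_def p2_fours_def mod_Suc)

lemma r2_fours_ends:
  "p2_fours m (q2_fours m 1) = 2" "p2_fours m (q2_fours m 2) = 1"
  "p2_fours m (q2_fours m 3) = 4" "p2_fours m (q2_fours m 4) = 3"
  "p2_fours m (q2_fours m (4 * m + 5)) = 4 * m + 7" "p2_fours m (q2_fours m (4 * m + 7)) = 4 * m + 5"
  "p2_fours m (q2_fours m (4 * m + 6)) = 4 * m + 6"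
  using m by (simp_all add: q2_fours_def p2_fours_def)

lemma r2_fours_cycle_type: "cycle_type (4 * m + 7) (p2_fours m \<circ> q2_fours m) = parts (B\<^sub>W (4 * m + 7) 1)"
proof (rule cycle_type_B)
  let ?r = "p2_fours m \<circ> q2_fours m"
  show "?r permutes {1..4 * m + 7}"
    using p2_fours_cycle_type q2_fours_cycle_type by (blast intro: permutes_compose)
  have *: "x \<in> {1, 2, 3, 4, 4 * m + 5, 4 * m + 7} \<or> x = 4 * m + 6 \<or> 5 \<le> x \<and> x < 5 + 4 * m" if "x \<in> {1..4 * m + 7}" for x
    using that by auto
  have pairs: "?r x \<noteq> x \<and> ?r (?r x) = x" if "5 \<le> x \<and> x < 5 + 4 * m" for x
    by (rule involution_pairs[of m ?r 5]) (use that r2_fours_block in simp_all)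
  have ends: "?r x \<noteq> x \<and> ?r (?r x) = x" if "x \<in> {1, 2, 3, 4, 4 * m + 5, 4 * m + 7}" for x
    using that r2_fours_ends by auto
  show "?r (?r x) = x" if "x \<in> {1..4 * m + 7}" for x
    using *[OF that]
  proof (elim disjE)
    assume "5 \<le> x \<and> x < 5 + 4 * m"
    then show ?thesis using pairs by blast
  next
    assume "x = 4 * m + 6"
    then show ?thesis using r2_fours_ends by auto
  qed (use ends in blast)
  have "{x \<in> {1..4 * m + 7}. ?r x = x} = {4 * m + 6}"
  proof (intro equalityI subsetI)
    fix x assume "x \<in> {x \<in> {1..4 * m + 7}. ?r x = x}"
    then have x: "x \<in> {1..4 * m + 7}" and "?r x = x" by blast+
    then have "\<not> (5 \<le> x \<and> x < 5 + 4 * m)" "x \<notin> {1, 2, 3, 4, 4 * m + 5, 4 * m + 7}" using pairs ends by blast+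
    then show "x \<in> {4 * m + 6}" using *[OF x] by blast
  qed (use r2_fours_ends in auto)
  then show "card {x \<in> {1..4 * m + 7}. ?r x = x} = 1" by simp
qed

lemma q2_fours_power: "q2_fours m ^^ 4 = id"
proof
  fix x
  consider "x = 1" | "x \<in> {4 * m + 5, 4 * m + 6}" | "x \<notin> {1..4 * m + 7}" | "1 \<le> x" "x \<le> 4 * m + 7" "x \<notin> {1, 4 * m + 5, 4 * m + 6}"
    by fastforce
  then show "(q2_fours m ^^ 4) x = id x"
  proof cases
    case 3
    then show ?thesis using q2_fours_outside by (simp add: funpow_4)
  next
    case 4
    then show ?thesis using q2_fours_four_cycles[OF 4] by (simp add: funpow_4)
  qed (use q2_fours_ends in \<open>auto simp: funpow_4\<close>)
qed

lemma row_F3_3_aux: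
  "realizable (4 * m + 7) [Cl_Pair [(3, 1), (4, (of_nat (4 * m + 7) - 3) / 4)] [(1, 1), (2, 1), (4, (of_nat (4 * m + 7) - 3) / 4)],
    Cl_Twisted (B\<^sub>W (4 * m + 7) 1), Cl_Swap]"
proof (rule realizable_triangle)
  have "(of_nat (4 * m + 7) - 3) / 4 = (of_nat (m + 1) :: rat)"
    by (simp add: field_simps)
  then have P: "parts [(3, 1), (4, (of_nat (4 * m + 7) - 3) / 4)] =
      replicate_mset 0 1 + replicate_mset 0 2 + replicate_mset 1 3 + replicate_mset (m + 1) 4"
    and Q: "parts [(1, 1), (2, 1), (4, (of_nat (4 * m + 7) - 3) / 4)] =
      replicate_mset 1 1 + replicate_mset 1 2 + replicate_mset 0 3 + replicate_mset (m + 1) 4"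
    by (simp_all only: parts_def floor_of_nat) (simp_all add: nat_add_distrib)
  show "4 * m + 7 \<ge> 8" using m by simp
  show perm: "p2_fours m permutes {1..4 * m + 7}" "q2_fours m permutes {1..4 * m + 7}"
    using p2_fours_cycle_type q2_fours_cycle_type by blast+
  show "pair_symbol (4 * m + 7) (p2_fours m) (q2_fours m)
      (Cl_Pair [(3, 1), (4, (of_nat (4 * m + 7) - 3) / 4)] [(1, 1), (2, 1), (4, (of_nat (4 * m + 7) - 3) / 4)])"
    unfolding pair_symbol.simps P Q using p2_fours_cycle_type q2_fours_cycle_type by blast
  show "cycle_type (4 * m + 7) (p2_fours m \<circ> q2_fours m) = parts (B\<^sub>W (4 * m + 7) 1)"
    by (rule r2_fours_cycle_type)
  have "(p2_fours m ^^ 4) 2 = 3" unfolding p2_fours_power by (simp add: cyc3_apply)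
  then show "kernel_nontrivial (4 * m + 7) G" if "perm_group G" "map_prod (p2_fours m) (q2_fours m) \<in> G" for G
    by (intro power_kernel_nontrivial[OF that perm, of 4 2]) (simp add: q2_fours_power)
  fix H assume H: "perm_group H" "p2_fours m \<in> H" "q2_fours m \<in> H"
  interpret perm_group H by fact
  let ?r = "p2_fours m \<circ> q2_fours m"
  have r: "?r \<in> H" by (rule comp_mem[OF H(2,3)])
  have "cyc3 1 2 3 \<in> H" using funpow_mem[OF H(2), of 4] unfolding p2_fours_power .
  then have "tri H 1 2" by (rule triI[rotated]) simp
  then have 21: "tri H 2 1" by (rule tri_sym)
  have one: "tri H (p2_fours m 1) 1" "tri H (?r 1) 1"
    using 21 r2_fours_ends(1) p2_fours_ends(1) by simp_all
  show "carrier (alt_group (4 * m + 7)) \<subseteq> H"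
  proof (rule alt_group_subset_chain[OF H(1)])
    fix x :: nat assume x: "1 < x" "x \<le> 4 * m + 7"
    obtain y where y: "x = Suc y" using x by (cases x) auto
    \<comment> \<open>The 4-cycles of \<open>p2_fours\<close> start at multiples of 4. These points
      are reached by r: 4 from 3, and 4j + 8 from 4j + 6.\<close>
    consider "x = 4" | "x \<noteq> 4" "x mod 4 = 0" | "x mod 4 \<noteq> 0" by blast
    then have "\<exists>y. 1 \<le> y \<and> y < x \<and> (p2_fours m y = x \<or> ?r y = x)"
    proof cases
      case 1
      then show ?thesis using r2_fours_ends(3) by (intro exI[of _ 3]) simp
    next
      case 2
      then obtain i where i: "x = 4 * i" by blast
      then have "i \<noteq> 0" "i \<noteq> 1" "i < m + 2" using 2(1) x by auto
      then have "i - 2 < m" "x = 4 * (i - 2) + 8" using i x by auto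
      then obtain j where j: "j < m" "x = 4 * j + 8" by blast
      then have "?r (4 * j + 6) = x" using r2_fours_block[OF j(1)] by simp
      then show ?thesis using j by (intro exI[of _ "4 * j + 6"]) simp
    next
      case 3
      then have "p2_fours m y = x" using x y by (auto simp: p2_fours_def mod_Suc split: if_splits)
      then show ?thesis using x y by (intro exI[of _ y]) simp
    qed
    then show "\<exists>y f. 1 \<le> y \<and> y < x \<and> f \<in> H \<and> f y = x \<and> tri H (f 1) 1"
      using H(2) r one by blast
  qed
qed

end

lemma row_F3_3:
  assumes "l \<ge> 9" "l mod 4 = 3"
  shows "realizable l [Cl_Pair [(3, 1), (4, (of_nat l - 3) / 4)] [(1, 1), (2, 1), (4, (of_nat l - 3) / 4)],
    Cl_Twisted (B\<^sub>W l 1), Cl_Swap]"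
proof -
  define m where "m = l div 4 - 1"
  have "m \<ge> 1" "l = 4 * m + 7"
    using assms mult_div_mod_eq[of 4 l] by (simp_all add: m_def del: mult_div_mod_eq)
  then show ?thesis using row_F3_3_aux by blast
qed

context
  fixes m :: nat
begin

text \<open>Up to 4m + 7 the permutation agrees with \<open>p2_fours m\<close>, which preserves that
  range, so only the transposition of the two new points has to be added.\<close>

lemma p3_fours_cycle_type:
  "p3_fours m permutes {1..4 * m + 9} \<and> cycle_type (4 * m + 9) (p3_fours m) =
    replicate_mset 0 1 + replicate_mset 1 2 + replicate_mset 1 3 + replicate_mset (m + 1) 4"
proof (rule permutes_cycle_type_fours[where ?E1.0 = "{}" and ?E2.0 = "{4 * m + 8, 4 * m + 9}" and ?E3.0 = "{1, 2, 3}"])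
  note p2 = p2_fours_cycle_type[of m, THEN conjunct1]
  fix x
  have p3: "p3_fours m x = p2_fours m x" if "x \<in> {1..4 * m + 7}" for x
    using that by (auto simp: p3_fours_def)
  have S: "p2_fours m x \<in> {1..4 * m + 7}" if "x \<in> {1..4 * m + 7}" for x
    using permutes_in_image[OF p2] that by blast
  show "p3_fours m x \<in> {1..4 * m + 9}" if "x \<in> {1..4 * m + 9}"
    using S[of x] that by (cases "x \<in> {1..4 * m + 7}") (auto simp: p3_fours_def)
  show "p3_fours m x \<noteq> x \<and> p3_fours m (p3_fours m x) \<noteq> x \<and> p3_fours m (p3_fours m (p3_fours m x)) \<noteq> x
      \<and> p3_fours m (p3_fours m (p3_fours m (p3_fours m x))) = x"
    if x: "x \<in> {1..4 * m + 9}" "x \<notin> {4 * m + 8, 4 * m + 9}" "x \<notin> {1, 2, 3}"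
  proof -
    have "x \<in> {1..4 * m + 7}" using x by auto
    then have "p3_fours m x = p2_fours m x" "p3_fours m (p3_fours m x) = p2_fours m (p2_fours m x)"
      "p3_fours m (p3_fours m (p3_fours m x)) = p2_fours m (p2_fours m (p2_fours m x))"
      "p3_fours m (p3_fours m (p3_fours m (p3_fours m x))) = p2_fours m (p2_fours m (p2_fours m (p2_fours m x)))"
      by (simp_all only: p3 S)
    then show ?thesis using x four_cycles_up[OF p2_fours_block[of _ m], of "m + 1" x] by auto
  qed
  show "p3_fours m x \<noteq> x \<and> p3_fours m (p3_fours m x) \<noteq> x \<and> p3_fours m (p3_fours m (p3_fours m x)) = x"
    if "x \<in> {1, 2, 3}"
  proof -
    have "p3_fours m 1 = 2" "p3_fours m 2 = 3" "p3_fours m 3 = 1"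
      using p3 p2_fours_ends by simp_all
    then show ?thesis using that by auto
  qed
  show "p3_fours m x = x" if "x \<notin> {1..4 * m + 9}"
  proof -
    have "p3_fours m x = p2_fours m x" using that by (auto simp: p3_fours_def)
    also have "\<dots> = x" using that by (intro permutes_not_in[OF p2]) auto
    finally show ?thesis .
  qed
qed (auto simp: p3_fours_def)

lemma p3_fours_power: "p3_fours m ^^ 4 = cyc3 1 2 3"
proof
  fix x
  note p2 = p2_fours_cycle_type[of m, THEN conjunct1]
  have d: "distinct [1, 2, 3 :: nat]" by simp
  have p3: "p3_fours m x = p2_fours m x" if "x \<notin> {4 * m + 8, 4 * m + 9}" for x
    using that by (auto simp: p3_fours_def)
  show "(p3_fours m ^^ 4) x = cyc3 1 2 3 x"
  proof (cases "x \<in> {4 * m + 8, 4 * m + 9}")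
    case True
    then have "x \<notin> {1, 2, 3}" by auto
    then have "cyc3 1 2 3 x = x" by (rule cyc3_apply(4)[OF d])
    then show ?thesis using True by (auto simp: funpow_4 p3_fours_def)
  next
    case False
    have S: "p2_fours m x \<notin> {4 * m + 8, 4 * m + 9}" if "x \<notin> {4 * m + 8, 4 * m + 9}" for x
      using permutes_in_image[OF p2, of x] permutes_not_in[OF p2, of x] that by (cases "x \<in> {1..4 * m + 7}") auto
    have "(p3_fours m ^^ 4) x = (p2_fours m ^^ 4) x"
      by (simp only: funpow_4 p3 S[OF False] S[OF S[OF False]] S[OF S[OF S[OF False]]] False not_False_eq_True)
    then show ?thesis by (simp only: p2_fours_power)
  qed
qed

lemma q3_fours_block:
  "j < m \<Longrightarrow> q3_fours m (4 * j + 5) = 4 * j + 6 \<and> q3_fours m (4 * j + 6) = 4 * j + 11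
      \<and> q3_fours m (4 * j + 11) = 4 * j + 8 \<and> q3_fours m (4 * j + 8) = 4 * j + 5"
  by (simp add: q3_fours_def) presburger

lemma q3_fours_ends:
  "q3_fours m 1 = 1" "q3_fours m 2 = 3" "q3_fours m 3 = 7" "q3_fours m 7 = 4" "q3_fours m 4 = 2"
  "q3_fours m (4 * m + 5) = 4 * m + 6" "q3_fours m (4 * m + 6) = 4 * m + 9"
  "q3_fours m (4 * m + 9) = 4 * m + 8" "q3_fours m (4 * m + 8) = 4 * m + 5"
  by (simp_all add: q3_fours_def)

lemma q3_fours_outside: "x \<notin> {1..4 * m + 9} \<Longrightarrow> q3_fours m x = x"
  by (auto simp: q3_fours_def)

lemma q3_fours_cover:
  assumes "x \<in> {1..4 * m + 9}"
  obtains "x = 1" | "x \<in> {2, 3, 7, 4}" | "x \<in> {4 * m + 5, 4 * m + 6, 4 * m + 9, 4 * m + 8}"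
    | j where "j < m" "x \<in> {4 * j + 5, 4 * j + 6, 4 * j + 11, 4 * j + 8}"
proof (cases "x \<in> {4 * m + 5, 4 * m + 6, 4 * m + 9, 4 * m + 8}")
  case False
  then have "1 \<le> x" "x < 4 * m + 8" "x \<notin> {4 * m + 5, 4 * m + 6}" using assms by auto
  from q2_fours_cover[OF this] show thesis using \<open>x = 1 \<Longrightarrow> thesis\<close> \<open>x \<in> {2, 3, 7, 4} \<Longrightarrow> thesis\<close>
    \<open>\<And>j. \<lbrakk>j < m; x \<in> {4 * j + 5, 4 * j + 6, 4 * j + 11, 4 * j + 8}\<rbrakk> \<Longrightarrow> thesis\<close> by blast
qed blast

lemma q3_fours_four_cycles:
  assumes "x \<in> {1..4 * m + 9}" "x \<noteq> 1"
  shows "q3_fours m x \<noteq> x \<and> q3_fours m (q3_fours m x) \<noteq> x \<and> q3_fours m (q3_fours m (q3_fours m x)) \<noteq> x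
      \<and> q3_fours m (q3_fours m (q3_fours m (q3_fours m x))) = x"
  using assms(1)
proof (cases rule: q3_fours_cover)
  case 2
  show ?thesis by (rule four_cycle[OF q3_fours_ends(2-5) _ 2]) simp
next
  case 3
  show ?thesis by (rule four_cycle[OF q3_fours_ends(6-9) _ 3]) simp
next
  case (4 j)
  show ?thesis by (rule four_cycle[OF _ _ _ _ _ 4(2)]) (use q3_fours_block[OF 4(1)] in simp_all)
qed (use assms(2) in blast)

lemma q3_fours_cycle_type:
  "q3_fours m permutes {1..4 * m + 9} \<and> cycle_type (4 * m + 9) (q3_fours m) =
    replicate_mset 1 1 + replicate_mset 0 2 + replicate_mset 0 3 + replicate_mset (m + 2) 4"
proof (rule permutes_cycle_type_fours[where ?E1.0 = "{1}" and ?E2.0 = "{}" and ?E3.0 = "{}"])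
  fix x assume x: "x \<in> {1..4 * m + 9}"
  then show "q3_fours m x \<in> {1..4 * m + 9}"
  proof (cases rule: q3_fours_cover)
    case (4 j)
    then show ?thesis using q3_fours_block[OF 4(1)] by auto
  qed (use q3_fours_ends in auto)
next
  fix x assume "x \<in> {1..4 * m + 9}" "x \<notin> {1}"
  then show "q3_fours m x \<noteq> x \<and> q3_fours m (q3_fours m x) \<noteq> x \<and> q3_fours m (q3_fours m (q3_fours m x)) \<noteq> x
      \<and> q3_fours m (q3_fours m (q3_fours m (q3_fours m x))) = x"
    by (intro q3_fours_four_cycles) auto
next
  fix x :: nat assume "x \<in> {1}"
  then show "q3_fours m x = x" using q3_fours_ends(1) by simp
qed (simp_all add: q3_fours_outside)

lemma r3_fours_block:
  assumes "j < m + 1"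
  shows "p3_fours m (q3_fours m (4 * j + 5)) = 4 * j + (5 + 2) \<and> p3_fours m (q3_fours m (4 * j + (5 + 1))) = 4 * j + (5 + 3)
      \<and> p3_fours m (q3_fours m (4 * j + (5 + 2))) = 4 * j + 5 \<and> p3_fours m (q3_fours m (4 * j + (5 + 3))) = 4 * j + (5 + 1)"
proof -
  have q: "q3_fours m (4 * j + 5) = 4 * j + 6" "q3_fours m (4 * j + 7) = 4 * j + 4" "q3_fours m (4 * j + 8) = 4 * j + 5"
    using assms by (simp_all add: q3_fours_def; presburger)+
  have p: "p3_fours m (4 * j + 4) = 4 * j + 5" "p3_fours m (4 * j + 5) = 4 * j + 6" "p3_fours m (4 * j + 6) = 4 * j + 7"
    using p2_fours_block[OF assms] assms by (simp_all add: p3_fours_def; presburger)+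
  have "p3_fours m (q3_fours m (4 * j + 6)) = 4 * j + 8"
  \<comment> \<open>At the right end \<open>q3_fours\<close> sends 4m + 6 to 4m + 9 instead of 4m +
    11, and the transposition of \<open>p3_fours\<close> takes this to 4m + 8.\<close>
  proof (cases "j = m")
    case True
    then show ?thesis by (simp add: q3_fours_ends) (simp add: p3_fours_def)
  next
    case False
    then have j: "j < m" using assms by simp
    then have "p2_fours m (4 * j + 11) = 4 * j + 8" using p2_fours_block[of "j + 1" m] by (simp add: add.commute)
    then have "p3_fours m (4 * j + 11) = 4 * j + 8" using j by (simp add: p3_fours_def; presburger)
    then show ?thesis using q3_fours_block[OF j] by simp
  qed
  then show ?thesis using p q by simp
qed

lemma r3_fours_ends:
  "p3_fours m (q3_fours m 1) = 2" "p3_fours m (q3_fours m 2) = 1"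
  "p3_fours m (q3_fours m 3) = 4" "p3_fours m (q3_fours m 4) = 3"
  "p3_fours m (q3_fours m (4 * m + 9)) = 4 * m + 9"
  by (simp_all add: q3_fours_def p3_fours_def p2_fours_def)

lemma r3_fours_cycle_type: "cycle_type (4 * m + 9) (p3_fours m \<circ> q3_fours m) = parts (B\<^sub>W (4 * m + 9) 1)"
proof (rule cycle_type_B)
  let ?r = "p3_fours m \<circ> q3_fours m"
  show "?r permutes {1..4 * m + 9}"
    using p3_fours_cycle_type q3_fours_cycle_type by (blast intro: permutes_compose)
  have *: "x \<in> {1, 2, 3, 4} \<or> x = 4 * m + 9 \<or> 5 \<le> x \<and> x < 5 + 4 * (m + 1)" if "x \<in> {1..4 * m + 9}" for x
    using that by auto
  have pairs: "?r x \<noteq> x \<and> ?r (?r x) = x" if "5 \<le> x \<and> x < 5 + 4 * (m + 1)" for x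
    by (rule involution_pairs[of "m + 1" ?r 5]) (use that r3_fours_block in simp_all)
  have ends: "?r x \<noteq> x \<and> ?r (?r x) = x" if "x \<in> {1, 2, 3, 4}" for x
    using that r3_fours_ends by auto
  show "?r (?r x) = x" if "x \<in> {1..4 * m + 9}" for x
    using *[OF that]
  proof (elim disjE)
    assume "5 \<le> x \<and> x < 5 + 4 * (m + 1)"
    then show ?thesis using pairs by blast
  next
    assume "x = 4 * m + 9"
    then show ?thesis using r3_fours_ends by auto
  qed (use ends in blast)
  have "{x \<in> {1..4 * m + 9}. ?r x = x} = {4 * m + 9}"
  proof (intro equalityI subsetI)
    fix x assume "x \<in> {x \<in> {1..4 * m + 9}. ?r x = x}"
    then have x: "x \<in> {1..4 * m + 9}" and "?r x = x" by blast+
    then have "\<not> (5 \<le> x \<and> x < 5 + 4 * (m + 1))" "x \<notin> {1, 2, 3, 4}" using pairs ends by blast+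
    then show "x \<in> {4 * m + 9}" using *[OF x] by blast
  qed (use r3_fours_ends in auto)
  then show "card {x \<in> {1..4 * m + 9}. ?r x = x} = 1" by simp
qed

lemma q3_fours_power: "q3_fours m ^^ 4 = id"
proof
  fix x
  consider "x = 1" | "x \<notin> {1..4 * m + 9}" | "x \<in> {1..4 * m + 9}" "x \<noteq> 1" by blast
  then show "(q3_fours m ^^ 4) x = id x"
  proof cases
    case 2
    then show ?thesis using q3_fours_outside by (simp add: funpow_4)
  next
    case 3
    then show ?thesis using q3_fours_four_cycles[OF 3] by (simp add: funpow_4)
  qed (use q3_fours_ends in \<open>auto simp: funpow_4\<close>)
qed

lemma row_F3_2_aux:
  "realizable (4 * m + 9) [Cl_Pair [(2, 1), (3, 1), (4, (of_nat (4 * m + 9) - 5) / 4)] [(1, 1), (4, (of_nat (4 * m + 9) - 1) / 4)],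
    Cl_Twisted (B\<^sub>W (4 * m + 9) 1), Cl_Swap]"
proof (rule realizable_triangle)
  have "(of_nat (4 * m + 9) - 5) / 4 = (of_nat (m + 1) :: rat)" "(of_nat (4 * m + 9) - 1) / 4 = (of_nat (m + 2) :: rat)"
    by (simp_all add: field_simps)
  then have P: "parts [(2, 1), (3, 1), (4, (of_nat (4 * m + 9) - 5) / 4)] =
      replicate_mset 0 1 + replicate_mset 1 2 + replicate_mset 1 3 + replicate_mset (m + 1) 4"
    and Q: "parts [(1, 1), (4, (of_nat (4 * m + 9) - 1) / 4)] =
      replicate_mset 1 1 + replicate_mset 0 2 + replicate_mset 0 3 + replicate_mset (m + 2) 4"
    by (simp_all only: parts_def floor_of_nat) (simp_all add: nat_add_distrib)
  show "4 * m + 9 \<ge> 8" by simp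
  show perm: "p3_fours m permutes {1..4 * m + 9}" "q3_fours m permutes {1..4 * m + 9}"
    using p3_fours_cycle_type q3_fours_cycle_type by blast+
  show "pair_symbol (4 * m + 9) (p3_fours m) (q3_fours m)
      (Cl_Pair [(2, 1), (3, 1), (4, (of_nat (4 * m + 9) - 5) / 4)] [(1, 1), (4, (of_nat (4 * m + 9) - 1) / 4)])"
    unfolding pair_symbol.simps P Q using p3_fours_cycle_type q3_fours_cycle_type by blast
  show "cycle_type (4 * m + 9) (p3_fours m \<circ> q3_fours m) = parts (B\<^sub>W (4 * m + 9) 1)"
    by (rule r3_fours_cycle_type)
  have "(p3_fours m ^^ 4) 2 = 3" unfolding p3_fours_power by (simp add: cyc3_apply)
  then show "kernel_nontrivial (4 * m + 9) G" if "perm_group G" "map_prod (p3_fours m) (q3_fours m) \<in> G" for G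
    by (intro power_kernel_nontrivial[OF that perm, of 4 2]) (simp add: q3_fours_power)
  fix H assume H: "perm_group H" "p3_fours m \<in> H" "q3_fours m \<in> H"
  interpret perm_group H by fact
  let ?r = "p3_fours m \<circ> q3_fours m"
  have r: "?r \<in> H" by (rule comp_mem[OF H(2,3)])
  have "cyc3 1 2 3 \<in> H" using funpow_mem[OF H(2), of 4] unfolding p3_fours_power .
  then have "tri H 1 2" by (rule triI[rotated]) simp
  then have 21: "tri H 2 1" by (rule tri_sym)
  have "p3_fours m 1 = 2" by (simp add: p3_fours_def p2_fours_def)
  then have one: "tri H (p3_fours m 1) 1" "tri H (?r 1) 1"
    using 21 r3_fours_ends(1) by simp_all
  show "carrier (alt_group (4 * m + 9)) \<subseteq> H"
  proof (rule alt_group_subset_chain[OF H(1)])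
    fix x :: nat assume x: "1 < x" "x \<le> 4 * m + 9"
    obtain y where y: "x = Suc y" using x by (cases x) auto
    consider "x = 4" | "x \<noteq> 4" "x mod 4 = 0" | "x mod 4 \<noteq> 0" by blast
    then have "\<exists>y. 1 \<le> y \<and> y < x \<and> (p3_fours m y = x \<or> ?r y = x)"
    proof cases
      case 1
      then show ?thesis using r3_fours_ends(3) by (intro exI[of _ 3]) simp
    next
      case 2
      then obtain i where i: "x = 4 * i" by blast
      then have "i \<noteq> 0" "i \<noteq> 1" "i < m + 3" using 2(1) x by auto
      then have "i - 2 < m + 1" "x = 4 * (i - 2) + 8" using i x by auto
      then obtain j where j: "j < m + 1" "x = 4 * j + 8" by blast
      then have "?r (4 * j + 6) = x" using r3_fours_block[OF j(1)] by simp
      then show ?thesis using j by (intro exI[of _ "4 * j + 6"]) simp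
    next
      case 3
      have "p3_fours m y = x"
      \<comment> \<open>The last point follows 4m + 8 through the transposition of
        \<open>p3_fours\<close>, not through a 4-cycle.\<close>
      proof (cases "x = 4 * m + 9")
        case True
        then show ?thesis using y by (simp add: p3_fours_def)
      next
        case False
        then have "x \<noteq> 4 * m + 8" using 3 by auto
        then show ?thesis using x y 3 False by (auto simp: p3_fours_def p2_fours_def mod_Suc split: if_splits)
      qed
      then show ?thesis using x y by (intro exI[of _ y]) simp
    qed
    then show "\<exists>y f. 1 \<le> y \<and> y < x \<and> f \<in> H \<and> f y = x \<and> tri H (f 1) 1"
      using H(2) r one by blast
  qed
qed

end

lemma row_F3_2:
  assumes "l \<ge> 9" "l mod 4 = 1"
  shows "realizable l [Cl_Pair [(2, 1), (3, 1), (4, (of_nat l - 5) / 4)] [(1, 1), (4, (of_nat l - 1) / 4)],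
    Cl_Twisted (B\<^sub>W l 1), Cl_Swap]"
proof -
  define m where "m = l div 4 - 2"
  have "l = 4 * m + 9"
    using assms mult_div_mod_eq[of 4 l] by (simp add: m_def del: mult_div_mod_eq)
  then show ?thesis using row_F3_2_aux by blast
qed

section \<open>The rows of the table\<close>

text \<open>The integrality of the exponents enters the proof through this step only: it becomes a
  congruence for l together with l >= c.\<close>

lemma fraction_Nats_dvd:
  assumes "(of_nat l - of_nat c) / of_nat d \<in> (\<nat> :: rat set)" "d > 0"
  shows "\<exists>n. l = c + d * n"
proof -
  obtain n where "(of_nat l - of_nat c) / of_nat d = (of_nat n :: rat)" using assms(1) by (auto elim: Nats_cases)
  then have "of_nat l = (of_nat (c + d * n) :: rat)" using assms(2) by (simp add: field_simps)
  then show ?thesis by (simp only: of_nat_eq_iff) blast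
qed

text \<open>A single entry B_j fixes the parity of l and thereby the cycle structures of the
  reflections.\<close>

lemma exponents_ok_B: "exponents_ok (B\<^sub>W l j) \<Longrightarrow> even (l + j)"
  using fraction_Nats_dvd[of l j 2] by (auto simp: exponents_ok_def B\<^sub>W_def)

text \<open>Only the multiset of classes matters, so the class to be split can be moved to the front
  and the result rearranged into the order of the row.\<close>

lemma realizable_split_transposition:
  assumes "realizable l S" "Cl_Twisted (\<tau>\<^sub>W l) \<in># mset S"
    and R: "mset R = {#Cl_Pair (\<tau>\<^sub>W l) (e\<^sub>W l), Cl_Swap#} + (mset S - {#Cl_Twisted (\<tau>\<^sub>W l)#})"
  shows "realizable l R"
proof -
  let ?T = "remove1 (Cl_Twisted (\<tau>\<^sub>W l)) S"
  have "realizable l (Cl_Twisted (\<tau>\<^sub>W l) # ?T)"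
    using assms(1) by (rule realizable_cong[THEN iffD1, rotated]) (use assms(2) in simp)
  from realizable_split[OF this cycle_type_id] show ?thesis
    by (rule realizable_cong[THEN iffD1, rotated]) (simp add: R)
qed

lemma realizable_row:
  assumes l: "l \<ge> 9" and row: "row_W l R" and ok: "\<forall>c \<in> set R. symbol_ok c"
  shows "realizable l R"
proof -
  note split = realizable_split_transposition
  \<comment> \<open>Stated for an arbitrary entry B_j of a pair, so that each row can pick one of
    its own entries to obtain the parity of l.\<close>
  have B: "even (l + j)"
    if "\<exists>P Q. c = Cl_Pair P Q \<and> B\<^sub>W l j \<in> {P, Q}" "c \<in> set R" for c j
  proof (rule exponents_ok_B)
    show "exponents_ok (B\<^sub>W l j)" using that ok by auto
  qed
  from row show ?thesis
  proof cases
    case (I1_1 a)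
    show ?thesis unfolding I1_1(1) by (rule row_I1_1[OF l I1_1(2)])
  next
    case I1A_1
    show ?thesis unfolding I1A_1(1) by (rule row_I1A_1[OF l])
  next
    case I1A_2a
    show ?thesis unfolding I1A_2a(1) by (rule row_I1A_2a[OF l])
  next
    case I1A_2b
    show ?thesis unfolding I1A_2b(1) by (rule split[OF row_I1A_2a[OF l]]) simp_all
  next
    case I1A_2c
    have "realizable l [Cl_Pair (L\<^sub>W l) (L\<^sub>W l), Cl_Pair (\<tau>\<^sub>W l) (e\<^sub>W l), Cl_Twisted (\<tau>\<^sub>W l), Cl_Swap]"
      by (rule split[OF row_I1A_2a[OF l]]) simp_all
    then show ?thesis unfolding I1A_2c(1) by (rule split) simp_all
  next
    case I1A_3
    show ?thesis unfolding I1A_3(1) by (rule row_I1A_3[OF l])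
  next
    case (I1A_4 a)
    show ?thesis unfolding I1A_4(1) by (rule row_I1A_4[OF l I1A_4(2)])
  next
    case (I1A_5a a)
    show ?thesis unfolding I1A_5a(1) by (rule row_I1A_5a[OF l I1A_5a(2)])
  next
    case (I1A_5b a)
    show ?thesis unfolding I1A_5b(1) by (rule split[OF row_I1A_5a[OF l I1A_5b(2)]]) simp_all
  next
    case (I1A_5c a)
    have "realizable l [Cl_Pair (A\<^sub>W l a) (A\<^sub>W l a), Cl_Pair (\<tau>\<^sub>W l) (e\<^sub>W l), Cl_Twisted (\<tau>\<^sub>W l), Cl_Swap]"
      by (rule split[OF row_I1A_5a[OF l I1A_5c(2)]]) simp_all
    then show ?thesis unfolding I1A_5c(1) by (rule split) simp_all
  next
    case (I1A_6 a)
    show ?thesis unfolding I1A_6(1) by (rule row_I1A_6[OF l I1A_6(2)])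
  next
    case (I1A_7a a)
    show ?thesis unfolding I1A_7a(1) by (rule split[OF row_I1A_7b[OF l I1A_7a(2)]]) simp_all
  next
    case (I1A_7b a)
    show ?thesis unfolding I1A_7b(1) by (rule row_I1A_7b[OF l I1A_7b(2)])
  next
    case I2_1a
    have par: "odd l" using B[of _ 3] unfolding I2_1a(1) by fastforce
    show ?thesis unfolding I2_1a(1) by (rule split[OF row_I2_1b[OF l par]]) simp_all
  next
    case I2_1b
    have par: "odd l" using B[of _ 3] unfolding I2_1b(1) by fastforce
    show ?thesis unfolding I2_1b(1) by (rule row_I2_1b[OF l par])
  next
    case I2_2a
    have par: "even l" using B[of _ 2] unfolding I2_2a(1) by fastforce
    show ?thesis unfolding I2_2a(1) by (rule row_I2_2a[OF l par])
  next
    case I2_2b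
    have par: "even l" using B[of _ 2] unfolding I2_2b(1) by fastforce
    show ?thesis unfolding I2_2b(1) by (rule split[OF row_I2_2a[OF l par]]) simp_all
  next
    case I2_3
    have par: "odd l" using B[of _ 3] unfolding I2_3(1) by fastforce
    show ?thesis unfolding I2_3(1) by (rule row_I2_3[OF l par])
  next
    case I2_4
    have par: "even l" using B[of _ 2] unfolding I2_4(1) by fastforce
    show ?thesis unfolding I2_4(1) by (rule row_I2_4[OF l par])
  next
    case I2_5
    have par: "odd l" using B[of _ 1] unfolding I2_5(1) by fastforce
    show ?thesis unfolding I2_5(1) by (rule row_I2_5[OF l par])
  next
    case I2_6
    have par: "odd l" using B[of _ 3] unfolding I2_6(1) by fastforce
    show ?thesis unfolding I2_6(1) by (rule row_I2_6[OF l par])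
  next
    case I2_7
    have par: "even l" using B[of _ 2] unfolding I2_7(1) by fastforce
    show ?thesis unfolding I2_7(1) by (rule row_I2_7[OF l par])
  next
    case I2_8
    have par: "odd l" using B[of _ 1] unfolding I2_8(1) by fastforce
    show ?thesis unfolding I2_8(1) by (rule row_I2_8[OF l par])
  next
    case (I2_9a a)
    have par: "even l" using B[of _ 2] unfolding I2_9a(1) by fastforce
    show ?thesis unfolding I2_9a(1) by (rule row_I2_9a[OF l I2_9a(2) par])
  next
    case (I2_9b a)
    have par: "even l" using B[of _ 2] unfolding I2_9b(1) by fastforce
    show ?thesis unfolding I2_9b(1) by (rule split[OF row_I2_9a[OF l I2_9b(2) par]]) simp_all
  next
    case (I2_10a a)
    have par: "odd l" using B[of _ 1] unfolding I2_10a(1) by fastforce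
    show ?thesis unfolding I2_10a(1) by (rule split[OF row_I2_10b[OF l I2_10a(2) par]]) simp_all
  next
    case (I2_10b a)
    have par: "odd l" using B[of _ 1] unfolding I2_10b(1) by fastforce
    show ?thesis unfolding I2_10b(1) by (rule row_I2_10b[OF l I2_10b(2) par])
  next
    case (I2_11 a)
    have par: "even l" using B[of _ 0] unfolding I2_11(1) by fastforce
    show ?thesis unfolding I2_11(1) by (rule row_I2_11_12(2)[OF l I2_11(2) par])
  next
    case (I2_12 a)
    have par: "odd l" using B[of _ 1] unfolding I2_12(1) by fastforce
    show ?thesis unfolding I2_12(1) by (rule row_I2_11_12(1)[OF l I2_12(2) par])
  next
    case (I2_13 a)
    have par: "even l" using B[of _ 2] unfolding I2_13(1) by fastforce
    show ?thesis unfolding I2_13(1) by (rule row_I2_13[OF l par I2_13(2)])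
  next
    case (I2_14 a)
    have par: "odd l" using B[of _ 1] unfolding I2_14(1) by fastforce
    show ?thesis unfolding I2_14(1) by (rule row_I2_14[OF l I2_14(2) par])
  next
    case (I2_15 a)
    have par: "even l" using B[of _ 0] unfolding I2_15(1) by fastforce
    show ?thesis unfolding I2_15(1) by (rule row_I2_15[OF l I2_15(2) par])
  next
    case F2_1
    have "(of_nat l - of_nat 3) / of_nat 3 \<in> (\<nat> :: rat set)"
      using ok unfolding F2_1(1) by (simp add: exponents_ok_def)
    from fraction_Nats_dvd[OF this] have *: "3 dvd l" by presburger
    show ?thesis unfolding F2_1(1) by (rule row_F2_1[OF l *])
  next
    case F2_2
    have "(of_nat l - of_nat 2) / of_nat 3 \<in> (\<nat> :: rat set)"
      using ok unfolding F2_2(1) by (simp add: exponents_ok_def)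
    from fraction_Nats_dvd[OF this] have *: "l mod 3 = 2" by presburger
    show ?thesis unfolding F2_2(1) by (rule row_F2_2[OF l *])
  next
    case F2_3
    have "(of_nat l - of_nat 1) / of_nat 3 \<in> (\<nat> :: rat set)"
      using ok unfolding F2_3(1) by (simp add: exponents_ok_def)
    from fraction_Nats_dvd[OF this] have *: "l mod 3 = 1" by presburger
    show ?thesis unfolding F2_3(1) by (rule row_F2_3[OF l *])
  next
    case F3_1
    have "(of_nat l - of_nat 4) / of_nat 4 \<in> (\<nat> :: rat set)"
      using ok unfolding F3_1(1) by (simp add: exponents_ok_def)
    from fraction_Nats_dvd[OF this] have *: "4 dvd l" by presburger
    show ?thesis unfolding F3_1(1) by (rule row_F3_1[OF l *])
  next
    case F3_2
    have "(of_nat l - of_nat 1) / of_nat 4 \<in> (\<nat> :: rat set)"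
      using ok unfolding F3_2(1) by (simp add: exponents_ok_def)
    from fraction_Nats_dvd[OF this] have *: "l mod 4 = 1" by presburger
    show ?thesis unfolding F3_2(1) by (rule row_F3_2[OF l *])
  next
    case F3_3
    have "(of_nat l - of_nat 3) / of_nat 4 \<in> (\<nat> :: rat set)"
      using ok unfolding F3_3(1) by (simp add: exponents_ok_def)
    from fraction_Nats_dvd[OF this] have *: "l mod 4 = 3" by presburger
    show ?thesis unfolding F3_3(1) by (rule row_F3_3[OF l *])
  next
    case F1A_1a
    have par: "even l" using B[of _ 2] unfolding F1A_1a(1) by fastforce
    show ?thesis unfolding F1A_1a(1) by (rule row_F1A_1a[OF l par])
  next
    case F1A_1b
    have par: "even l" using B[of _ 2] unfolding F1A_1b(1) by fastforce
    show ?thesis unfolding F1A_1b(1) by (rule split[OF row_F1A_1a[OF l par]]) simp_all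
  next
    case F1A_2a
    have par: "odd l" using B[of _ 1] unfolding F1A_2a(1) by fastforce
    show ?thesis unfolding F1A_2a(1) by (rule row_F1A_2a[OF l par])
  next
    case F1A_2b
    have par: "odd l" using B[of _ 1] unfolding F1A_2b(1) by fastforce
    show ?thesis unfolding F1A_2b(1) by (rule split[OF row_F1A_2a[OF l par]]) simp_all
  next
    case F1A_3a
    have par: "odd l" using B[of _ 3] unfolding F1A_3a(1) by fastforce
    show ?thesis unfolding F1A_3a(1) by (rule row_F1A_3a[OF l par])
  next
    case F1A_3b
    have par: "odd l" using B[of _ 1] unfolding F1A_3b(1) by fastforce
    show ?thesis unfolding F1A_3b(1) by (rule row_F1A_3b[OF l par])
  next
    case F1A_4a
    have par: "even l" using B[of _ 0] unfolding F1A_4a(1) by fastforce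
    show ?thesis unfolding F1A_4a(1) by (rule row_F1A_4a[OF l par])
  next
    case F1A_4b
    have par: "even l" using B[of _ 2] unfolding F1A_4b(1) by fastforce
    show ?thesis unfolding F1A_4b(1) by (rule row_F1A_4b[OF l par])
  next
    case F1A_5
    have par: "odd l" using B[of _ 1] unfolding F1A_5(1) by fastforce
    show ?thesis unfolding F1A_5(1) by (rule row_F1A_5[OF l par])
  next
    case F1A_6a
    have par: "odd l" using B[of _ 3] unfolding F1A_6a(1) by fastforce
    show ?thesis unfolding F1A_6a(1) by (rule row_F1A_6a[OF l par])
  next
    case F1A_6b
    have par: "odd l" using B[of _ 1] unfolding F1A_6b(1) by fastforce
    show ?thesis unfolding F1A_6b(1) by (rule row_F1A_6b[OF l par])
  next
    case F1A_7a
    have par: "even l" using B[of _ 0] unfolding F1A_7a(1) by fastforce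
    show ?thesis unfolding F1A_7a(1) by (rule row_F1A_7a[OF l par])
  next
    case F1A_7b
    have par: "even l" using B[of _ 2] unfolding F1A_7b(1) by fastforce
    show ?thesis unfolding F1A_7b(1) by (rule row_F1A_7b[OF l par])
  next
    case F1A_8
    have par: "odd l" using B[of _ 1] unfolding F1A_8(1) by fastforce
    show ?thesis unfolding F1A_8(1) by (rule row_F1A_8[OF l par])
  next
    case F1A_9
    have par: "even l" using B[of _ 2] unfolding F1A_9(1) by fastforce
    show ?thesis unfolding F1A_9(1) by (rule row_F1A_9[OF l par])
  next
    case F4_1
    show ?thesis unfolding F4_1(1) by (rule row_F4_1[OF l])
  next
    case F4_2
    show ?thesis unfolding F4_2(1) by (rule split[OF row_F4_1[OF l]]) simp_all
  next
    case F4_3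
    have "realizable l [Cl_Swap, Cl_Swap, Cl_Swap, Cl_Twisted (\<tau>\<^sub>W l), Cl_Pair (\<tau>\<^sub>W l) (e\<^sub>W l)]"
      by (rule split[OF row_F4_1[OF l]]) simp_all
    then show ?thesis unfolding F4_3(1) by (rule split) simp_all
  next
    case F4_4
    show ?thesis unfolding F4_4(1) by (rule row_F4_4[OF l])
  next
    case F4_5
    show ?thesis unfolding F4_5(1) by (rule row_F4_5[OF l])
  qed
qed

theorem proposition10p1:
  fixes l :: nat and R :: "class_symbol list"
  assumes "l \<ge> 9"
    and "ramification_type_W l R"
  shows "\<exists>R' xs. mset R' = mset R \<and>
    list_all2 (\<lambda>x c. x \<in> wreath_class l c) xs R' \<and>
    foldr (\<lambda>x y. x \<otimes>\<^bsub>wreath_S2 l\<^esub> y) xs \<one>\<^bsub>wreath_S2 l\<^esub> = \<one>\<^bsub>wreath_S2 l\<^esub> \<and>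
    primitive_action (subgroup_generated (wreath_S2 l) (set xs)) (square l) (square_action l) \<and>
    alt_square l \<subseteq> carrier (subgroup_generated (wreath_S2 l) (set xs))"
proof (rule realizable_imp_primitive)
  show "realizable l R" using assms realizable_row by (auto simp: ramification_type_W_def)
qed (use assms(1) in simp)

end
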